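(* Let $k$ be a field and let $R=kQ_R/I_R$ be a bound quiver algebra, oriented by three idempotents $e, e'_1, e'_2$, each of which is a sum of primitive idempotents $\varepsilon_x$ corresponding to vertices $x$ of $Q_R$. Let $C=eRe=kQ_C/I_C$ and $A_i=(e'_i+e)R(e'_i+e)=kQ_{A_i}/I_i$ for $i=1,2$. If $C=kQ_C/I_C$ is a core algebra, then: (a) $\dim_k{\rm H}^0(R)=\dim_k{\rm H}^0(A_1)+\dim_k{\rm H}^0(A_2)-1$; (b) $\dim_k{\rm H}^1(R)=\dim_k{\rm H}^1(A_1)+\dim_k{\rm H}^1(A_2)+\dim_k{\rm H}^0(C)-1$; (c) ${\rm H}^i(R)\simeq{\rm H}^i(A_1)\oplus{\rm H}^i(A_2)$ for $i\ge2$.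
   Context: Paths are composed left to right; a bound quiver $(Q,I)$ is a quiver $Q$ (here finite) with an admissible ideal $I$ of the path algebra $kQ$, i.e. $F^m\subseteq I\subseteq F^2$ for some $m\ge2$, where $F$ is the ideal generated by the arrows. $\varepsilon_x$ is the idempotent of $kQ/I$ given by the stationary path at the vertex $x$. An algebra $R$ is \emph{oriented} by $e,e'_1,e'_2$ if $e,e'_1,e'_2$ are orthogonal idempotents of $R$ with $1_R=e'_1+e+e'_2$, such that $e'_1Re'_2=e'_2Re'_1=0$ and at least one of the following holds: (1) $eRe'_1=eRe'_2=0$; (2) $e'_1Re=e'_2Re=0$; (3) $e'_1Re=eRe'_2=0$. $Q_C$, $Q_{A_1}$, $Q_{A_2}$ are the full and convex subquivers of $Q_R$ generated by the vertices whose idempotents occur in $e$, $e'_1+e$, $e'_2+e$ respectively, and $I_C=kQ_C\cap I_R$, $I_i=kQ_{A_i}\cap I_R$. ${\rm H}^n(\Lambda)={\rm Ext}^n_{\Lambda^e}(\Lambda,\Lambda)$ is Hochschild cohomology ($\Lambda^e=\Lambda\otimes_k\Lambda^{op}$). The algebra $C=kQ_C/I_C$ is a \emph{core algebra} if $Q_C$ contains no oriented cycles and ${\rm H}^n(C)=0$ for all $n\ge1$.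
   Formalization: Parts (a) and (b) are stated under the added condition that C is nonzero and all vertices of Q_C lie in one connected component of Q_{A_1} and also of Q_{A_2}; without it they fail (e.g. x→a, x→b, y→a with e=ε_a+ε_b). Part (c) is unrestricted. *)

theory Defs
  imports
    "Jordan_Normal_Form.VS_Connect"
    "Graph_Theory.Graph_Theory"
    "HOL-Algebra.QuotRing"
    "HOL-Algebra.Ideal_Product"
begin

hide_const (open) Multiset.mult Polynomial.smult Modules.module Modules.module_hom

text \<open>
  A field is a type \<open>'k\<close> of class \<^class>\<open>field\<close>; \<open>class_ring\<close> is that field as a record.
  An algebra over it is a record of type \<open>('k, 'a) module\<close>, whose ring part carries the
  multiplication. Vector spaces, and modules over a ring, use the same record type without the
  fields \<open>mult\<close> and \<open>one\<close>, which are then \<open>undefined\<close>.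
\<close>

section \<open>Algebras over a field\<close>

text \<open>
  The quotient of an algebra by an ideal, or of a vector space by a subspace. Scalars act on a
  coset \<open>X\<close> by \<open>c (W + x) = W + c x\<close>.
\<close>

definition quot_alg :: "('k, 'a) module \<Rightarrow> 'a set \<Rightarrow> ('k, 'a set) module" where
  "quot_alg V W =
    \<lparr>carrier = carrier (V Quot W), mult = mult (V Quot W), one = one (V Quot W),
     zero = zero (V Quot W), add = add (V Quot W),
     smult = (\<lambda>c X. \<Union>x\<in>X. W +>\<^bsub>V\<^esub> (c \<odot>\<^bsub>V\<^esub> x))\<rparr>"

definition supp :: "('s \<Rightarrow> 'k::zero) \<Rightarrow> 's set" where
  "supp f = {x. f x \<noteq> 0}"

definition unit_vec_at :: "'s \<Rightarrow> 's \<Rightarrow> 'k::field" where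
  "unit_vec_at s = (\<lambda>x. if x = s then 1 else 0)"

definition monoid_algebra :: "('s, 'b) monoid_scheme \<Rightarrow> ('k::field, 's \<Rightarrow> 'k) module" where
  "monoid_algebra G =
    \<lparr>carrier = {f. finite (supp f) \<and> supp f \<subseteq> carrier G},
     mult = (\<lambda>f g x. \<Sum>s\<in>supp f. \<Sum>t\<in>supp g. if s \<otimes>\<^bsub>G\<^esub> t = x then f s * g t else 0),
     one = unit_vec_at \<one>\<^bsub>G\<^esub>,
     zero = (\<lambda>_. 0),
     add = (\<lambda>f g x. f x + g x),
     smult = (\<lambda>c f x. c * f x)\<rparr>"

definition tensor_relations ::
    "('k::field, 'a) module \<Rightarrow> ('k, 'b) module \<Rightarrow> ('a \<times> 'b \<Rightarrow> 'k) set" where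
  "tensor_relations A B =
     {(\<lambda>x. unit_vec_at (a \<oplus>\<^bsub>A\<^esub> a', b) x - unit_vec_at (a, b) x - unit_vec_at (a', b) x) | a a' b.
        a \<in> carrier A \<and> a' \<in> carrier A \<and> b \<in> carrier B} \<union>
     {(\<lambda>x. unit_vec_at (a, b \<oplus>\<^bsub>B\<^esub> b') x - unit_vec_at (a, b) x - unit_vec_at (a, b') x) | a b b'.
        a \<in> carrier A \<and> b \<in> carrier B \<and> b' \<in> carrier B} \<union>
     {(\<lambda>x. unit_vec_at (c \<odot>\<^bsub>A\<^esub> a, b) x - c * unit_vec_at (a, b) x) | c a b.
        a \<in> carrier A \<and> b \<in> carrier B} \<union>
     {(\<lambda>x. unit_vec_at (a, c \<odot>\<^bsub>B\<^esub> b) x - c * unit_vec_at (a, b) x) | c a b.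
        a \<in> carrier A \<and> b \<in> carrier B}"

text \<open>
  \<open>A \<otimes>\<^sub>k B\<close> as the free vector space on the pairs \<open>(a, b)\<close> modulo the bilinearity relations.
  The linear span of the relations is already an ideal of the monoid algebra of
  \<open>A \<times> B\<close>, so dividing by the ideal they generate gives the tensor product of vector spaces,
  with \<open>(a \<otimes> b) (a' \<otimes> b') = a a' \<otimes> b b'\<close>.
\<close>

definition tensor_alg ::
    "('k::field, 'a) module \<Rightarrow> ('k, 'b) module \<Rightarrow> ('k, ('a \<times> 'b \<Rightarrow> 'k) set) module" where
  "tensor_alg A B =
    (let T = monoid_algebra (A \<times>\<times> B)
     in quot_alg T (genideal T (tensor_relations A B)))"

definition op_alg :: "('k, 'a) module \<Rightarrow> ('k, 'a) module" where
  "op_alg A = A\<lparr>mult := (\<lambda>x y. y \<otimes>\<^bsub>A\<^esub> x)\<rparr>"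

definition env_alg :: "('k::field, 'a) module \<Rightarrow> ('k, ('a \<times> 'a \<Rightarrow> 'k) set) module" where
  "env_alg A = tensor_alg A (op_alg A)"

text \<open>
  \<open>A\<close> as a left module over its enveloping algebra, \<open>(a \<otimes> b) x = a x b\<close>. An element \<open>X\<close> of the
  enveloping algebra is a coset; all its representatives \<open>f\<close> give the same value.
\<close>

definition bimod :: "('k::field, 'a) module \<Rightarrow> (('a \<times> 'a \<Rightarrow> 'k) set, 'a) module" where
  "bimod A =
    \<lparr>carrier = carrier A, mult = undefined, one = undefined, zero = \<zero>\<^bsub>A\<^esub>, add = add A,
     smult = (\<lambda>X x. the_elem
       ((\<lambda>f. \<Oplus>\<^bsub>A\<^esub>s\<in>supp f. f s \<odot>\<^bsub>A\<^esub> (fst s \<otimes>\<^bsub>A\<^esub> x \<otimes>\<^bsub>A\<^esub> snd s)) ` X))\<rparr>"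

section \<open>Ext and Hochschild cohomology\<close>

text \<open>The locale \<open>module\<close> of the library requires a commutative ring.\<close>

locale left_module = R?: ring R + M?: abelian_group M
  for R :: "('r, 'c) ring_scheme" (structure) and M :: "('r, 'm, 'd) module_scheme" (structure) +
  assumes smult_closed [simp, intro]:
      "\<lbrakk>r \<in> carrier R; x \<in> carrier M\<rbrakk> \<Longrightarrow> r \<odot>\<^bsub>M\<^esub> x \<in> carrier M"
    and smult_l_distr:
      "\<lbrakk>r \<in> carrier R; s \<in> carrier R; x \<in> carrier M\<rbrakk> \<Longrightarrow>
        (r \<oplus>\<^bsub>R\<^esub> s) \<odot>\<^bsub>M\<^esub> x = (r \<odot>\<^bsub>M\<^esub> x) \<oplus>\<^bsub>M\<^esub> (s \<odot>\<^bsub>M\<^esub> x)"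
    and smult_r_distr:
      "\<lbrakk>r \<in> carrier R; x \<in> carrier M; y \<in> carrier M\<rbrakk> \<Longrightarrow>
        r \<odot>\<^bsub>M\<^esub> (x \<oplus>\<^bsub>M\<^esub> y) = (r \<odot>\<^bsub>M\<^esub> x) \<oplus>\<^bsub>M\<^esub> (r \<odot>\<^bsub>M\<^esub> y)"
    and smult_assoc1:
      "\<lbrakk>r \<in> carrier R; s \<in> carrier R; x \<in> carrier M\<rbrakk> \<Longrightarrow>
        (r \<otimes>\<^bsub>R\<^esub> s) \<odot>\<^bsub>M\<^esub> x = r \<odot>\<^bsub>M\<^esub> (s \<odot>\<^bsub>M\<^esub> x)"
    and smult_one [simp]:
      "x \<in> carrier M \<Longrightarrow> \<one>\<^bsub>R\<^esub> \<odot>\<^bsub>M\<^esub> x = x"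

definition free_module :: "('r, 'c) ring_scheme \<Rightarrow> 's set \<Rightarrow> ('r, 's \<Rightarrow> 'r) module" where
  "free_module R S =
    \<lparr>carrier = {f. (\<forall>s. f s \<in> carrier R) \<and> finite {s. f s \<noteq> \<zero>\<^bsub>R\<^esub>} \<and> {s. f s \<noteq> \<zero>\<^bsub>R\<^esub>} \<subseteq> S},
     mult = undefined, one = undefined, zero = (\<lambda>_. \<zero>\<^bsub>R\<^esub>),
     add = (\<lambda>f g s. f s \<oplus>\<^bsub>R\<^esub> g s), smult = (\<lambda>r f s. r \<otimes>\<^bsub>R\<^esub> f s)\<rparr>"

text \<open>
  Projective modules are the direct summands of free modules. The basis \<open>S\<close> of the free module can
  always be chosen inside \<open>P\<close>, so its type is no restriction.
\<close>

definition projective_module :: "('r, 'c) ring_scheme \<Rightarrow> ('r, 'p) module \<Rightarrow> bool" where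
  "projective_module R P \<longleftrightarrow> left_module R P \<and>
    (\<exists>(S :: 'p set) \<iota> \<pi>. \<iota> \<in> module_hom R P (free_module R S) \<and>
       \<pi> \<in> module_hom R (free_module R S) P \<and> (\<forall>x\<in>carrier P. \<pi> (\<iota> x) = x))"

text \<open>\<open>d n\<close> is the differential from \<open>P (n + 1)\<close> to \<open>P n\<close>, and \<open>\<epsilon>\<close> the augmentation.\<close>

definition projective_resolution ::
    "('r, 'c) ring_scheme \<Rightarrow> ('r, 'm) module \<Rightarrow>
     (nat \<Rightarrow> ('r, 'p) module) \<Rightarrow> (nat \<Rightarrow> 'p \<Rightarrow> 'p) \<Rightarrow> bool" where
  "projective_resolution R M P d \<longleftrightarrow>
    (\<forall>n. projective_module R (P n)) \<and>
    (\<forall>n. d n \<in> module_hom R (P (Suc n)) (P n)) \<and>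
    (\<exists>\<epsilon> \<in> module_hom R (P 0) M. \<epsilon> ` carrier (P 0) = carrier M \<and>
       {x \<in> carrier (P 0). \<epsilon> x = \<zero>\<^bsub>M\<^esub>} = d 0 ` carrier (P 1)) \<and>
    (\<forall>n. {x \<in> carrier (P (Suc n)). d n x = \<zero>\<^bsub>P n\<^esub>} = d (Suc n) ` carrier (P (Suc (Suc n))))"

text \<open>
  For an algebra \<open>A\<close> over \<open>k\<close>, the \<open>k\<close>-vector space of \<open>A\<close>-linear maps; a scalar \<open>c\<close> acts
  through \<open>c 1\<close>, which is central in \<open>A\<close>.
\<close>

definition hom_space ::
    "('k, 'r) module \<Rightarrow> ('r, 'p) module \<Rightarrow> ('r, 'n) module \<Rightarrow> ('k, 'p \<Rightarrow> 'n) module" where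
  "hom_space A P N =
    \<lparr>carrier = module_hom A P N \<inter> extensional (carrier P),
     mult = undefined, one = undefined,
     zero = (\<lambda>x\<in>carrier P. \<zero>\<^bsub>N\<^esub>),
     add = (\<lambda>f g. \<lambda>x\<in>carrier P. f x \<oplus>\<^bsub>N\<^esub> g x),
     smult = (\<lambda>c f. \<lambda>x\<in>carrier P. (c \<odot>\<^bsub>A\<^esub> \<one>\<^bsub>A\<^esub>) \<odot>\<^bsub>N\<^esub> f x)\<rparr>"

definition cocycles ::
    "('k, 'r) module \<Rightarrow> (nat \<Rightarrow> ('r, 'p) module) \<Rightarrow> (nat \<Rightarrow> 'p \<Rightarrow> 'p) \<Rightarrow>
     ('r, 'n) module \<Rightarrow> nat \<Rightarrow> ('p \<Rightarrow> 'n) set" where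
  "cocycles A P d N n =
    {f \<in> carrier (hom_space A (P n) N). \<forall>x\<in>carrier (P (Suc n)). f (d n x) = \<zero>\<^bsub>N\<^esub>}"

fun coboundaries ::
    "('k, 'r) module \<Rightarrow> (nat \<Rightarrow> ('r, 'p) module) \<Rightarrow> (nat \<Rightarrow> 'p \<Rightarrow> 'p) \<Rightarrow>
     ('r, 'n) module \<Rightarrow> nat \<Rightarrow> ('p \<Rightarrow> 'n) set" where
  "coboundaries A P d N 0 = {\<zero>\<^bsub>hom_space A (P 0) N\<^esub>}"
| "coboundaries A P d N (Suc n) =
    (\<lambda>f. \<lambda>x\<in>carrier (P (Suc n)). f (d n x)) ` carrier (hom_space A (P n) N)"

definition hom_cohomology ::
    "('k, 'r) module \<Rightarrow> (nat \<Rightarrow> ('r, 'p) module) \<Rightarrow> (nat \<Rightarrow> 'p \<Rightarrow> 'p) \<Rightarrow>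
     ('r, 'n) module \<Rightarrow> nat \<Rightarrow> ('k, ('p \<Rightarrow> 'n) set) module" where
  "hom_cohomology A P d N n =
    quot_alg ((hom_space A (P n) N)\<lparr>carrier := cocycles A P d N n\<rparr>) (coboundaries A P d N n)"

text \<open>
  \<open>Ext\<close> is computed with some projective resolution \<open>(P, d)\<close> of \<open>M\<close>. The elements of \<open>P n\<close> are drawn
  from the type \<open>('r \<times> 'm) list \<Rightarrow> 'r\<close>. The lists over \<open>'r \<times> 'm\<close> are enough to index bases of all
  terms of a free resolution of \<open>M\<close>, so a resolution of this type exists for every \<open>M\<close>.
\<close>

definition Ext ::
    "('k, 'r) module \<Rightarrow> ('r, 'm) module \<Rightarrow> ('r, 'n) module \<Rightarrow> nat \<Rightarrow>
     ('k, ((('r \<times> 'm) list \<Rightarrow> 'r) \<Rightarrow> 'n) set) module" where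
  "Ext A M N n =
    (let (P, d) = (SOME (P, d). projective_resolution A M P d) in hom_cohomology A P d N n)"

definition HH where
  "HH A n = Ext (env_alg A) (bimod A) (bimod A) n"

abbreviation HH_dim :: "('k::field, 'a) module \<Rightarrow> nat \<Rightarrow> nat" where
  "HH_dim A n \<equiv> vectorspace.dim class_ring (HH A n)"

definition vs_isomorphic ::
    "('k::field, 'a) module \<Rightarrow> ('k, 'b) module \<Rightarrow> bool" where
  "vs_isomorphic V W \<longleftrightarrow>
    (\<exists>T. linear_map class_ring V W T \<and> bij_betw T (carrier V) (carrier W))"

section \<open>Bound quivers\<close>

text \<open>
  A quiver is a digraph with multiple arcs. A path is a pair of its source and its list of arcs, so
  that \<open>(x, [])\<close> is the stationary path at \<open>x\<close>; paths are composed from left to right.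
\<close>

type_synonym ('v, 'e) path = "'v \<times> 'e list"

definition paths :: "('v, 'e) pre_digraph \<Rightarrow> ('v, 'e) path set" where
  "paths Q = {(u, p). \<exists>v. pre_digraph.awalk Q u p v}"

text \<open>The product sums over the ways of cutting a path \<open>(u, p)\<close> in two.\<close>

definition path_algebra ::
    "('v, 'e) pre_digraph \<Rightarrow> ('k::field, ('v, 'e) path \<Rightarrow> 'k) module" where
  "path_algebra Q =
    \<lparr>carrier = {f. finite (supp f) \<and> supp f \<subseteq> paths Q},
     mult = (\<lambda>f g (u, p). \<Sum>i\<le>length p.
        f (u, take i p) * g (pre_digraph.awlast Q u (take i p), drop i p)),
     one = (\<lambda>(u, p). if u \<in> verts Q \<and> p = [] then 1 else 0),
     zero = (\<lambda>_. 0),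
     add = (\<lambda>f g x. f x + g x),
     smult = (\<lambda>c f x. c * f x)\<rparr>"

definition arrow_ideal :: "('v, 'e) pre_digraph \<Rightarrow> (('v, 'e) path \<Rightarrow> 'k::field) set" where
  "arrow_ideal Q = genideal (path_algebra Q :: ('k, ('v, 'e) path \<Rightarrow> 'k) module)
     ((\<lambda>a. unit_vec_at (tail Q a, [a])) ` arcs Q)"

primrec ideal_power :: "('a, 'c) ring_scheme \<Rightarrow> 'a set \<Rightarrow> nat \<Rightarrow> 'a set" where
  "ideal_power R J 0 = carrier R"
| "ideal_power R J (Suc n) = ideal_prod R (ideal_power R J n) J"

definition admissible_ideal ::
    "('v, 'e) pre_digraph \<Rightarrow> (('v, 'e) path \<Rightarrow> 'k::field) set \<Rightarrow> bool" where
  "admissible_ideal Q I \<longleftrightarrow> ideal I (path_algebra Q) \<and>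
    (\<exists>m\<ge>2. ideal_power (path_algebra Q) (arrow_ideal Q) m \<subseteq> I \<and>
            I \<subseteq> ideal_power (path_algebra Q) (arrow_ideal Q) 2)"

definition bound_quiver ::
    "('v, 'e) pre_digraph \<Rightarrow> (('v, 'e) path \<Rightarrow> 'k::field) set \<Rightarrow> bool" where
  "bound_quiver Q I \<longleftrightarrow> fin_digraph Q \<and> admissible_ideal Q I"

definition bq_algebra ::
    "('v, 'e) pre_digraph \<Rightarrow> (('v, 'e) path \<Rightarrow> 'k::field) set \<Rightarrow>
     ('k, (('v, 'e) path \<Rightarrow> 'k) set) module" where
  "bq_algebra Q I = quot_alg (path_algebra Q) I"

definition vertex_idem ::
    "('v, 'e) pre_digraph \<Rightarrow> (('v, 'e) path \<Rightarrow> 'k::field) set \<Rightarrow> 'v \<Rightarrow>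
     (('v, 'e) path \<Rightarrow> 'k) set" where
  "vertex_idem Q I x = I +>\<^bsub>path_algebra Q\<^esub> unit_vec_at (x, [])"

definition vertex_idem_sum ::
    "('v, 'e) pre_digraph \<Rightarrow> (('v, 'e) path \<Rightarrow> 'k::field) set \<Rightarrow> 'v set \<Rightarrow>
     (('v, 'e) path \<Rightarrow> 'k) set" where
  "vertex_idem_sum Q I V = (\<Oplus>\<^bsub>bq_algebra Q I\<^esub>x\<in>V. vertex_idem Q I x)"

text \<open>
  The bound quiver algebra of the full subquiver on \<open>V\<close>. Its path algebra is literally a subset of that
  of \<open>Q\<close>. When that subquiver is convex, as are the three belonging to an oriented algebra \<open>R\<close>, this is the
  algebra \<open>e R e\<close>, where \<open>e\<close> is the sum of the idempotents of the vertices in \<open>V\<close>.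
\<close>

definition restrict_ideal ::
    "('v, 'e) pre_digraph \<Rightarrow> (('v, 'e) path \<Rightarrow> 'k::field) set \<Rightarrow> 'v set \<Rightarrow>
     (('v, 'e) path \<Rightarrow> 'k) set" where
  "restrict_ideal Q I V =
     carrier (path_algebra (Q \<restriction> V) :: ('k, ('v, 'e) path \<Rightarrow> 'k) module) \<inter> I"

definition sub_bq_algebra ::
    "('v, 'e) pre_digraph \<Rightarrow> (('v, 'e) path \<Rightarrow> 'k::field) set \<Rightarrow> 'v set \<Rightarrow>
     ('k, (('v, 'e) path \<Rightarrow> 'k) set) module" where
  "sub_bq_algebra Q I V = bq_algebra (Q \<restriction> V) (restrict_ideal Q I V)"

text \<open>\<open>forest\<close> excludes directed cycles, loops included.\<close>

definition core_algebra ::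
    "('v, 'e) pre_digraph \<Rightarrow> (('v, 'e) path \<Rightarrow> 'k::field) set \<Rightarrow> bool" where
  "core_algebra Q I \<longleftrightarrow> forest Q \<and>
    (\<forall>n\<ge>1. carrier (HH (bq_algebra Q I) n) = {\<zero>\<^bsub>HH (bq_algebra Q I) n\<^esub>})"

section \<open>Oriented algebras\<close>

definition peirce :: "('a, 'c) ring_scheme \<Rightarrow> 'a \<Rightarrow> 'a \<Rightarrow> 'a set" where
  "peirce R x y = (\<lambda>r. x \<otimes>\<^bsub>R\<^esub> r \<otimes>\<^bsub>R\<^esub> y) ` carrier R"

definition orthogonal_idempotents :: "('a, 'c) ring_scheme \<Rightarrow> 'a \<Rightarrow> 'a \<Rightarrow> 'a \<Rightarrow> bool" where
  "orthogonal_idempotents R x y z \<longleftrightarrow>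
    {x, y, z} \<subseteq> carrier R \<and>
    x \<otimes>\<^bsub>R\<^esub> x = x \<and> y \<otimes>\<^bsub>R\<^esub> y = y \<and> z \<otimes>\<^bsub>R\<^esub> z = z \<and>
    x \<otimes>\<^bsub>R\<^esub> y = \<zero>\<^bsub>R\<^esub> \<and> y \<otimes>\<^bsub>R\<^esub> x = \<zero>\<^bsub>R\<^esub> \<and>
    x \<otimes>\<^bsub>R\<^esub> z = \<zero>\<^bsub>R\<^esub> \<and> z \<otimes>\<^bsub>R\<^esub> x = \<zero>\<^bsub>R\<^esub> \<and>
    y \<otimes>\<^bsub>R\<^esub> z = \<zero>\<^bsub>R\<^esub> \<and> z \<otimes>\<^bsub>R\<^esub> y = \<zero>\<^bsub>R\<^esub>"

definition oriented :: "('a, 'c) ring_scheme \<Rightarrow> 'a \<Rightarrow> 'a \<Rightarrow> 'a \<Rightarrow> bool" where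
  "oriented R e e1 e2 \<longleftrightarrow>
    orthogonal_idempotents R e e1 e2 \<and>
    \<one>\<^bsub>R\<^esub> = e1 \<oplus>\<^bsub>R\<^esub> e \<oplus>\<^bsub>R\<^esub> e2 \<and>
    peirce R e1 e2 = {\<zero>\<^bsub>R\<^esub>} \<and> peirce R e2 e1 = {\<zero>\<^bsub>R\<^esub>} \<and>
    (peirce R e e1 = {\<zero>\<^bsub>R\<^esub>} \<and> peirce R e e2 = {\<zero>\<^bsub>R\<^esub>} \<or>
     peirce R e1 e = {\<zero>\<^bsub>R\<^esub>} \<and> peirce R e2 e = {\<zero>\<^bsub>R\<^esub>} \<or>
     peirce R e1 e = {\<zero>\<^bsub>R\<^esub>} \<and> peirce R e e2 = {\<zero>\<^bsub>R\<^esub>})"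

text \<open>
  \<open>W\<close> is nonempty and lies in one connected component of the full subquiver of \<open>Q\<close> on \<open>V\<close>.
  For nonempty \<open>W \<subseteq> V\<close> this holds whenever that subquiver is connected. Some such condition
  on the core is needed when counting dimensions: gluing \<open>a \<leftarrow> x \<rightarrow> b\<close> and the disconnected
  \<open>a \<leftarrow> y, b\<close> along the core \<open>{a, b}\<close> gives a quiver of type \<open>A\<^sub>4\<close>, whose centre has dimension
  \<open>1\<close> and not \<open>1 + 2 - 1\<close>.
\<close>

definition connected_within :: "('v, 'e) pre_digraph \<Rightarrow> 'v set \<Rightarrow> 'v set \<Rightarrow> bool" where
  "connected_within Q V W \<longleftrightarrow>
    W \<noteq> {} \<and> (\<forall>x\<in>W. \<forall>y\<in>W. x \<rightarrow>\<^sup>*\<^bsub>mk_symmetric (Q \<restriction> V)\<^esub> y)"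

end

theory Submission
  imports Defs
begin

text \<open>
  The Hochschild cohomology of a bound quiver algebra is computed by a bar complex relative to the vertices:
  a basis of paths (containing all vertices and arrows) modulo the relations makes the algebra a
  category with finitely many objects, and an \<open>n\<close>-cochain is a value for every composable string of
  \<open>n\<close> basis elements, parallel to the string. Restricting cochains to the full subcategories \<open>A\<^sub>1\<close>, \<open>A\<^sub>2\<close>
  and \<open>C\<close> gives a sequence of complexes \<open>0 \<rightarrow> K(R) \<rightarrow> K(A\<^sub>1) \<oplus> K(A\<^sub>2) \<rightarrow> K(C) \<rightarrow> 0\<close>. It is exact because
  the orientation forbids a string whose ends are joined by a parallel path unless the string stays in
  \<open>A\<^sub>1\<close> or in \<open>A\<^sub>2\<close>. As \<open>C\<close> has no higher cohomology, the long exact sequence splits into isomorphisms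
  above degree \<open>1\<close>; in low degrees only \<open>H\<^sup>0(A\<^sub>1) \<oplus> H\<^sup>0(A\<^sub>2) \<rightarrow> H\<^sup>0(C)\<close> matters. Since \<open>C\<close> has no
  oriented cycles and lies in one component of each \<open>Q\<^bsub>A\<^sub>i\<^esub>\<close>, central elements of \<open>A\<^sub>i\<close> restrict to scalars
  on \<open>C\<close>, so this map has rank \<open>1\<close>.
\<close>

text \<open>\<open>Ext\<close> is computed from a resolution selected by \<open>SOME\<close>, of
  which nothing is known except that it is a projective resolution. The comparison theorem is
  therefore proved in full and used to replace it by the bar resolution, whose terms are recoded in
  the type that \<open>Ext\<close> prescribes. Working relative to the vertices makes every value of
  a cochain parallel to its string, so that values on a full subcategory stay inside it and a string
  between the two sides has no room for a nonzero value. All four complexes share one basis and one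
  table of structure constants: restriction only sets values to zero, and gluing is literal. The
  arrows can be put into the basis because the ideal lies in the square of the arrow ideal. For the
  same reason no path of length at least two has an arrow in its normal form, and centrality then
  forces the scalar parts at both ends of an arrow to agree. In degrees \<open>0\<close> and
  \<open>1\<close> dimensions are counted on cochains and cocycles, which are finite-dimensional
  fibre products; the \<open>- 1\<close> in both formulas is the line of scalars on the
  core.\<close>

no_notation vwalk_join (infixr "\<oplus>" 65)

section \<open>Vector spaces and algebras whose scalars form a field type\<close>

text \<open>Scalars range over the whole type \<open>'k\<close>, so no law carries a premise about
  \<open>carrier class_ring\<close>. \<open>kvs_vectorspace\<close> and
  \<open>vectorspace_kvs\<close> pass to and from the library locale, from which dimensions,
  rank-nullity and direct sums are taken.\<close>

locale kvs = abelian_group V for V :: "('k::field, 'a) module" (structure) +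
  assumes ks_closed [simp, intro]: "x \<in> carrier V \<Longrightarrow> c \<odot> x \<in> carrier V"
    and ks_l_distr: "x \<in> carrier V \<Longrightarrow> (c + d) \<odot> x = c \<odot> x \<oplus> d \<odot> x"
    and ks_r_distr: "x \<in> carrier V \<Longrightarrow> y \<in> carrier V \<Longrightarrow> c \<odot> (x \<oplus> y) = c \<odot> x \<oplus> c \<odot> y"
    and ks_assoc: "x \<in> carrier V \<Longrightarrow> (c * d) \<odot> x = c \<odot> (d \<odot> x)"
    and ks_one [simp]: "x \<in> carrier V \<Longrightarrow> 1 \<odot> x = x"

lemma kvs_vectorspace:
  assumes "kvs V" shows "vectorspace class_ring V"
proof -
  interpret kvs V by fact
  show ?thesis
    by unfold_locales
      (auto simp: ks_l_distr ks_r_distr ks_assoc field_simps intro: exI[of _ "inverse _"] dest: right_inverse simp: Units_def)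
qed

lemma vectorspace_kvs:
  assumes "vectorspace class_ring V" shows "kvs V"
proof -
  interpret V: vectorspace class_ring V by fact
  show ?thesis
    apply unfold_locales
    using V.smult_l_distr V.smult_r_distr V.smult_assoc1 V.smult_one by auto
qed

context kvs begin

lemma ks_zero_right [simp]: "c \<odot> \<zero> = \<zero>"
proof -
  have "c \<odot> \<zero> = c \<odot> \<zero> \<oplus> c \<odot> \<zero>"
    using ks_r_distr[of \<zero> \<zero> c] by simp
  then show ?thesis
    by (metis a_closed add.r_cancel_one' ks_closed zero_closed)
qed

lemma ks_zero_left [simp]: "x \<in> carrier V \<Longrightarrow> 0 \<odot> x = \<zero>"
  using ks_l_distr[of x 0 0] by (metis add.right_neutral add.r_cancel_one' ks_closed)

lemma ks_neg: "x \<in> carrier V \<Longrightarrow> (- c) \<odot> x = \<ominus> (c \<odot> x)"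
  using ks_l_distr[of x c "- c"] by (metis add.right_inverse add.inv_equality a_comm ks_closed ks_zero_left)

lemma ks_finsum:
  "g \<in> S \<rightarrow> carrier V \<Longrightarrow> c \<odot> (\<Oplus>i\<in>S. g i) = (\<Oplus>i\<in>S. c \<odot> g i)"
proof (induct S rule: infinite_finite_induct)
  case (insert x F)
  then show ?case by (simp add: ks_r_distr Pi_def)
qed auto

end

locale kalg = ring A + kvs A for A :: "('k::field, 'a) module" (structure) +
  assumes ks_mult_left: "x \<in> carrier A \<Longrightarrow> y \<in> carrier A \<Longrightarrow> (c \<odot> x) \<otimes> y = c \<odot> (x \<otimes> y)"
    and ks_mult_right: "x \<in> carrier A \<Longrightarrow> y \<in> carrier A \<Longrightarrow> x \<otimes> (c \<odot> y) = c \<odot> (x \<otimes> y)"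

section \<open>Quotients\<close>

lemma quot_alg_simps [simp]:
  "carrier (quot_alg V W) = a_rcosets\<^bsub>V\<^esub> W"
  "zero (quot_alg V W) = W"
  "add (quot_alg V W) = set_add V"
  "one (quot_alg V W) = W +>\<^bsub>V\<^esub> \<one>\<^bsub>V\<^esub>"
  "mult (quot_alg V W) = rcoset_mult V W"
  by (simp_all add: quot_alg_def FactRing_def)

locale kquot = kvs V for V :: "('k::field, 'a) module" (structure) +
  fixes W
  assumes W_subset: "W \<subseteq> carrier V" and W_zero: "\<zero> \<in> W"
    and W_add: "x \<in> W \<Longrightarrow> y \<in> W \<Longrightarrow> x \<oplus> y \<in> W"
    and W_smult: "x \<in> W \<Longrightarrow> c \<odot> x \<in> W"
begin

lemma W_neg: "x \<in> W \<Longrightarrow> \<ominus> x \<in> W"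
  using W_smult[of x "-1"] ks_neg[of x 1] W_subset by auto

sublocale W: abelian_subgroup W V
proof (rule abelian_subgroupI3)
  show "additive_subgroup W V"
    by (intro additive_subgroupI subgroup.intro)
      (use W_subset W_zero W_add W_neg in \<open>auto simp: a_inv_def[symmetric]\<close>)
qed unfold_locales

lemma coset_eq_iff:
  "a \<in> carrier V \<Longrightarrow> b \<in> carrier V \<Longrightarrow> W +> a = W +> b \<longleftrightarrow> a \<ominus> b \<in> W"
proof -
  assume ab: "a \<in> carrier V" "b \<in> carrier V"
  have "W +> a = W +> b \<longleftrightarrow> a \<in> W +> b"
    using W.a_repr_independence'[of a b] W.a_rcos_self[OF ab(1)] ab by auto
  then show ?thesis using W.a_rcos_module[OF ab(2,1)] by (simp add: minus_eq)
qed

lemma coset_zero_iff: "a \<in> carrier V \<Longrightarrow> W +> a = W \<longleftrightarrow> a \<in> W"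
  using W.a_rcos_const[of a] W.a_rcos_self[of a] by auto

lemma coset_add: "a \<in> carrier V \<Longrightarrow> b \<in> carrier V \<Longrightarrow> (W +> a) <+> (W +> b) = W +> (a \<oplus> b)"
  by (rule W.a_rcos_sum)

text \<open>Every element of \<open>W +> a\<close> is \<open>w \<oplus> a\<close> with
  \<open>w\<close> in \<open>W\<close>, and \<open>c \<odot> w\<close> stays in \<open>W\<close>;
  hence all cosets in the union that defines the scalar action coincide.\<close>

lemma quot_smult: "a \<in> carrier V \<Longrightarrow> c \<odot>\<^bsub>quot_alg V W\<^esub> (W +> a) = W +> (c \<odot> a)"
proof -
  assume a: "a \<in> carrier V"
  have *: "W +> (c \<odot> x) = W +> (c \<odot> a)" if "x \<in> W +> a" for x
  proof -
    from that obtain w where w: "w \<in> W" "x = w \<oplus> a" unfolding a_r_coset_def' by auto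
    then have "w \<in> carrier V" using W_subset by auto
    then have "c \<odot> x = c \<odot> w \<oplus> c \<odot> a" using w a by (simp add: ks_r_distr)
    then have "c \<odot> x \<in> W +> (c \<odot> a)" using w W_smult unfolding a_r_coset_def' by auto
    then show ?thesis
      using a W.a_repr_independence' ks_closed by metis
  qed
  have "a \<in> W +> a" using a W.a_rcos_self by auto
  then have "(\<Union>x\<in>W +> a. W +> (c \<odot> x)) = W +> (c \<odot> a)"
    by (subst SUP_cong[OF refl *]) auto
  then show ?thesis by (simp add: quot_alg_def)
qed

lemma rcosetsE:
  assumes "X \<in> a_rcosets W" obtains a where "a \<in> carrier V" "X = W +> a"
  using assms unfolding A_RCOSETS_def' by auto

lemma quot_kvs: "kvs (quot_alg V W)"
proof -
  have "abelian_group (V Quot W)"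
    by (rule comm_group_abelian_groupI)
      (use W.a_factorgroup_is_comm_group in \<open>simp add: FactRing_def A_FactGroup_def'\<close>)
  then interpret F: abelian_group "V Quot W" .
  have "abelian_group (quot_alg V W)"
  proof (rule abelian_groupI, goal_cases)
    case (6 x)
    then have "x \<in> carrier (V Quot W)" by (simp add: FactRing_def)
    from F.add.l_inv_ex[OF this] show ?case by (auto simp: FactRing_def)
  qed (use F.a_closed F.a_assoc F.a_comm F.l_zero F.zero_closed in \<open>simp_all add: FactRing_def\<close>)
  then interpret Q: abelian_group "quot_alg V W" .
  show ?thesis
  proof unfold_locales
    fix X c assume "X \<in> carrier (quot_alg V W)"
    then obtain a where a: "a \<in> carrier V" "X = W +> a" using rcosetsE[of X] by auto
    show "c \<odot>\<^bsub>quot_alg V W\<^esub> X \<in> carrier (quot_alg V W)"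
      using a by (simp add: quot_smult a_rcosetsI W_subset)
    show "1 \<odot>\<^bsub>quot_alg V W\<^esub> X = X" using a by (simp add: quot_smult)
    fix d
    show "(c + d) \<odot>\<^bsub>quot_alg V W\<^esub> X = c \<odot>\<^bsub>quot_alg V W\<^esub> X \<oplus>\<^bsub>quot_alg V W\<^esub> d \<odot>\<^bsub>quot_alg V W\<^esub> X"
      using a by (simp add: quot_smult W.a_rcos_sum ks_l_distr)
    show "(c * d) \<odot>\<^bsub>quot_alg V W\<^esub> X = c \<odot>\<^bsub>quot_alg V W\<^esub> (d \<odot>\<^bsub>quot_alg V W\<^esub> X)"
      using a by (simp add: quot_smult ks_assoc)
    fix Y assume "Y \<in> carrier (quot_alg V W)"
    then obtain b where b: "b \<in> carrier V" "Y = W +> b" using rcosetsE[of Y] by auto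
    show "c \<odot>\<^bsub>quot_alg V W\<^esub> (X \<oplus>\<^bsub>quot_alg V W\<^esub> Y) = c \<odot>\<^bsub>quot_alg V W\<^esub> X \<oplus>\<^bsub>quot_alg V W\<^esub> c \<odot>\<^bsub>quot_alg V W\<^esub> Y"
      using a b by (simp add: quot_smult W.a_rcos_sum ks_r_distr)
  qed
qed

end

text \<open>A ring ideal of an algebra is a subspace, since \<open>c \<odot> x\<close> is the
  product of \<open>c \<odot> \<one>\<close> with \<open>x\<close>. The ring laws come from
  \<open>T Quot J\<close>, the scalar laws from \<open>kquot\<close>.\<close>

lemma kalg_quot:
  assumes "kalg T" "ideal J T"
  shows "kalg (quot_alg T J)" "kquot T J"
proof -
  interpret T: kalg T by fact
  interpret J: ideal J T by fact
  have sm: "c \<odot>\<^bsub>T\<^esub> x \<in> J" if "x \<in> J" for c x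
    using J.I_l_closed[OF that, of "c \<odot>\<^bsub>T\<^esub> \<one>\<^bsub>T\<^esub>"] that J.a_subset
    by (auto simp: T.ks_mult_left)
  interpret Q: kquot T J
    by unfold_locales (use J.a_subset sm in auto)
  show "kquot T J" by unfold_locales
  interpret Qv: kvs "quot_alg T J" by (rule Q.quot_kvs)
  have "ring (T Quot J)" by (rule J.quotient_is_ring)
  then interpret Qr: ring "T Quot J" .
  show "kalg (quot_alg T J)"
  proof (intro kalg.intro kalg_axioms.intro ringI)
    show "kvs (quot_alg T J)" by unfold_locales
    show "abelian_group (quot_alg T J)" by unfold_locales
    show "Group.monoid (quot_alg T J)"
      using Qr.monoid_axioms unfolding Group.monoid_def by (simp add: FactRing_def)
  next
    fix x y c assume "x \<in> carrier (quot_alg T J)" "y \<in> carrier (quot_alg T J)"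
    then obtain a b where "a \<in> carrier T" "x = J +>\<^bsub>T\<^esub> a" "b \<in> carrier T" "y = J +>\<^bsub>T\<^esub> b"
      using Q.rcosetsE[of x] Q.rcosetsE[of y] by (metis quot_alg_simps(1))
    then show "(c \<odot>\<^bsub>quot_alg T J\<^esub> x) \<otimes>\<^bsub>quot_alg T J\<^esub> y = c \<odot>\<^bsub>quot_alg T J\<^esub> (x \<otimes>\<^bsub>quot_alg T J\<^esub> y)"
      "x \<otimes>\<^bsub>quot_alg T J\<^esub> (c \<odot>\<^bsub>quot_alg T J\<^esub> y) = c \<odot>\<^bsub>quot_alg T J\<^esub> (x \<otimes>\<^bsub>quot_alg T J\<^esub> y)"
      by (simp_all add: Q.quot_smult J.rcoset_mult_add T.ks_mult_left T.ks_mult_right)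
  next
    fix x y z assume "x \<in> carrier (quot_alg T J)" "y \<in> carrier (quot_alg T J)" "z \<in> carrier (quot_alg T J)"
    then have "x \<in> carrier (T Quot J)" "y \<in> carrier (T Quot J)" "z \<in> carrier (T Quot J)"
      by (simp_all add: FactRing_def)
    from Qr.l_distr[OF this] Qr.r_distr[OF this]
    show "(x \<oplus>\<^bsub>quot_alg T J\<^esub> y) \<otimes>\<^bsub>quot_alg T J\<^esub> z = x \<otimes>\<^bsub>quot_alg T J\<^esub> z \<oplus>\<^bsub>quot_alg T J\<^esub> y \<otimes>\<^bsub>quot_alg T J\<^esub> z"
      "z \<otimes>\<^bsub>quot_alg T J\<^esub> (x \<oplus>\<^bsub>quot_alg T J\<^esub> y) = z \<otimes>\<^bsub>quot_alg T J\<^esub> x \<oplus>\<^bsub>quot_alg T J\<^esub> z \<otimes>\<^bsub>quot_alg T J\<^esub> y"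
      by (simp_all add: FactRing_def)
  qed
qed

section \<open>Functions with finite support\<close>

text \<open>This is the form in which "check on a basis and extend linearly" is used throughout. The
  supports in the case \<open>add\<close> may overlap, so additivity of the property is all that has
  to be shown there.\<close>

lemma fun_supp_induct [consumes 2, case_names zero unit add]:
  fixes f :: "'s \<Rightarrow> 'k::field"
  assumes "finite (supp f)" "supp f \<subseteq> S"
    and zero: "P (\<lambda>_. 0)"
    and unit: "\<And>c s. s \<in> S \<Longrightarrow> P (\<lambda>x. c * unit_vec_at s x)"
    and add: "\<And>f g. finite (supp f) \<Longrightarrow> finite (supp g) \<Longrightarrow> supp f \<subseteq> S \<Longrightarrow> supp g \<subseteq> S \<Longrightarrow>
       P f \<Longrightarrow> P g \<Longrightarrow> P (\<lambda>x. f x + g x)"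
  shows "P f"
proof -
  have "finite A \<Longrightarrow> A \<subseteq> S \<Longrightarrow> supp f \<subseteq> A \<Longrightarrow> P f" for A f
  proof (induct A arbitrary: f rule: finite_induct)
    case empty
    then have "f = (\<lambda>_. 0)" by (auto simp: supp_def)
    then show ?case using zero by simp
  next
    case (insert a A)
    let ?g = "\<lambda>x. if x = a then 0 else f x" and ?h = "\<lambda>x. f a * unit_vec_at a x"
    have g: "supp ?g \<subseteq> A" using insert by (auto simp: supp_def)
    have "P ?g" using insert g by auto
    moreover have "P ?h" using insert by (intro unit) auto
    moreover have "supp ?h \<subseteq> {a}" by (auto simp: supp_def unit_vec_at_def split: if_splits)
    moreover have "finite (supp ?g)" "supp ?g \<subseteq> S" using g insert finite_subset by blast+
    moreover have "finite (supp ?h)" "supp ?h \<subseteq> S"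
      using \<open>supp ?h \<subseteq> {a}\<close> insert by (auto intro: finite_subset)
    ultimately have "P (\<lambda>x. ?g x + ?h x)" by (intro add)
    moreover have "(\<lambda>x. ?g x + ?h x) = f" by (auto simp: unit_vec_at_def)
    ultimately show ?case by simp
  qed
  from this[of "supp f" f] assms show ?thesis by auto
qed

lemma supp_add_subset: "supp (\<lambda>x. f x + (g x :: 'k::field)) \<subseteq> supp f \<union> supp g"
  by (auto simp: supp_def)

lemma supp_diff_subset: "supp (\<lambda>x. f x - (g x :: 'k::field)) \<subseteq> supp f \<union> supp g"
  by (auto simp: supp_def)

lemma supp_smult_subset: "supp (\<lambda>x. c * (f x :: 'k::field)) \<subseteq> supp f"
  by (auto simp: supp_def)

lemma supp_unit [simp]: "supp (unit_vec_at s :: 's \<Rightarrow> 'k::field) = {s}"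
  by (auto simp: supp_def unit_vec_at_def)

text \<open>The support of a sum can be smaller than the union of the supports, so linear
  combinations are moved to a common finite index set before they are added.\<close>

lemma (in kvs) lin_comb_superset:
  assumes "finite S" "supp f \<subseteq> S" "g \<in> S \<rightarrow> carrier V"
  shows "(\<Oplus>s\<in>supp f. f s \<odot> g s) = (\<Oplus>s\<in>S. f s \<odot> g s)"
  using assms by (intro add.finprod_mono_neutral_cong_left) (auto simp: supp_def Pi_def)

lemma (in kvs) lin_comb_unit:
  assumes "finite S" "s \<in> S" "g \<in> S \<rightarrow> carrier V"
  shows "(\<Oplus>x\<in>S. unit_vec_at s x \<odot> g x) = g s"
proof -
  have "(\<Oplus>x\<in>S. unit_vec_at s x \<odot> g x) = (\<Oplus>x\<in>S. if s = x then g x else \<zero>)"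
    using assms by (intro finsum_cong') (auto simp: unit_vec_at_def Pi_def)
  also have "\<dots> = g s" using assms by (subst add.finprod_singleton) auto
  finally show ?thesis .
qed

lemma (in kvs) lin_comb_add:
  assumes "g \<in> S \<rightarrow> carrier V"
  shows "(\<Oplus>s\<in>S. (f s + h s) \<odot> g s) = (\<Oplus>s\<in>S. f s \<odot> g s) \<oplus> (\<Oplus>s\<in>S. h s \<odot> g s)"
proof -
  have "(\<Oplus>s\<in>S. (f s + h s) \<odot> g s) = (\<Oplus>s\<in>S. f s \<odot> g s \<oplus> h s \<odot> g s)"
    using assms by (intro finsum_cong') (auto simp: ks_l_distr Pi_def)
  also have "\<dots> = (\<Oplus>s\<in>S. f s \<odot> g s) \<oplus> (\<Oplus>s\<in>S. h s \<odot> g s)"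
    using assms by (intro finsum_addf) auto
  finally show ?thesis .
qed

lemma (in kvs) lin_comb_smult:
  assumes "g \<in> S \<rightarrow> carrier V"
  shows "(\<Oplus>s\<in>S. (c * f s) \<odot> g s) = c \<odot> (\<Oplus>s\<in>S. f s \<odot> g s)"
  using assms by (subst ks_finsum) (auto intro!: finsum_cong' simp: ks_assoc Pi_def)

section \<open>Presentations of a vector space as a quotient of a function space\<close>

text \<open>This says that \<open>q\<close> induces an isomorphism from \<open>Z\<close> modulo
  \<open>B\<close> onto \<open>H\<close> without forming the quotient. Cohomology spaces whose
  elements have unrelated types are compared through it, because \<open>Z\<close> and
  \<open>B\<close> are then sets of functions of one type.\<close>

definition pres :: "('k::field, 'h) module \<Rightarrow> ('x \<Rightarrow> 'k) set \<Rightarrow> ('x \<Rightarrow> 'k) set \<Rightarrow> (('x \<Rightarrow> 'k) \<Rightarrow> 'h) \<Rightarrow> bool" where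
  "pres H Z B q \<longleftrightarrow> kvs H \<and> q ` Z = carrier H \<and>
    (\<forall>x\<in>Z. \<forall>y\<in>Z. q (\<lambda>i. x i + y i) = q x \<oplus>\<^bsub>H\<^esub> q y) \<and>
    (\<forall>c. \<forall>x\<in>Z. q (\<lambda>i. c * x i) = c \<odot>\<^bsub>H\<^esub> q x) \<and>
    (\<forall>x\<in>Z. q x = \<zero>\<^bsub>H\<^esub> \<longleftrightarrow> x \<in> B)"

lemma presD:
  assumes "pres H Z B q"
  shows "q ` Z = carrier H"
    "x \<in> Z \<Longrightarrow> y \<in> Z \<Longrightarrow> q (\<lambda>i. x i + y i) = q x \<oplus>\<^bsub>H\<^esub> q y"
    "x \<in> Z \<Longrightarrow> q (\<lambda>i. k * x i) = k \<odot>\<^bsub>H\<^esub> q x"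
    "x \<in> Z \<Longrightarrow> q x = \<zero>\<^bsub>H\<^esub> \<longleftrightarrow> x \<in> B"
proof -
  note a = assms[unfolded pres_def, THEN conjunct2]
  show "q ` Z = carrier H" by (rule a[THEN conjunct1])
  show "x \<in> Z \<Longrightarrow> y \<in> Z \<Longrightarrow> q (\<lambda>i. x i + y i) = q x \<oplus>\<^bsub>H\<^esub> q y"
    by (rule a[THEN conjunct2, THEN conjunct1, rule_format])
  show "x \<in> Z \<Longrightarrow> q (\<lambda>i. k * x i) = k \<odot>\<^bsub>H\<^esub> q x"
    by (rule a[THEN conjunct2, THEN conjunct2, THEN conjunct1, rule_format])
  show "x \<in> Z \<Longrightarrow> q x = \<zero>\<^bsub>H\<^esub> \<longleftrightarrow> x \<in> B"
    by (rule a[THEN conjunct2, THEN conjunct2, THEN conjunct2, rule_format])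
qed

section \<open>Modules over a ring\<close>

context left_module begin

lemma smult_zero_right [simp]: "r \<in> carrier R \<Longrightarrow> r \<odot>\<^bsub>M\<^esub> \<zero>\<^bsub>M\<^esub> = \<zero>\<^bsub>M\<^esub>"
  using smult_r_distr[of r "\<zero>\<^bsub>M\<^esub>" "\<zero>\<^bsub>M\<^esub>"]
  by (metis M.add.r_cancel_one' M.l_zero M.zero_closed smult_closed)

lemma smult_zero_left [simp]: "x \<in> carrier M \<Longrightarrow> \<zero>\<^bsub>R\<^esub> \<odot>\<^bsub>M\<^esub> x = \<zero>\<^bsub>M\<^esub>"
  using smult_l_distr[of "\<zero>\<^bsub>R\<^esub>" "\<zero>\<^bsub>R\<^esub>" x]
  by (metis M.add.r_cancel_one' R.l_zero R.zero_closed smult_closed)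

lemma smult_neg: "r \<in> carrier R \<Longrightarrow> x \<in> carrier M \<Longrightarrow> r \<odot>\<^bsub>M\<^esub> (\<ominus>\<^bsub>M\<^esub> x) = \<ominus>\<^bsub>M\<^esub> (r \<odot>\<^bsub>M\<^esub> x)"
  using smult_r_distr[of r x "\<ominus>\<^bsub>M\<^esub> x"]
  by (metis M.add.inv_closed M.minus_equality M.r_neg M.a_comm smult_closed smult_zero_right)

lemma smult_finsum_right:
  "r \<in> carrier R \<Longrightarrow> g \<in> S \<rightarrow> carrier M \<Longrightarrow> r \<odot>\<^bsub>M\<^esub> (\<Oplus>\<^bsub>M\<^esub>i\<in>S. g i) = (\<Oplus>\<^bsub>M\<^esub>i\<in>S. r \<odot>\<^bsub>M\<^esub> g i)"
proof (induct S rule: infinite_finite_induct)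
  case (insert x F)
  then show ?case by (simp add: smult_r_distr Pi_def)
qed auto

end

lemma module_homI:
  assumes "\<And>x. x \<in> carrier M \<Longrightarrow> f x \<in> carrier N"
    "\<And>x y. x \<in> carrier M \<Longrightarrow> y \<in> carrier M \<Longrightarrow> f (x \<oplus>\<^bsub>M\<^esub> y) = f x \<oplus>\<^bsub>N\<^esub> f y"
    "\<And>r x. r \<in> carrier R \<Longrightarrow> x \<in> carrier M \<Longrightarrow> f (r \<odot>\<^bsub>M\<^esub> x) = r \<odot>\<^bsub>N\<^esub> f x"
  shows "f \<in> module_hom R M N"
  using assms by (auto simp: LinearCombinations.module_hom_def)

lemma module_homD:
  assumes "f \<in> module_hom R M N"
  shows "x \<in> carrier M \<Longrightarrow> f x \<in> carrier N"
    "x \<in> carrier M \<Longrightarrow> y \<in> carrier M \<Longrightarrow> f (x \<oplus>\<^bsub>M\<^esub> y) = f x \<oplus>\<^bsub>N\<^esub> f y"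
    "r \<in> carrier R \<Longrightarrow> x \<in> carrier M \<Longrightarrow> f (r \<odot>\<^bsub>M\<^esub> x) = r \<odot>\<^bsub>N\<^esub> f x"
  using assms by (auto simp: LinearCombinations.module_hom_def)

lemma additive_zero:
  assumes "abelian_group M" "abelian_group N"
    "\<And>x. x \<in> carrier M \<Longrightarrow> f x \<in> carrier N"
    "\<And>x y. x \<in> carrier M \<Longrightarrow> y \<in> carrier M \<Longrightarrow> f (x \<oplus>\<^bsub>M\<^esub> y) = f x \<oplus>\<^bsub>N\<^esub> f y"
  shows "f \<zero>\<^bsub>M\<^esub> = \<zero>\<^bsub>N\<^esub>"
proof -
  interpret M: abelian_group M by fact
  interpret N: abelian_group N by fact
  have "f \<zero>\<^bsub>M\<^esub> = f \<zero>\<^bsub>M\<^esub> \<oplus>\<^bsub>N\<^esub> f \<zero>\<^bsub>M\<^esub>"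
    using assms(4)[of "\<zero>\<^bsub>M\<^esub>" "\<zero>\<^bsub>M\<^esub>"] by simp
  then show ?thesis by (metis N.add.r_cancel_one' assms(3) M.zero_closed)
qed

lemma left_module_abelian [dest]: "left_module R M \<Longrightarrow> abelian_group M"
  by (simp add: left_module_def)

lemma module_hom_zero:
  assumes "f \<in> module_hom R M N" "left_module R M" "left_module R N"
  shows "f \<zero>\<^bsub>M\<^esub> = \<zero>\<^bsub>N\<^esub>"
  using additive_zero[of M N f] assms left_module_abelian module_homD(1,2)[OF assms(1)] by blast

lemma module_hom_minus:
  assumes "f \<in> module_hom R M N" "left_module R M" "left_module R N" "x \<in> carrier M" "y \<in> carrier M"
  shows "f (x \<ominus>\<^bsub>M\<^esub> y) = f x \<ominus>\<^bsub>N\<^esub> f y"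
proof -
  interpret M: left_module R M by fact
  interpret N: left_module R N by fact
  note f = module_homD[OF assms(1)]
  have "f (\<ominus>\<^bsub>M\<^esub> y) \<oplus>\<^bsub>N\<^esub> f y = \<zero>\<^bsub>N\<^esub>"
    using f(2)[of "\<ominus>\<^bsub>M\<^esub> y" y] assms module_hom_zero[OF assms(1-3)] by (simp add: M.M.l_neg)
  then have "f (\<ominus>\<^bsub>M\<^esub> y) = \<ominus>\<^bsub>N\<^esub> f y"
    using assms f(1) by (metis M.M.a_inv_closed N.M.minus_equality)
  then show ?thesis using assms f by (simp add: M.M.minus_eq N.M.minus_eq)
qed

lemma module_hom_comp:
  assumes "f \<in> module_hom R M N" "g \<in> module_hom R N K"
  shows "(\<lambda>x. g (f x)) \<in> module_hom R M K"
  using module_homD[OF assms(1)] module_homD[OF assms(2)] by (intro module_homI) auto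

lemma module_hom_diff:
  assumes "f \<in> module_hom R M N" "g \<in> module_hom R M N" "left_module R M" "left_module R N"
  shows "(\<lambda>x. f x \<ominus>\<^bsub>N\<^esub> g x) \<in> module_hom R M N"
proof -
  interpret M: left_module R M by fact
  interpret N: left_module R N by fact
  note f = module_homD[OF assms(1)] and g = module_homD[OF assms(2)]
  show ?thesis
    by (intro module_homI)
      (auto simp: f g N.M.minus_eq N.smult_r_distr N.smult_neg N.M.minus_add N.M.a_ac)
qed

lemma module_hom_sum:
  assumes "f \<in> module_hom R M N" "g \<in> module_hom R M N" "left_module R M" "left_module R N"
  shows "(\<lambda>x. f x \<oplus>\<^bsub>N\<^esub> g x) \<in> module_hom R M N"
proof -
  interpret M: left_module R M by fact
  interpret N: left_module R N by fact
  note f = module_homD[OF assms(1)] and g = module_homD[OF assms(2)]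
  show ?thesis
    by (intro module_homI) (auto simp: f g N.smult_r_distr N.M.a_ac)
qed

lemma free_module_simps [simp]:
  "zero (free_module R S) = (\<lambda>_. \<zero>\<^bsub>R\<^esub>)"
  "add (free_module R S) = (\<lambda>f g s. f s \<oplus>\<^bsub>R\<^esub> g s)"
  "smult (free_module R S) = (\<lambda>r f s. r \<otimes>\<^bsub>R\<^esub> f s)"
  by (simp_all add: free_module_def)

lemma free_module_carrier:
  "f \<in> carrier (free_module R S) \<longleftrightarrow>
    (\<forall>s. f s \<in> carrier R) \<and> finite {s. f s \<noteq> \<zero>\<^bsub>R\<^esub>} \<and> {s. f s \<noteq> \<zero>\<^bsub>R\<^esub>} \<subseteq> S"
  by (simp add: free_module_def)

lemma left_module_free:
  assumes "ring R" shows "left_module R (free_module R S)"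
proof -
  interpret ring R by fact
  have supp: "finite {s. h s \<noteq> \<zero>\<^bsub>R\<^esub>} \<and> {s. h s \<noteq> \<zero>\<^bsub>R\<^esub>} \<subseteq> S"
    if "\<And>s. h s \<noteq> \<zero>\<^bsub>R\<^esub> \<Longrightarrow> f s \<noteq> \<zero>\<^bsub>R\<^esub> \<or> g s \<noteq> \<zero>\<^bsub>R\<^esub>" "f \<in> carrier (free_module R S)" "g \<in> carrier (free_module R S)"
    for f g h :: "_ \<Rightarrow> _"
  proof -
    have "{s. h s \<noteq> \<zero>\<^bsub>R\<^esub>} \<subseteq> {s. f s \<noteq> \<zero>\<^bsub>R\<^esub>} \<union> {s. g s \<noteq> \<zero>\<^bsub>R\<^esub>}" using that by auto
    with that show ?thesis unfolding free_module_carrier by (meson finite_UnI finite_subset le_sup_iff order_trans)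
  qed
  have add: "(\<lambda>s. f s \<oplus>\<^bsub>R\<^esub> g s) \<in> carrier (free_module R S)"
    if "f \<in> carrier (free_module R S)" "g \<in> carrier (free_module R S)" for f g
  proof -
    have "finite {s. f s \<oplus>\<^bsub>R\<^esub> g s \<noteq> \<zero>\<^bsub>R\<^esub>} \<and> {s. f s \<oplus>\<^bsub>R\<^esub> g s \<noteq> \<zero>\<^bsub>R\<^esub>} \<subseteq> S"
      by (rule supp[of _ f g]) (use that in auto)
    with that show ?thesis by (simp add: free_module_carrier)
  qed
  have sm: "(\<lambda>s. r \<otimes>\<^bsub>R\<^esub> f s) \<in> carrier (free_module R S)"
    if "f \<in> carrier (free_module R S)" "r \<in> carrier R" for f r
  proof -
    have "finite {s. r \<otimes>\<^bsub>R\<^esub> f s \<noteq> \<zero>\<^bsub>R\<^esub>} \<and> {s. r \<otimes>\<^bsub>R\<^esub> f s \<noteq> \<zero>\<^bsub>R\<^esub>} \<subseteq> S"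
      by (rule supp[of _ f f]) (use that in auto)
    with that show ?thesis by (simp add: free_module_carrier)
  qed
  have neg: "(\<lambda>s. \<ominus>\<^bsub>R\<^esub> f s) \<in> carrier (free_module R S)"
    if "f \<in> carrier (free_module R S)" for f
  proof -
    have "finite {s. \<ominus>\<^bsub>R\<^esub> f s \<noteq> \<zero>\<^bsub>R\<^esub>} \<and> {s. \<ominus>\<^bsub>R\<^esub> f s \<noteq> \<zero>\<^bsub>R\<^esub>} \<subseteq> S"
      by (rule supp[of _ f f]) (use that in auto)
    with that show ?thesis by (simp add: free_module_carrier)
  qed
  have car: "f s \<in> carrier R" if "f \<in> carrier (free_module R S)" for f s
    using that by (auto simp: free_module_carrier)
  have "abelian_group (free_module R S)"
  proof (rule abelian_groupI, goal_cases)
    case (6 x)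
    then show ?case
      by (intro bexI[OF _ neg[OF 6]]) (auto simp: car l_neg)
  next
    case 2 then show ?case by (simp add: free_module_carrier)
  qed (auto simp: car a_ac intro: add)
  moreover have "left_module_axioms R (free_module R S)"
    by unfold_locales (auto simp: sm car l_distr r_distr m_assoc)
  ultimately show ?thesis by (intro left_module.intro) (auto intro: ring_axioms)
qed

definition free_gen :: "('r, 'c) ring_scheme \<Rightarrow> 's \<Rightarrow> 's \<Rightarrow> 'r" where
  "free_gen R s = (\<lambda>x. if x = s then \<one>\<^bsub>R\<^esub> else \<zero>\<^bsub>R\<^esub>)"

lemma free_gen_closed: "ring R \<Longrightarrow> s \<in> S \<Longrightarrow> free_gen R s \<in> carrier (free_module R S)"
  by (auto simp: free_module_carrier free_gen_def ring.ring_simprules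
      intro: finite_subset[of _ "{s}"])

lemma free_module_ext:
  assumes F: "F \<in> module_hom R (free_module R S) M" and G: "G \<in> module_hom R (free_module R S) M"
    and M: "left_module R M"
    and eq: "\<And>s. s \<in> S \<Longrightarrow> F (free_gen R s) = G (free_gen R s)"
    and g: "g \<in> carrier (free_module R S)"
  shows "F g = G g"
proof -
  interpret M: left_module R M by fact
  have R: "ring R" by unfold_locales
  interpret Fr: left_module R "free_module R S" by (rule left_module_free[OF R])
  have "finite A \<Longrightarrow> {s. g s \<noteq> \<zero>\<^bsub>R\<^esub>} \<subseteq> A \<Longrightarrow> A \<subseteq> S \<Longrightarrow> g \<in> carrier (free_module R S) \<Longrightarrow> F g = G g" for A g
  proof (induct A arbitrary: g rule: finite_induct)
    case empty
    then have "g = \<zero>\<^bsub>free_module R S\<^esub>" by auto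
    then show ?case using module_hom_zero[OF F Fr.left_module_axioms M] module_hom_zero[OF G Fr.left_module_axioms M]
      by metis
  next
    case (insert a A)
    let ?h = "\<lambda>s. if s = a then \<zero>\<^bsub>R\<^esub> else g s"
    let ?u = "g a \<odot>\<^bsub>free_module R S\<^esub> free_gen R a"
    have h: "?h \<in> carrier (free_module R S)"
      using insert(6) by (auto simp: free_module_carrier elim!: rev_finite_subset)
    have ga: "g a \<in> carrier R" using insert by (auto simp: free_module_carrier)
    have e: "free_gen R a \<in> carrier (free_module R S)" using insert by (intro free_gen_closed R) auto
    have u: "?u \<in> carrier (free_module R S)" using ga e by blast
    have "g s \<in> carrier R" for s using insert(6) by (auto simp: free_module_carrier)
    then have "g = ?h \<oplus>\<^bsub>free_module R S\<^esub> ?u" by (auto simp: free_gen_def)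
    moreover have "F ?h = G ?h" using insert(4,5) h by (intro insert(3)) auto
    moreover have "F ?u = G ?u"
      using module_homD(3)[OF F ga e] module_homD(3)[OF G ga e] eq[of a] insert by simp
    ultimately show ?case
      using module_homD(2)[OF F h u] module_homD(2)[OF G h u] by simp
  qed
  from this[of "{s. g s \<noteq> \<zero>\<^bsub>R\<^esub>}" g] g show ?thesis by (auto simp: free_module_carrier)
qed

text \<open>The value is given as a sum over any finite \<open>T\<close> between the support and
  \<open>S\<close>, so that two elements and their sum can be expanded over the same index set when
  additivity is checked.\<close>

lemma free_module_lift:
  assumes "left_module R M" and m: "m \<in> S \<rightarrow> carrier M"
  shows "\<exists>F \<in> module_hom R (free_module R S) M.
    (\<forall>s\<in>S. F (free_gen R s) = m s) \<and>
    (\<forall>T g. finite T \<longrightarrow> T \<subseteq> S \<longrightarrow> {s. g s \<noteq> \<zero>\<^bsub>R\<^esub>} \<subseteq> T \<longrightarrow> g \<in> carrier (free_module R S) \<longrightarrow>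
       F g = (\<Oplus>\<^bsub>M\<^esub>s\<in>T. g s \<odot>\<^bsub>M\<^esub> m s))"
proof -
  interpret M: left_module R M by fact
  have R: "ring R" by unfold_locales
  interpret Fr: left_module R "free_module R S" by (rule left_module_free[OF R])
  define F where "F g = (\<Oplus>\<^bsub>M\<^esub>s\<in>{s. g s \<noteq> \<zero>\<^bsub>R\<^esub>}. g s \<odot>\<^bsub>M\<^esub> m s)" for g
  have car: "g s \<in> carrier R" if "g \<in> carrier (free_module R S)" for g s
    using that by (auto simp: free_module_carrier)
  have mc: "m s \<in> carrier M" if "s \<in> S" for s using m that by auto
  have F: "F g = (\<Oplus>\<^bsub>M\<^esub>s\<in>T. g s \<odot>\<^bsub>M\<^esub> m s)"
    if "finite T" "T \<subseteq> S" "{s. g s \<noteq> \<zero>\<^bsub>R\<^esub>} \<subseteq> T" "g \<in> carrier (free_module R S)" for T g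
    unfolding F_def using that mc car
    by (intro M.M.add.finprod_mono_neutral_cong_left) auto
  have fin: "finite {s. g s \<noteq> \<zero>\<^bsub>R\<^esub>}" "{s. g s \<noteq> \<zero>\<^bsub>R\<^esub>} \<subseteq> S" if "g \<in> carrier (free_module R S)" for g
    using that by (auto simp: free_module_carrier)
  have "F \<in> module_hom R (free_module R S) M"
  proof (rule module_homI)
    fix x assume x: "x \<in> carrier (free_module R S)"
    have "(\<lambda>s. x s \<odot>\<^bsub>M\<^esub> m s) \<in> {s. x s \<noteq> \<zero>\<^bsub>R\<^esub>} \<rightarrow> carrier M"
      using fin(2)[OF x] car[OF x] mc by blast
    then show "F x \<in> carrier M" unfolding F_def by (rule M.M.finsum_closed)
    fix r assume r: "r \<in> carrier R"
    have rx: "r \<odot>\<^bsub>free_module R S\<^esub> x \<in> carrier (free_module R S)" using r x by blast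
    let ?T = "{s. x s \<noteq> \<zero>\<^bsub>R\<^esub>}"
    have "F (r \<odot>\<^bsub>free_module R S\<^esub> x) = (\<Oplus>\<^bsub>M\<^esub>s\<in>?T. (r \<otimes>\<^bsub>R\<^esub> x s) \<odot>\<^bsub>M\<^esub> m s)"
    proof (subst F[OF fin[OF x] _ rx])
      show "{s. (r \<odot>\<^bsub>free_module R S\<^esub> x) s \<noteq> \<zero>\<^bsub>R\<^esub>} \<subseteq> ?T" using r by auto
    qed simp
    also have "\<dots> = (\<Oplus>\<^bsub>M\<^esub>s\<in>?T. r \<odot>\<^bsub>M\<^esub> (x s \<odot>\<^bsub>M\<^esub> m s))"
      using fin(2)[OF x] car[OF x] mc r by (intro M.M.finsum_cong') (auto simp: M.smult_assoc1 subset_iff)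
    also have "\<dots> = r \<odot>\<^bsub>M\<^esub> F x"
      unfolding F_def using fin(2)[OF x] car[OF x] mc r by (subst M.smult_finsum_right) (auto simp: subset_iff)
    finally show "F (r \<odot>\<^bsub>free_module R S\<^esub> x) = r \<odot>\<^bsub>M\<^esub> F x" .
  next
    fix x y assume x: "x \<in> carrier (free_module R S)" and y: "y \<in> carrier (free_module R S)"
    let ?T = "{s. x s \<noteq> \<zero>\<^bsub>R\<^esub>} \<union> {s. y s \<noteq> \<zero>\<^bsub>R\<^esub>}"
    have xy: "x \<oplus>\<^bsub>free_module R S\<^esub> y \<in> carrier (free_module R S)" using x y by blast
    have T: "finite ?T" "?T \<subseteq> S" using fin[OF x] fin[OF y] by auto
    have "F (x \<oplus>\<^bsub>free_module R S\<^esub> y) = (\<Oplus>\<^bsub>M\<^esub>s\<in>?T. (x s \<oplus>\<^bsub>R\<^esub> y s) \<odot>\<^bsub>M\<^esub> m s)"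
    proof (subst F[OF T _ xy])
      show "{s. (x \<oplus>\<^bsub>free_module R S\<^esub> y) s \<noteq> \<zero>\<^bsub>R\<^esub>} \<subseteq> ?T" by auto
    qed simp
    also have "\<dots> = (\<Oplus>\<^bsub>M\<^esub>s\<in>?T. (x s \<odot>\<^bsub>M\<^esub> m s) \<oplus>\<^bsub>M\<^esub> (y s \<odot>\<^bsub>M\<^esub> m s))"
      using T(2) car[OF x] car[OF y] mc by (intro M.M.finsum_cong') (auto simp: M.smult_l_distr subset_iff)
    also have "\<dots> = (\<Oplus>\<^bsub>M\<^esub>s\<in>?T. x s \<odot>\<^bsub>M\<^esub> m s) \<oplus>\<^bsub>M\<^esub> (\<Oplus>\<^bsub>M\<^esub>s\<in>?T. y s \<odot>\<^bsub>M\<^esub> m s)"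
      using T(2) car[OF x] car[OF y] mc by (intro M.M.finsum_addf) (auto simp: subset_iff)
    also have "\<dots> = F x \<oplus>\<^bsub>M\<^esub> F y" using F[OF T _ x] F[OF T _ y] by auto
    finally show "F (x \<oplus>\<^bsub>free_module R S\<^esub> y) = F x \<oplus>\<^bsub>M\<^esub> F y" .
  qed
  moreover have "F (free_gen R s) = m s" if "s \<in> S" for s
  proof -
    have "F (free_gen R s) = (\<Oplus>\<^bsub>M\<^esub>s'\<in>{s}. free_gen R s s' \<odot>\<^bsub>M\<^esub> m s')"
      using that by (intro F free_gen_closed R) (auto simp: free_gen_def)
    then show ?thesis using mc[OF that] by (simp add: free_gen_def)
  qed
  ultimately show ?thesis using F by blast
qed

text \<open>\<open>P\<close> is a retract of a free module: choose preimages under \<open>g\<close>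
  of the images of the free generators, extend linearly and precompose with \<open>\<iota>\<close>.
  Asking only that the image of \<open>f\<close> lies in that of \<open>g\<close> makes the lemma
  fit a differential \<open>g\<close>, which is onto the next kernel but not onto
  \<open>Y\<close>.\<close>

lemma projective_lift:
  assumes "projective_module R P" "left_module R X" "left_module R Y"
    and f: "f \<in> module_hom R P Y" and g: "g \<in> module_hom R X Y"
    and sub: "\<And>x. x \<in> carrier P \<Longrightarrow> f x \<in> g ` carrier X"
  shows "\<exists>h \<in> module_hom R P X. \<forall>x\<in>carrier P. g (h x) = f x"
proof -
  from assms(1) obtain S :: "'c set" and \<iota> \<pi> where
    i: "\<iota> \<in> module_hom R P (free_module R S)" and p: "\<pi> \<in> module_hom R (free_module R S) P"
    and pi: "\<And>x. x \<in> carrier P \<Longrightarrow> \<pi> (\<iota> x) = x" and P: "left_module R P"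
    unfolding projective_module_def by blast
  interpret P: left_module R P by fact
  have R: "ring R" by unfold_locales
  have "\<exists>m. m \<in> carrier X \<and> g m = f (\<pi> (free_gen R s))" if "s \<in> S" for s
    using sub[OF module_homD(1)[OF p free_gen_closed[OF R that]]] by force
  then obtain m where m: "\<And>s. s \<in> S \<Longrightarrow> m s \<in> carrier X" "\<And>s. s \<in> S \<Longrightarrow> g (m s) = f (\<pi> (free_gen R s))"
    by metis
  then have "m \<in> S \<rightarrow> carrier X" by simp
  from free_module_lift[OF assms(2) this] obtain F where
    F: "F \<in> module_hom R (free_module R S) X" and F': "\<forall>s\<in>S. F (free_gen R s) = m s" by (elim bexE conjE)
  have eq: "g (F (\<iota> x)) = f x" if "x \<in> carrier P" for x
  proof -
    have "g (F (\<iota> x)) = f (\<pi> (\<iota> x))"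
      by (rule free_module_ext[OF module_hom_comp[OF F(1) g] module_hom_comp[OF p f] assms(3)])
        (use m F' module_homD(1)[OF i that] in simp_all)
    then show ?thesis using pi that by simp
  qed
  show ?thesis
  proof (rule bexI[of _ "\<lambda>x. F (\<iota> x)"])
    show "(\<lambda>x. F (\<iota> x)) \<in> module_hom R P X" by (rule module_hom_comp[OF i F(1)])
    show "\<forall>x\<in>carrier P. g (F (\<iota> x)) = f x" using eq by simp
  qed
qed

section \<open>Comparison of projective resolutions\<close>

definition augmentation where
  "augmentation R M P d \<epsilon> \<longleftrightarrow> \<epsilon> \<in> module_hom R (P 0) M \<and> \<epsilon> ` carrier (P 0) = carrier M \<and>
       {x \<in> carrier (P 0). \<epsilon> x = \<zero>\<^bsub>M\<^esub>} = d 0 ` carrier (P (Suc 0))"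

lemma projective_resolutionD:
  assumes "projective_resolution R M P d"
  shows "projective_module R (P n)" "left_module R (P n)"
    "d n \<in> module_hom R (P (Suc n)) (P n)"
    "\<exists>\<epsilon>. augmentation R M P d \<epsilon>"
    "{x \<in> carrier (P (Suc n)). d n x = \<zero>\<^bsub>P n\<^esub>} = d (Suc n) ` carrier (P (Suc (Suc n)))"
    "x \<in> carrier (P (Suc (Suc n))) \<Longrightarrow> d n (d (Suc n) x) = \<zero>\<^bsub>P n\<^esub>"
proof -
  note A = assms[unfolded projective_resolution_def]
  show *: "{x \<in> carrier (P (Suc n)). d n x = \<zero>\<^bsub>P n\<^esub>} = d (Suc n) ` carrier (P (Suc (Suc n)))"
    by (rule A[THEN conjunct2, THEN conjunct2, THEN conjunct2, THEN spec])
  then show "x \<in> carrier (P (Suc (Suc n))) \<Longrightarrow> d n (d (Suc n) x) = \<zero>\<^bsub>P n\<^esub>" by blast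
  show "projective_module R (P n)" by (rule A[THEN conjunct1, THEN spec])
  then show "left_module R (P n)" unfolding projective_module_def by (rule conjunct1)
  show "d n \<in> module_hom R (P (Suc n)) (P n)" by (rule A[THEN conjunct2, THEN conjunct1, THEN spec])
  from A[THEN conjunct2, THEN conjunct2, THEN conjunct1]
  obtain \<epsilon> where "\<epsilon> \<in> module_hom R (P 0) M"
    "\<epsilon> ` carrier (P 0) = carrier M \<and> {x \<in> carrier (P 0). \<epsilon> x = \<zero>\<^bsub>M\<^esub>} = d 0 ` carrier (P 1)" ..
  then show "\<exists>\<epsilon>. augmentation R M P d \<epsilon>"
    unfolding augmentation_def One_nat_def by (intro exI[of _ \<epsilon>] conjI) simp_all
qed

text \<open>The invariant \<open>?Q\<close> of the dependent choice includes that
  \<open>h (d n x)\<close> lies in the image of \<open>d' n\<close>. This is the premise for lifting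
  to the next degree, and it is restored there because the new map sends boundaries to cycles, which
  are boundaries by exactness.\<close>

lemma chain_map_exists:
  assumes P: "projective_resolution R M P d" and P': "projective_resolution R M P' d'"
    and M: "left_module R M"
    and e: "augmentation R M P d \<epsilon>" and e': "augmentation R M P' d' \<epsilon>'"
  shows "\<exists>\<alpha>. (\<forall>n. \<alpha> n \<in> module_hom R (P n) (P' n)) \<and>
     (\<forall>x\<in>carrier (P 0). \<epsilon>' (\<alpha> 0 x) = \<epsilon> x) \<and>
     (\<forall>n. \<forall>x\<in>carrier (P (Suc n)). d' n (\<alpha> (Suc n) x) = \<alpha> n (d n x))"
proof -
  note p = projective_resolutionD[OF P] and p' = projective_resolutionD[OF P']
  let ?Q = "\<lambda>n h. h \<in> module_hom R (P n) (P' n) \<and> (n = 0 \<longrightarrow> (\<forall>x\<in>carrier (P 0). \<epsilon>' (h x) = \<epsilon> x)) \<and>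
     (\<forall>x\<in>carrier (P (Suc n)). h (d n x) \<in> d' n ` carrier (P' (Suc n)))"
  have "\<exists>\<alpha>. \<forall>n. ?Q n (\<alpha> n) \<and> (\<forall>x\<in>carrier (P (Suc n)). d' n (\<alpha> (Suc n) x) = \<alpha> n (d n x))"
  proof (rule dependent_nat_choice, goal_cases)
    case 1
    have "\<exists>h \<in> module_hom R (P 0) (P' 0). \<forall>x\<in>carrier (P 0). \<epsilon>' (h x) = \<epsilon> x"
      by (rule projective_lift[OF p(1) p'(2) M])
        (use e e' module_homD(1) in \<open>auto simp: augmentation_def\<close>)
    then obtain h where h: "h \<in> module_hom R (P 0) (P' 0)" "\<And>x. x \<in> carrier (P 0) \<Longrightarrow> \<epsilon>' (h x) = \<epsilon> x" by blast
    have "h (d 0 x) \<in> d' 0 ` carrier (P' (Suc 0))" if x: "x \<in> carrier (P (Suc 0))" for x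
    proof -
      have d: "d 0 x \<in> carrier (P 0)" using module_homD(1)[OF p(3)] x by auto
      have "\<epsilon> (d 0 x) = \<zero>\<^bsub>M\<^esub>" using e x unfolding augmentation_def by blast
      then have "h (d 0 x) \<in> {x \<in> carrier (P' 0). \<epsilon>' x = \<zero>\<^bsub>M\<^esub>}"
        using h d module_homD(1)[OF h(1)] by auto
      then show ?thesis using e' unfolding augmentation_def by auto
    qed
    with h show ?case by (intro exI[of _ h] conjI ballI impI)
  next
    case (2 h n)
    then have h: "h \<in> module_hom R (P n) (P' n)"
      and *: "\<And>x. x \<in> carrier (P (Suc n)) \<Longrightarrow> h (d n x) \<in> d' n ` carrier (P' (Suc n))" by auto
    have "\<exists>k \<in> module_hom R (P (Suc n)) (P' (Suc n)). \<forall>x\<in>carrier (P (Suc n)). d' n (k x) = h (d n x)"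
      by (rule projective_lift[OF p(1) p'(2) p'(2) module_hom_comp[OF p(3) h] p'(3) *])
    then obtain k where k: "k \<in> module_hom R (P (Suc n)) (P' (Suc n))"
      "\<And>x. x \<in> carrier (P (Suc n)) \<Longrightarrow> d' n (k x) = h (d n x)" by blast
    have "k (d (Suc n) x) \<in> d' (Suc n) ` carrier (P' (Suc (Suc n)))" if x: "x \<in> carrier (P (Suc (Suc n)))" for x
    proof -
      have dx: "d (Suc n) x \<in> carrier (P (Suc n))" using module_homD(1)[OF p(3)] x by auto
      have "d' n (k (d (Suc n) x)) = h (\<zero>\<^bsub>P n\<^esub>)" using k(2)[OF dx] p(6)[OF x] by simp
      also have "\<dots> = \<zero>\<^bsub>P' n\<^esub>" by (rule module_hom_zero[OF h p(2) p'(2)])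
      finally show ?thesis using p'(5)[of n] module_homD(1)[OF k(1) dx] by blast
    qed
    with k show ?case by (intro exI[of _ k] conjI ballI impI) simp_all
  qed
  then obtain \<alpha> where "\<forall>n. ?Q n (\<alpha> n) \<and> (\<forall>x\<in>carrier (P (Suc n)). d' n (\<alpha> (Suc n) x) = \<alpha> n (d n x))" ..
  then show ?thesis by (intro exI[of _ \<alpha>]) simp
qed

text \<open>The invariant \<open>?Q\<close> records that \<open>d' n (s n y) = g n y\<close> when
  \<open>y\<close> is a boundary. Then \<open>g (Suc n) x\<close> minus \<open>s n (d n x)\<close>
  is a cycle, hence a boundary by exactness, and can be lifted to define the next component.\<close>

lemma null_homotopy_exists:
  assumes P: "projective_resolution R M P d" and P': "projective_resolution R M P' d'"
    and M: "left_module R M"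
    and e: "augmentation R M P d \<epsilon>" and e': "augmentation R M P' d' \<epsilon>'"
    and g: "\<And>n. g n \<in> module_hom R (P n) (P' n)"
    and g0: "\<And>x. x \<in> carrier (P 0) \<Longrightarrow> \<epsilon>' (g 0 x) = \<zero>\<^bsub>M\<^esub>"
    and gd: "\<And>n x. x \<in> carrier (P (Suc n)) \<Longrightarrow> d' n (g (Suc n) x) = g n (d n x)"
  shows "\<exists>s. (\<forall>n. s n \<in> module_hom R (P n) (P' (Suc n))) \<and>
     (\<forall>x\<in>carrier (P 0). g 0 x = d' 0 (s 0 x)) \<and>
     (\<forall>n. \<forall>x\<in>carrier (P (Suc n)). g (Suc n) x = d' (Suc n) (s (Suc n) x) \<oplus>\<^bsub>P' (Suc n)\<^esub> s n (d n x))"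
proof -
  note p = projective_resolutionD[OF P] and p' = projective_resolutionD[OF P']
  let ?Q = "\<lambda>n h. h \<in> module_hom R (P n) (P' (Suc n)) \<and> (n = 0 \<longrightarrow> (\<forall>x\<in>carrier (P 0). d' 0 (h x) = g 0 x)) \<and>
     (\<forall>x\<in>carrier (P (Suc n)). d' n (h (d n x)) = g n (d n x))"
  have "\<exists>s. \<forall>n. ?Q n (s n) \<and> (\<forall>x\<in>carrier (P (Suc n)). d' (Suc n) (s (Suc n) x) = g (Suc n) x \<ominus>\<^bsub>P' (Suc n)\<^esub> s n (d n x))"
  proof (rule dependent_nat_choice, goal_cases)
    case 1
    have "\<exists>h \<in> module_hom R (P 0) (P' (Suc 0)). \<forall>x\<in>carrier (P 0). d' 0 (h x) = g 0 x"
    proof (rule projective_lift[OF p(1) p'(2) p'(2) g p'(3)])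
      fix x assume x: "x \<in> carrier (P 0)"
      then show "g 0 x \<in> d' 0 ` carrier (P' (Suc 0))"
        using g0[OF x] module_homD(1)[OF g x] e' unfolding augmentation_def by blast
    qed
    then obtain h where h: "h \<in> module_hom R (P 0) (P' (Suc 0))" "\<And>x. x \<in> carrier (P 0) \<Longrightarrow> d' 0 (h x) = g 0 x" by blast
    then show ?case using module_homD(1)[OF p(3)[of 0]] by (intro exI[of _ h] conjI ballI impI) simp_all
  next
    case (2 h n)
    then have h: "h \<in> module_hom R (P n) (P' (Suc n))"
      and *: "\<And>x. x \<in> carrier (P (Suc n)) \<Longrightarrow> d' n (h (d n x)) = g n (d n x)" by auto
    interpret P'n: left_module R "P' n" by (rule p'(2))
    interpret P'S: left_module R "P' (Suc n)" by (rule p'(2))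
    let ?f = "\<lambda>x. g (Suc n) x \<ominus>\<^bsub>P' (Suc n)\<^esub> h (d n x)"
    have f: "?f \<in> module_hom R (P (Suc n)) (P' (Suc n))"
      by (rule module_hom_diff[OF g module_hom_comp[OF p(3) h] p(2) p'(2)])
    have "\<exists>k \<in> module_hom R (P (Suc n)) (P' (Suc (Suc n))). \<forall>x\<in>carrier (P (Suc n)). d' (Suc n) (k x) = ?f x"
    proof (rule projective_lift[OF p(1) p'(2) p'(2) f p'(3)])
      fix x assume x: "x \<in> carrier (P (Suc n))"
      have dx: "d n x \<in> carrier (P n)" using module_homD(1)[OF p(3)] x by auto
      have "d' n (?f x) = d' n (g (Suc n) x) \<ominus>\<^bsub>P' n\<^esub> d' n (h (d n x))"
        by (rule module_hom_minus[OF p'(3) p'(2) p'(2) module_homD(1)[OF g x] module_homD(1)[OF h dx]])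
      also have "\<dots> = \<zero>\<^bsub>P' n\<^esub>"
        using *[OF x] gd[OF x] module_homD(1)[OF g dx] by (simp add: P'n.M.minus_eq P'n.M.r_neg)
      finally show "?f x \<in> d' (Suc n) ` carrier (P' (Suc (Suc n)))"
        using p'(5)[of n] module_homD(1)[OF f x] by blast
    qed
    then obtain k where k: "k \<in> module_hom R (P (Suc n)) (P' (Suc (Suc n)))"
      "\<And>x. x \<in> carrier (P (Suc n)) \<Longrightarrow> d' (Suc n) (k x) = ?f x" by blast
    have "d' (Suc n) (k (d (Suc n) x)) = g (Suc n) (d (Suc n) x)" if x: "x \<in> carrier (P (Suc (Suc n)))" for x
    proof -
      have dx: "d (Suc n) x \<in> carrier (P (Suc n))" using module_homD(1)[OF p(3)] x by auto
      have "h (d n (d (Suc n) x)) = \<zero>\<^bsub>P' (Suc n)\<^esub>"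
        using p(6)[OF x] module_hom_zero[OF h p(2) p'(2)] by simp
      then show ?thesis using k(2)[OF dx] module_homD(1)[OF g dx] by (simp add: P'S.M.minus_eq)
    qed
    with k show ?case by (intro exI[of _ k] conjI ballI impI) simp_all
  qed
  then obtain s where S: "\<forall>n. ?Q n (s n) \<and> (\<forall>x\<in>carrier (P (Suc n)). d' (Suc n) (s (Suc n) x) = g (Suc n) x \<ominus>\<^bsub>P' (Suc n)\<^esub> s n (d n x))" ..
  then have s: "s n \<in> module_hom R (P n) (P' (Suc n))" "x \<in> carrier (P 0) \<Longrightarrow> d' 0 (s 0 x) = g 0 x"
    "y \<in> carrier (P (Suc n)) \<Longrightarrow> d' (Suc n) (s (Suc n) y) = g (Suc n) y \<ominus>\<^bsub>P' (Suc n)\<^esub> s n (d n y)" for n x y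
    by simp_all
  have "g (Suc n) x = d' (Suc n) (s (Suc n) x) \<oplus>\<^bsub>P' (Suc n)\<^esub> s n (d n x)" if x: "x \<in> carrier (P (Suc n))" for n x
  proof -
    interpret P'S: left_module R "P' (Suc n)" by (rule p'(2))
    have "d n x \<in> carrier (P n)" using module_homD(1)[OF p(3)] x by auto
    then have "s n (d n x) \<in> carrier (P' (Suc n))" by (rule module_homD(1)[OF s(1)])
    then show ?thesis using s(3)[OF x] module_homD(1)[OF g x]
      by (simp add: P'S.M.minus_eq P'S.M.a_assoc P'S.M.l_neg)
  qed
  then show ?thesis using s(1,2) by (intro exI[of _ s] conjI allI ballI) simp_all
qed

section \<open>Cohomology of Hom complexes\<close>

lemma (in kalg) one_smult_central:
  "r \<in> carrier A \<Longrightarrow> (c \<odot> \<one>) \<otimes> r = c \<odot> r" "r \<in> carrier A \<Longrightarrow> r \<otimes> (c \<odot> \<one>) = c \<odot> r"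
  by (simp_all add: ks_mult_left ks_mult_right)

lemma hom_space_simps [simp]:
  "zero (hom_space A P N) = (\<lambda>x\<in>carrier P. \<zero>\<^bsub>N\<^esub>)"
  "add (hom_space A P N) = (\<lambda>f g. \<lambda>x\<in>carrier P. f x \<oplus>\<^bsub>N\<^esub> g x)"
  "smult (hom_space A P N) = (\<lambda>c f. \<lambda>x\<in>carrier P. (c \<odot>\<^bsub>A\<^esub> \<one>\<^bsub>A\<^esub>) \<odot>\<^bsub>N\<^esub> f x)"
  by (simp_all add: hom_space_def)

lemma hom_space_carrier:
  "f \<in> carrier (hom_space A P N) \<longleftrightarrow> f \<in> module_hom A P N \<and> f \<in> extensional (carrier P)"
  by (simp add: hom_space_def)

text \<open>The carrier is an arbitrary subspace \<open>Z\<close> because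
  \<open>hom_cohomology\<close> replaces the carrier of the Hom space by the cocycles. Functions are
  extensional on \<open>carrier P\<close>, so equality may be tested there; negatives come from the
  scalar \<open>-1\<close>.\<close>

lemma hom_space_kvs:
  assumes "kalg A" "left_module A P" "left_module A N"
    and Z: "Z \<subseteq> carrier (hom_space A P N)"
    and z0: "\<zero>\<^bsub>hom_space A P N\<^esub> \<in> Z"
    and add: "\<And>f g. f \<in> Z \<Longrightarrow> g \<in> Z \<Longrightarrow> f \<oplus>\<^bsub>hom_space A P N\<^esub> g \<in> Z"
    and smult: "\<And>c f. f \<in> Z \<Longrightarrow> c \<odot>\<^bsub>hom_space A P N\<^esub> f \<in> Z"
  shows "kvs ((hom_space A P N)\<lparr>carrier := Z\<rparr>)"
proof -
  interpret A: kalg A by fact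
  interpret P: left_module A P by fact
  interpret N: left_module A N by fact
  have car: "f x \<in> carrier N" if "f \<in> Z" "x \<in> carrier P" for f x
    using Z that module_homD(1)[of f A P N x] by (auto simp: hom_space_carrier)
  have ext: "f = (\<lambda>x\<in>carrier P. f x)" if "f \<in> Z" for f
    using Z that by (auto simp: hom_space_carrier extensional_restrict)
  have c1: "c \<odot>\<^bsub>A\<^esub> \<one>\<^bsub>A\<^esub> \<in> carrier A" for c by simp
  have one: "1 \<odot>\<^bsub>A\<^esub> \<one>\<^bsub>A\<^esub> = \<one>\<^bsub>A\<^esub>" by simp
  have m1: "(-1) \<odot>\<^bsub>A\<^esub> \<one>\<^bsub>A\<^esub> \<oplus>\<^bsub>A\<^esub> \<one>\<^bsub>A\<^esub> = \<zero>\<^bsub>A\<^esub>"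
    using A.ks_l_distr[of "\<one>\<^bsub>A\<^esub>" "-1" 1] by simp
  let ?V = "(hom_space A P N)\<lparr>carrier := Z\<rparr>"
  have "abelian_group ?V"
  proof (rule abelian_groupI, goal_cases)
    case (6 f)
    then have f: "f \<in> Z" by simp
    have "((-1) \<odot>\<^bsub>A\<^esub> \<one>\<^bsub>A\<^esub>) \<odot>\<^bsub>N\<^esub> f x \<oplus>\<^bsub>N\<^esub> f x = \<zero>\<^bsub>N\<^esub>" if "x \<in> carrier P" for x
      using N.smult_l_distr[OF c1 A.one_closed car[OF f that], of "-1"] m1 car[OF f that] by simp
    then have "(-1) \<odot>\<^bsub>hom_space A P N\<^esub> f \<oplus>\<^bsub>?V\<^esub> f = \<zero>\<^bsub>?V\<^esub>"
      by (auto intro!: restrict_ext)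
    moreover have "(-1) \<odot>\<^bsub>hom_space A P N\<^esub> f \<in> carrier ?V" using smult[OF f, of "-1"] by simp
    ultimately show ?case by (rule bexI)
  next
    case (5 f)
    then have f: "f \<in> Z" by simp
    have "\<zero>\<^bsub>?V\<^esub> \<oplus>\<^bsub>?V\<^esub> f = (\<lambda>x\<in>carrier P. f x)" using car[OF f] by (auto intro!: restrict_ext)
    then show ?case using ext[OF f] by simp
  qed (use add z0 in \<open>auto simp: car N.M.a_ac intro!: restrict_ext\<close>)
  then interpret V: abelian_group ?V .
  show ?thesis
  proof unfold_locales
    fix f :: "'c \<Rightarrow> 'd" and c d assume "f \<in> carrier ?V"
    then have f: "f \<in> Z" by simp
    show "c \<odot>\<^bsub>?V\<^esub> f \<in> carrier ?V" using smult[OF f, of c] by simp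
    have "1 \<odot>\<^bsub>?V\<^esub> f = (\<lambda>x\<in>carrier P. f x)" using car[OF f] by (auto simp: one intro!: restrict_ext)
    then show "1 \<odot>\<^bsub>?V\<^esub> f = f" using ext[OF f] by simp
    show "(c + d) \<odot>\<^bsub>?V\<^esub> f = c \<odot>\<^bsub>?V\<^esub> f \<oplus>\<^bsub>?V\<^esub> d \<odot>\<^bsub>?V\<^esub> f"
      using car[OF f] by (auto simp: A.ks_l_distr N.smult_l_distr c1 intro!: restrict_ext)
    have "(c * d) \<odot>\<^bsub>A\<^esub> \<one>\<^bsub>A\<^esub> = (c \<odot>\<^bsub>A\<^esub> \<one>\<^bsub>A\<^esub>) \<otimes>\<^bsub>A\<^esub> (d \<odot>\<^bsub>A\<^esub> \<one>\<^bsub>A\<^esub>)"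
      by (simp add: A.ks_mult_left flip: A.ks_assoc)
    then show "(c * d) \<odot>\<^bsub>?V\<^esub> f = c \<odot>\<^bsub>?V\<^esub> (d \<odot>\<^bsub>?V\<^esub> f)"
      using car[OF f] by (auto simp: N.smult_assoc1 c1 intro!: restrict_ext)
    fix g assume "g \<in> carrier ?V"
    then have g: "g \<in> Z" by simp
    show "c \<odot>\<^bsub>?V\<^esub> (f \<oplus>\<^bsub>?V\<^esub> g) = c \<odot>\<^bsub>?V\<^esub> f \<oplus>\<^bsub>?V\<^esub> c \<odot>\<^bsub>?V\<^esub> g"
      using car[OF f] car[OF g] by (auto simp: N.smult_r_distr c1 intro!: restrict_ext)
  qed
qed

lemma hom_space_restrict:
  assumes "f \<in> module_hom A P N" "left_module A P"
  shows "(\<lambda>x\<in>carrier P. f x) \<in> carrier (hom_space A P N)"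
proof -
  interpret P: left_module A P by fact
  show ?thesis using module_homD[OF assms(1)]
    by (auto simp: hom_space_carrier intro!: module_homI)
qed

lemma hom_space_add_closed:
  assumes "left_module A P" "left_module A N" "f \<in> module_hom A P N" "g \<in> module_hom A P N"
  shows "f \<oplus>\<^bsub>hom_space A P N\<^esub> g \<in> carrier (hom_space A P N)"
  using hom_space_restrict[OF module_hom_sum[OF assms(3,4,1,2)] assms(1)] by simp

text \<open>\<open>A\<close> need not be commutative; a multiple of a linear map is again linear
  because \<open>c \<odot> \<one>\<close> is central.\<close>

lemma module_hom_central_smult:
  assumes "kalg A" "left_module A P" "left_module A N" "f \<in> module_hom A P N"
  shows "(\<lambda>x. (c \<odot>\<^bsub>A\<^esub> \<one>\<^bsub>A\<^esub>) \<odot>\<^bsub>N\<^esub> f x) \<in> module_hom A P N"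
proof -
  interpret A: kalg A by fact
  interpret P: left_module A P by fact
  interpret N: left_module A N by fact
  note f = module_homD[OF assms(4)]
  show ?thesis
  proof (rule module_homI)
    fix r x assume rx: "r \<in> carrier A" "x \<in> carrier P"
    have "(c \<odot>\<^bsub>A\<^esub> \<one>\<^bsub>A\<^esub>) \<odot>\<^bsub>N\<^esub> f (r \<odot>\<^bsub>P\<^esub> x) = ((c \<odot>\<^bsub>A\<^esub> \<one>\<^bsub>A\<^esub>) \<otimes>\<^bsub>A\<^esub> r) \<odot>\<^bsub>N\<^esub> f x"
      using rx by (simp add: f N.smult_assoc1)
    also have "\<dots> = (r \<otimes>\<^bsub>A\<^esub> (c \<odot>\<^bsub>A\<^esub> \<one>\<^bsub>A\<^esub>)) \<odot>\<^bsub>N\<^esub> f x"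
      using rx by (simp add: A.one_smult_central)
    also have "\<dots> = r \<odot>\<^bsub>N\<^esub> ((c \<odot>\<^bsub>A\<^esub> \<one>\<^bsub>A\<^esub>) \<odot>\<^bsub>N\<^esub> f x)"
      using rx by (simp add: f N.smult_assoc1)
    finally show "(c \<odot>\<^bsub>A\<^esub> \<one>\<^bsub>A\<^esub>) \<odot>\<^bsub>N\<^esub> f (r \<odot>\<^bsub>P\<^esub> x) = r \<odot>\<^bsub>N\<^esub> ((c \<odot>\<^bsub>A\<^esub> \<one>\<^bsub>A\<^esub>) \<odot>\<^bsub>N\<^esub> f x)" .
  qed (use f in \<open>auto simp: N.smult_r_distr\<close>)
qed

lemma hom_space_smult_closed:
  assumes "kalg A" "left_module A P" "left_module A N" "f \<in> module_hom A P N"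
  shows "c \<odot>\<^bsub>hom_space A P N\<^esub> f \<in> carrier (hom_space A P N)"
  using hom_space_restrict[OF module_hom_central_smult[OF assms] assms(2)] by simp

lemma zero_hom: "left_module A N \<Longrightarrow> (\<lambda>_. \<zero>\<^bsub>N\<^esub>) \<in> module_hom A P N"
proof -
  assume "left_module A N"
  then interpret left_module A N .
  show ?thesis by (intro module_homI) auto
qed

lemma hom_cohomology_kquot:
  assumes A: "kalg A" and P: "projective_resolution A M P d" and N: "left_module A N"
  shows "kquot ((hom_space A (P n) N)\<lparr>carrier := cocycles A P d N n\<rparr>) (coboundaries A P d N n)"
proof -
  interpret A: kalg A by fact
  interpret N: left_module A N by fact
  note p = projective_resolutionD[OF P]
  let ?H = "\<lambda>n. hom_space A (P n) N"
  note dc = module_homD(1)[OF p(3)]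
  have hD: "f \<in> module_hom A (P n) N" if "f \<in> carrier (?H n)" for f n
    using that by (simp add: hom_space_carrier)
  have hc: "f x \<in> carrier N" if "f \<in> carrier (?H n)" "x \<in> carrier (P n)" for f n x
    using module_homD(1)[OF hD[OF that(1)] that(2)] .
  have z: "\<zero>\<^bsub>?H n\<^esub> \<in> carrier (?H n)" for n
    using hom_space_restrict[OF zero_hom[OF N] p(2)] by simp
  have a: "f \<oplus>\<^bsub>?H n\<^esub> g \<in> carrier (?H n)" if "f \<in> carrier (?H n)" "g \<in> carrier (?H n)" for f g n
    by (rule hom_space_add_closed[OF p(2) N hD[OF that(1)] hD[OF that(2)]])
  have s: "c \<odot>\<^bsub>?H n\<^esub> f \<in> carrier (?H n)" if "f \<in> carrier (?H n)" for f n c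
    by (rule hom_space_smult_closed[OF A p(2) N hD[OF that]])
  have "kvs ((?H n)\<lparr>carrier := cocycles A P d N n\<rparr>)"
  proof (rule hom_space_kvs[OF A p(2) N])
    show "cocycles A P d N n \<subseteq> carrier (?H n)" by (auto simp: cocycles_def)
    show "\<zero>\<^bsub>?H n\<^esub> \<in> cocycles A P d N n" using z dc by (auto simp: cocycles_def)
    fix f assume f: "f \<in> cocycles A P d N n"
    then show "c \<odot>\<^bsub>?H n\<^esub> f \<in> cocycles A P d N n" for c
      using s[of f n c] dc by (auto simp: cocycles_def)
    fix g assume g: "g \<in> cocycles A P d N n"
    then show "f \<oplus>\<^bsub>?H n\<^esub> g \<in> cocycles A P d N n"
      using f a[of f n g] dc by (auto simp: cocycles_def)
  qed
  then interpret V: kvs "(?H n)\<lparr>carrier := cocycles A P d N n\<rparr>" .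
  show ?thesis
  proof (cases n)
    case 0
    then show ?thesis
      using V.zero_closed
        V.ks_zero_right V.l_zero[OF V.zero_closed]
      by unfold_locales auto
  next
    case (Suc m)
    let ?c = "\<lambda>f. \<lambda>x\<in>carrier (P (Suc m)). f (d m x)"
    have cl: "?c f \<in> cocycles A P d N (Suc m)" if f: "f \<in> carrier (?H m)" for f
    proof -
      have "?c f \<in> carrier (?H (Suc m))"
        by (rule hom_space_restrict[OF module_hom_comp[OF p(3) hD[OF f]] p(2)])
      moreover have "f (d m (d (Suc m) x)) = \<zero>\<^bsub>N\<^esub>" if "x \<in> carrier (P (Suc (Suc m)))" for x
        using p(6)[OF that] module_hom_zero[OF hD[OF f] p(2) N] by simp
      ultimately show ?thesis using dc by (auto simp: cocycles_def)
    qed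
    show ?thesis unfolding Suc
    proof (intro kquot.intro kquot_axioms.intro)
      show "kvs ((?H (Suc m))\<lparr>carrier := cocycles A P d N (Suc m)\<rparr>)"
        using V.kvs_axioms unfolding Suc .
    next
      show "coboundaries A P d N (Suc m) \<subseteq> carrier ((?H (Suc m))\<lparr>carrier := cocycles A P d N (Suc m)\<rparr>)"
        using cl by auto
    next
      have "?c (\<zero>\<^bsub>?H m\<^esub>) = \<zero>\<^bsub>?H (Suc m)\<^esub>" using dc by (auto intro!: restrict_ext)
      then show "\<zero>\<^bsub>(?H (Suc m))\<lparr>carrier := cocycles A P d N (Suc m)\<rparr>\<^esub> \<in> coboundaries A P d N (Suc m)"
        using z[of m] by (auto intro!: image_eqI[of _ _ "\<zero>\<^bsub>?H m\<^esub>"])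
    next
      fix x y assume "x \<in> coboundaries A P d N (Suc m)" "y \<in> coboundaries A P d N (Suc m)"
      then obtain f g where f: "f \<in> carrier (?H m)" "x = ?c f" and g: "g \<in> carrier (?H m)" "y = ?c g" by auto
      have "x \<oplus>\<^bsub>?H (Suc m)\<^esub> y = ?c (f \<oplus>\<^bsub>?H m\<^esub> g)"
        unfolding f g using dc by (auto intro!: restrict_ext)
      with a[OF f(1) g(1)]
      show "x \<oplus>\<^bsub>(?H (Suc m))\<lparr>carrier := cocycles A P d N (Suc m)\<rparr>\<^esub> y \<in> coboundaries A P d N (Suc m)"
        unfolding coboundaries.simps by (intro image_eqI[of _ _ "f \<oplus>\<^bsub>?H m\<^esub> g"]) simp_all
    next
      fix x c assume "x \<in> coboundaries A P d N (Suc m)"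
      then obtain f where f: "f \<in> carrier (?H m)" "x = ?c f" by auto
      have "c \<odot>\<^bsub>?H (Suc m)\<^esub> x = ?c (c \<odot>\<^bsub>?H m\<^esub> f)"
        unfolding f using dc by (auto intro!: restrict_ext)
      with s[OF f(1), of c]
      show "c \<odot>\<^bsub>(?H (Suc m))\<lparr>carrier := cocycles A P d N (Suc m)\<rparr>\<^esub> x \<in> coboundaries A P d N (Suc m)"
        unfolding coboundaries.simps by (intro image_eqI[of _ _ "c \<odot>\<^bsub>?H m\<^esub> f"]) simp_all
    qed
  qed
qed

section \<open>Homotopy equivalence of resolutions\<close>

definition chain_map where
  "chain_map R P d P' d' \<alpha> \<longleftrightarrow> (\<forall>n. \<alpha> n \<in> module_hom R (P n) (P' n)) \<and>
     (\<forall>n. \<forall>x\<in>carrier (P (Suc n)). d' n (\<alpha> (Suc n) x) = \<alpha> n (d n x))"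

text \<open>The relation \<open>\<gamma> - id = d s + s d\<close>; degree \<open>0\<close> is
  separate because no differential leaves \<open>P 0\<close>.\<close>

definition id_homotopy where
  "id_homotopy R P d \<gamma> s \<longleftrightarrow> (\<forall>n. s n \<in> module_hom R (P n) (P (Suc n))) \<and>
     (\<forall>x\<in>carrier (P 0). \<gamma> 0 x \<ominus>\<^bsub>P 0\<^esub> x = d 0 (s 0 x)) \<and>
     (\<forall>n. \<forall>x\<in>carrier (P (Suc n)). \<gamma> (Suc n) x \<ominus>\<^bsub>P (Suc n)\<^esub> x =
        d (Suc n) (s (Suc n) x) \<oplus>\<^bsub>P (Suc n)\<^esub> s n (d n x))"

lemma module_hom_id: "(\<lambda>x. x) \<in> module_hom R M M"
  by (rule module_homI) auto

lemma id_homotopy_exists: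
  assumes P: "projective_resolution R M P d" and M: "left_module R M"
    and e: "augmentation R M P d \<epsilon>"
    and \<gamma>: "\<And>n. \<gamma> n \<in> module_hom R (P n) (P n)"
    and \<gamma>d: "\<And>n x. x \<in> carrier (P (Suc n)) \<Longrightarrow> d n (\<gamma> (Suc n) x) = \<gamma> n (d n x)"
    and \<gamma>e: "\<And>x. x \<in> carrier (P 0) \<Longrightarrow> \<epsilon> (\<gamma> 0 x) = \<epsilon> x"
  shows "\<exists>s. id_homotopy R P d \<gamma> s"
proof -
  note p = projective_resolutionD[OF P]
  interpret M: left_module R M by fact
  have eh: "\<epsilon> \<in> module_hom R (P 0) M" using e by (simp add: augmentation_def)
  let ?g = "\<lambda>n x. \<gamma> n x \<ominus>\<^bsub>P n\<^esub> x"
  have "\<exists>s. (\<forall>n. s n \<in> module_hom R (P n) (P (Suc n))) \<and>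
     (\<forall>x\<in>carrier (P 0). ?g 0 x = d 0 (s 0 x)) \<and>
     (\<forall>n. \<forall>x\<in>carrier (P (Suc n)). ?g (Suc n) x = d (Suc n) (s (Suc n) x) \<oplus>\<^bsub>P (Suc n)\<^esub> s n (d n x))"
  proof (rule null_homotopy_exists[OF P P M e e, of ?g])
    show "?g n \<in> module_hom R (P n) (P n)" for n
      by (rule module_hom_diff[OF \<gamma> module_hom_id p(2) p(2)])
    show "\<epsilon> (?g 0 x) = \<zero>\<^bsub>M\<^esub>" if x: "x \<in> carrier (P 0)" for x
      using module_hom_minus[OF eh p(2) M module_homD(1)[OF \<gamma> x] x] \<gamma>e[OF x] module_homD(1)[OF eh x]
      by (simp add: M.M.minus_eq M.M.r_neg)
    show "d n (?g (Suc n) x) = ?g n (d n x)" if x: "x \<in> carrier (P (Suc n))" for n x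
      using module_hom_minus[OF p(3) p(2) p(2) module_homD(1)[OF \<gamma> x] x] \<gamma>d[OF x] by simp
  qed
  then show ?thesis unfolding id_homotopy_def .
qed

text \<open>Chain maps over the identity of \<open>M\<close> exist in both directions. Each
  composite also lies over the identity, so its difference from the identity map lies over zero and
  is null homotopic.\<close>

lemma homotopy_equivalence_exists:
  assumes P: "projective_resolution R M P d" and P': "projective_resolution R M P' d'"
    and M: "left_module R M"
  obtains \<alpha> \<beta> s s' where
    "chain_map R P d P' d' \<alpha>" "chain_map R P' d' P d \<beta>"
    "id_homotopy R P d (\<lambda>n x. \<beta> n (\<alpha> n x)) s" "id_homotopy R P' d' (\<lambda>n x. \<alpha> n (\<beta> n x)) s'"
proof -
  note p = projective_resolutionD[OF P] and p' = projective_resolutionD[OF P']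
  from p(4) obtain \<epsilon> where e: "augmentation R M P d \<epsilon>" ..
  from p'(4) obtain \<epsilon>' where e': "augmentation R M P' d' \<epsilon>'" ..
  from chain_map_exists[OF P P' M e e'] obtain \<alpha> where
    "(\<forall>n. \<alpha> n \<in> module_hom R (P n) (P' n)) \<and> (\<forall>x\<in>carrier (P 0). \<epsilon>' (\<alpha> 0 x) = \<epsilon> x) \<and>
     (\<forall>n. \<forall>x\<in>carrier (P (Suc n)). d' n (\<alpha> (Suc n) x) = \<alpha> n (d n x))" ..
  then have a: "\<And>n. \<alpha> n \<in> module_hom R (P n) (P' n)" "\<And>x. x\<in>carrier (P 0) \<Longrightarrow> \<epsilon>' (\<alpha> 0 x) = \<epsilon> x"
     "\<And>n x. x\<in>carrier (P (Suc n)) \<Longrightarrow> d' n (\<alpha> (Suc n) x) = \<alpha> n (d n x)" by simp_all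
  from chain_map_exists[OF P' P M e' e] obtain \<beta> where
    "(\<forall>n. \<beta> n \<in> module_hom R (P' n) (P n)) \<and> (\<forall>x\<in>carrier (P' 0). \<epsilon> (\<beta> 0 x) = \<epsilon>' x) \<and>
     (\<forall>n. \<forall>x\<in>carrier (P' (Suc n)). d n (\<beta> (Suc n) x) = \<beta> n (d' n x))" ..
  then have b: "\<And>n. \<beta> n \<in> module_hom R (P' n) (P n)" "\<And>x. x\<in>carrier (P' 0) \<Longrightarrow> \<epsilon> (\<beta> 0 x) = \<epsilon>' x"
     "\<And>n x. x\<in>carrier (P' (Suc n)) \<Longrightarrow> d n (\<beta> (Suc n) x) = \<beta> n (d' n x)" by simp_all
  have "\<exists>s. id_homotopy R P d (\<lambda>n x. \<beta> n (\<alpha> n x)) s"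
    by (rule id_homotopy_exists[OF P M e module_hom_comp[OF a(1) b(1)]])
      (use a b module_homD(1)[OF a(1)] module_homD(1)[OF b(1)] in simp_all)
  then obtain s where s: "id_homotopy R P d (\<lambda>n x. \<beta> n (\<alpha> n x)) s" ..
  have "\<exists>s. id_homotopy R P' d' (\<lambda>n x. \<alpha> n (\<beta> n x)) s"
    by (rule id_homotopy_exists[OF P' M e' module_hom_comp[OF b(1) a(1)]])
      (use a b module_homD(1)[OF a(1)] module_homD(1)[OF b(1)] in simp_all)
  then obtain s' where s': "id_homotopy R P' d' (\<lambda>n x. \<alpha> n (\<beta> n x)) s'" ..
  have "chain_map R P d P' d' \<alpha>" "chain_map R P' d' P d \<beta>" using a b by (simp_all add: chain_map_def)
  with s s' show ?thesis by (intro that)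
qed

text \<open>Apply \<open>F\<close> to the homotopy relation: the summand
  \<open>F (d n (s n x))\<close> vanishes because \<open>F\<close> is a cocycle, and what is left is
  the coboundary of \<open>F\<close> composed with \<open>s\<close>, or nothing in degree
  \<open>0\<close>.\<close>

lemma id_homotopy_apply:
  assumes P: "projective_resolution R M P d" and h: "id_homotopy R P d \<gamma> s"
    and \<gamma>: "\<And>n. \<gamma> n \<in> module_hom R (P n) (P n)" and N: "left_module R N"
    and F: "F \<in> module_hom R (P n) N" and Fd: "\<And>y. y \<in> carrier (P (Suc n)) \<Longrightarrow> F (d n y) = \<zero>\<^bsub>N\<^esub>"
    and x: "x \<in> carrier (P n)"
  shows "F (\<gamma> n x) = F x \<oplus>\<^bsub>N\<^esub> (case n of 0 \<Rightarrow> \<zero>\<^bsub>N\<^esub> | Suc m \<Rightarrow> F (s m (d m x)))"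
proof -
  note p = projective_resolutionD[OF P]
  interpret N: left_module R N by fact
  note Fc = module_homD(1)[OF F] and dc = module_homD(1)[OF p(3)]
  have sh: "s n \<in> module_hom R (P n) (P (Suc n))" for n
    using h by (simp add: id_homotopy_def)
  note sc = module_homD(1)[OF sh]
  have \<gamma>x: "\<gamma> n x \<in> carrier (P n)" by (rule module_homD(1)[OF \<gamma> x])
  have e: "F (\<gamma> n x \<ominus>\<^bsub>P n\<^esub> x) = (case n of 0 \<Rightarrow> \<zero>\<^bsub>N\<^esub> | Suc m \<Rightarrow> F (s m (d m x)))"
  proof (cases n)
    case 0
    then have "\<gamma> 0 x \<ominus>\<^bsub>P 0\<^esub> x = d 0 (s 0 x)" using h x by (simp add: id_homotopy_def)
    with 0 show ?thesis using Fd[of "s 0 x"] sc[of x 0] x by simp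
  next
    case (Suc m)
    then have eq: "\<gamma> n x \<ominus>\<^bsub>P n\<^esub> x = d n (s n x) \<oplus>\<^bsub>P n\<^esub> s m (d m x)" using h x by (simp add: id_homotopy_def)
    have "s n x \<in> carrier (P (Suc n))" using sc x by simp
    then have 1: "d n (s n x) \<in> carrier (P n)" "F (d n (s n x)) = \<zero>\<^bsub>N\<^esub>" using dc Fd by auto
    have "d m x \<in> carrier (P m)" using dc x Suc by simp
    then have 2: "s m (d m x) \<in> carrier (P n)" using sc[of "d m x" m] Suc by simp
    show ?thesis using module_homD(2)[OF F 1(1) 2] 1(2) Fc[OF 2] eq Suc by simp
  qed
  have "F (\<gamma> n x \<ominus>\<^bsub>P n\<^esub> x) = F (\<gamma> n x) \<ominus>\<^bsub>N\<^esub> F x"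
    by (rule module_hom_minus[OF F p(2) N \<gamma>x x])
  then have "F (\<gamma> n x) = F x \<oplus>\<^bsub>N\<^esub> F (\<gamma> n x \<ominus>\<^bsub>P n\<^esub> x)"
    using Fc[OF x] Fc[OF \<gamma>x] by (simp add: N.M.minus_eq N.M.a_lcomm[of "F x" "F (\<gamma> n x)"] N.M.r_neg)
  with e show ?thesis by simp
qed

section \<open>Hom complexes in coordinates\<close>

text \<open>\<open>T n\<close> identifies the space \<open>K n\<close> of scalar functions with the
  linear maps from \<open>P' n\<close> to \<open>N\<close>, and \<open>\<delta>\<close> corresponds
  to precomposition with \<open>d'\<close>. Cohomology can then be handled with scalar functions on
  a fixed index type, on which restriction and gluing are elementary.\<close>

locale hom_model =
  fixes A :: "('k::field, 'r) module" and N :: "('r, 'n) module"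
    and P' :: "nat \<Rightarrow> ('r, 'q) module" and d' :: "nat \<Rightarrow> 'q \<Rightarrow> 'q"
    and K :: "nat \<Rightarrow> ('x \<Rightarrow> 'k) set" and \<delta> :: "nat \<Rightarrow> ('x \<Rightarrow> 'k) \<Rightarrow> 'x \<Rightarrow> 'k"
    and T :: "nat \<Rightarrow> ('x \<Rightarrow> 'k) \<Rightarrow> 'q \<Rightarrow> 'n"
  assumes T_hom: "\<phi> \<in> K n \<Longrightarrow> T n \<phi> \<in> module_hom A (P' n) N"
    and T_add: "\<phi> \<in> K n \<Longrightarrow> \<psi> \<in> K n \<Longrightarrow> x \<in> carrier (P' n) \<Longrightarrow> T n (\<lambda>i. \<phi> i + \<psi> i) x = T n \<phi> x \<oplus>\<^bsub>N\<^esub> T n \<psi> x"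
    and T_smult: "\<phi> \<in> K n \<Longrightarrow> x \<in> carrier (P' n) \<Longrightarrow> T n (\<lambda>i. c * \<phi> i) x = (c \<odot>\<^bsub>A\<^esub> \<one>\<^bsub>A\<^esub>) \<odot>\<^bsub>N\<^esub> T n \<phi> x"
    and T_inj: "\<phi> \<in> K n \<Longrightarrow> \<psi> \<in> K n \<Longrightarrow> (\<And>x. x \<in> carrier (P' n) \<Longrightarrow> T n \<phi> x = T n \<psi> x) \<Longrightarrow> \<phi> = \<psi>"
    and T_surj: "F \<in> module_hom A (P' n) N \<Longrightarrow> \<exists>\<phi>\<in>K n. \<forall>x\<in>carrier (P' n). T n \<phi> x = F x"
    and K_zero: "(\<lambda>_. 0) \<in> K n"
    and K_add: "\<phi> \<in> K n \<Longrightarrow> \<psi> \<in> K n \<Longrightarrow> (\<lambda>i. \<phi> i + \<psi> i) \<in> K n"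
    and K_smult: "\<phi> \<in> K n \<Longrightarrow> (\<lambda>i. c * \<phi> i) \<in> K n"
    and K_\<delta>: "\<phi> \<in> K n \<Longrightarrow> \<delta> n \<phi> \<in> K (Suc n)"
    and T_\<delta>: "\<phi> \<in> K n \<Longrightarrow> x \<in> carrier (P' (Suc n)) \<Longrightarrow> T (Suc n) (\<delta> n \<phi>) x = T n \<phi> (d' n x)"

definition model_cocycles :: "(nat \<Rightarrow> ('x \<Rightarrow> 'k::field) set) \<Rightarrow> (nat \<Rightarrow> ('x \<Rightarrow> 'k) \<Rightarrow> 'x \<Rightarrow> 'k) \<Rightarrow> nat \<Rightarrow> ('x \<Rightarrow> 'k) set" where
  "model_cocycles K \<delta> n = {\<phi> \<in> K n. \<delta> n \<phi> = (\<lambda>_. 0)}"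

fun model_coboundaries :: "(nat \<Rightarrow> ('x \<Rightarrow> 'k::field) set) \<Rightarrow> (nat \<Rightarrow> ('x \<Rightarrow> 'k) \<Rightarrow> 'x \<Rightarrow> 'k) \<Rightarrow> nat \<Rightarrow> ('x \<Rightarrow> 'k) set" where
  "model_coboundaries K \<delta> 0 = {\<lambda>_. 0}"
| "model_coboundaries K \<delta> (Suc n) = \<delta> n ` K n"

text \<open>\<open>P\<close> is an arbitrary resolution and \<open>P'\<close> the one that has
  coordinates. A cocycle \<open>z\<close> of the model goes to the class of \<open>T n z\<close>
  composed with the comparison map \<open>\<alpha>\<close>. A preimage of the class of
  \<open>f\<close> has the coordinates of \<open>f\<close> composed with \<open>\<beta>\<close>; the
  two homotopies absorb the difference of the composites from the identity.\<close>

lemma (in hom_model) pres_hom_cohomology: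
  fixes P :: "nat \<Rightarrow> ('r, 'p) module"
  assumes A: "kalg A" and M: "left_module A M" and N: "left_module A N"
    and P: "projective_resolution A M P d" and P': "projective_resolution A M P' d'"
  shows "\<exists>q. pres (hom_cohomology A P d N n) (model_cocycles K \<delta> n) (model_coboundaries K \<delta> n) q"
proof -
  interpret A: kalg A by fact
  interpret N: left_module A N by fact
  note p = projective_resolutionD[OF P] and p' = projective_resolutionD[OF P']
  obtain \<alpha> \<beta> s s' where 
    ab: "chain_map A P d P' d' \<alpha>" "chain_map A P' d' P d \<beta>"
    and s: "id_homotopy A P d (\<lambda>n x. \<beta> n (\<alpha> n x)) s" and s': "id_homotopy A P' d' (\<lambda>n x. \<alpha> n (\<beta> n x)) s'"
    by (rule homotopy_equivalence_exists[OF P P' M])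
  have a: "\<And>n. \<alpha> n \<in> module_hom A (P n) (P' n)" 
     "\<And>n x. x\<in>carrier (P (Suc n)) \<Longrightarrow> d' n (\<alpha> (Suc n) x) = \<alpha> n (d n x)"
    and b: "\<And>n. \<beta> n \<in> module_hom A (P' n) (P n)" 
     "\<And>n x. x\<in>carrier (P' (Suc n)) \<Longrightarrow> d n (\<beta> (Suc n) x) = \<beta> n (d' n x)"
    using ab by (simp_all add: chain_map_def)
  note ac = module_homD(1)[OF a(1)] and bc = module_homD(1)[OF b(1)]
    and dc = module_homD(1)[OF p(3)] and dc' = module_homD(1)[OF p'(3)]
  have sh: "s n \<in> module_hom A (P n) (P (Suc n))" and sh': "s' n \<in> module_hom A (P' n) (P' (Suc n))" for n
    using s s' by (simp_all add: id_homotopy_def)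
  note sc = module_homD(1)[OF sh] and sc' = module_homD(1)[OF sh']
  have T0: "T n (\<lambda>_. 0) x = \<zero>\<^bsub>N\<^esub>" if "x \<in> carrier (P' n)" for n x
    using T_smult[OF K_zero that, of 0] N.smult_zero_left[OF module_homD(1)[OF T_hom[OF K_zero] that]]
    by simp
  let ?H = "\<lambda>n. hom_space A (P n) N"
  let ?V = "(?H n)\<lparr>carrier := cocycles A P d N n\<rparr>" and ?W = "coboundaries A P d N n"
  interpret V: kquot ?V ?W by (rule hom_cohomology_kquot[OF A P N])
  define r where "r z = (\<lambda>x\<in>carrier (P n). T n z (\<alpha> n x))" for z
  define q where "q z = ?W +>\<^bsub>?V\<^esub> r z" for z
  have Z: "z \<in> K n" "\<delta> n z = (\<lambda>_. 0)" if "z \<in> model_cocycles K \<delta> n" for z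
    using that by (simp_all add: model_cocycles_def)
  have Zc: "T n z (d' n x) = \<zero>\<^bsub>N\<^esub>" if "z \<in> model_cocycles K \<delta> n" "x \<in> carrier (P' (Suc n))" for z x
    using T_\<delta>[OF Z(1)[OF that(1)] that(2)] Z(2)[OF that(1)] T0[OF that(2)] by simp
  have r: "r z \<in> cocycles A P d N n" if z: "z \<in> model_cocycles K \<delta> n" for z
  proof -
    have "r z \<in> carrier (?H n)"
      unfolding r_def by (rule hom_space_restrict[OF module_hom_comp[OF a(1) T_hom[OF Z(1)[OF z]]] p(2)])
    moreover have "r z (d n x) = \<zero>\<^bsub>N\<^esub>" if x: "x \<in> carrier (P (Suc n))" for x
      using a(2)[OF x, symmetric] Zc[OF z ac[OF x]] dc[OF x] by (simp add: r_def)
    ultimately show ?thesis by (simp add: cocycles_def)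
  qed
  have H: "hom_cohomology A P d N n = quot_alg ?V ?W" by (simp add: hom_cohomology_def)
  have \<beta>\<alpha>: "(\<lambda>x. \<beta> n (\<alpha> n x)) \<in> module_hom A (P n) (P n)" for n by (rule module_hom_comp[OF a(1) b(1)])
  have \<alpha>\<beta>: "(\<lambda>x. \<alpha> n (\<beta> n x)) \<in> module_hom A (P' n) (P' n)" for n by (rule module_hom_comp[OF b(1) a(1)])
  have "kvs (hom_cohomology A P d N n)" unfolding H by (rule V.quot_kvs)
  moreover have "q ` model_cocycles K \<delta> n = carrier (hom_cohomology A P d N n)"
  proof (intro equalityI subsetI)
    fix X assume "X \<in> q ` model_cocycles K \<delta> n"
    then show "X \<in> carrier (hom_cohomology A P d N n)"
      using V.a_rcosetsI[OF V.W_subset] r by (auto simp: H q_def)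
  next
    fix X assume "X \<in> carrier (hom_cohomology A P d N n)"
    then obtain f where f: "f \<in> cocycles A P d N n" "X = ?W +>\<^bsub>?V\<^esub> f"
      using V.rcosetsE[of X] by (auto simp: H)
    have fh: "f \<in> module_hom A (P n) N" and fd: "\<And>x. x \<in> carrier (P (Suc n)) \<Longrightarrow> f (d n x) = \<zero>\<^bsub>N\<^esub>"
      using f by (auto simp: cocycles_def hom_space_carrier)
    from T_surj[OF module_hom_comp[OF b(1) fh]] obtain z where
      "z \<in> K n" and "\<forall>x\<in>carrier (P' n). T n z x = f (\<beta> n x)" ..
    then have z: "z \<in> K n" "\<And>x. x \<in> carrier (P' n) \<Longrightarrow> T n z x = f (\<beta> n x)" by simp_all
    have "\<delta> n z = (\<lambda>_. 0)"
    proof (rule T_inj[OF K_\<delta>[OF z(1)] K_zero])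
      fix x assume x: "x \<in> carrier (P' (Suc n))"
      show "T (Suc n) (\<delta> n z) x = T (Suc n) (\<lambda>_. 0) x"
        using T_\<delta>[OF z(1) x] z(2)[OF dc'[OF x]] b(2)[OF x] fd[OF bc[OF x]] T0[OF x] by simp
    qed
    with z have zZ: "z \<in> model_cocycles K \<delta> n" by (simp add: model_cocycles_def)
    have rz: "r z x = f x \<oplus>\<^bsub>N\<^esub> (case n of 0 \<Rightarrow> \<zero>\<^bsub>N\<^esub> | Suc m \<Rightarrow> f (s m (d m x)))" if x: "x \<in> carrier (P n)" for x
      using id_homotopy_apply[OF P s \<beta>\<alpha> N fh fd x] z(2)[OF ac[OF x]] x by (simp add: r_def)
    have fc: "f x \<in> carrier N" if "x \<in> carrier (P n)" for x using module_homD(1)[OF fh that] .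
    have "\<exists>w \<in> ?W. r z = w \<oplus>\<^bsub>?V\<^esub> f"
    proof (cases n)
      case 0
      have "r z = \<zero>\<^bsub>?H 0\<^esub> \<oplus>\<^bsub>?V\<^esub> f"
        using rz fc unfolding 0 by (auto simp: fun_eq_iff r_def 0)
      then show ?thesis unfolding 0 by (intro bexI) simp_all
    next
      case (Suc m)
      \<comment> \<open>By the homotopy, composing \<open>f\<close> with \<open>\<beta>\<close> and
        \<open>\<alpha>\<close> adds \<open>f (s m (d m x))\<close> to \<open>f x\<close>;
        \<open>?w\<close> is this summand written as a coboundary.\<close>
      let ?w = "\<lambda>x\<in>carrier (P (Suc m)). (\<lambda>y\<in>carrier (P m). f (s m y)) (d m x)"
      have "(\<lambda>y\<in>carrier (P m). f (s m y)) \<in> carrier (?H m)"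
        using hom_space_restrict[OF module_hom_comp[OF sh fh[unfolded Suc]] p(2)] .
      then have w: "?w \<in> coboundaries A P d N (Suc m)" unfolding coboundaries.simps by (rule imageI)
      have "r z = ?w \<oplus>\<^bsub>?V\<^esub> f"
        using rz fc dc[of _ m] sc[of _ m] unfolding Suc 
        by (auto simp: fun_eq_iff r_def Suc N.M.a_comm)
      then show ?thesis using w unfolding Suc Bex_def by (intro exI[of _ ?w] conjI)
    qed
    then obtain w where w: "w \<in> ?W" "r z = w \<oplus>\<^bsub>?V\<^esub> f" ..
    then have "r z \<in> ?W +>\<^bsub>?V\<^esub> f" unfolding a_r_coset_def' by blast
    then have "q z = X" unfolding q_def f(2) using V.W.a_repr_independence'[of "r z" f] f(1) by simp
    with zZ show "X \<in> q ` model_cocycles K \<delta> n" by (intro image_eqI[of _ _ z]) simp_all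
  qed
  moreover have "\<forall>x\<in>model_cocycles K \<delta> n. \<forall>y\<in>model_cocycles K \<delta> n.
      q (\<lambda>i. x i + y i) = q x \<oplus>\<^bsub>hom_cohomology A P d N n\<^esub> q y"
  proof (intro ballI)
    fix x y assume x: "x \<in> model_cocycles K \<delta> n" and y: "y \<in> model_cocycles K \<delta> n"
    have "r (\<lambda>i. x i + y i) = r x \<oplus>\<^bsub>?V\<^esub> r y"
      using T_add[OF Z(1)[OF x] Z(1)[OF y] ac] by (auto simp: r_def fun_eq_iff)
    with r[OF x] r[OF y] show "q (\<lambda>i. x i + y i) = q x \<oplus>\<^bsub>hom_cohomology A P d N n\<^esub> q y"
      unfolding q_def H quot_alg_simps using V.W.a_rcos_sum[of "r x" "r y"] by simp
  qed
  moreover have "\<forall>c. \<forall>x\<in>model_cocycles K \<delta> n. q (\<lambda>i. c * x i) = c \<odot>\<^bsub>hom_cohomology A P d N n\<^esub> q x"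
  proof (intro ballI allI)
    fix c x assume x: "x \<in> model_cocycles K \<delta> n"
    have "r (\<lambda>i. c * x i) = c \<odot>\<^bsub>?V\<^esub> r x"
      using T_smult[OF Z(1)[OF x] ac] by (auto simp: r_def fun_eq_iff)
    with r[OF x] show "q (\<lambda>i. c * x i) = c \<odot>\<^bsub>hom_cohomology A P d N n\<^esub> q x"
      unfolding q_def H using V.quot_smult[of "r x" c] by simp
  qed
  moreover have "\<forall>x\<in>model_cocycles K \<delta> n. q x = \<zero>\<^bsub>hom_cohomology A P d N n\<^esub> \<longleftrightarrow> x \<in> model_coboundaries K \<delta> n"
  proof
    fix z assume z: "z \<in> model_cocycles K \<delta> n"
    have q0: "q z = \<zero>\<^bsub>hom_cohomology A P d N n\<^esub> \<longleftrightarrow> r z \<in> ?W"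
      unfolding q_def H quot_alg_simps using V.coset_zero_iff[of "r z"] r[OF z] by simp
    note Th = T_hom[OF Z(1)[OF z]]
    have id': "T n z (\<alpha> n (\<beta> n x)) = T n z x \<oplus>\<^bsub>N\<^esub> (case n of 0 \<Rightarrow> \<zero>\<^bsub>N\<^esub> | Suc m \<Rightarrow> T n z (s' m (d' m x)))"
      if "x \<in> carrier (P' n)" for x
      by (rule id_homotopy_apply[OF P' s' \<alpha>\<beta> N Th _ that]) (rule Zc[OF z])
    have Tc: "T n z x \<in> carrier N" if "x \<in> carrier (P' n)" for x using module_homD(1)[OF Th that] .
    show "q z = \<zero>\<^bsub>hom_cohomology A P d N n\<^esub> \<longleftrightarrow> z \<in> model_coboundaries K \<delta> n"
    proof (cases n)
      case 0
      have "z = (\<lambda>_. 0)" if "r z \<in> ?W"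
      proof (rule T_inj[OF Z(1)[OF z] K_zero])
        fix x assume x: "x \<in> carrier (P' n)"
        have "r z = \<zero>\<^bsub>?H n\<^esub>" using that 0 by simp
        then have "r z (\<beta> n x) = \<zero>\<^bsub>N\<^esub>" using bc[OF x] by simp
        then have "T n z (\<alpha> n (\<beta> n x)) = \<zero>\<^bsub>N\<^esub>" using bc[OF x] by (simp add: r_def)
        then show "T n z x = T n (\<lambda>_. 0) x" using id'[OF x] x Tc[OF x] T0[OF x] 0 by simp
      qed
      moreover have "r (\<lambda>_. 0) \<in> ?W" using T0 ac 0 by (auto simp: r_def fun_eq_iff)
      ultimately show ?thesis unfolding q0 using 0 by auto
    next
      case (Suc m)
      show ?thesis unfolding q0
      proof
        assume "r z \<in> ?W"
        then obtain h where h: "h \<in> carrier (?H m)" "r z = (\<lambda>x\<in>carrier (P (Suc m)). h (d m x))"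
          unfolding Suc by auto
        then have hh: "h \<in> module_hom A (P m) N" by (simp add: hom_space_carrier)
        have sm: "(\<lambda>y. T n z (s' m y)) \<in> module_hom A (P' m) N"
          using module_hom_comp[OF sh' Th[unfolded Suc]] Suc by simp
        \<comment> \<open>Evaluated at \<open>\<alpha> n (\<beta> n x)\<close>, the map
          \<open>T n z\<close> equals \<open>h (\<beta> m (d' m x))\<close> as a coboundary, and
          equals \<open>T n z x\<close> plus \<open>T n z (s' m (d' m x))\<close> by the homotopy on
          \<open>P'\<close>. Subtracting shows that \<open>T n z\<close> is the coboundary of
          \<open>?F\<close>.\<close>
        let ?F = "\<lambda>y. h (\<beta> m y) \<ominus>\<^bsub>N\<^esub> T n z (s' m y)"
        have "?F \<in> module_hom A (P' m) N"
          by (rule module_hom_diff[OF module_hom_comp[OF b(1) hh] sm p'(2) N])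
        from T_surj[OF this] obtain \<psi> where "\<psi> \<in> K m" "\<forall>x\<in>carrier (P' m). T m \<psi> x = ?F x" ..
        then have \<psi>: "\<psi> \<in> K m" "\<And>x. x \<in> carrier (P' m) \<Longrightarrow> T m \<psi> x = ?F x" by simp_all
        have "z = \<delta> m \<psi>"
        proof (rule T_inj[OF Z(1)[OF z]])
          show "\<delta> m \<psi> \<in> K n" using K_\<delta>[OF \<psi>(1)] Suc by simp
          fix x assume x: "x \<in> carrier (P' n)"
          then have x': "x \<in> carrier (P' (Suc m))" using Suc by simp
          have dx: "d' m x \<in> carrier (P' m)" by (rule dc'[OF x'])
          have "T n z (\<alpha> n (\<beta> n x)) = r z (\<beta> n x)" using bc[OF x] by (simp add: r_def)
          also have "\<dots> = h (d m (\<beta> n x))"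
            using bc[OF x] unfolding h(2) Suc by simp
          also have "\<dots> = h (\<beta> m (d' m x))" using b(2)[OF x'] Suc by simp
          finally have "h (\<beta> m (d' m x)) = T n z x \<oplus>\<^bsub>N\<^esub> T n z (s' m (d' m x))" using id'[OF x] Suc by simp
          then have "?F (d' m x) = T n z x"
            using Tc[OF x] module_homD(1)[OF sm dx] by (simp add: N.M.minus_eq N.M.a_assoc N.M.r_neg)
          then show "T n z x = T n (\<delta> m \<psi>) x" using T_\<delta>[OF \<psi>(1) x'] \<psi>(2)[OF dx] Suc by simp
        qed
        then show "z \<in> model_coboundaries K \<delta> n" using \<psi>(1) Suc by simp
      next
        assume "z \<in> model_coboundaries K \<delta> n"
        then obtain \<psi> where \<psi>: "\<psi> \<in> K m" "z = \<delta> m \<psi>" using Suc by auto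
        let ?h = "\<lambda>x\<in>carrier (P m). T m \<psi> (\<alpha> m x)"
        have "?h \<in> carrier (?H m)"
          by (rule hom_space_restrict[OF module_hom_comp[OF a(1) T_hom[OF \<psi>(1)]] p(2)])
        moreover have "r z = (\<lambda>x\<in>carrier (P (Suc m)). ?h (d m x))"
          using T_\<delta>[OF \<psi>(1) ac] a(2)[of _ m] dc[of _ m] unfolding r_def \<psi>(2) Suc
          by (auto simp: fun_eq_iff)
        ultimately show "r z \<in> ?W" unfolding Suc coboundaries.simps by (intro image_eqI[of _ _ ?h])
      qed
    qed
  qed
  ultimately have "pres (hom_cohomology A P d N n) (model_cocycles K \<delta> n) (model_coboundaries K \<delta> n) q"
    unfolding pres_def by (intro conjI)
  then show ?thesis by (intro exI[of _ q])
qed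

section \<open>The enveloping algebra and its modules\<close>

lemma monoid_algebra_simps [simp]:
  "zero (monoid_algebra G) = (\<lambda>_. 0)"
  "one (monoid_algebra G) = unit_vec_at \<one>\<^bsub>G\<^esub>"
  "add (monoid_algebra G) = (\<lambda>f g x. f x + g x)"
  "smult (monoid_algebra G) = (\<lambda>c f x. c * f x)"
  by (simp_all add: monoid_algebra_def)

lemma monoid_algebra_carrier:
  "f \<in> carrier (monoid_algebra G) \<longleftrightarrow> finite (supp f) \<and> supp f \<subseteq> carrier G"
  by (simp add: monoid_algebra_def)

lemma monoid_algebra_mult:
  assumes "finite S" "finite T" "supp f \<subseteq> S" "supp g \<subseteq> T"
  shows "(f \<otimes>\<^bsub>monoid_algebra G\<^esub> g) x = (\<Sum>s\<in>S. \<Sum>t\<in>T. if s \<otimes>\<^bsub>G\<^esub> t = x then f s * g t else 0)"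
proof -
  have "(\<Sum>s\<in>S. \<Sum>t\<in>T. if s \<otimes>\<^bsub>G\<^esub> t = x then f s * g t else 0) =
    (\<Sum>s\<in>S. \<Sum>t\<in>supp g. if s \<otimes>\<^bsub>G\<^esub> t = x then f s * g t else 0)"
    using assms by (intro sum.cong refl sum.mono_neutral_right) (auto simp: supp_def)
  also have "\<dots> = (\<Sum>s\<in>supp f. \<Sum>t\<in>supp g. if s \<otimes>\<^bsub>G\<^esub> t = x then f s * g t else 0)"
    using assms by (intro sum.mono_neutral_right) (auto simp: supp_def intro!: sum.neutral)
  finally show ?thesis by (simp add: monoid_algebra_def)
qed

lemma monoid_algebra_mult_unit:
  fixes c d :: "'k::field"
  shows "(\<lambda>x. c * unit_vec_at s x) \<otimes>\<^bsub>monoid_algebra G\<^esub> (\<lambda>x. d * unit_vec_at t x) =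
    (\<lambda>x. (c * d) * unit_vec_at (s \<otimes>\<^bsub>G\<^esub> t) x)"
  by (rule ext, subst monoid_algebra_mult[of "{s}" "{t}"])
    (auto simp: supp_def unit_vec_at_def split: if_splits)

lemma monoid_algebra_mult_add_left:
  fixes f g h :: "'s \<Rightarrow> 'k::field"
  assumes "finite (supp f)" "finite (supp g)" "finite (supp h)"
  shows "(\<lambda>x. f x + g x) \<otimes>\<^bsub>monoid_algebra G\<^esub> h = (\<lambda>x. (f \<otimes>\<^bsub>monoid_algebra G\<^esub> h) x + (g \<otimes>\<^bsub>monoid_algebra G\<^esub> h) x)"
proof
  fix x
  have fin: "finite (supp f \<union> supp g)" using assms by auto
  note m = monoid_algebra_mult[OF fin assms(3) _ order_refl]
  show "((\<lambda>x. f x + g x) \<otimes>\<^bsub>monoid_algebra G\<^esub> h) x = (f \<otimes>\<^bsub>monoid_algebra G\<^esub> h) x + (g \<otimes>\<^bsub>monoid_algebra G\<^esub> h) x"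
    unfolding m[OF supp_add_subset] m[OF Un_upper1] m[OF Un_upper2] sum.distrib[symmetric]
    by (intro sum.cong refl) (simp add: distrib_right)
qed

lemma monoid_algebra_mult_add_right:
  fixes f g h :: "'s \<Rightarrow> 'k::field"
  assumes "finite (supp f)" "finite (supp g)" "finite (supp h)"
  shows "h \<otimes>\<^bsub>monoid_algebra G\<^esub> (\<lambda>x. f x + g x) = (\<lambda>x. (h \<otimes>\<^bsub>monoid_algebra G\<^esub> f) x + (h \<otimes>\<^bsub>monoid_algebra G\<^esub> g) x)"
proof
  fix x
  have fin: "finite (supp f \<union> supp g)" using assms by auto
  note m = monoid_algebra_mult[OF assms(3) fin order_refl]
  show "(h \<otimes>\<^bsub>monoid_algebra G\<^esub> (\<lambda>x. f x + g x)) x = (h \<otimes>\<^bsub>monoid_algebra G\<^esub> f) x + (h \<otimes>\<^bsub>monoid_algebra G\<^esub> g) x"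
    unfolding m[OF supp_add_subset] m[OF Un_upper1] m[OF Un_upper2] sum.distrib[symmetric]
    by (intro sum.cong refl) (simp add: distrib_left)
qed

lemma monoid_algebra_mult_zero [simp]:
  "(\<lambda>_. 0) \<otimes>\<^bsub>monoid_algebra G\<^esub> h = (\<lambda>_. 0)" "h \<otimes>\<^bsub>monoid_algebra G\<^esub> (\<lambda>_. 0) = (\<lambda>_. 0)"
  by (simp_all add: monoid_algebra_def fun_eq_iff)

lemma monoid_algebra_mult_smult:
  fixes f h :: "'s \<Rightarrow> 'k::field"
  assumes "finite (supp f)" "finite (supp h)"
  shows "(\<lambda>x. c * f x) \<otimes>\<^bsub>monoid_algebra G\<^esub> h = (\<lambda>x. c * (f \<otimes>\<^bsub>monoid_algebra G\<^esub> h) x)"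
    "h \<otimes>\<^bsub>monoid_algebra G\<^esub> (\<lambda>x. c * f x) = (\<lambda>x. c * (h \<otimes>\<^bsub>monoid_algebra G\<^esub> f) x)"
proof -
  note m = monoid_algebra_mult[OF assms _ order_refl] and m' = monoid_algebra_mult[OF assms(2,1) order_refl]
  show "(\<lambda>x. c * f x) \<otimes>\<^bsub>monoid_algebra G\<^esub> h = (\<lambda>x. c * (f \<otimes>\<^bsub>monoid_algebra G\<^esub> h) x)"
    unfolding fun_eq_iff m[OF supp_smult_subset] m[OF order_refl] sum_distrib_left
    by (intro allI sum.cong refl) simp
  show "h \<otimes>\<^bsub>monoid_algebra G\<^esub> (\<lambda>x. c * f x) = (\<lambda>x. c * (h \<otimes>\<^bsub>monoid_algebra G\<^esub> f) x)"
    unfolding fun_eq_iff m'[OF supp_smult_subset] m'[OF order_refl] sum_distrib_left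
    by (intro allI sum.cong refl) simp
qed

lemma monoid_algebra_mult_closed:
  assumes "Group.monoid G" "f \<in> carrier (monoid_algebra G)" "g \<in> carrier (monoid_algebra G)"
  shows "f \<otimes>\<^bsub>monoid_algebra G\<^esub> g \<in> carrier (monoid_algebra G)"
proof -
  interpret monoid G by fact
  have sub: "supp (f \<otimes>\<^bsub>monoid_algebra G\<^esub> g) \<subseteq> (\<lambda>(s, t). s \<otimes>\<^bsub>G\<^esub> t) ` (supp f \<times> supp g)"
  proof
    fix x assume "x \<in> supp (f \<otimes>\<^bsub>monoid_algebra G\<^esub> g)"
    then have "(\<Sum>s\<in>supp f. \<Sum>t\<in>supp g. if s \<otimes>\<^bsub>G\<^esub> t = x then f s * g t else 0) \<noteq> 0"
      by (simp add: supp_def[of "_ \<otimes>\<^bsub>monoid_algebra G\<^esub> _"]) (simp add: monoid_algebra_def)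
    then obtain s where "s \<in> supp f" "(\<Sum>t\<in>supp g. if s \<otimes>\<^bsub>G\<^esub> t = x then f s * g t else 0) \<noteq> 0"
      by (rule sum.not_neutral_contains_not_neutral)
    moreover from this(2) obtain t where "t \<in> supp g" "(if s \<otimes>\<^bsub>G\<^esub> t = x then f s * g t else 0) \<noteq> 0"
      by (rule sum.not_neutral_contains_not_neutral)
    ultimately show "x \<in> (\<lambda>(s, t). s \<otimes>\<^bsub>G\<^esub> t) ` (supp f \<times> supp g)"
      by (auto split: if_splits)
  qed
  have fin: "finite (supp f \<times> supp g)" and car: "supp f \<subseteq> carrier G" "supp g \<subseteq> carrier G"
    using assms by (auto simp: monoid_algebra_carrier)
  have "(\<lambda>(s, t). s \<otimes>\<^bsub>G\<^esub> t) ` (supp f \<times> supp g) \<subseteq> carrier G" using car by auto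
  with sub fin show ?thesis unfolding monoid_algebra_carrier
    by (meson finite_imageI finite_subset order_trans)
qed

text \<open>Associativity is trilinear; three nested inductions over the supports reduce it to unit
  vectors, where it is associativity in \<open>G\<close>.\<close>

lemma monoid_algebra_kalg:
  assumes "Group.monoid G" shows "kalg (monoid_algebra G :: ('k::field, 's \<Rightarrow> 'k) module)"
proof -
  interpret monoid G by fact
  let ?T = "monoid_algebra G :: ('k, 's \<Rightarrow> 'k) module"
  have add: "(\<lambda>x. f x + g x) \<in> carrier ?T" if "f \<in> carrier ?T" "g \<in> carrier ?T" for f g
    using that supp_add_subset[of f g] unfolding monoid_algebra_carrier
    by (meson finite_UnI finite_subset order_trans Un_least)
  have smult: "(\<lambda>x. c * f x) \<in> carrier ?T" if "f \<in> carrier ?T" for c f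
    using that supp_smult_subset[of c f] unfolding monoid_algebra_carrier
    by (meson finite_subset order_trans)
  have fin: "finite (supp f)" if "f \<in> carrier ?T" for f using that by (simp add: monoid_algebra_carrier)
  have unit: "(\<lambda>x. c * unit_vec_at s x) \<in> carrier ?T" if "s \<in> carrier G" for c s
    using that by (intro smult) (simp add: monoid_algebra_carrier)
  have one: "(\<lambda>x. 1 * unit_vec_at s x) = (unit_vec_at s :: 's \<Rightarrow> 'k)" for s by simp
  note closed = monoid_algebra_mult_closed[OF assms]
  note ind = fun_supp_induct[where S = "carrier G"]
  have carI: "f \<in> carrier ?T" if "finite (supp f)" "supp f \<subseteq> carrier G" for f
    using that by (simp add: monoid_algebra_carrier)
  have fin_mult: "finite (supp (f \<otimes>\<^bsub>?T\<^esub> g))" if "f \<in> carrier ?T" "g \<in> carrier ?T" for f g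
    using fin[OF closed[OF that]] .
  note fins = fin fin_mult carI smult unit
  have assoc: "(f \<otimes>\<^bsub>?T\<^esub> g) \<otimes>\<^bsub>?T\<^esub> h = f \<otimes>\<^bsub>?T\<^esub> (g \<otimes>\<^bsub>?T\<^esub> h)"
    if "f \<in> carrier ?T" "g \<in> carrier ?T" "h \<in> carrier ?T" for f g h
    using that(1)[unfolded monoid_algebra_carrier, THEN conjunct1] that(1)[unfolded monoid_algebra_carrier, THEN conjunct2]
  proof (induct f rule: fun_supp_induct)
    case (unit c s)
    note s = unit
    show ?case using that(2)[unfolded monoid_algebra_carrier, THEN conjunct1] that(2)[unfolded monoid_algebra_carrier, THEN conjunct2]
    proof (induct g rule: fun_supp_induct)
      case (unit d t)
      note t = unit
      show ?case using that(3)[unfolded monoid_algebra_carrier, THEN conjunct1] that(3)[unfolded monoid_algebra_carrier, THEN conjunct2]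
      proof (induct h rule: fun_supp_induct)
        case (unit e u)
        then show ?case using s t by (simp add: monoid_algebra_mult_unit m_assoc, (simp add: mult.assoc)?)
      next
        case (add f g)
        then show ?case using s t by (simp add: monoid_algebra_mult_add_right fins \<open>\<And>s c. s \<in> carrier G \<Longrightarrow> (\<lambda>x. c * unit_vec_at s x) \<in> carrier ?T\<close>)
      qed simp
    next
      case (add f g)
      then show ?case using s that(3)
        by (simp add: monoid_algebra_mult_add_right monoid_algebra_mult_add_left fins \<open>\<And>s c. s \<in> carrier G \<Longrightarrow> (\<lambda>x. c * unit_vec_at s x) \<in> carrier ?T\<close>)
    qed simp
  next
    case (add f f')
    then show ?case using that
      by (simp add: monoid_algebra_mult_add_left fins)
  qed simp
  have lone: "unit_vec_at \<one>\<^bsub>G\<^esub> \<otimes>\<^bsub>?T\<^esub> f = f \<and> f \<otimes>\<^bsub>?T\<^esub> unit_vec_at \<one>\<^bsub>G\<^esub> = f" if "f \<in> carrier ?T" for f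
    using that[unfolded monoid_algebra_carrier, THEN conjunct1] that[unfolded monoid_algebra_carrier, THEN conjunct2]
  proof (induct f rule: fun_supp_induct)
    case (unit c s)
    then show ?case
      using monoid_algebra_mult_unit[of G 1 "\<one>\<^bsub>G\<^esub>" c s] monoid_algebra_mult_unit[of G c s 1 "\<one>\<^bsub>G\<^esub>"] by (simp add: one)
  next
    case (add f f')
    then show ?case by (simp add: monoid_algebra_mult_add_left monoid_algebra_mult_add_right)
  qed simp
  have zero: "(\<lambda>_. 0) \<in> carrier ?T" by (simp add: monoid_algebra_carrier supp_def)
  show ?thesis
  proof (intro kalg.intro kalg_axioms.intro kvs.intro kvs_axioms.intro ringI)
    show "abelian_group ?T"
    proof (rule abelian_groupI, goal_cases)
      case (6 x)
      then show ?case using smult[of x "-1"] by (intro bexI[of _ "\<lambda>i. -1 * x i"]) (auto simp: fun_eq_iff)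
    qed (use add zero in \<open>auto simp: algebra_simps\<close>)
    then show "abelian_group ?T" .
    show "Group.monoid ?T"
    proof (rule monoidI)
      show "\<one>\<^bsub>?T\<^esub> \<in> carrier ?T" by (simp add: monoid_algebra_carrier)
    qed (use closed assoc lone in auto)
  qed (auto simp: smult monoid_algebra_mult_add_left monoid_algebra_mult_add_right monoid_algebra_mult_smult fin algebra_simps)
qed

lemma op_alg_simps [simp]:
  "carrier (op_alg A) = carrier A" "one (op_alg A) = one A" "zero (op_alg A) = zero A"
  "add (op_alg A) = add A" "smult (op_alg A) = smult A" "x \<otimes>\<^bsub>op_alg A\<^esub> y = y \<otimes>\<^bsub>A\<^esub> x"
  by (simp_all add: op_alg_def)

abbreviation pair_algebra :: "('k::field, 'a) module \<Rightarrow> ('k, 'a \<times> 'a \<Rightarrow> 'k) module" where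
  "pair_algebra A \<equiv> monoid_algebra (A \<times>\<times> op_alg A)"

abbreviation tensor_ideal :: "('k::field, 'a) module \<Rightarrow> ('a \<times> 'a \<Rightarrow> 'k) set" where
  "tensor_ideal A \<equiv> genideal (pair_algebra A) (tensor_relations A (op_alg A))"

definition pure_tensor :: "('k::field, 'a) module \<Rightarrow> 'a \<Rightarrow> 'a \<Rightarrow> ('a \<times> 'a \<Rightarrow> 'k) set" where
  "pure_tensor A a b = tensor_ideal A +>\<^bsub>pair_algebra A\<^esub> unit_vec_at (a, b)"

lemma env_alg_quot: "env_alg A = quot_alg (pair_algebra A) (tensor_ideal A)"
  by (simp add: env_alg_def tensor_alg_def Let_def)

lemma tensor_relationsI:
  "a \<in> carrier A \<Longrightarrow> a' \<in> carrier A \<Longrightarrow> b \<in> carrier B \<Longrightarrow>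
    (\<lambda>x. unit_vec_at (a \<oplus>\<^bsub>A\<^esub> a', b) x - unit_vec_at (a, b) x - unit_vec_at (a', b) x) \<in> tensor_relations A B"
  "a \<in> carrier A \<Longrightarrow> b \<in> carrier B \<Longrightarrow> b' \<in> carrier B \<Longrightarrow>
    (\<lambda>x. unit_vec_at (a, b \<oplus>\<^bsub>B\<^esub> b') x - unit_vec_at (a, b) x - unit_vec_at (a, b') x) \<in> tensor_relations A B"
  "a \<in> carrier A \<Longrightarrow> b \<in> carrier B \<Longrightarrow>
    (\<lambda>x. unit_vec_at (c \<odot>\<^bsub>A\<^esub> a, b) x - c * unit_vec_at (a, b) x) \<in> tensor_relations A B"
  "a \<in> carrier A \<Longrightarrow> b \<in> carrier B \<Longrightarrow>
    (\<lambda>x. unit_vec_at (a, c \<odot>\<^bsub>B\<^esub> b) x - c * unit_vec_at (a, b) x) \<in> tensor_relations A B"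
  unfolding tensor_relations_def
  subgoal by (rule UnI1, rule UnI1, rule UnI1, rule CollectI, intro exI conjI, rule refl)
  subgoal by (rule UnI1, rule UnI1, rule UnI2, rule CollectI, intro exI conjI, rule refl)
  subgoal by (rule UnI1, rule UnI2, rule CollectI, intro exI conjI, rule refl)
  subgoal by (rule UnI2, rule CollectI, intro exI conjI, rule refl)
  done

context kalg begin

lemma pair_monoid: "Group.monoid (A \<times>\<times> op_alg A)"
proof (rule DirProd_monoid)
  show "Group.monoid (op_alg A)" by (rule monoidI) (auto simp: m_assoc)
qed (rule monoid_axioms)

lemma pair_kalg: "kalg (pair_algebra A)"
  by (rule monoid_algebra_kalg[OF pair_monoid])

lemma pair_carrier: "f \<in> carrier (pair_algebra A) \<longleftrightarrow> finite (supp f) \<and> supp f \<subseteq> carrier A \<times> carrier A"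
  by (simp add: monoid_algebra_carrier)

lemma tensor_relations_subset: "tensor_relations A (op_alg A) \<subseteq> carrier (pair_algebra A)"
proof -
  have *: "f \<in> carrier (pair_algebra A)"
    if "finite S" "S \<subseteq> carrier A \<times> carrier A" "\<And>x. x \<notin> S \<Longrightarrow> f x = 0" for f S
  proof -
    have "supp f \<subseteq> S" using that by (auto simp: supp_def)
    then show ?thesis unfolding pair_carrier using that finite_subset by blast
  qed
  show ?thesis
    unfolding tensor_relations_def
  proof (intro Un_least subsetI; elim CollectE exE conjE; clarify)
    fix a a' b assume "a \<in> carrier A" "a' \<in> carrier A" "b \<in> carrier (op_alg A)"
    then show "(\<lambda>x. unit_vec_at (a \<oplus> a', b) x - unit_vec_at (a, b) x - unit_vec_at (a', b) x) \<in> carrier (pair_algebra A)"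
      by (intro *[of "{(a \<oplus> a', b), (a, b), (a', b)}"]) (auto simp: unit_vec_at_def)
  next
    fix a b b' assume "a \<in> carrier A" "b \<in> carrier (op_alg A)" "b' \<in> carrier (op_alg A)"
    then show "(\<lambda>x. unit_vec_at (a, b \<oplus>\<^bsub>op_alg A\<^esub> b') x - unit_vec_at (a, b) x - unit_vec_at (a, b') x) \<in> carrier (pair_algebra A)"
      by (intro *[of "{(a, b \<oplus> b'), (a, b), (a, b')}"]) (auto simp: unit_vec_at_def)
  next
    fix c a b assume "a \<in> carrier A" "b \<in> carrier (op_alg A)"
    then show "(\<lambda>x. unit_vec_at (c \<odot> a, b) x - c * unit_vec_at (a, b) x) \<in> carrier (pair_algebra A)"
      by (intro *[of "{(c \<odot> a, b), (a, b)}"]) (auto simp: unit_vec_at_def)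
  next
    fix c a b assume "a \<in> carrier A" "b \<in> carrier (op_alg A)"
    then show "(\<lambda>x. unit_vec_at (a, c \<odot>\<^bsub>op_alg A\<^esub> b) x - c * unit_vec_at (a, b) x) \<in> carrier (pair_algebra A)"
      by (intro *[of "{(a, c \<odot> b), (a, b)}"]) (auto simp: unit_vec_at_def)
  qed
qed

lemma tensor_ideal: "ideal (tensor_ideal A) (pair_algebra A)"
proof -
  interpret T: kalg "pair_algebra A" by (rule pair_kalg)
  show ?thesis by (rule T.genideal_ideal[OF tensor_relations_subset])
qed

lemma env_kalg: "kalg (env_alg A)"
  unfolding env_alg_quot by (rule kalg_quot(1)[OF pair_kalg tensor_ideal])

end

sublocale kalg \<subseteq> env: kquot "pair_algebra A" "tensor_ideal A"
  by (rule kalg_quot(2)[OF pair_kalg tensor_ideal])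

context kalg begin

lemma pair_minus:
  assumes "f \<in> carrier (pair_algebra A)" "g \<in> carrier (pair_algebra A)"
  shows "f \<ominus>\<^bsub>pair_algebra A\<^esub> g = (\<lambda>x. f x - g x)"
proof -
  interpret T: kalg "pair_algebra A" by (rule pair_kalg)
  have "(- 1) \<odot>\<^bsub>pair_algebra A\<^esub> g = \<ominus>\<^bsub>pair_algebra A\<^esub> g"
    using env.ks_neg[OF assms(2), of 1] env.ks_one[OF assms(2)] by simp
  then have "\<ominus>\<^bsub>pair_algebra A\<^esub> g = (\<lambda>x. - g x)" by simp
  then show ?thesis by (simp add: env.minus_eq)
qed

lemma unit_vec_pair_closed [simp, intro]:
  "a \<in> carrier A \<Longrightarrow> b \<in> carrier A \<Longrightarrow> unit_vec_at (a, b) \<in> carrier (pair_algebra A)"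
  by (simp add: pair_carrier)

lemma env_simps:
  "carrier (env_alg A) = a_rcosets\<^bsub>pair_algebra A\<^esub> (tensor_ideal A)"
  "zero (env_alg A) = tensor_ideal A"
  "one (env_alg A) = pure_tensor A \<one> \<one>"
  by (simp_all add: env_alg_quot pure_tensor_def)

lemma pure_tensor_closed [simp, intro]:
  "a \<in> carrier A \<Longrightarrow> b \<in> carrier A \<Longrightarrow> pure_tensor A a b \<in> carrier (env_alg A)"
  unfolding env_simps pure_tensor_def by (rule env.a_rcosetsI[OF env.W_subset]) simp

lemma pure_tensor_add_left:
  assumes "a \<in> carrier A" "a' \<in> carrier A" "b \<in> carrier A"
  shows "pure_tensor A (a \<oplus> a') b = pure_tensor A a b \<oplus>\<^bsub>env_alg A\<^esub> pure_tensor A a' b"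
proof -
  interpret T: kalg "pair_algebra A" by (rule pair_kalg)
  let ?u = "unit_vec_at (a, b) \<oplus>\<^bsub>pair_algebra A\<^esub> unit_vec_at (a', b)"
  have u: "?u \<in> carrier (pair_algebra A)" using assms by (intro env.a_closed) auto
  have "unit_vec_at (a \<oplus> a', b) \<ominus>\<^bsub>pair_algebra A\<^esub> ?u \<in> tensor_relations A (op_alg A)"
    using assms tensor_relationsI(1)[of a A a' b "op_alg A"] by (subst pair_minus[OF _ u]) (simp_all add: diff_diff_eq)
  then have "unit_vec_at (a \<oplus> a', b) \<ominus>\<^bsub>pair_algebra A\<^esub> ?u \<in> tensor_ideal A"
    using T.genideal_self[OF tensor_relations_subset] by auto
  then have "pure_tensor A (a \<oplus> a') b = tensor_ideal A +>\<^bsub>pair_algebra A\<^esub> ?u"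
    unfolding pure_tensor_def using assms u by (subst env.coset_eq_iff) auto
  also have "\<dots> = pure_tensor A a b \<oplus>\<^bsub>env_alg A\<^esub> pure_tensor A a' b"
    unfolding pure_tensor_def env_alg_quot quot_alg_simps using assms by (subst env.W.a_rcos_sum) auto
  finally show ?thesis .
qed

lemma pure_tensor_add_right:
  assumes "a \<in> carrier A" "b \<in> carrier A" "b' \<in> carrier A"
  shows "pure_tensor A a (b \<oplus> b') = pure_tensor A a b \<oplus>\<^bsub>env_alg A\<^esub> pure_tensor A a b'"
proof -
  interpret T: kalg "pair_algebra A" by (rule pair_kalg)
  let ?u = "unit_vec_at (a, b) \<oplus>\<^bsub>pair_algebra A\<^esub> unit_vec_at (a, b')"
  have u: "?u \<in> carrier (pair_algebra A)" using assms by (intro env.a_closed) auto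
  have "unit_vec_at (a, b \<oplus> b') \<ominus>\<^bsub>pair_algebra A\<^esub> ?u \<in> tensor_relations A (op_alg A)"
    using assms tensor_relationsI(2)[of a A b "op_alg A" b'] by (subst pair_minus[OF _ u]) (simp_all add: diff_diff_eq)
  then have "unit_vec_at (a, b \<oplus> b') \<ominus>\<^bsub>pair_algebra A\<^esub> ?u \<in> tensor_ideal A"
    using T.genideal_self[OF tensor_relations_subset] by auto
  then have "pure_tensor A a (b \<oplus> b') = tensor_ideal A +>\<^bsub>pair_algebra A\<^esub> ?u"
    unfolding pure_tensor_def using assms u by (subst env.coset_eq_iff) auto
  also have "\<dots> = pure_tensor A a b \<oplus>\<^bsub>env_alg A\<^esub> pure_tensor A a b'"
    unfolding pure_tensor_def env_alg_quot quot_alg_simps using assms by (subst env.W.a_rcos_sum) auto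
  finally show ?thesis .
qed

lemma pure_tensor_coset_smult:
  assumes "a \<in> carrier A" "b \<in> carrier A"
  shows "tensor_ideal A +>\<^bsub>pair_algebra A\<^esub> (\<lambda>x. c * unit_vec_at (a, b) x) = c \<odot>\<^bsub>env_alg A\<^esub> pure_tensor A a b"
  unfolding pure_tensor_def env_alg_quot using env.quot_smult[of "unit_vec_at (a, b)" c] assms by simp

lemma pure_tensor_smult:
  assumes "a \<in> carrier A" "b \<in> carrier A"
  shows "pure_tensor A (c \<odot> a) b = c \<odot>\<^bsub>env_alg A\<^esub> pure_tensor A a b"
    "pure_tensor A a (c \<odot> b) = c \<odot>\<^bsub>env_alg A\<^esub> pure_tensor A a b"
proof -
  interpret T: kalg "pair_algebra A" by (rule pair_kalg)
  let ?u = "c \<odot>\<^bsub>pair_algebra A\<^esub> unit_vec_at (a, b)"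
  have u: "?u \<in> carrier (pair_algebra A)" using assms by (intro env.ks_closed) auto
  have *: "tensor_ideal A +>\<^bsub>pair_algebra A\<^esub> f = c \<odot>\<^bsub>env_alg A\<^esub> pure_tensor A a b"
    if f: "f \<in> carrier (pair_algebra A)" and "f \<ominus>\<^bsub>pair_algebra A\<^esub> ?u \<in> tensor_relations A (op_alg A)" for f
  proof -
    have "f \<ominus>\<^bsub>pair_algebra A\<^esub> ?u \<in> tensor_ideal A"
      using T.genideal_self[OF tensor_relations_subset] that by auto
    then have "tensor_ideal A +>\<^bsub>pair_algebra A\<^esub> f = tensor_ideal A +>\<^bsub>pair_algebra A\<^esub> ?u"
      using assms u f by (subst env.coset_eq_iff) auto
    then show ?thesis using pure_tensor_coset_smult[OF assms] by simp
  qed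
  have "unit_vec_at (c \<odot> a, b) \<ominus>\<^bsub>pair_algebra A\<^esub> ?u \<in> tensor_relations A (op_alg A)"
    using assms tensor_relationsI(3)[of a A b "op_alg A" c] by (subst pair_minus[OF _ u]) simp_all
  from *[OF _ this] show "pure_tensor A (c \<odot> a) b = c \<odot>\<^bsub>env_alg A\<^esub> pure_tensor A a b"
    using assms by (simp add: pure_tensor_def)
  have "unit_vec_at (a, c \<odot> b) \<ominus>\<^bsub>pair_algebra A\<^esub> ?u \<in> tensor_relations A (op_alg A)"
    using assms tensor_relationsI(4)[of a A b "op_alg A" c] by (subst pair_minus[OF _ u]) simp_all
  from *[OF _ this] show "pure_tensor A a (c \<odot> b) = c \<odot>\<^bsub>env_alg A\<^esub> pure_tensor A a b"
    using assms by (simp add: pure_tensor_def)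
qed

lemma pure_tensor_mult:
  assumes "a \<in> carrier A" "b \<in> carrier A" "a' \<in> carrier A" "b' \<in> carrier A"
  shows "pure_tensor A a b \<otimes>\<^bsub>env_alg A\<^esub> pure_tensor A a' b' = pure_tensor A (a \<otimes> a') (b' \<otimes> b)"
  using ideal.rcoset_mult_add[OF tensor_ideal, of "unit_vec_at (a, b)" "unit_vec_at (a', b')"]
    monoid_algebra_mult_unit[of "A \<times>\<times> op_alg A" "1::'k" "(a, b)" 1 "(a', b')"] assms
  by (simp add: pure_tensor_def env_alg_quot)

text \<open>Every class is a sum of pure tensors. Scalars have no case of their own because a
  multiple of a pure tensor is pure: \<open>c\<close> is absorbed into the left factor.\<close>

lemma env_induct [consumes 1, case_names pure add]:
  assumes X: "X \<in> carrier (env_alg A)"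
    and pure: "\<And>a b. a \<in> carrier A \<Longrightarrow> b \<in> carrier A \<Longrightarrow> P (pure_tensor A a b)"
    and add: "\<And>X Y. X \<in> carrier (env_alg A) \<Longrightarrow> Y \<in> carrier (env_alg A) \<Longrightarrow> P X \<Longrightarrow> P Y \<Longrightarrow> P (X \<oplus>\<^bsub>env_alg A\<^esub> Y)"
  shows "P X"
proof -
  interpret E: kalg "env_alg A" by (rule env_kalg)
  obtain f where f: "f \<in> carrier (pair_algebra A)" "X = tensor_ideal A +>\<^bsub>pair_algebra A\<^esub> f"
    using X env.rcosetsE[of X] unfolding env_simps by auto
  have "finite (supp f)" "supp f \<subseteq> carrier A \<times> carrier A" using f by (auto simp: pair_carrier)
  then have "P (tensor_ideal A +>\<^bsub>pair_algebra A\<^esub> f)"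
  proof (induct f rule: fun_supp_induct)
    case zero
    \<comment> \<open>The zero class is obtained as a pure tensor, so the empty sum is covered by
      the case \<open>pure\<close>.\<close>
    have "pure_tensor A \<zero> \<zero> = 0 \<odot>\<^bsub>env_alg A\<^esub> pure_tensor A \<zero> \<zero>"
      using pure_tensor_smult(1)[of \<zero> \<zero> 0] by simp
    also have "\<dots> = tensor_ideal A" using env_simps(2) by simp
    finally have "P (tensor_ideal A)" using pure[of \<zero> \<zero>] by simp
    then show ?case using env.coset_zero_iff[of "\<lambda>_. 0"] env.W_zero env.W_subset by auto
  next
    case (unit c s)
    then obtain a b where s: "s = (a, b)" "a \<in> carrier A" "b \<in> carrier A" by auto
    then show ?case using pure[of "c \<odot> a" b] by (simp add: pure_tensor_coset_smult pure_tensor_smult)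
  next
    case (add f g)
    then have fg: "f \<in> carrier (pair_algebra A)" "g \<in> carrier (pair_algebra A)" by (simp_all add: pair_carrier)
    have "P ((tensor_ideal A +>\<^bsub>pair_algebra A\<^esub> f) \<oplus>\<^bsub>env_alg A\<^esub> (tensor_ideal A +>\<^bsub>pair_algebra A\<^esub> g))"
      using add fg env.a_rcosetsI[OF env.W_subset] by (intro assms(3)) (auto simp: env_simps)
    then show ?case using env.W.a_rcos_sum[OF fg] by (simp add: env_alg_quot)
  qed
  with f show ?thesis by simp
qed

end

section \<open>Bimodules as modules over the enveloping algebra\<close>

text \<open>The shape of \<open>bimod\<close> with an arbitrary two-sided action in place of
  multiplication in \<open>A\<close>; the terms of the bar resolution are further instances. As
  there, \<open>the_elem\<close> picks the common value over all representatives of a class.\<close>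

definition env_module :: "('k::field, 'a) module \<Rightarrow> ('k, 'n) module \<Rightarrow> ('a \<Rightarrow> 'a \<Rightarrow> 'n \<Rightarrow> 'n) \<Rightarrow>
    (('a \<times> 'a \<Rightarrow> 'k) set, 'n) module" where
  "env_module A N act =
    \<lparr>carrier = carrier N, mult = undefined, one = undefined, zero = \<zero>\<^bsub>N\<^esub>, add = add N,
     smult = (\<lambda>X x. the_elem
       ((\<lambda>f. \<Oplus>\<^bsub>N\<^esub>s\<in>supp f. f s \<odot>\<^bsub>N\<^esub> act (fst s) (snd s) x) ` X))\<rparr>"

lemma bimod_env_module: "bimod A = env_module A A (\<lambda>a b x. a \<otimes>\<^bsub>A\<^esub> x \<otimes>\<^bsub>A\<^esub> b)"
  by (simp add: bimod_def env_module_def)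

lemma env_module_simps [simp]:
  "carrier (env_module A N act) = carrier N" "zero (env_module A N act) = zero N" "add (env_module A N act) = add N"
  by (simp_all add: env_module_def)

locale kbimod = A: kalg A + N: kvs N for A :: "('k::field, 'a) module" and N :: "('k, 'n) module" +
  fixes act :: "'a \<Rightarrow> 'a \<Rightarrow> 'n \<Rightarrow> 'n"
  assumes act_closed [simp]: "a \<in> carrier A \<Longrightarrow> b \<in> carrier A \<Longrightarrow> x \<in> carrier N \<Longrightarrow> act a b x \<in> carrier N"
    and act_add: "a \<in> carrier A \<Longrightarrow> b \<in> carrier A \<Longrightarrow> x \<in> carrier N \<Longrightarrow> y \<in> carrier N \<Longrightarrow>
      act a b (x \<oplus>\<^bsub>N\<^esub> y) = act a b x \<oplus>\<^bsub>N\<^esub> act a b y"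
    and act_ks: "a \<in> carrier A \<Longrightarrow> b \<in> carrier A \<Longrightarrow> x \<in> carrier N \<Longrightarrow> act a b (c \<odot>\<^bsub>N\<^esub> x) = c \<odot>\<^bsub>N\<^esub> act a b x"
    and act_add_left: "a \<in> carrier A \<Longrightarrow> a' \<in> carrier A \<Longrightarrow> b \<in> carrier A \<Longrightarrow> x \<in> carrier N \<Longrightarrow>
      act (a \<oplus>\<^bsub>A\<^esub> a') b x = act a b x \<oplus>\<^bsub>N\<^esub> act a' b x"
    and act_add_right: "a \<in> carrier A \<Longrightarrow> b \<in> carrier A \<Longrightarrow> b' \<in> carrier A \<Longrightarrow> x \<in> carrier N \<Longrightarrow>
      act a (b \<oplus>\<^bsub>A\<^esub> b') x = act a b x \<oplus>\<^bsub>N\<^esub> act a b' x"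
    and act_ks_left: "a \<in> carrier A \<Longrightarrow> b \<in> carrier A \<Longrightarrow> x \<in> carrier N \<Longrightarrow> act (c \<odot>\<^bsub>A\<^esub> a) b x = c \<odot>\<^bsub>N\<^esub> act a b x"
    and act_ks_right: "a \<in> carrier A \<Longrightarrow> b \<in> carrier A \<Longrightarrow> x \<in> carrier N \<Longrightarrow> act a (c \<odot>\<^bsub>A\<^esub> b) x = c \<odot>\<^bsub>N\<^esub> act a b x"
    and act_one: "x \<in> carrier N \<Longrightarrow> act \<one>\<^bsub>A\<^esub> \<one>\<^bsub>A\<^esub> x = x"
    and act_mult: "a \<in> carrier A \<Longrightarrow> b \<in> carrier A \<Longrightarrow> a' \<in> carrier A \<Longrightarrow> b' \<in> carrier A \<Longrightarrow> x \<in> carrier N \<Longrightarrow>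
      act (a \<otimes>\<^bsub>A\<^esub> a') (b' \<otimes>\<^bsub>A\<^esub> b) x = act a b (act a' b' x)"
begin

text \<open>The action of the free space on pairs, before the tensor relations are divided
  out.\<close>

definition rho :: "('a \<times> 'a \<Rightarrow> 'k) \<Rightarrow> 'n \<Rightarrow> 'n" where
  "rho f x = (\<Oplus>\<^bsub>N\<^esub>s\<in>supp f. f s \<odot>\<^bsub>N\<^esub> act (fst s) (snd s) x)"

lemma rho_superset:
  assumes "finite S" "supp f \<subseteq> S" "S \<subseteq> carrier A \<times> carrier A" "x \<in> carrier N"
  shows "rho f x = (\<Oplus>\<^bsub>N\<^esub>s\<in>S. f s \<odot>\<^bsub>N\<^esub> act (fst s) (snd s) x)"
  unfolding rho_def using assms by (intro N.lin_comb_superset) auto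

lemma rho_closed [simp]: "f \<in> carrier (pair_algebra A) \<Longrightarrow> x \<in> carrier N \<Longrightarrow> rho f x \<in> carrier N"
  unfolding rho_def A.pair_carrier by (intro N.finsum_closed) auto

lemma rho_add:
  assumes "f \<in> carrier (pair_algebra A)" "g \<in> carrier (pair_algebra A)" "x \<in> carrier N"
  shows "rho (\<lambda>s. f s + g s) x = rho f x \<oplus>\<^bsub>N\<^esub> rho g x"
proof -
  let ?S = "supp f \<union> supp g"
  have S: "finite ?S" "?S \<subseteq> carrier A \<times> carrier A" using assms by (auto simp: A.pair_carrier)
  note r = rho_superset[OF S(1) _ S(2) assms(3)]
  have "(\<lambda>s. act (fst s) (snd s) x) \<in> ?S \<rightarrow> carrier N" using S assms by auto
  from N.lin_comb_add[OF this] show ?thesis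
    unfolding r[OF supp_add_subset] r[OF Un_upper1] r[OF Un_upper2] .
qed

lemma rho_smult:
  assumes "f \<in> carrier (pair_algebra A)" "x \<in> carrier N"
  shows "rho (\<lambda>s. c * f s) x = c \<odot>\<^bsub>N\<^esub> rho f x"
proof -
  let ?S = "supp f"
  have S: "finite ?S" "?S \<subseteq> carrier A \<times> carrier A" using assms by (auto simp: A.pair_carrier)
  note r = rho_superset[OF S(1) _ S(2) assms(2)]
  have "(\<lambda>s. act (fst s) (snd s) x) \<in> ?S \<rightarrow> carrier N" using S assms by auto
  from N.lin_comb_smult[OF this] show ?thesis
    unfolding r[OF supp_smult_subset] r[OF order_refl] .
qed

lemma rho_unit:
  assumes "a \<in> carrier A" "b \<in> carrier A" "x \<in> carrier N"
  shows "rho (unit_vec_at (a, b)) x = act a b x"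
  using assms by (simp add: rho_def) (simp add: unit_vec_at_def)

lemma rho_zero [simp]: "rho (\<lambda>_. 0) x = \<zero>\<^bsub>N\<^esub>"
  by (simp add: rho_def supp_def)

lemma rho_add_right:
  assumes "f \<in> carrier (pair_algebra A)" "x \<in> carrier N" "y \<in> carrier N"
  shows "rho f (x \<oplus>\<^bsub>N\<^esub> y) = rho f x \<oplus>\<^bsub>N\<^esub> rho f y"
proof -
  have S: "supp f \<subseteq> carrier A \<times> carrier A" using assms by (auto simp: A.pair_carrier)
  have "rho f (x \<oplus>\<^bsub>N\<^esub> y) = (\<Oplus>\<^bsub>N\<^esub>s\<in>supp f. f s \<odot>\<^bsub>N\<^esub> act (fst s) (snd s) x \<oplus>\<^bsub>N\<^esub> f s \<odot>\<^bsub>N\<^esub> act (fst s) (snd s) y)"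
    unfolding rho_def using S assms
    by (intro N.finsum_cong') (auto simp: act_add N.ks_r_distr mem_Times_iff subset_iff)
  also have "\<dots> = rho f x \<oplus>\<^bsub>N\<^esub> rho f y"
    unfolding rho_def using S assms by (intro N.finsum_addf) (auto simp: mem_Times_iff subset_iff)
  finally show ?thesis .
qed

lemma rho_smult_right:
  assumes "f \<in> carrier (pair_algebra A)" "x \<in> carrier N"
  shows "rho f (c \<odot>\<^bsub>N\<^esub> x) = c \<odot>\<^bsub>N\<^esub> rho f x"
proof -
  have S: "supp f \<subseteq> carrier A \<times> carrier A" using assms by (auto simp: A.pair_carrier)
  have "rho f (c \<odot>\<^bsub>N\<^esub> x) = (\<Oplus>\<^bsub>N\<^esub>s\<in>supp f. c \<odot>\<^bsub>N\<^esub> (f s \<odot>\<^bsub>N\<^esub> act (fst s) (snd s) x))"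
    unfolding rho_def using S assms
    by (intro N.finsum_cong') (auto simp: act_ks N.ks_assoc[symmetric] mult.commute mem_Times_iff subset_iff)
  also have "\<dots> = c \<odot>\<^bsub>N\<^esub> rho f x"
    unfolding rho_def using S assms by (intro N.ks_finsum[symmetric]) (auto simp: mem_Times_iff subset_iff)
  finally show ?thesis .
qed

lemma rho_zero_right: "f \<in> carrier (pair_algebra A) \<Longrightarrow> rho f \<zero>\<^bsub>N\<^esub> = \<zero>\<^bsub>N\<^esub>"
  using rho_smult_right[of f "\<zero>\<^bsub>N\<^esub>" 0] by simp

lemma rho_mult:
  assumes f: "f \<in> carrier (pair_algebra A)" and g: "g \<in> carrier (pair_algebra A)" and x: "x \<in> carrier N"
  shows "rho (f \<otimes>\<^bsub>pair_algebra A\<^esub> g) x = rho f (rho g x)"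
proof -
  interpret T: kalg "pair_algebra A" by (rule A.pair_kalg)
  have carI: "f \<in> carrier (pair_algebra A)" if "finite (supp f)" "supp f \<subseteq> carrier A \<times> carrier A" for f :: "'a \<times> 'a \<Rightarrow> 'k"
    using that by (simp add: A.pair_carrier)
  have unitc: "(\<lambda>x. c * unit_vec_at s x) \<in> carrier (pair_algebra A)" if "s \<in> carrier A \<times> carrier A" for c s
    using A.env.ks_closed[of "unit_vec_at s" c] that by auto
  have "finite (supp f)" "supp f \<subseteq> carrier A \<times> carrier A" using f by (auto simp: A.pair_carrier)
  then show ?thesis
  proof (induct f rule: fun_supp_induct)
    case (unit c s)
    note s = unit
    then obtain a b where ab: "s = (a, b)" "a \<in> carrier A" "b \<in> carrier A" by auto
    have "finite (supp g)" "supp g \<subseteq> carrier A \<times> carrier A" using g by (auto simp: A.pair_carrier)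
    then show ?case
    proof (induct g rule: fun_supp_induct)
      case (unit d t)
      then obtain a' b' where ab': "t = (a', b')" "a' \<in> carrier A" "b' \<in> carrier A" by auto
      show ?case using ab ab' x
        by (simp add: monoid_algebra_mult_unit rho_smult rho_unit act_mult act_ks N.ks_assoc[symmetric])
    next
      case (add g h)
      then show ?case
        using s x T.r_distr[of g h "\<lambda>x. c * unit_vec_at s x"] T.m_closed
        by (simp add: carI unitc rho_add rho_add_right)
    qed (use s x in \<open>simp add: rho_zero_right unitc\<close>)
  next
    case (add f h)
    then show ?case using g x T.l_distr[of f h g] T.m_closed
      by (simp add: carI rho_add)
  qed simp
qed

text \<open>The elements of \<open>pair_algebra A\<close> that annihilate \<open>N\<close> form a
  two-sided ideal, by \<open>rho_mult\<close>, and the relations lie in it because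
  \<open>act\<close> is bilinear. So it contains the ideal that they generate.\<close>

lemma rho_tensor_ideal:
  assumes "j \<in> tensor_ideal A" "x \<in> carrier N"
  shows "rho j x = \<zero>\<^bsub>N\<^esub>"
proof -
  interpret T: kalg "pair_algebra A" by (rule A.pair_kalg)
  let ?I = "{f \<in> carrier (pair_algebra A). \<forall>x\<in>carrier N. rho f x = \<zero>\<^bsub>N\<^esub>}"
  have "ideal ?I (pair_algebra A)"
  proof (rule idealI)
    show "ring (pair_algebra A)" by (rule T.ring_axioms)
    show "subgroup ?I (add_monoid (pair_algebra A))"
    proof (rule A.env.add.subgroupI)
      show "?I \<noteq> {}" using A.env.zero_closed by auto
      fix f assume f: "f \<in> ?I"
      have "\<ominus>\<^bsub>pair_algebra A\<^esub> f = (\<lambda>x. -1 * f x)"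
        using A.env.ks_neg[of f 1] A.env.ks_one[of f] f by simp
      then show "\<ominus>\<^bsub>pair_algebra A\<^esub> f \<in> ?I"
        using f rho_smult[of f _ "-1"] A.env.a_inv_closed[of f] by simp
      fix g assume g: "g \<in> ?I"
      then show "f \<oplus>\<^bsub>pair_algebra A\<^esub> g \<in> ?I"
        using f rho_add[of f g] A.env.a_closed[of f g] by simp
    qed auto
    fix f g assume "f \<in> ?I" "g \<in> carrier (pair_algebra A)"
    then show "g \<otimes>\<^bsub>pair_algebra A\<^esub> f \<in> ?I" "f \<otimes>\<^bsub>pair_algebra A\<^esub> g \<in> ?I"
      by (auto simp: rho_mult T.m_closed rho_zero_right)
  qed
  moreover have "tensor_relations A (op_alg A) \<subseteq> ?I"
  proof
    fix f assume f: "f \<in> tensor_relations A (op_alg A)"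
    have minus: "rho (\<lambda>s. u s - c * v s) x = rho u x \<ominus>\<^bsub>N\<^esub> c \<odot>\<^bsub>N\<^esub> rho v x"
      if "u \<in> carrier (pair_algebra A)" "v \<in> carrier (pair_algebra A)" "x \<in> carrier N" for u v x c
    proof -
      have "(\<lambda>s. u s - c * v s) = (\<lambda>s. u s + (- c) * v s)" by simp
      then have "rho (\<lambda>s. u s - c * v s) x = rho u x \<oplus>\<^bsub>N\<^esub> rho (\<lambda>s. (- c) * v s) x"
        using rho_add[OF that(1) A.env.ks_closed[OF that(2), of "- c", simplified monoid_algebra_simps] that(3)] by simp
      then show ?thesis
        using that rho_smult[OF that(2,3), of "- c"] by (simp add: N.ks_neg N.minus_eq)
    qed
    have minus1: "rho (\<lambda>s. u s - v s) x = rho u x \<ominus>\<^bsub>N\<^esub> rho v x"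
      if "u \<in> carrier (pair_algebra A)" "v \<in> carrier (pair_algebra A)" "x \<in> carrier N" for u v x
      using minus[OF that, of 1] that by simp
    have minusc: "(\<lambda>s. u s - v s) \<in> carrier (pair_algebra A)"
      if "u \<in> carrier (pair_algebra A)" "v \<in> carrier (pair_algebra A)" for u v
      using A.pair_minus[OF that] A.env.minus_closed[OF that] by simp
    have "rho f x = \<zero>\<^bsub>N\<^esub>" if x: "x \<in> carrier N" for x
      using f[unfolded tensor_relations_def]
    proof (elim UnE CollectE exE conjE)
      fix a a' b assume ab: "f = (\<lambda>x. unit_vec_at (a \<oplus>\<^bsub>A\<^esub> a', b) x - unit_vec_at (a, b) x - unit_vec_at (a', b) x)"
        "a \<in> carrier A" "a' \<in> carrier A" "b \<in> carrier (op_alg A)"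
      then show ?thesis using x unfolding ab(1)
        by (subst minus1) (auto simp: minus1 minusc rho_unit act_add_left N.minus_eq N.minus_add N.a_ac N.r_neg
            N.r_neg1)
    next
      fix a b b' assume ab: "f = (\<lambda>x. unit_vec_at (a, b \<oplus>\<^bsub>op_alg A\<^esub> b') x - unit_vec_at (a, b) x - unit_vec_at (a, b') x)"
        "a \<in> carrier A" "b \<in> carrier (op_alg A)" "b' \<in> carrier (op_alg A)"
      then show ?thesis using x unfolding ab(1)
        by (subst minus1) (auto simp: minus1 minusc rho_unit act_add_right N.minus_eq N.minus_add N.a_ac N.r_neg
            N.r_neg1)
    next
      fix c a b assume ab: "f = (\<lambda>x. unit_vec_at (c \<odot>\<^bsub>A\<^esub> a, b) x - c * unit_vec_at (a, b) x)"
        "a \<in> carrier A" "b \<in> carrier (op_alg A)"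
      then show ?thesis using x unfolding ab(1)
        by (subst minus) (auto simp: rho_unit act_ks_left N.minus_eq N.r_neg)
    next
      fix c a b assume ab: "f = (\<lambda>x. unit_vec_at (a, c \<odot>\<^bsub>op_alg A\<^esub> b) x - c * unit_vec_at (a, b) x)"
        "a \<in> carrier A" "b \<in> carrier (op_alg A)"
      then show ?thesis using x unfolding ab(1)
        by (subst minus) (auto simp: rho_unit act_ks_right N.minus_eq N.r_neg)
    qed
    then show "f \<in> ?I" using A.tensor_relations_subset f by auto
  qed
  ultimately have "tensor_ideal A \<subseteq> ?I" by (rule T.genideal_minimal)
  with assms show ?thesis by auto
qed

text \<open>Since \<open>rho\<close> kills the tensor ideal, it is constant on a coset, and the set
  to which \<open>the_elem\<close> is applied is a singleton.\<close>

lemma env_module_coset: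
  assumes f: "f \<in> carrier (pair_algebra A)" and x: "x \<in> carrier N"
  shows "(tensor_ideal A +>\<^bsub>pair_algebra A\<^esub> f) \<odot>\<^bsub>env_module A N act\<^esub> x = rho f x"
proof -
  let ?X = "tensor_ideal A +>\<^bsub>pair_algebra A\<^esub> f"
  have eq: "rho g x = rho f x" if g: "g \<in> ?X" for g
  proof -
    from g obtain j where j: "j \<in> tensor_ideal A" "g = (\<lambda>x. j x + f x)"
      unfolding a_r_coset_def' by auto
    then show ?thesis using rho_add[of j f x] rho_tensor_ideal[OF j(1) x] f x A.env.W_subset by auto
  qed
  have "f \<in> ?X" using A.env.W.a_rcos_self[OF f] .
  then have "(\<lambda>g. rho f x) ` ?X = {rho f x}" by (rule image_constant)
  then have "(\<lambda>g. rho g x) ` ?X = {rho f x}" by (subst image_cong[OF refl eq]) simp_all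
  then show ?thesis by (simp add: env_module_def rho_def)
qed

lemma env_module_pure:
  assumes "a \<in> carrier A" "b \<in> carrier A" "x \<in> carrier N"
  shows "pure_tensor A a b \<odot>\<^bsub>env_module A N act\<^esub> x = act a b x"
  unfolding pure_tensor_def using assms by (simp add: env_module_coset rho_unit)

lemma left_module_env_module: "left_module (env_alg A) (env_module A N act)"
proof -
  interpret T: kalg "pair_algebra A" by (rule A.pair_kalg)
  interpret E: kalg "env_alg A" by (rule A.env_kalg)
  let ?M = "env_module A N act"
  have "abelian_group ?M"
    by (rule abelian_groupI) (use N.add.l_inv_ex in \<open>auto simp: N.a_ac\<close>)
  moreover have rep: "\<exists>f\<in>carrier (pair_algebra A). X = tensor_ideal A +>\<^bsub>pair_algebra A\<^esub> f"
    if "X \<in> carrier (env_alg A)" for X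
    using that A.env.rcosetsE[of X] unfolding A.env_simps by auto
  have "left_module_axioms (env_alg A) ?M"
  proof unfold_locales
    fix X x assume X: "X \<in> carrier (env_alg A)" and x: "x \<in> carrier ?M"
    from rep[OF X] obtain f where f: "f \<in> carrier (pair_algebra A)" "X = tensor_ideal A +>\<^bsub>pair_algebra A\<^esub> f" ..
    show "X \<odot>\<^bsub>?M\<^esub> x \<in> carrier ?M" using f x by (simp add: env_module_coset)
    fix y assume "y \<in> carrier ?M"
    with f x show "X \<odot>\<^bsub>?M\<^esub> (x \<oplus>\<^bsub>?M\<^esub> y) = X \<odot>\<^bsub>?M\<^esub> x \<oplus>\<^bsub>?M\<^esub> X \<odot>\<^bsub>?M\<^esub> y"
      by (simp add: env_module_coset rho_add_right)
  next
    fix X Y x assume X: "X \<in> carrier (env_alg A)" and Y: "Y \<in> carrier (env_alg A)" and x: "x \<in> carrier ?M"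
    from rep[OF X] obtain f where f: "f \<in> carrier (pair_algebra A)" "X = tensor_ideal A +>\<^bsub>pair_algebra A\<^esub> f" ..
    from rep[OF Y] obtain g where g: "g \<in> carrier (pair_algebra A)" "Y = tensor_ideal A +>\<^bsub>pair_algebra A\<^esub> g" ..
    have "X \<oplus>\<^bsub>env_alg A\<^esub> Y = tensor_ideal A +>\<^bsub>pair_algebra A\<^esub> (\<lambda>x. f x + g x)"
      using A.env.W.a_rcos_sum[OF f(1) g(1)] f g by (simp add: env_alg_quot)
    then show "(X \<oplus>\<^bsub>env_alg A\<^esub> Y) \<odot>\<^bsub>?M\<^esub> x = X \<odot>\<^bsub>?M\<^esub> x \<oplus>\<^bsub>?M\<^esub> Y \<odot>\<^bsub>?M\<^esub> x"
      using f g x A.env.a_closed[OF f(1) g(1)] by (simp add: env_module_coset rho_add)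
    have "X \<otimes>\<^bsub>env_alg A\<^esub> Y = tensor_ideal A +>\<^bsub>pair_algebra A\<^esub> (f \<otimes>\<^bsub>pair_algebra A\<^esub> g)"
      using ideal.rcoset_mult_add[OF A.tensor_ideal f(1) g(1)] f g by (simp add: env_alg_quot)
    then show "(X \<otimes>\<^bsub>env_alg A\<^esub> Y) \<odot>\<^bsub>?M\<^esub> x = X \<odot>\<^bsub>?M\<^esub> (Y \<odot>\<^bsub>?M\<^esub> x)"
      using f g x T.m_closed[OF f(1) g(1)] by (simp add: env_module_coset rho_mult)
  next
    fix x assume "x \<in> carrier ?M"
    then show "\<one>\<^bsub>env_alg A\<^esub> \<odot>\<^bsub>?M\<^esub> x = x"
      by (simp add: A.env_simps env_module_pure act_one)
  qed
  ultimately show ?thesis by (intro left_module.intro) (auto intro: E.ring_axioms)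
qed

lemma env_module_central:
  assumes "x \<in> carrier N"
  shows "(c \<odot>\<^bsub>env_alg A\<^esub> \<one>\<^bsub>env_alg A\<^esub>) \<odot>\<^bsub>env_module A N act\<^esub> x = c \<odot>\<^bsub>N\<^esub> x"
  using assms
  by (simp add: A.env_simps env_module_pure act_one act_ks_left flip: A.pure_tensor_smult(1))

end

text \<open>Pure tensors generate the enveloping algebra additively, so an additive map need only be
  tested against them.\<close>

lemma (in kalg) module_hom_envI:
  assumes M: "left_module (env_alg A) M" and M': "left_module (env_alg A) M'"
    and F: "\<And>x. x \<in> carrier M \<Longrightarrow> F x \<in> carrier M'"
    and add: "\<And>x y. x \<in> carrier M \<Longrightarrow> y \<in> carrier M \<Longrightarrow> F (x \<oplus>\<^bsub>M\<^esub> y) = F x \<oplus>\<^bsub>M'\<^esub> F y"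
    and pure: "\<And>a b x. a \<in> carrier A \<Longrightarrow> b \<in> carrier A \<Longrightarrow> x \<in> carrier M \<Longrightarrow>
      F (pure_tensor A a b \<odot>\<^bsub>M\<^esub> x) = pure_tensor A a b \<odot>\<^bsub>M'\<^esub> F x"
  shows "F \<in> module_hom (env_alg A) M M'"
proof (rule module_homI)
  interpret M: left_module "env_alg A" M by fact
  interpret M': left_module "env_alg A" M' by fact
  fix X x assume "X \<in> carrier (env_alg A)" and x: "x \<in> carrier M"
  then show "F (X \<odot>\<^bsub>M\<^esub> x) = X \<odot>\<^bsub>M'\<^esub> F x"
  proof (induct X rule: env_induct)
    case (add X Y)
    then show ?case using x by (simp add: M.smult_l_distr M'.smult_l_distr F assms(4))
  qed (use x pure in simp)
qed (use F add in auto)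

lemma (in kalg) kbimod_self: "kbimod A A (\<lambda>a b x. a \<otimes> x \<otimes> b)"
  by unfold_locales
    (auto simp: l_distr r_distr ks_mult_left ks_mult_right m_assoc)

lemma (in kalg) left_module_bimod: "left_module (env_alg A) (bimod A)"
  unfolding bimod_env_module by (rule kbimod.left_module_env_module[OF kbimod_self])

section \<open>The bar complex of a based linear category\<close>

lemma sum_rotate4:
  "(\<Sum>x\<in>A. \<Sum>r\<in>B. \<Sum>p\<in>C. \<Sum>q\<in>D. F x r p q) = (\<Sum>p\<in>C. \<Sum>q\<in>D. \<Sum>r\<in>B. \<Sum>x\<in>A. F x r p q)"
proof -
  have "(\<Sum>x\<in>A. \<Sum>r\<in>B. \<Sum>p\<in>C. \<Sum>q\<in>D. F x r p q) = (\<Sum>x\<in>A. \<Sum>p\<in>C. \<Sum>r\<in>B. \<Sum>q\<in>D. F x r p q)"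
    by (intro sum.cong refl sum.swap)
  also have "\<dots> = (\<Sum>p\<in>C. \<Sum>x\<in>A. \<Sum>r\<in>B. \<Sum>q\<in>D. F x r p q)" by (rule sum.swap)
  also have "\<dots> = (\<Sum>p\<in>C. \<Sum>x\<in>A. \<Sum>q\<in>D. \<Sum>r\<in>B. F x r p q)" by (intro sum.cong refl sum.swap)
  also have "\<dots> = (\<Sum>p\<in>C. \<Sum>q\<in>D. \<Sum>x\<in>A. \<Sum>r\<in>B. F x r p q)" by (intro sum.cong refl sum.swap)
  also have "\<dots> = (\<Sum>p\<in>C. \<Sum>q\<in>D. \<Sum>r\<in>B. \<Sum>x\<in>A. F x r p q)" by (intro sum.cong refl sum.swap)
  finally show ?thesis .
qed

text \<open>A finite linear category given by structure constants. The basis \<open>B\<close> of all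
  morphisms contains the identities, and these stand for the objects, so source and target are maps
  from \<open>B\<close> to \<open>B\<close>; \<open>\<mu> a b c\<close> is the coefficient of
  \<open>c\<close> in the product of \<open>a\<close> and \<open>b\<close>.\<close>

locale lincat =
  fixes B :: "'b set" and s t :: "'b \<Rightarrow> 'b" and \<mu> :: "'b \<Rightarrow> 'b \<Rightarrow> 'b \<Rightarrow> 'k::field"
  assumes finite_B: "finite B"
    and s_in [simp]: "b \<in> B \<Longrightarrow> s b \<in> B" and t_in [simp]: "b \<in> B \<Longrightarrow> t b \<in> B"
    and ss [simp]: "b \<in> B \<Longrightarrow> s (s b) = s b" and ts [simp]: "b \<in> B \<Longrightarrow> t (s b) = s b"
    and st [simp]: "b \<in> B \<Longrightarrow> s (t b) = t b" and tt [simp]: "b \<in> B \<Longrightarrow> t (t b) = t b"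
    and \<mu>_supp: "a \<in> B \<Longrightarrow> b \<in> B \<Longrightarrow> \<mu> a b c \<noteq> 0 \<Longrightarrow> c \<in> B \<and> t a = s b \<and> s c = s a \<and> t c = t b"
    and \<mu>_assoc: "a \<in> B \<Longrightarrow> b \<in> B \<Longrightarrow> c \<in> B \<Longrightarrow> (\<Sum>x\<in>B. \<mu> a b x * \<mu> x c d) = (\<Sum>x\<in>B. \<mu> b c x * \<mu> a x d)"
    and \<mu>_unit_left: "b \<in> B \<Longrightarrow> \<mu> (s b) b c = (if c = b then 1 else 0)"
    and \<mu>_unit_right: "b \<in> B \<Longrightarrow> \<mu> b (t b) c = (if c = b then 1 else 0)"
begin

definition V :: "('b \<Rightarrow> 'k) set" where "V = {x. \<forall>b. x b \<noteq> 0 \<longrightarrow> b \<in> B}"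

definition mul :: "('b \<Rightarrow> 'k) \<Rightarrow> ('b \<Rightarrow> 'k) \<Rightarrow> 'b \<Rightarrow> 'k" where
  "mul x y = (\<lambda>c. \<Sum>a\<in>B. \<Sum>b\<in>B. x a * y b * \<mu> a b c)"

definition one :: "'b \<Rightarrow> 'k" where
  "one b = (if b \<in> B \<and> s b = b then 1 else 0)"

abbreviation composable :: "'b list \<Rightarrow> bool" where
  "composable \<equiv> successively (\<lambda>a b. t a = s b)"

definition J :: "nat \<Rightarrow> 'b list set" where
  "J m = {L. length L = m \<and> set L \<subseteq> B \<and> composable L}"

text \<open>The \<open>m\<close>-fold tensor power of the algebra over the span of the identities,
  with the composable words as basis. The index counts letters, so the term of degree
  \<open>n\<close> in the resolution is \<open>bar (n + 2)\<close>: two outer letters for the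
  actions and \<open>n\<close> inner ones.\<close>

definition bar :: "nat \<Rightarrow> ('b list \<Rightarrow> 'k) set" where
  "bar m = {f. \<forall>L. f L \<noteq> 0 \<longrightarrow> L \<in> J m}"

text \<open>
  Coordinates of the bar differential: \<open>bd M f\<close> is the coefficient at \<open>M\<close> of the image of \<open>f\<close>. It is
  characterised by \<open>d (b # L) = b L - b \<otimes> d L\<close>, where \<open>b L\<close> multiplies \<open>b\<close> into the head of \<open>L\<close>; with this
  recursion the contracting homotopy and \<open>d d = 0\<close> need no sign bookkeeping.
\<close>

primrec bd :: "'b list \<Rightarrow> ('b list \<Rightarrow> 'k) \<Rightarrow> 'k" where
  "bd [] f = 0"
| "bd (c # M) f = (\<Sum>a\<in>B. \<Sum>b\<in>B. \<mu> a b c * f (a # b # M)) - bd M (\<lambda>L. f (c # L))"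

definition Lm :: "('b \<Rightarrow> 'k) \<Rightarrow> ('b list \<Rightarrow> 'k) \<Rightarrow> 'b list \<Rightarrow> 'k" where
  "Lm x f M = (case M of [] \<Rightarrow> 0 | c # M' \<Rightarrow> \<Sum>a\<in>B. \<Sum>b\<in>B. x a * \<mu> a b c * f (b # M'))"

definition Rm :: "('b \<Rightarrow> 'k) \<Rightarrow> ('b list \<Rightarrow> 'k) \<Rightarrow> 'b list \<Rightarrow> 'k" where
  "Rm y f M = (if M = [] then 0 else \<Sum>b\<in>B. \<Sum>a\<in>B. y a * \<mu> b a (last M) * f (butlast M @ [b]))"

lemma finite_J [simp]: "finite (J m)"
  by (rule finite_subset[OF _ finite_lists_length_eq[OF finite_B, of m]]) (auto simp: J_def)

lemma Lm_simps [simp]: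
  "Lm x f [] = 0" "Lm x f (c # M) = (\<Sum>a\<in>B. \<Sum>b\<in>B. x a * \<mu> a b c * f (b # M))"
  by (simp_all add: Lm_def)

lemma Rm_simps [simp]:
  "Rm x f [] = 0" "Rm y f (M @ [c]) = (\<Sum>b\<in>B. \<Sum>a\<in>B. y a * \<mu> b a c * f (M @ [b]))"
  "Rm y f [c] = (\<Sum>b\<in>B. \<Sum>a\<in>B. y a * \<mu> b a c * f [b])"
  "M \<noteq> [] \<Longrightarrow> Rm y f (c # M) = Rm y (\<lambda>L. f (c # L)) M"
  by (simp_all add: Rm_def)

lemma bd_cong:
  "(\<And>L. length L = Suc (length M) \<Longrightarrow> f L = g L) \<Longrightarrow> bd M f = bd M g"
proof (induct M arbitrary: f g)
  case (Cons c M)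
  have "bd M (\<lambda>L. f (c # L)) = bd M (\<lambda>L. g (c # L))" using Cons(2) by (intro Cons(1)) auto
  moreover have "f (a # b # M) = g (a # b # M)" for a b using Cons(2) by auto
  ultimately show ?case by simp
qed simp

lemma bd_add: "bd M (\<lambda>L. f L + g L) = bd M f + bd M g"
proof (induct M arbitrary: f g)
  case (Cons c M)
  then show ?case by (simp add: distrib_left sum.distrib)
qed simp

lemma bd_smult: "bd M (\<lambda>L. c * f L) = c * bd M f"
proof (induct M arbitrary: f)
  case (Cons a M)
  then show ?case by (simp add: right_diff_distrib sum_distrib_left mult.left_commute)
qed simp

lemma bd_zero [simp]: "bd M (\<lambda>L. 0) = 0"
  using bd_smult[of M 0 "\<lambda>_. 0"] by simp

lemma bd_diff: "bd M (\<lambda>L. f L - g L) = bd M f - bd M g"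
  using bd_add[of M f "\<lambda>L. -1 * g L"] bd_smult[of M "-1" g] by simp

lemma bd_sum: "bd M (\<lambda>L. \<Sum>i\<in>I. f i L) = (\<Sum>i\<in>I. bd M (f i))"
  by (induct I rule: infinite_finite_induct) (simp_all add: bd_add)

lemma assoc_sum:
  assumes "p \<in> B" "q \<in> B" "r \<in> B"
  shows "(\<Sum>x\<in>B. \<mu> p q x * (\<mu> x r c * k)) = (\<Sum>x\<in>B. \<mu> q r x * (\<mu> p x c * k))"
  using \<mu>_assoc[OF assms, of c] by (simp add: mult.assoc[symmetric] flip: sum_distrib_right)

text \<open>Associativity of \<open>\<mu>\<close> with an arbitrary coefficient \<open>F\<close>
  carried along. Every later computation in which two multiplications meet is an instance with a
  suitable \<open>F\<close>.\<close>

lemma assoc_move: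
  "(\<Sum>x\<in>B. \<Sum>r\<in>B. \<mu> x r c * (\<Sum>p\<in>B. \<Sum>q\<in>B. \<mu> p q x * F p q r)) =
   (\<Sum>p\<in>B. \<Sum>x\<in>B. \<mu> p x c * (\<Sum>q\<in>B. \<Sum>r\<in>B. \<mu> q r x * F p q r))"
proof -
  have "(\<Sum>x\<in>B. \<Sum>r\<in>B. \<mu> x r c * (\<Sum>p\<in>B. \<Sum>q\<in>B. \<mu> p q x * F p q r)) =
    (\<Sum>x\<in>B. \<Sum>r\<in>B. \<Sum>p\<in>B. \<Sum>q\<in>B. \<mu> p q x * (\<mu> x r c * F p q r))"
    by (simp add: sum_distrib_left mult.left_commute)
  also have "\<dots> = (\<Sum>p\<in>B. \<Sum>q\<in>B. \<Sum>r\<in>B. \<Sum>x\<in>B. \<mu> p q x * (\<mu> x r c * F p q r))"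
    by (rule sum_rotate4)
  also have "\<dots> = (\<Sum>p\<in>B. \<Sum>q\<in>B. \<Sum>r\<in>B. \<Sum>x\<in>B. \<mu> q r x * (\<mu> p x c * F p q r))"
    by (intro sum.cong refl assoc_sum)
  also have "\<dots> = (\<Sum>p\<in>B. \<Sum>q\<in>B. \<Sum>x\<in>B. \<Sum>r\<in>B. \<mu> q r x * (\<mu> p x c * F p q r))"
    by (intro sum.cong refl sum.swap)
  also have "\<dots> = (\<Sum>p\<in>B. \<Sum>x\<in>B. \<Sum>q\<in>B. \<Sum>r\<in>B. \<mu> q r x * (\<mu> p x c * F p q r))"
    by (intro sum.cong refl sum.swap)
  also have "\<dots> = (\<Sum>p\<in>B. \<Sum>x\<in>B. \<mu> p x c * (\<Sum>q\<in>B. \<Sum>r\<in>B. \<mu> q r x * F p q r))"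
    by (simp add: sum_distrib_left mult.left_commute)
  finally show ?thesis .
qed

text \<open>Unfolding the recursion twice leaves three kinds of terms. Those multiplying three
  leading letters cancel by \<open>assoc_move\<close>, those with one product at the head and one
  further right occur twice with opposite signs, and those that leave the head alone vanish by
  induction.\<close>

lemma bd_bd: "bd M (\<lambda>L. bd L f) = 0"
proof (induct M arbitrary: f)
  case (Cons c M)
  define S where "S L = (\<Sum>a\<in>B. \<Sum>b\<in>B. \<mu> a b c * f (a # b # L))" for L
  have "bd M (\<lambda>L. bd (c # L) f) = bd M S - bd M (\<lambda>L. bd L (\<lambda>L. f (c # L)))"
    by (simp add: S_def[abs_def] bd_diff)
  also have "\<dots> = (\<Sum>a\<in>B. \<Sum>b\<in>B. \<mu> a b c * bd M (\<lambda>L. f (a # b # L)))"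
    by (simp add: Cons S_def[abs_def] bd_sum bd_smult)
  finally have 1: "bd M (\<lambda>L. bd (c # L) f) = \<dots>" .
  have "(\<Sum>a\<in>B. \<Sum>b\<in>B. \<mu> a b c * bd (a # b # M) f) =
    (\<Sum>a\<in>B. \<Sum>b\<in>B. \<mu> a b c * (\<Sum>p\<in>B. \<Sum>q\<in>B. \<mu> p q a * f (p # q # b # M))) -
    (\<Sum>a\<in>B. \<Sum>b\<in>B. \<mu> a b c * (\<Sum>p\<in>B. \<Sum>q\<in>B. \<mu> p q b * f (a # p # q # M))) +
    (\<Sum>a\<in>B. \<Sum>b\<in>B. \<mu> a b c * bd M (\<lambda>L. f (a # b # L)))"
    by (simp add: right_diff_distrib sum_subtractf)
  also have "\<dots> = (\<Sum>a\<in>B. \<Sum>b\<in>B. \<mu> a b c * bd M (\<lambda>L. f (a # b # L)))"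
    using assoc_move[of c "\<lambda>p q r. f (p # q # r # M)"] by simp
  finally show ?case using 1 by simp
qed simp

lemma bd_Lm: "bd M (Lm x f) = Lm x (\<lambda>L. bd L f) M"
proof (cases M)
  case (Cons c M')
  have e: "(\<lambda>L. Lm x f (c # L)) = (\<lambda>L. \<Sum>a\<in>B. \<Sum>b\<in>B. (x a * \<mu> a b c) * f (b # L))" by simp
  have "(\<Sum>a'\<in>B. \<Sum>b\<in>B. \<mu> a' b c * (\<Sum>a\<in>B. \<Sum>b'\<in>B. \<mu> a b' a' * (x a * f (b' # b # M')))) =
    (\<Sum>a\<in>B. \<Sum>x'\<in>B. \<mu> a x' c * (\<Sum>b'\<in>B. \<Sum>b\<in>B. \<mu> b' b x' * (x a * f (b' # b # M'))))"
    by (rule assoc_move)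
  then show ?thesis unfolding Cons
    by (simp add: e bd_sum bd_smult right_diff_distrib sum_subtractf sum_distrib_left mult_ac)
qed simp

text \<open>Right multiplication touches the last letter and the first face the first two, so they
  interact only when one letter remains; there the claim is associativity. Otherwise the sums are
  interchanged and the other faces follow by induction.\<close>

lemma bd_Rm: "bd M (Rm y f) = Rm y (\<lambda>L. bd L f) M"
proof (induct M arbitrary: f)
  case (Cons c M)
  show ?case
  proof (cases "M = []")
    case True
    have "(\<Sum>b\<in>B. \<Sum>r\<in>B. \<mu> b r c * (\<Sum>p\<in>B. \<Sum>q\<in>B. \<mu> p q b * (y r * f [p, q]))) =
      (\<Sum>p\<in>B. \<Sum>b\<in>B. \<mu> p b c * (\<Sum>q\<in>B. \<Sum>r\<in>B. \<mu> q r b * (y r * f [p, q])))"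
      by (rule assoc_move)
    then show ?thesis unfolding True
      by (simp add: sum_distrib_left mult_ac)
  next
    case False
    have "bd M (\<lambda>L. Rm y f (c # L)) = bd M (Rm y (\<lambda>L. f (c # L)))"
      by (rule bd_cong) (metis Rm_simps(4) length_0_conv nat.distinct(1))
    then have 1: "bd M (\<lambda>L. Rm y f (c # L)) = Rm y (\<lambda>L. bd L (\<lambda>L. f (c # L))) M"
      by (simp add: Cons)
    have 2: "(\<Sum>p\<in>B. \<Sum>q\<in>B. \<mu> p q c * Rm y f (p # q # M)) =
      (\<Sum>b\<in>B. \<Sum>a\<in>B. y a * \<mu> b a (last M) * (\<Sum>p\<in>B. \<Sum>q\<in>B. \<mu> p q c * f (p # q # butlast M @ [b])))"
    proof -
      have "(\<Sum>p\<in>B. \<Sum>q\<in>B. \<mu> p q c * Rm y f (p # q # M)) =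
        (\<Sum>p\<in>B. \<Sum>q\<in>B. \<Sum>b\<in>B. \<Sum>a\<in>B. y a * \<mu> b a (last M) * (\<mu> p q c * f (p # q # butlast M @ [b])))"
        using False by (simp add: Rm_def sum_distrib_left mult_ac)
      also have "\<dots> = (\<Sum>b\<in>B. \<Sum>a\<in>B. \<Sum>q\<in>B. \<Sum>p\<in>B. y a * \<mu> b a (last M) * (\<mu> p q c * f (p # q # butlast M @ [b])))"
        by (rule sum_rotate4)
      also have "\<dots> = (\<Sum>b\<in>B. \<Sum>a\<in>B. \<Sum>p\<in>B. \<Sum>q\<in>B. y a * \<mu> b a (last M) * (\<mu> p q c * f (p # q # butlast M @ [b])))"
        by (intro sum.cong refl sum.swap)
      finally show ?thesis by (simp add: sum_distrib_left)
    qed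
    have "Rm y (\<lambda>L. bd L f) (c # M) = Rm y (\<lambda>L. bd (c # L) f) M" using False by simp
    also have "\<dots> = (\<Sum>p\<in>B. \<Sum>q\<in>B. \<mu> p q c * Rm y f (p # q # M)) - Rm y (\<lambda>L. bd L (\<lambda>L. f (c # L))) M"
      unfolding 2 using False by (simp add: Rm_def right_diff_distrib sum_subtractf)
    finally show ?thesis by (simp add: 1)
  qed
qed simp

section \<open>The contracting homotopy of the bar complex\<close>

text \<open>In terms of words, \<open>hh\<close> puts the identity at the source of \<open>L\<close>
  in front of \<open>L\<close>. It is not compatible with the left action, which does no harm
  because exactness concerns only the underlying vector spaces.\<close>

definition hh :: "('b list \<Rightarrow> 'k) \<Rightarrow> 'b list \<Rightarrow> 'k" where
  "hh f M = (case M of [] \<Rightarrow> 0 | c # M' \<Rightarrow> if M' \<noteq> [] \<and> c = s (hd M') then f M' else 0)"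

text \<open>Multiplying the first two letters does not change the source of the head, and the other
  faces leave the head alone; hence selecting words by the source of their head commutes with the
  differential.\<close>

lemma bd_filter:
  "bd M (\<lambda>L. if L \<noteq> [] \<and> s (hd L) = c then f L else 0) = (if M \<noteq> [] \<and> s (hd M) = c then bd M f else 0)"
proof (cases M)
  case (Cons e M')
  have "(\<Sum>a\<in>B. \<Sum>b\<in>B. \<mu> a b e * (if s a = c then f (a # b # M') else 0)) =
     (\<Sum>a\<in>B. \<Sum>b\<in>B. if s e = c then \<mu> a b e * f (a # b # M') else 0)"
  proof (intro sum.cong refl)
    fix a b assume "a \<in> B" "b \<in> B"
    then show "\<mu> a b e * (if s a = c then f (a # b # M') else 0) = (if s e = c then \<mu> a b e * f (a # b # M') else 0)"
      using \<mu>_supp[of a b e] by (cases "\<mu> a b e = 0") auto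
  qed
  also have "\<dots> = (if s e = c then (\<Sum>a\<in>B. \<Sum>b\<in>B. \<mu> a b e * f (a # b # M')) else 0)" by simp
  finally show ?thesis using Cons by simp
qed simp

lemma barD: "f \<in> bar m \<Longrightarrow> f L \<noteq> 0 \<Longrightarrow> L \<in> J m"
  by (simp add: bar_def)

lemma barI: "(\<And>L. f L \<noteq> 0 \<Longrightarrow> L \<in> J m) \<Longrightarrow> f \<in> bar m"
  by (simp add: bar_def)

text \<open>In the boundary of \<open>hh f\<close> the product of the prepended identity with the
  head returns \<open>f\<close>. The remaining faces are \<open>hh\<close> of the boundary of
  \<open>f\<close>, with the minus sign supplied by the recursion.\<close>

lemma bd_hh:
  assumes f: "f \<in> bar m" and m: "m \<ge> 1"
  shows "bd M (hh f) + hh (\<lambda>L. bd L f) M = f M"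
proof (cases M)
  case Nil
  have "f [] = 0" using barD[OF f, of "[]"] m by (auto simp: J_def)
  then show ?thesis using Nil by (simp add: hh_def)
next
  case (Cons c M')
  have "(\<Sum>a\<in>B. \<Sum>b\<in>B. \<mu> a b c * hh f (a # b # M')) = (\<Sum>b\<in>B. \<Sum>a\<in>B. \<mu> a b c * hh f (a # b # M'))"
    by (rule sum.swap)
  also have "\<dots> = (\<Sum>b\<in>B. \<Sum>a\<in>B. if a = s b then \<mu> a b c * f (b # M') else 0)"
    by (intro sum.cong refl) (simp add: hh_def)
  also have "\<dots> = (\<Sum>b\<in>B. \<mu> (s b) b c * f (b # M'))"
    using finite_B by (intro sum.cong refl) (simp add: sum.delta)
  also have "\<dots> = (\<Sum>b\<in>B. if b = c then f (b # M') else 0)"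
    by (intro sum.cong refl) (auto simp: \<mu>_unit_left)
  also have "\<dots> = f (c # M')"
    using barD[OF f, of "c # M'"] finite_B by (auto simp: sum.delta J_def)
  finally have 1: "(\<Sum>a\<in>B. \<Sum>b\<in>B. \<mu> a b c * hh f (a # b # M')) = f (c # M')" .
  have "bd M' (\<lambda>L. hh f (c # L)) = bd M' (\<lambda>L. if L \<noteq> [] \<and> s (hd L) = c then f L else 0)"
    by (intro bd_cong) (auto simp: hh_def)
  also have "\<dots> = hh (\<lambda>L. bd L f) (c # M')"
    unfolding bd_filter by (auto simp: hh_def)
  finally show ?thesis using 1 Cons by simp
qed

text \<open>Each face multiplies two neighbours, and a product with nonzero coefficient has the
  source of its left factor and the target of its right one. So faces keep words composable and keep
  both ends.\<close>

lemma bd_support: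
  "bd M f \<noteq> 0 \<Longrightarrow> \<exists>L. f L \<noteq> 0 \<and> length L = Suc (length M) \<and> M \<noteq> [] \<and>
    (set L \<subseteq> B \<and> composable L \<longrightarrow> set M \<subseteq> B \<and> composable M \<and> s (hd M) = s (hd L) \<and> t (last M) = t (last L))"
proof (induct M arbitrary: f)
  case (Cons c M)
  show ?case
  proof (cases "(\<Sum>a\<in>B. \<Sum>b\<in>B. \<mu> a b c * f (a # b # M)) = 0")
    case True
    with Cons(2) have "bd M (\<lambda>L. f (c # L)) \<noteq> 0" by simp
    from Cons(1)[OF this] obtain L where "f (c # L) \<noteq> 0" "length L = Suc (length M)" "M \<noteq> []"
      "set L \<subseteq> B \<and> composable L \<longrightarrow> set M \<subseteq> B \<and> composable M \<and> s (hd M) = s (hd L) \<and> t (last M) = t (last L)"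
      by blast
    then show ?thesis by (intro exI[of _ "c # L"]) (auto simp: successively_Cons)
  next
    case False
    then obtain a where a: "a \<in> B" "(\<Sum>b\<in>B. \<mu> a b c * f (a # b # M)) \<noteq> 0"
      by (rule sum.not_neutral_contains_not_neutral)
    from a(2) obtain b where b: "b \<in> B" "\<mu> a b c * f (a # b # M) \<noteq> 0"
      by (rule sum.not_neutral_contains_not_neutral)
    with \<mu>_supp[OF a(1) b(1), of c] show ?thesis
      by (intro exI[of _ "a # b # M"]) (auto simp: successively_Cons)
  qed
qed simp

lemma bar_bd:
  assumes "f \<in> bar (Suc m)" "m \<ge> 1"
  shows "(\<lambda>M. bd M f) \<in> bar m"
proof (rule barI)
  fix M assume "bd M f \<noteq> 0"
  from bd_support[OF this] obtain L where "f L \<noteq> 0" "length L = Suc (length M)"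
    "set L \<subseteq> B \<and> composable L \<longrightarrow> set M \<subseteq> B \<and> composable M" by blast
  with barD[OF assms(1)] show "M \<in> J m" by (auto simp: J_def)
qed

lemma bd_bar_one:
  assumes "f \<in> bar 1" shows "bd M f = 0"
proof (rule ccontr)
  assume "bd M f \<noteq> 0"
  from bd_support[OF this] obtain L where "f L \<noteq> 0" "length L = Suc (length M)" "M \<noteq> []" by blast
  with barD[OF assms] show False by (auto simp: J_def)
qed

lemma bar_hh:
  assumes "f \<in> bar m" "m \<ge> 1" shows "hh f \<in> bar (Suc m)"
proof (rule barI)
  fix M assume "hh f M \<noteq> 0"
  then obtain M' where "M = s (hd M') # M'" "M' \<noteq> []" "f M' \<noteq> 0"
    by (auto simp: hh_def split: list.splits if_splits)
  with barD[OF assms(1), of M'] show "M \<in> J (Suc m)"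
    by (cases M') (auto simp: J_def successively_Cons)
qed

lemma bar_Lm:
  assumes "f \<in> bar m" shows "Lm x f \<in> bar m"
proof (rule barI)
  fix M assume nz: "Lm x f M \<noteq> 0"
  then obtain c M' where M: "M = c # M'" by (cases M) auto
  with nz have "(\<Sum>a\<in>B. \<Sum>b\<in>B. x a * \<mu> a b c * f (b # M')) \<noteq> 0" by simp
  then obtain a where a: "a \<in> B" "(\<Sum>b\<in>B. x a * \<mu> a b c * f (b # M')) \<noteq> 0"
    by (rule sum.not_neutral_contains_not_neutral)
  from a(2) obtain b where b: "b \<in> B" "x a * \<mu> a b c * f (b # M') \<noteq> 0"
    by (rule sum.not_neutral_contains_not_neutral)
  with \<mu>_supp[OF a(1) b(1), of c] barD[OF assms, of "b # M'"] show "M \<in> J m"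
    unfolding M by (auto simp: J_def successively_Cons)
qed

lemma bar_Rm:
  assumes "f \<in> bar m" shows "Rm x f \<in> bar m"
proof (rule barI)
  fix M assume nz: "Rm x f M \<noteq> 0"
  then obtain c M' where M: "M = M' @ [c]" by (cases M rule: rev_cases) auto
  with nz have "(\<Sum>b\<in>B. \<Sum>a\<in>B. x a * \<mu> b a c * f (M' @ [b])) \<noteq> 0" by simp
  then obtain b where b: "b \<in> B" "(\<Sum>a\<in>B. x a * \<mu> b a c * f (M' @ [b])) \<noteq> 0"
    by (rule sum.not_neutral_contains_not_neutral)
  from b(2) obtain a where a: "a \<in> B" "x a * \<mu> b a c * f (M' @ [b]) \<noteq> 0"
    by (rule sum.not_neutral_contains_not_neutral)
  with \<mu>_supp[OF b(1) a(1), of c] barD[OF assms, of "M' @ [b]"] show "M \<in> J m"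
    unfolding M by (auto simp: J_def successively_append_iff)
qed

lemma Lm_mul: "Lm (mul x y) f = Lm x (Lm y f)"
proof
  fix M show "Lm (mul x y) f M = Lm x (Lm y f) M"
  proof (cases M)
    case (Cons c M')
    have "(\<Sum>a\<in>B. \<Sum>b\<in>B. \<mu> a b c * (\<Sum>p\<in>B. \<Sum>q\<in>B. \<mu> p q a * (x p * y q * f (b # M')))) =
      (\<Sum>p\<in>B. \<Sum>a\<in>B. \<mu> p a c * (\<Sum>q\<in>B. \<Sum>b\<in>B. \<mu> q b a * (x p * y q * f (b # M'))))"
      by (rule assoc_move)
    then show ?thesis unfolding Cons by (simp add: mul_def sum_distrib_left sum_distrib_right mult_ac)
  qed simp
qed

lemma Rm_mul: "Rm (mul x y) f = Rm y (Rm x f)"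
proof
  fix M show "Rm (mul x y) f M = Rm y (Rm x f) M"
  proof (cases M rule: rev_cases)
    case (snoc M' c)
    have "(\<Sum>a\<in>B. \<Sum>b\<in>B. \<mu> a b c * (\<Sum>p\<in>B. \<Sum>q\<in>B. \<mu> p q a * (x q * y b * f (M' @ [p])))) =
      (\<Sum>p\<in>B. \<Sum>a\<in>B. \<mu> p a c * (\<Sum>q\<in>B. \<Sum>b\<in>B. \<mu> q b a * (x q * y b * f (M' @ [p]))))"
      by (rule assoc_move)
    then show ?thesis unfolding snoc by (simp add: mul_def sum_distrib_left sum_distrib_right mult_ac)
  qed simp
qed

lemma Lm_Rm: "Lm x (Rm y f) = Rm y (Lm x f)"
proof
  fix M show "Lm x (Rm y f) M = Rm y (Lm x f) M"
  proof (cases M)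
    case (Cons c M')
    show ?thesis
    proof (cases "M' = []")
      case True
      have "(\<Sum>a\<in>B. \<Sum>b\<in>B. \<mu> a b c * (\<Sum>p\<in>B. \<Sum>q\<in>B. \<mu> p q a * (x p * y b * f [q]))) =
        (\<Sum>p\<in>B. \<Sum>a\<in>B. \<mu> p a c * (\<Sum>q\<in>B. \<Sum>b\<in>B. \<mu> q b a * (x p * y b * f [q])))"
        by (rule assoc_move)
      then show ?thesis unfolding Cons True by (simp add: sum_distrib_left mult_ac)
    next
      case False
      then obtain N d where M': "M' = N @ [d]" by (cases M' rule: rev_cases) auto
      have "Lm x (Rm y f) M = (\<Sum>a\<in>B. \<Sum>b\<in>B. \<Sum>p\<in>B. \<Sum>q\<in>B. (x a * \<mu> a b c) * (y q * \<mu> p q d) * f (b # N @ [p]))"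
        unfolding Cons using False by (simp add: M' sum_distrib_left mult_ac)
      also have "\<dots> = (\<Sum>p\<in>B. \<Sum>q\<in>B. \<Sum>b\<in>B. \<Sum>a\<in>B. (x a * \<mu> a b c) * (y q * \<mu> p q d) * f (b # N @ [p]))"
        by (rule sum_rotate4)
      also have "\<dots> = (\<Sum>p\<in>B. \<Sum>q\<in>B. \<Sum>a\<in>B. \<Sum>b\<in>B. (x a * \<mu> a b c) * (y q * \<mu> p q d) * f (b # N @ [p]))"
        by (intro sum.cong refl sum.swap)
      also have "\<dots> = Rm y (Lm x f) M"
        unfolding Cons using Rm_simps(2)[of y "Lm x f" "c # N" d] by (simp add: M' sum_distrib_left mult_ac)
      finally show ?thesis .
    qed
  qed simp
qed

lemma mul_assoc: "mul (mul x y) z = mul x (mul y z)"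
proof
  fix c
  have "(\<Sum>a\<in>B. \<Sum>b\<in>B. \<mu> a b c * (\<Sum>p\<in>B. \<Sum>q\<in>B. \<mu> p q a * (x p * y q * z b))) =
    (\<Sum>p\<in>B. \<Sum>a\<in>B. \<mu> p a c * (\<Sum>q\<in>B. \<Sum>b\<in>B. \<mu> q b a * (x p * y q * z b)))"
    by (rule assoc_move)
  then show "mul (mul x y) z c = mul x (mul y z) c"
    by (simp add: mul_def sum_distrib_left sum_distrib_right mult_ac)
qed

lemma mul_V: "mul x y \<in> V"
proof -
  have "c \<in> B" if "mul x y c \<noteq> 0" for c
  proof -
    from that have "(\<Sum>a\<in>B. \<Sum>b\<in>B. x a * y b * \<mu> a b c) \<noteq> 0" by (simp add: mul_def)
    then obtain a where a: "a \<in> B" "(\<Sum>b\<in>B. x a * y b * \<mu> a b c) \<noteq> 0"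
      by (rule sum.not_neutral_contains_not_neutral)
    from a(2) obtain b where b: "b \<in> B" "x a * y b * \<mu> a b c \<noteq> 0"
      by (rule sum.not_neutral_contains_not_neutral)
    with \<mu>_supp[OF a(1) b(1), of c] show ?thesis by auto
  qed
  then show ?thesis by (simp add: V_def)
qed

lemma idem_coeff:
  assumes "a \<in> B" "b \<in> B" "s a = a"
  shows "\<mu> a b c = (if a = s b \<and> c = b then 1 else 0)"
proof (cases "a = s b")
  case True
  then show ?thesis using \<mu>_unit_left[OF assms(2)] by simp
next
  case False
  have "t a = a" using ts[OF assms(1)] assms(3) by simp
  then show ?thesis using \<mu>_supp[OF assms(1,2), of c] False by auto
qed

lemma idem_coeff_right:
  assumes "a \<in> B" "b \<in> B" "s b = b"
  shows "\<mu> a b c = (if b = t a \<and> c = a then 1 else 0)"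
proof (cases "b = t a")
  case True
  then show ?thesis using \<mu>_unit_right[OF assms(1)] by simp
next
  case False
  then show ?thesis using \<mu>_supp[OF assms(1,2), of c] assms(3) by auto
qed

lemma one_left_sum:
  "(\<Sum>a\<in>B. \<Sum>b\<in>B. one a * \<mu> a b c * F b) = (if c \<in> B then F c else 0)"
proof -
  have "(\<Sum>a\<in>B. \<Sum>b\<in>B. one a * \<mu> a b c * F b) = (\<Sum>b\<in>B. \<Sum>a\<in>B. one a * \<mu> a b c * F b)" by (rule sum.swap)
  also have "\<dots> = (\<Sum>b\<in>B. \<Sum>a\<in>B. if a = s b then (if c = b then F b else 0) else 0)"
    by (intro sum.cong refl) (auto simp: one_def idem_coeff)
  also have "\<dots> = (\<Sum>b\<in>B. if b = c then F b else 0)"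
    using finite_B by (intro sum.cong refl) (auto simp: sum.delta)
  finally show ?thesis using finite_B by (simp add: sum.delta)
qed

lemma one_right_sum:
  "(\<Sum>b\<in>B. \<Sum>a\<in>B. one a * \<mu> b a c * F b) = (if c \<in> B then F c else 0)"
proof -
  have "(\<Sum>b\<in>B. \<Sum>a\<in>B. one a * \<mu> b a c * F b) = (\<Sum>b\<in>B. \<Sum>a\<in>B. if a = t b then (if c = b then F b else 0) else 0)"
    by (intro sum.cong refl) (auto simp: one_def idem_coeff_right)
  also have "\<dots> = (\<Sum>b\<in>B. if b = c then F b else 0)"
    using finite_B by (intro sum.cong refl) (auto simp: sum.delta)
  finally show ?thesis using finite_B by (simp add: sum.delta)
qed

lemma Lm_one: "f \<in> bar m \<Longrightarrow> m \<ge> 1 \<Longrightarrow> Lm one f = f"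
proof
  fix M assume f: "f \<in> bar m" "m \<ge> 1"
  show "Lm one f M = f M"
  proof (cases M)
    case Nil
    then show ?thesis using barD[OF f(1), of M] f(2) by (auto simp: J_def)
  next
    case (Cons c M')
    then show ?thesis using barD[OF f(1), of M] by (auto simp: one_left_sum J_def)
  qed
qed

lemma Rm_one: "f \<in> bar m \<Longrightarrow> m \<ge> 1 \<Longrightarrow> Rm one f = f"
proof
  fix M assume f: "f \<in> bar m" "m \<ge> 1"
  show "Rm one f M = f M"
  proof (cases M rule: rev_cases)
    case Nil
    then show ?thesis using barD[OF f(1), of M] f(2) by (auto simp: J_def)
  next
    case (snoc M' c)
    then show ?thesis using barD[OF f(1), of M] by (auto simp: one_right_sum J_def)
  qed
qed

lemma one_V: "one \<in> V" by (simp add: V_def one_def)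

end

section \<open>Bimodule cochains in coordinates\<close>

context lincat begin

declare add_2_eq_Suc [simp del] add_2_eq_Suc' [simp del]

lemma Lm_add: "Lm x (\<lambda>L. f L + g L) = (\<lambda>M. Lm x f M + Lm x g M)"
  by (rule ext) (simp add: Lm_def distrib_left sum.distrib split: list.split)

lemma Lm_smult: "Lm x (\<lambda>L. c * f L) = (\<lambda>M. c * Lm x f M)"
  by (rule ext) (simp add: Lm_def sum_distrib_left mult_ac split: list.split)

lemma Lm_add_left: "Lm (\<lambda>b. x b + y b) f = (\<lambda>M. Lm x f M + Lm y f M)"
  by (rule ext) (simp add: Lm_def distrib_right sum.distrib split: list.split)

lemma Lm_smult_left: "Lm (\<lambda>b. c * x b) f = (\<lambda>M. c * Lm x f M)"
  by (rule ext) (simp add: Lm_def sum_distrib_left mult_ac split: list.split)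

lemma Rm_add: "Rm x (\<lambda>L. f L + g L) = (\<lambda>M. Rm x f M + Rm x g M)"
  by (rule ext) (simp add: Rm_def distrib_left sum.distrib)

lemma Rm_smult: "Rm x (\<lambda>L. c * f L) = (\<lambda>M. c * Rm x f M)"
  by (rule ext) (simp add: Rm_def sum_distrib_left mult_ac)

lemma Rm_add_left: "Rm (\<lambda>b. x b + y b) f = (\<lambda>M. Rm x f M + Rm y f M)"
  by (rule ext) (simp add: Rm_def distrib_right sum.distrib)

lemma Rm_smult_left: "Rm (\<lambda>b. c * x b) f = (\<lambda>M. c * Rm x f M)"
  by (rule ext) (simp add: Rm_def sum_distrib_left mult_ac)

lemma mul_add_left: "mul (\<lambda>b. x b + y b) z = (\<lambda>c. mul x z c + mul y z c)"
  by (rule ext) (simp add: mul_def distrib_right sum.distrib)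

lemma mul_add_right: "mul z (\<lambda>b. x b + y b) = (\<lambda>c. mul z x c + mul z y c)"
  by (rule ext) (simp add: mul_def distrib_right distrib_left sum.distrib)

lemma mul_smult_left: "mul (\<lambda>b. k * x b) z = (\<lambda>c. k * mul x z c)"
  by (rule ext) (simp add: mul_def sum_distrib_left mult_ac)

lemma mul_smult_right: "mul z (\<lambda>b. k * x b) = (\<lambda>c. k * mul z x c)"
  by (rule ext) (simp add: mul_def sum_distrib_left mult_ac)

lemma mul_zero [simp]: "mul (\<lambda>_. 0) z = (\<lambda>_. 0)" "mul z (\<lambda>_. 0) = (\<lambda>_. 0)"
  by (simp_all add: mul_def)

lemma sum_unit_vec:
  assumes "finite I" "i \<in> I" shows "(\<Sum>j\<in>I. unit_vec_at i j * F j) = (F i :: 'k)"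
proof -
  have "(\<Sum>j\<in>I. unit_vec_at i j * F j) = (\<Sum>j\<in>I. if j = i then F j else 0)"
    by (intro sum.cong refl) (simp add: unit_vec_at_def)
  then show ?thesis using assms by (simp add: sum.delta)
qed

lemma mul_unit: "a \<in> B \<Longrightarrow> b \<in> B \<Longrightarrow> mul (unit_vec_at a) (unit_vec_at b) c = \<mu> a b c"
proof -
  assume "a \<in> B" "b \<in> B"
  then have "(\<Sum>p\<in>B. unit_vec_at a p * (\<Sum>q\<in>B. unit_vec_at b q * \<mu> p q c)) = \<mu> a b c"
    using finite_B by (simp add: sum_unit_vec)
  then show ?thesis by (simp add: mul_def sum_distrib_left mult_ac)
qed

lemma unit_V [simp]: "b \<in> B \<Longrightarrow> unit_vec_at b \<in> V"
  by (simp add: V_def unit_vec_at_def)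

lemma V_add: "x \<in> V \<Longrightarrow> y \<in> V \<Longrightarrow> (\<lambda>b. x b + y b) \<in> V"
  unfolding V_def by (simp add: mem_Collect_eq) (metis add.right_neutral)

lemma V_smult: "x \<in> V \<Longrightarrow> (\<lambda>b. c * x b) \<in> V"
  by (simp add: V_def)

lemma V_zero [simp]: "(\<lambda>_. 0) \<in> V" by (simp add: V_def)

lemma bar_add: "f \<in> bar m \<Longrightarrow> g \<in> bar m \<Longrightarrow> (\<lambda>b. f b + g b) \<in> bar m"
  unfolding bar_def by (simp add: mem_Collect_eq) (metis add.right_neutral)

lemma bar_smult: "f \<in> bar m \<Longrightarrow> (\<lambda>b. c * f b) \<in> bar m"
  by (simp add: bar_def)

lemma bar_zero [simp]: "(\<lambda>_. 0) \<in> bar m" by (simp add: bar_def)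

lemma bar_unit [simp]: "L \<in> J m \<Longrightarrow> unit_vec_at L \<in> bar m"
  by (simp add: bar_def unit_vec_at_def)

lemma bar_iff_supp: "f \<in> bar m \<longleftrightarrow> supp f \<subseteq> J m"
  by (auto simp: bar_def supp_def)

lemma V_iff_supp: "x \<in> V \<longleftrightarrow> supp x \<subseteq> B"
  by (auto simp: V_def supp_def)

lemma bd_act: "(\<lambda>M. bd M (Lm x (Rm y f))) = Lm x (Rm y (\<lambda>M. bd M f))"
  by (simp add: bd_Lm bd_Rm fun_eq_iff Lm_def split: list.split)

lemma bar_one_act:
  "(\<lambda>b. Lm x (Rm y f) [b]) = mul x (mul (\<lambda>b. f [b]) y)"
  by (rule ext) (simp add: mul_def sum_distrib_left mult_ac)

lemma bar_induct [consumes 1, case_names zero unit add]: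
  assumes f: "f \<in> bar m" and "P (\<lambda>_. 0)"
    and "\<And>c L. L \<in> J m \<Longrightarrow> P (\<lambda>x. c * unit_vec_at L x)"
    and "\<And>f g. f \<in> bar m \<Longrightarrow> g \<in> bar m \<Longrightarrow> P f \<Longrightarrow> P g \<Longrightarrow> P (\<lambda>x. f x + g x)"
  shows "P f"
proof -
  have sub: "supp f \<subseteq> J m" using f by (simp add: bar_iff_supp)
  then have "finite (supp f)" by (rule finite_subset) simp
  from this sub show ?thesis
    by (induct f rule: fun_supp_induct) (use assms in \<open>auto simp: bar_iff_supp\<close>)
qed

lemma J_cases:
  assumes "L \<in> J (n + 2)"
  obtains a N b where "L = a # N @ [b]" "length N = n" "a \<in> B" "b \<in> B" "set N \<subseteq> B"
proof -
  have L: "length L = n + 2" "set L \<subseteq> B" using assms by (auto simp: J_def)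
  then obtain a L' where L': "L = a # L'" "length L' = n + 1" by (cases L) auto
  then obtain N b where "L' = N @ [b]" by (cases L' rule: rev_cases) auto
  with L L' that show ?thesis by auto
qed

section \<open>Bimodule generators of the bar terms\<close>

text \<open>A word \<open>a # N @ [b]\<close> is \<open>a\<close> times
  \<open>t a # N @ [s b]\<close> times \<open>b\<close>, see \<open>unit_from_gen\<close>. Words
  whose outer letters are identities therefore generate the bar term as a bimodule.\<close>

definition gen :: "'b list \<Rightarrow> 'b list" where
  "gen L = t (hd L) # butlast (tl L) @ [s (last L)]"

lemma gen_simp [simp]: "gen (a # N @ [b]) = t a # N @ [s b]"
  by (simp add: gen_def)

lemma J_ends:
  assumes "a # N @ [b] \<in> J m" "c \<in> B" "d \<in> B" "t c = t a" "s d = s b"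
  shows "c # N @ [d] \<in> J m"
  using assms by (cases "N = []") (auto simp: J_def successively_Cons successively_append_iff)

lemma J_gen: "a # N @ [b] \<in> J m \<Longrightarrow> t a # N @ [s b] \<in> J m"
  by (rule J_ends) (auto simp: J_def)

definition ev :: "nat \<Rightarrow> ('b list \<times> 'b \<Rightarrow> 'k) \<Rightarrow> ('b list \<Rightarrow> 'k) \<Rightarrow> 'b \<Rightarrow> 'k" where
  "ev m \<phi> f = (\<lambda>b. \<Sum>L\<in>J m. f L * \<phi> (L, b))"

text \<open>The transpose of the bar differential: the value at \<open>L\<close> is
  \<open>\<phi>\<close> extended linearly and evaluated at the boundary of \<open>L\<close>.\<close>

definition del :: "nat \<Rightarrow> ('b list \<times> 'b \<Rightarrow> 'k) \<Rightarrow> 'b list \<times> 'b \<Rightarrow> 'k" where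
  "del m \<phi> = (\<lambda>(L, b). if L \<in> J (Suc m) then \<Sum>M\<in>J m. bd M (unit_vec_at L) * \<phi> (M, b) else 0)"

lemma ev_add: "ev m \<phi> (\<lambda>L. f L + g L) = (\<lambda>b. ev m \<phi> f b + ev m \<phi> g b)"
  by (simp add: ev_def distrib_right sum.distrib)

lemma ev_smult: "ev m \<phi> (\<lambda>L. c * f L) = (\<lambda>b. c * ev m \<phi> f b)"
  by (simp add: ev_def sum_distrib_left mult_ac)

lemma ev_zero [simp]: "ev m \<phi> (\<lambda>_. 0) = (\<lambda>_. 0)"
  by (simp add: ev_def)

lemma ev_unit: "L \<in> J m \<Longrightarrow> ev m \<phi> (unit_vec_at L) = (\<lambda>b. \<phi> (L, b))"
  by (simp add: ev_def sum_unit_vec)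

lemma ev_add_left: "ev m (\<lambda>i. \<phi> i + \<psi> i) f = (\<lambda>b. ev m \<phi> f b + ev m \<psi> f b)"
  by (simp add: ev_def distrib_left sum.distrib)

lemma ev_smult_left: "ev m (\<lambda>i. c * \<phi> i) f = (\<lambda>b. c * ev m \<phi> f b)"
  by (simp add: ev_def sum_distrib_left mult_ac)

lemma del_simp: "L \<in> J (Suc m) \<Longrightarrow> del m \<phi> (L, b) = ev m \<phi> (\<lambda>M. bd M (unit_vec_at L)) b"
  by (simp add: del_def ev_def)

lemma ev_del:
  assumes "f \<in> bar (Suc m)"
  shows "ev (Suc m) (del m \<phi>) f = ev m \<phi> (\<lambda>M. bd M f)"
  using assms
proof (induct f rule: bar_induct)
  case (unit c L)
  then show ?case by (simp add: ev_smult bd_smult ev_unit del_simp fun_eq_iff)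
qed (simp_all add: ev_add bd_add)

lemma del_add: "del m (\<lambda>i. \<phi> i + \<psi> i) = (\<lambda>i. del m \<phi> i + del m \<psi> i)"
  by (auto simp: del_def fun_eq_iff distrib_left sum.distrib)

lemma del_smult: "del m (\<lambda>i. c * \<phi> i) = (\<lambda>i. c * del m \<phi> i)"
  by (auto simp: del_def fun_eq_iff sum_distrib_left mult_ac)

lemma del_del: "m \<ge> 1 \<Longrightarrow> del (Suc m) (del m \<phi>) = (\<lambda>_. 0)"
proof (rule ext, clarify)
  fix L b assume m: "m \<ge> 1"
  show "del (Suc m) (del m \<phi>) (L, b) = 0"
  proof (cases "L \<in> J (Suc (Suc m))")
    case True
    then have "(\<lambda>M. bd M (unit_vec_at L)) \<in> bar (Suc m)" by (intro bar_bd) auto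
    then show ?thesis using True by (simp add: del_simp ev_del bd_bd)
  qed (simp add: del_def)
qed

text \<open>The tensor with left factor \<open>u\<close>, fixed middle word \<open>N\<close> and
  right factor \<open>v\<close>. The two actions change only \<open>u\<close> and \<open>v\<close>,
  which turns statements about the actions on words into statements about
  \<open>mul\<close>.\<close>

definition outer :: "'b list \<Rightarrow> ('b \<Rightarrow> 'k) \<Rightarrow> ('b \<Rightarrow> 'k) \<Rightarrow> 'b list \<Rightarrow> 'k" where
  "outer N u v M = (if length M = length N + 2 \<and> butlast (tl M) = N then u (hd M) * v (last M) else 0)"

lemma outer_simp: "outer N u v (c # N' @ [d]) = (if N' = N then u c * v d else 0)"
  by (auto simp: outer_def)

lemma outer_short: "length M < 2 \<Longrightarrow> outer N u v M = 0"
  by (simp add: outer_def)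

lemma list_cases2:
  obtains "length (M :: 'c list) < 2" | c N d where "M = c # N @ [d]"
proof (cases M)
  case (Cons c M')
  then show ?thesis using that by (cases M' rule: rev_cases) auto
qed (use that in auto)

lemma Lm_outer: "Lm x (outer N u v) = outer N (mul x u) v"
proof
  fix M show "Lm x (outer N u v) M = outer N (mul x u) v M"
  proof (cases M rule: list_cases2)
    case 1
    then have "M = [] \<or> (\<exists>c. M = [c])" by (cases M) auto
    then show ?thesis by (auto simp: outer_short)
  next
    case (2 c N' d)
    have "outer N u v (b # N' @ [d]) = (if N' = N then u b * v d else 0)" for b by (simp add: outer_simp)
    then show ?thesis unfolding 2 by (simp add: outer_simp mul_def sum_distrib_left sum_distrib_right mult_ac)
  qed
qed

lemma Rm_outer: "Rm y (outer N u v) = outer N u (mul v y)"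
proof
  fix M show "Rm y (outer N u v) M = outer N u (mul v y) M"
  proof (cases M rule: list_cases2)
    case 1
    then have "M = [] \<or> (\<exists>c. M = [c])" by (cases M) auto
    then show ?thesis by (auto simp: outer_short)
  next
    case (2 c N' d)
    show ?thesis unfolding 2 using Rm_simps(2)[of y "outer N u v" "c # N'" d]
      by (simp add: outer_simp mul_def sum_distrib_left mult_ac)
  qed
qed

lemma unit_outer: "unit_vec_at (a # N @ [b]) = outer N (unit_vec_at a) (unit_vec_at b)"
proof
  fix M show "unit_vec_at (a # N @ [b]) M = outer N (unit_vec_at a) (unit_vec_at b) M"
    by (cases M rule: list_cases2) (auto simp: outer_short outer_simp unit_vec_at_def)
qed

lemma outer_add:
  "outer N (\<lambda>b. u b + u' b) v = (\<lambda>M. outer N u v M + outer N u' v M)"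
  "outer N u (\<lambda>b. v b + v' b) = (\<lambda>M. outer N u v M + outer N u v' M)"
  by (auto simp: outer_def fun_eq_iff algebra_simps)

lemma outer_smult:
  "outer N (\<lambda>b. c * u b) v = (\<lambda>M. c * outer N u v M)"
  "outer N u (\<lambda>b. c * v b) = (\<lambda>M. c * outer N u v M)"
  by (auto simp: outer_def fun_eq_iff)

lemma outer_zero [simp]: "outer N (\<lambda>b. 0) v = (\<lambda>M. 0)" "outer N u (\<lambda>b. 0) = (\<lambda>M. 0)"
  by (auto simp: outer_def fun_eq_iff)

lemma mul_unit_t: "b \<in> B \<Longrightarrow> mul (unit_vec_at b) (unit_vec_at (t b)) = unit_vec_at b"
  by (auto simp: fun_eq_iff mul_unit \<mu>_unit_right) (auto simp: unit_vec_at_def)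

lemma mul_s_unit: "b \<in> B \<Longrightarrow> mul (unit_vec_at (s b)) (unit_vec_at b) = unit_vec_at b"
  by (auto simp: fun_eq_iff mul_unit \<mu>_unit_left) (auto simp: unit_vec_at_def)

lemma unit_from_gen:
  assumes "a \<in> B" "b \<in> B"
  shows "Lm (unit_vec_at a) (Rm (unit_vec_at b) (unit_vec_at (t a # N @ [s b]))) = unit_vec_at (a # N @ [b])"
  using assms by (simp add: unit_outer Lm_outer Rm_outer mul_unit_t mul_s_unit)

lemma mul_supp:
  assumes "mul x y c \<noteq> 0"
  obtains a b where "a \<in> B" "b \<in> B" "x a \<noteq> 0" "y b \<noteq> 0" "\<mu> a b c \<noteq> 0"
proof -
  from assms have "(\<Sum>a\<in>B. \<Sum>b\<in>B. x a * y b * \<mu> a b c) \<noteq> 0" by (simp add: mul_def)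
  then obtain a where a: "a \<in> B" "(\<Sum>b\<in>B. x a * y b * \<mu> a b c) \<noteq> 0"
    by (rule sum.not_neutral_contains_not_neutral)
  from a(2) obtain b where b: "b \<in> B" "x a * y b * \<mu> a b c \<noteq> 0"
    by (rule sum.not_neutral_contains_not_neutral)
  with a that show ?thesis by auto
qed

lemma supp_mul_unit_right: "b \<in> B \<Longrightarrow> supp (mul x (unit_vec_at b)) \<subseteq> {c \<in> B. t c = t b}"
  by (auto simp: supp_def unit_vec_at_def elim!: mul_supp split: if_splits dest: \<mu>_supp)

lemma supp_mul_unit_left: "b \<in> B \<Longrightarrow> supp (mul (unit_vec_at b) x) \<subseteq> {c \<in> B. s c = s b}"
  by (auto simp: supp_def unit_vec_at_def elim!: mul_supp split: if_splits dest: \<mu>_supp)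

text \<open>
  \<open>\<phi> \<in> K n\<close> is the coordinate matrix of a bimodule map from the n-th term \<open>bar (n + 2)\<close> of the bar
  resolution to the algebra, and the second condition recovers it from its values on the bimodule
  generators \<open>gen L\<close>.
\<close>

definition K :: "nat \<Rightarrow> ('b list \<times> 'b \<Rightarrow> 'k) set" where
  "K n = {\<phi>. (\<forall>L b. \<phi> (L, b) \<noteq> 0 \<longrightarrow> L \<in> J (n + 2) \<and> b \<in> B) \<and>
     (\<forall>L\<in>J (n + 2). (\<lambda>b. \<phi> (L, b)) =
        mul (unit_vec_at (hd L)) (mul (\<lambda>b. \<phi> (gen L, b)) (unit_vec_at (last L))))}"

lemma K_supp: "\<phi> \<in> K n \<Longrightarrow> \<phi> (L, b) \<noteq> 0 \<Longrightarrow> L \<in> J (n + 2) \<and> b \<in> B"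
  by (auto simp: K_def)

lemma K_gen:
  "\<phi> \<in> K n \<Longrightarrow> a # N @ [b] \<in> J (n + 2) \<Longrightarrow>
    (\<lambda>c. \<phi> (a # N @ [b], c)) = mul (unit_vec_at a) (mul (\<lambda>c. \<phi> (t a # N @ [s b], c)) (unit_vec_at b))"
  unfolding K_def by (auto dest!: bspec[where x = "a # N @ [b]"])

lemma ev_V: "\<phi> \<in> K n \<Longrightarrow> ev (n + 2) \<phi> f \<in> V"
  using K_supp[of \<phi> n] by (auto simp: V_def ev_def elim!: sum.not_neutral_contains_not_neutral)

text \<open>By bilinearity \<open>u\<close> and \<open>v\<close> may be basis elements
  \<open>c\<close> and \<open>d\<close>. The support conditions make \<open>c # N @ [d]\<close> a
  composable word with the same generator as the given one, so \<open>K_gen\<close> applies to it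
  with the same inner value.\<close>

lemma ev_outer:
  assumes \<phi>: "\<phi> \<in> K n" and L: "a # N @ [b] \<in> J (n + 2)"
    and u: "supp u \<subseteq> {c \<in> B. t c = t a}" and v: "supp v \<subseteq> {d \<in> B. s d = s b}"
  shows "ev (n + 2) \<phi> (outer N u v) = mul u (mul (\<lambda>c. \<phi> (t a # N @ [s b], c)) v)"
proof -
  have "finite (supp u)" using u finite_B by (auto intro: finite_subset)
  then show ?thesis using u
  proof (induct u rule: fun_supp_induct)
    case (unit k c)
    note c = unit
    have "finite (supp v)" using v finite_B by (auto intro: finite_subset)
    then show ?case using v
    proof (induct v rule: fun_supp_induct)
      case (unit k' d)
      have "c # N @ [d] \<in> J (n + 2)" using J_ends[OF L] c unit by auto
      with K_gen[OF \<phi> this] c unit show ?case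
        by (simp add: outer_smult unit_outer[symmetric] ev_smult ev_unit mul_smult_left mul_smult_right fun_eq_iff)
    qed (simp_all add: outer_add ev_add mul_add_right)
  qed (simp_all add: outer_add ev_add mul_add_left)
qed

text \<open>Acting on a word changes only its outer letters, hence not the generator it comes from;
  \<open>ev_outer\<close> and associativity then give bimodule linearity on words.\<close>

lemma ev_act:
  assumes \<phi>: "\<phi> \<in> K n" and f: "f \<in> bar (n + 2)"
  shows "ev (n + 2) \<phi> (Lm x (Rm y f)) = mul x (mul (ev (n + 2) \<phi> f) y)"
  using f
proof (induct f rule: bar_induct)
  case zero
  then show ?case using Lm_smult[of x 0 "\<lambda>_. 0"] Rm_smult[of y 0 "\<lambda>_. 0"] by simp
next
  case (unit k L)
  then obtain a N b where L: "L = a # N @ [b]" "a \<in> B" "b \<in> B" by (auto elim: J_cases)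
  let ?\<psi> = "\<lambda>c. \<phi> (t a # N @ [s b], c)"
  have "ev (n + 2) \<phi> (Lm x (Rm y (unit_vec_at L))) =
    mul (mul x (unit_vec_at a)) (mul ?\<psi> (mul (unit_vec_at b) y))"
    unfolding L(1) unit_outer Lm_outer Rm_outer
    by (intro ev_outer[OF \<phi>] unit[unfolded L(1)] supp_mul_unit_right supp_mul_unit_left L)
  also have "\<dots> = mul x (mul (ev (n + 2) \<phi> (unit_vec_at L)) y)"
    unfolding ev_unit[OF unit] unfolding L(1) K_gen[OF \<phi> unit[unfolded L(1)]] by (simp add: mul_assoc)
  finally show ?case
    by (simp add: Rm_smult Lm_smult ev_smult mul_smult_left mul_smult_right)
qed (simp_all add: Rm_add Lm_add ev_add mul_add_left mul_add_right)

text \<open>Conversely, bimodule linearity applied to a word written as \<open>a\<close> times its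
  generator times \<open>b\<close> is the second condition in \<open>K\<close>. This is the
  convenient way to show membership.\<close>

lemma K_I:
  assumes "\<And>L b. \<phi> (L, b) \<noteq> 0 \<Longrightarrow> L \<in> J (n + 2) \<and> b \<in> B"
    and "\<And>x y f. x \<in> V \<Longrightarrow> y \<in> V \<Longrightarrow> f \<in> bar (n + 2) \<Longrightarrow>
      ev (n + 2) \<phi> (Lm x (Rm y f)) = mul x (mul (ev (n + 2) \<phi> f) y)"
  shows "\<phi> \<in> K n"
proof -
  have "(\<lambda>b. \<phi> (L, b)) = mul (unit_vec_at (hd L)) (mul (\<lambda>b. \<phi> (gen L, b)) (unit_vec_at (last L)))"
    if LJ: "L \<in> J (n + 2)" for L
  proof -
    from LJ obtain a N b where L: "L = a # N @ [b]" "a \<in> B" "b \<in> B" by (auto elim: J_cases)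
    have g: "t a # N @ [s b] \<in> J (n + 2)" using LJ unfolding L(1) by (rule J_gen)
    have "(\<lambda>b. \<phi> (L, b)) = ev (n + 2) \<phi> (unit_vec_at L)" by (simp add: ev_unit[OF LJ])
    also have "\<dots> = ev (n + 2) \<phi> (Lm (unit_vec_at a) (Rm (unit_vec_at b) (unit_vec_at (t a # N @ [s b]))))"
      using unit_from_gen[OF L(2,3)] L(1) by simp
    also have "\<dots> = mul (unit_vec_at a) (mul (ev (n + 2) \<phi> (unit_vec_at (t a # N @ [s b]))) (unit_vec_at b))"
      using L g by (intro assms(2)) auto
    finally show ?thesis by (simp add: L(1) ev_unit[OF g])
  qed
  with assms(1) show ?thesis by (simp add: K_def)
qed

lemma K_zero: "(\<lambda>_. 0) \<in> K n"
  by (simp add: K_def)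

lemma K_add: "\<phi> \<in> K n \<Longrightarrow> \<psi> \<in> K n \<Longrightarrow> (\<lambda>i. \<phi> i + \<psi> i) \<in> K n"
proof (rule K_I)
  assume "\<phi> \<in> K n" "\<psi> \<in> K n"
  then show "ev (n + 2) (\<lambda>i. \<phi> i + \<psi> i) (Lm x (Rm y f)) = mul x (mul (ev (n + 2) (\<lambda>i. \<phi> i + \<psi> i) f) y)"
    if "f \<in> bar (n + 2)" for x y f
    using that by (simp add: ev_add_left ev_act mul_add_left mul_add_right)
  fix L b assume a: "\<phi> (L, b) + \<psi> (L, b) \<noteq> 0"
  have "\<phi> (L, b) \<noteq> 0 \<or> \<psi> (L, b) \<noteq> 0" using a by auto
  then show "L \<in> J (n + 2) \<and> b \<in> B" using \<open>\<phi> \<in> K n\<close> \<open>\<psi> \<in> K n\<close> K_supp by blast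
qed

lemma K_smult: "\<phi> \<in> K n \<Longrightarrow> (\<lambda>i. c * \<phi> i) \<in> K n"
proof (rule K_I)
  assume "\<phi> \<in> K n"
  then show "ev (n + 2) (\<lambda>i. c * \<phi> i) (Lm x (Rm y f)) = mul x (mul (ev (n + 2) (\<lambda>i. c * \<phi> i) f) y)"
    if "f \<in> bar (n + 2)" for x y f
    using that by (simp add: ev_smult_left ev_act mul_smult_left mul_smult_right)
  fix L b assume "c * \<phi> (L, b) \<noteq> 0"
  then show "L \<in> J (n + 2) \<and> b \<in> B" using \<open>\<phi> \<in> K n\<close> K_supp by auto
qed

lemma K_del: "\<phi> \<in> K n \<Longrightarrow> del (n + 2) \<phi> \<in> K (Suc n)"
proof (rule K_I)
  assume \<phi>: "\<phi> \<in> K n"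
  fix L b assume nz: "del (n + 2) \<phi> (L, b) \<noteq> 0"
  then have L: "L \<in> J (Suc n + 2)" by (auto simp: del_def split: if_splits)
  with nz have "ev (n + 2) \<phi> (\<lambda>M. bd M (unit_vec_at L)) b \<noteq> 0" by (simp add: del_simp)
  then show "L \<in> J (Suc n + 2) \<and> b \<in> B" using ev_V[OF \<phi>] L by (auto simp: V_def)
next
  assume \<phi>: "\<phi> \<in> K n"
  fix x y f assume f: "f \<in> bar (Suc n + 2)"
  have f': "f \<in> bar (Suc (n + 2))" using f by simp
  have bf: "(\<lambda>M. bd M f) \<in> bar (n + 2)" using f' by (rule bar_bd) simp
  have "Lm x (Rm y f) \<in> bar (Suc (n + 2))" using f' by (intro bar_Lm bar_Rm)
  then have "ev (Suc (n + 2)) (del (n + 2) \<phi>) (Lm x (Rm y f)) = ev (n + 2) \<phi> (\<lambda>M. bd M (Lm x (Rm y f)))"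
    by (rule ev_del)
  also have "(\<lambda>M. bd M (Lm x (Rm y f))) = Lm x (Rm y (\<lambda>M. bd M f))"
    by (simp add: bd_Lm bd_Rm fun_eq_iff Lm_def split: list.split)
  also have "ev (n + 2) \<phi> \<dots> = mul x (mul (ev (n + 2) \<phi> (\<lambda>M. bd M f)) y)"
    by (rule ev_act[OF \<phi> bf])
  also have "ev (n + 2) \<phi> (\<lambda>M. bd M f) = ev (Suc (n + 2)) (del (n + 2) \<phi>) f"
    by (rule ev_del[OF f', symmetric])
  finally show "ev (Suc n + 2) (del (n + 2) \<phi>) (Lm x (Rm y f)) = mul x (mul (ev (Suc n + 2) (del (n + 2) \<phi>) f) y)"
    by simp
qed

abbreviation \<delta> :: "nat \<Rightarrow> ('b list \<times> 'b \<Rightarrow> 'k) \<Rightarrow> 'b list \<times> 'b \<Rightarrow> 'k" where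
  "\<delta> n \<equiv> del (n + 2)"

end

section \<open>Hochschild cohomology of a based algebra\<close>

text \<open>\<open>\<Gamma>\<close> is an algebra isomorphism from coordinate vectors onto
  \<open>A\<close>. It separates the combinatorics of \<open>lincat\<close> from the actual
  elements, which will be cosets.\<close>

locale presented = lincat B s t \<mu> + A: kalg A
  for B :: "'b set" and s t :: "'b \<Rightarrow> 'b" and \<mu> :: "'b \<Rightarrow> 'b \<Rightarrow> 'b \<Rightarrow> 'k::field"
    and A :: "('k, 'a) module" +
  fixes \<Gamma> :: "('b \<Rightarrow> 'k) \<Rightarrow> 'a"
  assumes \<Gamma>_closed [simp]: "x \<in> V \<Longrightarrow> \<Gamma> x \<in> carrier A"
    and \<Gamma>_add: "x \<in> V \<Longrightarrow> y \<in> V \<Longrightarrow> \<Gamma> (\<lambda>b. x b + y b) = \<Gamma> x \<oplus>\<^bsub>A\<^esub> \<Gamma> y"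
    and \<Gamma>_smult: "x \<in> V \<Longrightarrow> \<Gamma> (\<lambda>b. c * x b) = c \<odot>\<^bsub>A\<^esub> \<Gamma> x"
    and \<Gamma>_mul: "x \<in> V \<Longrightarrow> y \<in> V \<Longrightarrow> \<Gamma> (mul x y) = \<Gamma> x \<otimes>\<^bsub>A\<^esub> \<Gamma> y"
    and \<Gamma>_one: "\<Gamma> one = \<one>\<^bsub>A\<^esub>"
    and \<Gamma>_inj: "x \<in> V \<Longrightarrow> y \<in> V \<Longrightarrow> \<Gamma> x = \<Gamma> y \<Longrightarrow> x = y"
    and \<Gamma>_surj: "a \<in> carrier A \<Longrightarrow> \<exists>x\<in>V. \<Gamma> x = a"
begin

definition co :: "'a \<Rightarrow> 'b \<Rightarrow> 'k" where "co a = (THE x. x \<in> V \<and> \<Gamma> x = a)"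

lemma co_\<Gamma> [simp]: "x \<in> V \<Longrightarrow> co (\<Gamma> x) = x"
  unfolding co_def using \<Gamma>_inj by (intro the_equality) auto

lemma co: "a \<in> carrier A \<Longrightarrow> co a \<in> V" "a \<in> carrier A \<Longrightarrow> \<Gamma> (co a) = a"
  using \<Gamma>_surj[of a] by auto

lemma co_add: "a \<in> carrier A \<Longrightarrow> b \<in> carrier A \<Longrightarrow> co (a \<oplus>\<^bsub>A\<^esub> b) = (\<lambda>i. co a i + co b i)"
  using co_\<Gamma>[OF V_add[OF co(1)[of a] co(1)[of b]]] \<Gamma>_add[OF co(1)[of a] co(1)[of b]] by (simp add: co)

lemma co_smult: "a \<in> carrier A \<Longrightarrow> co (c \<odot>\<^bsub>A\<^esub> a) = (\<lambda>i. c * co a i)"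
  using co_\<Gamma>[OF V_smult[OF co(1)[of a], of c]] \<Gamma>_smult[OF co(1)[of a], of c] by (simp add: co)

lemma co_mult: "a \<in> carrier A \<Longrightarrow> b \<in> carrier A \<Longrightarrow> co (a \<otimes>\<^bsub>A\<^esub> b) = mul (co a) (co b)"
  using co_\<Gamma>[OF mul_V[of "co a" "co b"]] \<Gamma>_mul[OF co(1)[of a] co(1)[of b]] by (simp add: co)

lemma co_one: "co \<one>\<^bsub>A\<^esub> = one"
  using co_\<Gamma>[OF one_V] by (simp add: \<Gamma>_one)

lemma \<Gamma>_zero [simp]: "\<Gamma> (\<lambda>_. 0) = \<zero>\<^bsub>A\<^esub>"
  using \<Gamma>_smult[OF one_V, of 0] by (simp add: \<Gamma>_one)

abbreviation \<gamma> :: "'b \<Rightarrow> 'a" where "\<gamma> b \<equiv> \<Gamma> (unit_vec_at b)"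

lemma \<gamma>_inj: "inj_on \<gamma> B"
proof (rule inj_onI)
  fix a b assume "a \<in> B" "b \<in> B" "\<gamma> a = \<gamma> b"
  then have "unit_vec_at a = (unit_vec_at b :: 'b \<Rightarrow> 'k)" by (intro \<Gamma>_inj) auto
  then have "unit_vec_at a a = (unit_vec_at b a :: 'k)" by simp
  then show "a = b" by (simp add: unit_vec_at_def split: if_splits)
qed

section \<open>The bar resolution in the type prescribed by Ext\<close>

text \<open>
  The terms of the bar resolution are moved into the type that \<^const>\<open>Ext\<close> prescribes: a word \<open>L\<close> is
  coded as a list of pairs whose second components are the basis elements, a scalar \<open>c\<close> as \<open>{\<lambda>_. c}\<close>.
\<close>

definition enc :: "('b list \<Rightarrow> 'k) \<Rightarrow> (('a \<times> 'a \<Rightarrow> 'k) set \<times> 'a) list \<Rightarrow> ('a \<times> 'a \<Rightarrow> 'k) set" where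
  "enc f = (\<lambda>P. {\<lambda>_. f (map (\<lambda>p. inv_into B \<gamma> (snd p)) P)})"

text \<open>\<open>enc\<close> ignores the first components of the pairs and codes a scalar as a
  constant function, so both occurrences of \<open>undefined\<close> are harmless. The guard keeps
  to words on which \<open>inv_into B \<gamma>\<close> really inverts
  \<open>\<gamma>\<close>.\<close>

definition dec :: "((('a \<times> 'a \<Rightarrow> 'k) set \<times> 'a) list \<Rightarrow> ('a \<times> 'a \<Rightarrow> 'k) set) \<Rightarrow> 'b list \<Rightarrow> 'k" where
  "dec X L = (if set L \<subseteq> B then the_elem (X (map (\<lambda>b. (undefined, \<gamma> b)) L)) undefined else 0)"

lemma dec_enc [simp]: "f \<in> bar m \<Longrightarrow> dec (enc f) = f"
proof
  fix L assume f: "f \<in> bar m"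
  show "dec (enc f) L = f L"
  proof (cases "set L \<subseteq> B")
    case True
    then have "map (\<lambda>b. inv_into B \<gamma> (\<gamma> b)) L = L"
      by (intro map_idI) (auto simp: inv_into_f_f[OF \<gamma>_inj])
    then show ?thesis using True by (simp add: dec_def enc_def comp_def)
  next
    case False
    then show ?thesis using barD[OF f, of L] by (auto simp: dec_def J_def)
  qed
qed

definition barmod :: "nat \<Rightarrow> ('k, (('a \<times> 'a \<Rightarrow> 'k) set \<times> 'a) list \<Rightarrow> ('a \<times> 'a \<Rightarrow> 'k) set) module" where
  "barmod m = \<lparr>carrier = enc ` bar m, mult = undefined, one = undefined, zero = enc (\<lambda>_. 0),
     add = (\<lambda>X Y. enc (\<lambda>L. dec X L + dec Y L)), smult = (\<lambda>c X. enc (\<lambda>L. c * dec X L))\<rparr>"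

lemma barmod_simps [simp]:
  "carrier (barmod m) = enc ` bar m" "zero (barmod m) = enc (\<lambda>_. 0)"
  "X \<oplus>\<^bsub>barmod m\<^esub> Y = enc (\<lambda>L. dec X L + dec Y L)" "c \<odot>\<^bsub>barmod m\<^esub> X = enc (\<lambda>L. c * dec X L)"
  by (simp_all add: barmod_def)

lemma dec_bar: "X \<in> enc ` bar m \<Longrightarrow> dec X \<in> bar m" "X \<in> enc ` bar m \<Longrightarrow> enc (dec X) = X"
  by auto

lemma dec_enc_add [simp]: "f \<in> bar m \<Longrightarrow> g \<in> bar m \<Longrightarrow> dec (enc (\<lambda>L. f L + g L)) = (\<lambda>L. f L + g L)"
  by (rule dec_enc[OF bar_add])

lemma dec_enc_smult [simp]: "f \<in> bar m \<Longrightarrow> dec (enc (\<lambda>L. c * f L)) = (\<lambda>L. c * f L)"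
  by (rule dec_enc[OF bar_smult])

lemma dec_enc_zero [simp]: "dec (enc (\<lambda>_. 0)) = (\<lambda>_. 0)"
  by (rule dec_enc[OF bar_zero])

lemma barmod_kvs: "kvs (barmod m)"
proof -
  have "abelian_group (barmod m)"
  proof (rule abelian_groupI, goal_cases)
    case (6 X)
    then obtain f where f: "f \<in> bar m" "X = enc f" by auto
    have "enc (\<lambda>L. - 1 * f L) \<in> carrier (barmod m)" using bar_smult[OF f(1), of "-1"] by simp
    moreover have "enc (\<lambda>L. - 1 * f L) \<oplus>\<^bsub>barmod m\<^esub> X = \<zero>\<^bsub>barmod m\<^esub>"
      using f dec_enc_smult[OF f(1), of "-1"] by (simp add: dec_enc[OF f(1)])
    ultimately show ?case unfolding Bex_def by (intro exI[of _ "enc (\<lambda>L. - 1 * f L)"] conjI)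
  next
    case (1 X Y) then show ?case by (auto intro!: imageI bar_add simp: dec_enc)
  next
    case (3 X Y Z)
    then obtain f g h where "f \<in> bar m" "X = enc f" "g \<in> bar m" "Y = enc g" "h \<in> bar m" "Z = enc h" by auto
    then show ?case by (simp add: dec_enc_add[of f m g] dec_enc_add[of g m h] dec_enc[of f m] dec_enc[of g m] dec_enc[of h m] add.assoc)
  next
    case (4 X Y) then show ?case by (simp add: add.commute)
  next
    case (5 X) then show ?case by (auto simp: dec_bar)
  qed (auto intro: imageI)
  moreover have "kvs_axioms (barmod m)"
  proof unfold_locales
    fix X c assume "X \<in> carrier (barmod m)"
    then obtain f where f: "f \<in> bar m" "X = enc f" by auto
    note [simp] = dec_enc[OF f(1)] dec_enc_smult[OF f(1)]
    show "c \<odot>\<^bsub>barmod m\<^esub> X \<in> carrier (barmod m)" using bar_smult[OF f(1), of c] f by simp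
    show "1 \<odot>\<^bsub>barmod m\<^esub> X = X" using f by simp
    fix d
    show "(c + d) \<odot>\<^bsub>barmod m\<^esub> X = c \<odot>\<^bsub>barmod m\<^esub> X \<oplus>\<^bsub>barmod m\<^esub> d \<odot>\<^bsub>barmod m\<^esub> X"
      using f by (simp add: distrib_right)
    show "(c * d) \<odot>\<^bsub>barmod m\<^esub> X = c \<odot>\<^bsub>barmod m\<^esub> (d \<odot>\<^bsub>barmod m\<^esub> X)"
      using f by (simp add: mult.assoc)
    fix Y assume "Y \<in> carrier (barmod m)"
    then obtain g where g: "g \<in> bar m" "Y = enc g" by auto
    note [simp] = dec_enc[OF g(1)] dec_enc_smult[OF g(1)] dec_enc_add[OF f(1) g(1)]
    show "c \<odot>\<^bsub>barmod m\<^esub> (X \<oplus>\<^bsub>barmod m\<^esub> Y) = c \<odot>\<^bsub>barmod m\<^esub> X \<oplus>\<^bsub>barmod m\<^esub> c \<odot>\<^bsub>barmod m\<^esub> Y"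
      using f g by (simp add: distrib_left)
  qed
  ultimately show ?thesis by (rule kvs.intro)
qed

definition bact :: "'a \<Rightarrow> 'a \<Rightarrow> ((('a \<times> 'a \<Rightarrow> 'k) set \<times> 'a) list \<Rightarrow> ('a \<times> 'a \<Rightarrow> 'k) set) \<Rightarrow>
    (('a \<times> 'a \<Rightarrow> 'k) set \<times> 'a) list \<Rightarrow> ('a \<times> 'a \<Rightarrow> 'k) set" where
  "bact a b X = enc (Lm (co a) (Rm (co b) (dec X)))"

lemma bact_enc: "f \<in> bar m \<Longrightarrow> bact a b (enc f) = enc (Lm (co a) (Rm (co b) f))"
  by (simp add: bact_def)

lemma bar_act: "f \<in> bar m \<Longrightarrow> Lm x (Rm y f) \<in> bar m"
  by (intro bar_Lm bar_Rm)

text \<open>The bound on \<open>m\<close> is for the unit law: multiplication by \<open>one\<close>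
  restores a word only through one of its letters and sends the empty word to zero.\<close>

lemma barmod_kbimod:
  assumes m: "m \<ge> 1" shows "kbimod A (barmod m) bact"
proof -
  interpret N: kvs "barmod m" by (rule barmod_kvs)
  show ?thesis
  proof (intro kbimod.intro kbimod_axioms.intro A.kalg_axioms N.kvs_axioms)
    fix a b X assume ab: "a \<in> carrier A" "b \<in> carrier A" and "X \<in> carrier (barmod m)"
    then obtain f where f: "f \<in> bar m" "X = enc f" by auto
    note [simp] = dec_enc[OF f(1)] dec_enc[OF bar_act[OF f(1)]] bact_enc[OF f(1)] bact_enc[OF bar_smult[OF f(1)]]
       bact_enc[OF bar_act[OF f(1)]]
    show "bact a b X \<in> carrier (barmod m)" using f by (auto intro!: imageI bar_act)
    show "bact a b (c \<odot>\<^bsub>barmod m\<^esub> X) = c \<odot>\<^bsub>barmod m\<^esub> bact a b X" for c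
      using f by (simp add: Rm_smult Lm_smult)
    show "bact (c \<odot>\<^bsub>A\<^esub> a) b X = c \<odot>\<^bsub>barmod m\<^esub> bact a b X" for c
      using f ab by (simp add: co_smult Lm_smult_left)
    show "bact a (c \<odot>\<^bsub>A\<^esub> b) X = c \<odot>\<^bsub>barmod m\<^esub> bact a b X" for c
      using f ab by (simp add: co_smult Rm_smult_left Lm_smult)
    fix a' assume a': "a' \<in> carrier A"
    show "bact (a \<oplus>\<^bsub>A\<^esub> a') b X = bact a b X \<oplus>\<^bsub>barmod m\<^esub> bact a' b X"
      using f ab a' by (simp add: co_add Lm_add_left)
    show "bact a (b \<oplus>\<^bsub>A\<^esub> a') X = bact a b X \<oplus>\<^bsub>barmod m\<^esub> bact a a' X"
      using f ab a' by (simp add: co_add Rm_add_left Lm_add)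
    fix b' assume b': "b' \<in> carrier A"
    show "bact (a \<otimes>\<^bsub>A\<^esub> a') (b' \<otimes>\<^bsub>A\<^esub> b) X = bact a b (bact a' b' X)"
      using f ab a' b' by (simp add: co_mult Lm_mul Rm_mul flip: Lm_Rm)
  next
    fix a b X Y assume ab: "a \<in> carrier A" "b \<in> carrier A" and "X \<in> carrier (barmod m)" "Y \<in> carrier (barmod m)"
    then obtain f g where f: "f \<in> bar m" "X = enc f" and g: "g \<in> bar m" "Y = enc g" by auto
    then show "bact a b (X \<oplus>\<^bsub>barmod m\<^esub> Y) = bact a b X \<oplus>\<^bsub>barmod m\<^esub> bact a b Y"
      by (simp add: dec_enc[OF f(1)] dec_enc[OF g(1)] dec_enc[OF bar_act[OF f(1)]] dec_enc[OF bar_act[OF g(1)]]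
        bact_enc[OF f(1)] bact_enc[OF g(1)] bact_enc[OF bar_add[OF f(1) g(1)]] Rm_add Lm_add)
  next
    fix X assume "X \<in> carrier (barmod m)"
    then obtain f where f: "f \<in> bar m" "X = enc f" by auto
    then show "bact \<one>\<^bsub>A\<^esub> \<one>\<^bsub>A\<^esub> X = X"
      using m by (simp add: bact_enc[OF f(1)] co_one Rm_one[OF f(1)] Lm_one[OF f(1)])
  qed
qed

definition barres :: "nat \<Rightarrow> (('a \<times> 'a \<Rightarrow> 'k) set, (('a \<times> 'a \<Rightarrow> 'k) set \<times> 'a) list \<Rightarrow> ('a \<times> 'a \<Rightarrow> 'k) set) module" where
  "barres n = env_module A (barmod (n + 2)) bact"

definition bardiff :: "nat \<Rightarrow> ((('a \<times> 'a \<Rightarrow> 'k) set \<times> 'a) list \<Rightarrow> ('a \<times> 'a \<Rightarrow> 'k) set) \<Rightarrow>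
    (('a \<times> 'a \<Rightarrow> 'k) set \<times> 'a) list \<Rightarrow> ('a \<times> 'a \<Rightarrow> 'k) set" where
  "bardiff n X = enc (\<lambda>M. bd M (dec X))"

lemma left_module_barres: "left_module (env_alg A) (barres n)"
  unfolding barres_def by (intro kbimod.left_module_env_module barmod_kbimod) simp

lemma barres_simps [simp]:
  "carrier (barres n) = enc ` bar (n + 2)" "zero (barres n) = enc (\<lambda>_. 0)"
  "X \<oplus>\<^bsub>barres n\<^esub> Y = enc (\<lambda>L. dec X L + dec Y L)"
  by (simp_all add: barres_def)

lemma barres_pure:
  assumes "a \<in> carrier A" "b \<in> carrier A" "f \<in> bar (n + 2)"
  shows "pure_tensor A a b \<odot>\<^bsub>barres n\<^esub> enc f = enc (Lm (co a) (Rm (co b) f))"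
proof -
  interpret kbimod A "barmod (n + 2)" bact by (rule barmod_kbimod) simp
  show ?thesis unfolding barres_def using assms by (simp add: env_module_pure bact_enc)
qed

lemma bimod_pure:
  assumes "a \<in> carrier A" "b \<in> carrier A" "x \<in> carrier A"
  shows "pure_tensor A a b \<odot>\<^bsub>bimod A\<^esub> x = a \<otimes>\<^bsub>A\<^esub> x \<otimes>\<^bsub>A\<^esub> b"
  unfolding bimod_env_module by (rule kbimod.env_module_pure[OF A.kbimod_self assms])

lemma bimod_simps [simp]:
  "carrier (bimod A) = carrier A" "zero (bimod A) = zero A" "add (bimod A) = add A"
  by (simp_all add: bimod_def)

lemma bar_bd': "f \<in> bar (Suc n + 2) \<Longrightarrow> (\<lambda>M. bd M f) \<in> bar (n + 2)"
  by (rule bar_bd) simp_all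

lemma bardiff_hom: "bardiff n \<in> module_hom (env_alg A) (barres (Suc n)) (barres n)"
proof (rule A.module_hom_envI[OF left_module_barres left_module_barres])
  fix X assume "X \<in> carrier (barres (Suc n))"
  then obtain f where f: "f \<in> bar (Suc n + 2)" "X = enc f" by auto
  show "bardiff n X \<in> carrier (barres n)"
    using f bar_bd'[OF f(1)] by (auto simp: bardiff_def dec_enc[OF f(1)])
  fix Y assume "Y \<in> carrier (barres (Suc n))"
  then obtain g where g: "g \<in> bar (Suc n + 2)" "Y = enc g" by auto
  show "bardiff n (X \<oplus>\<^bsub>barres (Suc n)\<^esub> Y) = bardiff n X \<oplus>\<^bsub>barres n\<^esub> bardiff n Y"
    by (simp add: bardiff_def f g dec_enc[OF f(1)] dec_enc[OF g(1)] dec_enc_add[OF f(1) g(1)] bd_add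
      dec_enc[OF bar_bd'[OF f(1)]] dec_enc[OF bar_bd'[OF g(1)]])
next
  fix a b X assume ab: "a \<in> carrier A" "b \<in> carrier A" and "X \<in> carrier (barres (Suc n))"
  then obtain f where f: "f \<in> bar (Suc n + 2)" "X = enc f" by auto
  then show "bardiff n (pure_tensor A a b \<odot>\<^bsub>barres (Suc n)\<^esub> X) = pure_tensor A a b \<odot>\<^bsub>barres n\<^esub> bardiff n X"
    by (simp add: bardiff_def barres_pure[OF ab f(1)] barres_pure[OF ab bar_bd'[OF f(1)]] dec_enc[OF f(1)]
        dec_enc[OF bar_act[OF f(1)]] bd_act)
qed

lemma bar_one_eq: "f \<in> bar 1 \<Longrightarrow> f L = (case L of [b] \<Rightarrow> f [b] | _ \<Rightarrow> 0)"
  using barD[of f 1 L] by (cases L rule: list.exhaust; cases "tl L") (auto simp: J_def split: list.splits)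

lemma bar_one_V: "f \<in> bar 1 \<Longrightarrow> (\<lambda>b. f [b]) \<in> V"
  using barD[of f 1 "[_]"] by (auto simp: V_def J_def)

text \<open>The augmentation is multiplication of the two letters, which is the bar differential on
  words of length two once one-letter words are read as elements of \<open>A\<close>. Surjectivity
  and exactness then both come from \<open>bd_hh\<close>.\<close>

lemma bar_res_augmentation:
  "augmentation (env_alg A) (bimod A) barres bardiff (\<lambda>X. \<Gamma> (\<lambda>b. bd [b] (dec X)))"
  unfolding augmentation_def
proof (intro conjI)
  let ?\<epsilon> = "\<lambda>X. \<Gamma> (\<lambda>b. bd [b] (dec X))"
  have b1: "(\<lambda>M. bd M f) \<in> bar 1" if "f \<in> bar (0 + 2)" for f
    using that by (intro bar_bd) (simp_all add: numeral_2_eq_2)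
  have bV: "(\<lambda>b. bd [b] f) \<in> V" if "f \<in> bar (0 + 2)" for f
    using bar_one_V[OF b1[OF that]] .
  show hom: "?\<epsilon> \<in> module_hom (env_alg A) (barres 0) (bimod A)"
  proof (rule A.module_hom_envI[OF left_module_barres A.left_module_bimod])
    fix X assume "X \<in> carrier (barres 0)"
    then obtain f where f: "f \<in> bar (0 + 2)" "X = enc f" by auto
    show "?\<epsilon> X \<in> carrier (bimod A)"
      using bV[OF f(1)] unfolding f(2) dec_enc[OF f(1)] bimod_simps by (rule \<Gamma>_closed)
    fix Y assume "Y \<in> carrier (barres 0)"
    then obtain g where g: "g \<in> bar (0 + 2)" "Y = enc g" by auto
    show "?\<epsilon> (X \<oplus>\<^bsub>barres 0\<^esub> Y) = ?\<epsilon> X \<oplus>\<^bsub>bimod A\<^esub> ?\<epsilon> Y"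
      unfolding f(2) g(2) barres_simps bimod_simps dec_enc[OF f(1)] dec_enc[OF g(1)] dec_enc_add[OF f(1) g(1)] bd_add
      by (rule \<Gamma>_add[OF bV[OF f(1)] bV[OF g(1)]])
  next
    fix a b X assume ab: "a \<in> carrier A" "b \<in> carrier A" and "X \<in> carrier (barres 0)"
    then obtain f where f: "f \<in> bar (0 + 2)" "X = enc f" by auto
    have "?\<epsilon> (pure_tensor A a b \<odot>\<^bsub>barres 0\<^esub> X) = \<Gamma> (\<lambda>c. Lm (co a) (Rm (co b) (\<lambda>M. bd M f)) [c])"
      unfolding f(2) barres_pure[OF ab f(1)] dec_enc[OF bar_act[OF f(1)]] bd_act[symmetric] ..
    also have "\<dots> = \<Gamma> (mul (co a) (mul (\<lambda>c. bd [c] f) (co b)))" unfolding bar_one_act ..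
    also have "\<dots> = a \<otimes>\<^bsub>A\<^esub> (\<Gamma> (\<lambda>c. bd [c] f) \<otimes>\<^bsub>A\<^esub> b)"
      using bV[OF f(1)] ab by (simp only: \<Gamma>_mul mul_V co)
    also have "\<dots> = pure_tensor A a b \<odot>\<^bsub>bimod A\<^esub> ?\<epsilon> X"
      using \<Gamma>_closed[OF bV[OF f(1)]] ab unfolding f(2) dec_enc[OF f(1)] by (simp only: bimod_pure A.m_assoc)
    finally show "?\<epsilon> (pure_tensor A a b \<odot>\<^bsub>barres 0\<^esub> X) = pure_tensor A a b \<odot>\<^bsub>bimod A\<^esub> ?\<epsilon> X" .
  qed
  have sub: "?\<epsilon> ` carrier (barres 0) \<subseteq> carrier (bimod A)" using module_homD(1)[OF hom] by blast
  have "a \<in> ?\<epsilon> ` carrier (barres 0)" if a: "a \<in> carrier A" for a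
  proof -
    \<comment> \<open>The coordinates of \<open>a\<close> as a combination of one-letter words.
      \<open>hh f\<close> puts an identity in front of each, and multiplying the two letters gives
      \<open>a\<close> back.\<close>
    define f where "f L = (case L of [b] \<Rightarrow> co a b | _ \<Rightarrow> 0)" for L
    have f: "f \<in> bar 1"
      using co(1)[OF a] by (intro barI) (auto simp: f_def J_def V_def split: list.splits)
    have h: "hh f \<in> bar (0 + 2)" using bar_hh[OF f] by (simp add: numeral_2_eq_2)
    have "bd [b] (hh f) = co a b" for b
      using bd_hh[OF f, of "[b]"] bd_bar_one[OF f] by (simp add: f_def hh_def)
    then have "?\<epsilon> (enc (hh f)) = a" unfolding dec_enc[OF h] by (simp only: co[OF a])
    then show ?thesis using h by (auto intro!: image_eqI)
  qed
  with sub show "?\<epsilon> ` carrier (barres 0) = carrier (bimod A)" by auto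
  show "{X \<in> carrier (barres 0). ?\<epsilon> X = \<zero>\<^bsub>bimod A\<^esub>} = bardiff 0 ` carrier (barres (Suc 0))"
  proof (intro equalityI subsetI)
    fix X assume X: "X \<in> {X \<in> carrier (barres 0). ?\<epsilon> X = \<zero>\<^bsub>bimod A\<^esub>}"
    then obtain f where f: "f \<in> bar (0 + 2)" "X = enc f" by auto
    have "\<Gamma> (\<lambda>b. bd [b] f) = \<Gamma> (\<lambda>_. 0)"
    proof -
      from X have "?\<epsilon> X = \<zero>\<^bsub>A\<^esub>" by simp
      then show ?thesis unfolding f(2) dec_enc[OF f(1)] \<Gamma>_zero .
    qed
    then have "(\<lambda>b. bd [b] f) = (\<lambda>_. 0)" by (intro \<Gamma>_inj bV f) simp
    then have z: "bd M f = 0" for M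
      using bar_one_eq[OF b1[OF f(1)], of M] by (auto split: list.splits simp: fun_eq_iff)
    have h: "hh f \<in> bar (Suc 0 + 2)" using bar_hh[OF f(1)] by simp
    have "bd M (hh f) = f M" for M
      using bd_hh[OF f(1), of M] z by (simp add: hh_def split: list.splits)
    then have "X = bardiff 0 (enc (hh f))" unfolding bardiff_def dec_enc[OF h] f(2) by simp
    then show "X \<in> bardiff 0 ` carrier (barres (Suc 0))" using h by auto
  next
    fix X assume "X \<in> bardiff 0 ` carrier (barres (Suc 0))"
    then obtain f where f: "f \<in> bar (Suc 0 + 2)" "X = enc (\<lambda>M. bd M f)" by (auto simp: bardiff_def)
    have "?\<epsilon> X = \<zero>\<^bsub>A\<^esub>" unfolding f(2) dec_enc[OF bar_bd'[OF f(1)]] bd_bd by simp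
    then show "X \<in> {X \<in> carrier (barres 0). ?\<epsilon> X = \<zero>\<^bsub>bimod A\<^esub>}"
      using f bar_bd'[OF f(1)] by simp
  qed
qed

text \<open>If the boundary of \<open>f\<close> vanishes, the homotopy formula reads
  \<open>bd M (hh f) = f M\<close>, so \<open>hh f\<close> is the required preimage.\<close>

lemma bar_res_exact:
  "{X \<in> carrier (barres (Suc n)). bardiff n X = \<zero>\<^bsub>barres n\<^esub>} = bardiff (Suc n) ` carrier (barres (Suc (Suc n)))"
proof (intro equalityI subsetI)
  fix X assume X: "X \<in> {X \<in> carrier (barres (Suc n)). bardiff n X = \<zero>\<^bsub>barres n\<^esub>}"
  then obtain f where f: "f \<in> bar (Suc n + 2)" "X = enc f" by auto
  have "enc (\<lambda>M. bd M f) = enc (\<lambda>_. 0)"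
  proof -
    from X have "bardiff n X = enc (\<lambda>_. 0)" by simp
    then show ?thesis unfolding f(2) bardiff_def dec_enc[OF f(1)] .
  qed
  then have "dec (enc (\<lambda>M. bd M f)) = dec (enc (\<lambda>_. 0))" by simp
  then have z: "bd M f = 0" for M unfolding dec_enc[OF bar_bd'[OF f(1)]] by (simp add: fun_eq_iff)
  have h: "hh f \<in> bar (Suc (Suc n) + 2)" using bar_hh[OF f(1)] by simp
  have "bd M (hh f) = f M" for M
    using bd_hh[OF f(1), of M] z by (simp add: hh_def split: list.splits)
  then have "X = bardiff (Suc n) (enc (hh f))" unfolding bardiff_def dec_enc[OF h] f(2) by simp
  then show "X \<in> bardiff (Suc n) ` carrier (barres (Suc (Suc n)))" using h by auto
next
  fix X assume "X \<in> bardiff (Suc n) ` carrier (barres (Suc (Suc n)))"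
  then obtain f where f: "f \<in> bar (Suc (Suc n) + 2)" "X = enc (\<lambda>M. bd M f)" by (auto simp: bardiff_def)
  have "bardiff n X = enc (\<lambda>_. 0)" unfolding bardiff_def f(2) dec_enc[OF bar_bd'[OF f(1)]] bd_bd ..
  then show "X \<in> {X \<in> carrier (barres (Suc n)). bardiff n X = \<zero>\<^bsub>barres n\<^esub>}"
    using f bar_bd'[OF f(1)] by simp
qed

section \<open>Projectivity of the bar terms\<close>

abbreviation pt :: "'b list \<Rightarrow> ('a \<times> 'a \<Rightarrow> 'k) set" where
  "pt L \<equiv> pure_tensor A (\<gamma> (hd L)) (\<gamma> (last L))"

definition gens :: "nat \<Rightarrow> 'b list set" where "gens n = gen ` J (n + 2)"

text \<open>The definition of a projective module indexes the free module by elements of the type of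
  \<open>P\<close> itself, so the generating words are used in their encoded form.\<close>

definition gmod :: "'b list \<Rightarrow> (('a \<times> 'a \<Rightarrow> 'k) set \<times> 'a) list \<Rightarrow> ('a \<times> 'a \<Rightarrow> 'k) set" where
  "gmod g = enc (unit_vec_at g)"

text \<open>The coefficient of \<open>f\<close> at the generator \<open>g\<close> in the enveloping
  algebra: a word with that generator contributes its first letter tensored with its last.\<close>

definition gcoeff :: "nat \<Rightarrow> 'b list \<Rightarrow> ('b list \<Rightarrow> 'k) \<Rightarrow> ('a \<times> 'a \<Rightarrow> 'k) set" where
  "gcoeff n g f = (\<Oplus>\<^bsub>env_alg A\<^esub>L\<in>{L \<in> J (n + 2). gen L = g}. f L \<odot>\<^bsub>env_alg A\<^esub> pt L)"

lemma gens_subset: "gens n \<subseteq> J (n + 2)"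
proof
  fix g assume "g \<in> gens n"
  then obtain L where L: "L \<in> J (n + 2)" "g = gen L" unfolding gens_def by auto
  from L(1) obtain a N b where "L = a # N @ [b]" by (auto elim: J_cases)
  with L J_gen show "g \<in> J (n + 2)" by simp
qed

lemma gmod_inj: "inj_on gmod (gens n)"
proof (rule inj_onI)
  fix g h assume gh: "g \<in> gens n" "h \<in> gens n" "gmod g = gmod h"
  then have "unit_vec_at g \<in> bar (n + 2)" "unit_vec_at h \<in> bar (n + 2)" using gens_subset[of n] by auto
  then have "unit_vec_at g = (unit_vec_at h :: 'b list \<Rightarrow> 'k)" using gh(3) dec_enc unfolding gmod_def by metis
  then have "unit_vec_at g g = (unit_vec_at h g :: 'k)" by simp
  then show "g = h" by (simp add: unit_vec_at_def split: if_splits)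
qed

lemma pt_closed [simp]: "L \<in> J (n + 2) \<Longrightarrow> pt L \<in> carrier (env_alg A)"
  by (auto elim!: J_cases)

lemma gcoeff_closed: "gcoeff n g f \<in> carrier (env_alg A)"
proof -
  interpret E: kalg "env_alg A" by (rule A.env_kalg)
  show ?thesis unfolding gcoeff_def by (intro E.finsum_closed) auto
qed

lemma gcoeff_add: "gcoeff n g (\<lambda>L. f L + h L) = gcoeff n g f \<oplus>\<^bsub>env_alg A\<^esub> gcoeff n g h"
proof -
  interpret E: kalg "env_alg A" by (rule A.env_kalg)
  show ?thesis unfolding gcoeff_def by (intro E.lin_comb_add) auto
qed

lemma gcoeff_smult: "gcoeff n g (\<lambda>L. c * f L) = c \<odot>\<^bsub>env_alg A\<^esub> gcoeff n g f"
proof -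
  interpret E: kalg "env_alg A" by (rule A.env_kalg)
  show ?thesis unfolding gcoeff_def by (intro E.lin_comb_smult) auto
qed

lemma gcoeff_zero: "gcoeff n g (\<lambda>L. 0) = \<zero>\<^bsub>env_alg A\<^esub>"
proof -
  interpret E: kalg "env_alg A" by (rule A.env_kalg)
  show ?thesis using gcoeff_smult[of n g 0 "\<lambda>_. 0"] gcoeff_closed by simp
qed

lemma gcoeff_unit:
  assumes "L \<in> J (n + 2)"
  shows "gcoeff n g (unit_vec_at L) = (if gen L = g then pt L else \<zero>\<^bsub>env_alg A\<^esub>)"
proof -
  interpret E: kalg "env_alg A" by (rule A.env_kalg)
  show ?thesis
  proof (cases "gen L = g")
    case True
    then show ?thesis unfolding gcoeff_def using assms by (subst E.lin_comb_unit) auto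
  next
    case False
    then have "gcoeff n g (unit_vec_at L) = (\<Oplus>\<^bsub>env_alg A\<^esub>L\<in>{L \<in> J (n + 2). gen L = g}. \<zero>\<^bsub>env_alg A\<^esub>)"
      unfolding gcoeff_def
    proof (intro E.finsum_cong' refl)
      fix M assume M: "M \<in> {L \<in> J (n + 2). gen L = g}"
      then have "unit_vec_at L M = (0 :: 'k)" using False by (auto simp: unit_vec_at_def)
      then show "unit_vec_at L M \<odot>\<^bsub>env_alg A\<^esub> pt M = \<zero>\<^bsub>env_alg A\<^esub>" using M pt_closed[of M n] by simp
    qed simp
    then show ?thesis using False by simp
  qed
qed

lemma gcoeff_outer:
  assumes L: "a # N @ [b] \<in> J (n + 2)"
    and u: "supp u \<subseteq> {c \<in> B. t c = t a}" and v: "supp v \<subseteq> {d \<in> B. s d = s b}"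
  shows "gcoeff n g (outer N u v) = (if t a # N @ [s b] = g then pure_tensor A (\<Gamma> u) (\<Gamma> v) else \<zero>\<^bsub>env_alg A\<^esub>)"
proof -
  interpret E: kalg "env_alg A" by (rule A.env_kalg)
  have sV: "w \<in> V" if "supp w \<subseteq> {c \<in> B. P c}" for w :: "'b \<Rightarrow> 'k" and P using that by (auto simp: V_iff_supp)
  have z: "pure_tensor A \<zero>\<^bsub>A\<^esub> x = \<zero>\<^bsub>env_alg A\<^esub>" "pure_tensor A x \<zero>\<^bsub>A\<^esub> = \<zero>\<^bsub>env_alg A\<^esub>" if "x \<in> carrier A" for x
    using A.pure_tensor_smult(1)[of "\<zero>\<^bsub>A\<^esub>" x 0] A.pure_tensor_smult(2)[of x "\<zero>\<^bsub>A\<^esub>" 0] that by simp_all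
  have fin: "finite (supp u)" "finite (supp v)" using u v finite_B by (auto intro: finite_subset)
  show ?thesis using fin(1) u
  proof (induct u rule: fun_supp_induct)
    case zero
    then show ?case using sV[OF v] by (simp add: gcoeff_zero z)
  next
    case (unit k c)
    note c = unit
    show ?case using fin(2) v
    proof (induct v rule: fun_supp_induct)
      case zero
      then show ?case using c by (simp add: gcoeff_zero z V_smult)
    next
      case (unit k' d)
      have M: "c # N @ [d] \<in> J (n + 2)" using J_ends[OF L] c unit by auto
      then show ?case using c unit
        by (simp add: outer_smult unit_outer[symmetric] gcoeff_smult gcoeff_unit \<Gamma>_smult A.pure_tensor_smult E.ks_assoc[symmetric] mult.commute)
    next
      case (add v v')
      then show ?case using c by (simp add: outer_add gcoeff_add \<Gamma>_add sV V_smult A.pure_tensor_add_right)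
    qed
  next
    case (add u u')
    then show ?case using sV[OF v] by (simp add: outer_add gcoeff_add \<Gamma>_add sV A.pure_tensor_add_left)
  qed
qed

text \<open>On a word both sides reduce to the rule that \<open>x \<otimes> y\<close> times
  \<open>a \<otimes> b\<close> is \<open>xa \<otimes> by\<close> in the enveloping algebra;
  \<open>gcoeff_outer\<close> handles the products \<open>xa\<close> and \<open>by\<close>, which
  are combinations of letters and no longer single ones.\<close>

lemma gcoeff_act:
  assumes f: "f \<in> bar (n + 2)" and xy: "x \<in> V" "y \<in> V"
  shows "gcoeff n g (Lm x (Rm y f)) = pure_tensor A (\<Gamma> x) (\<Gamma> y) \<otimes>\<^bsub>env_alg A\<^esub> gcoeff n g f"
  using f
proof (induct f rule: bar_induct)
  interpret E: kalg "env_alg A" by (rule A.env_kalg)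
  have p: "pure_tensor A (\<Gamma> x) (\<Gamma> y) \<in> carrier (env_alg A)" using xy by simp
  {
    case zero
    then show ?case using Lm_smult[of x 0 "\<lambda>_. 0"] Rm_smult[of y 0 "\<lambda>_. 0"] p by (simp add: gcoeff_zero)
  next
    case (unit k L)
    then obtain a N b where L: "L = a # N @ [b]" "a \<in> B" "b \<in> B" by (auto elim: J_cases)
    have "gcoeff n g (Lm x (Rm y (unit_vec_at L))) =
      (if t a # N @ [s b] = g then pure_tensor A (\<Gamma> (mul x (unit_vec_at a))) (\<Gamma> (mul (unit_vec_at b) y)) else \<zero>\<^bsub>env_alg A\<^esub>)"
      unfolding L(1) unit_outer Lm_outer Rm_outer
      by (intro gcoeff_outer unit[unfolded L(1)] supp_mul_unit_right supp_mul_unit_left L)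
    also have "\<dots> = pure_tensor A (\<Gamma> x) (\<Gamma> y) \<otimes>\<^bsub>env_alg A\<^esub> gcoeff n g (unit_vec_at L)"
      unfolding gcoeff_unit[OF unit] using L xy p by (simp add: \<Gamma>_mul A.pure_tensor_mult)
    finally show ?case using p
      by (simp add: Rm_smult Lm_smult gcoeff_smult E.ks_mult_right gcoeff_closed)
  next
    case (add f h)
    then show ?case using p by (simp add: Rm_add Lm_add gcoeff_add E.r_distr gcoeff_closed)
  }
qed

definition inc :: "nat \<Rightarrow> ((('a \<times> 'a \<Rightarrow> 'k) set \<times> 'a) list \<Rightarrow> ('a \<times> 'a \<Rightarrow> 'k) set) \<Rightarrow>
    ((('a \<times> 'a \<Rightarrow> 'k) set \<times> 'a) list \<Rightarrow> ('a \<times> 'a \<Rightarrow> 'k) set) \<Rightarrow> ('a \<times> 'a \<Rightarrow> 'k) set" where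
  "inc n X = (\<lambda>p. if p \<in> gmod ` gens n then gcoeff n (inv_into (gens n) gmod p) (dec X) else \<zero>\<^bsub>env_alg A\<^esub>)"

lemma inc_hom: "inc n \<in> module_hom (env_alg A) (barres n) (free_module (env_alg A) (gmod ` gens n))"
proof -
  interpret E: kalg "env_alg A" by (rule A.env_kalg)
  have R: "ring (env_alg A)" by (rule E.ring_axioms)
  have fin: "finite (gmod ` gens n)" by (intro finite_imageI finite_subset[OF gens_subset]) simp
  show ?thesis
  proof (rule A.module_hom_envI[OF left_module_barres left_module_free[OF R]])
    fix X assume "X \<in> carrier (barres n)"
    then obtain f where f: "f \<in> bar (n + 2)" "X = enc f" by auto
    have "{p. inc n X p \<noteq> \<zero>\<^bsub>env_alg A\<^esub>} \<subseteq> gmod ` gens n" by (auto simp: inc_def)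
    then show "inc n X \<in> carrier (free_module (env_alg A) (gmod ` gens n))"
      unfolding free_module_carrier using finite_subset[OF _ fin] by (auto simp: inc_def gcoeff_closed)
    fix Y assume "Y \<in> carrier (barres n)"
    then obtain g where g: "g \<in> bar (n + 2)" "Y = enc g" by auto
    show "inc n (X \<oplus>\<^bsub>barres n\<^esub> Y) = inc n X \<oplus>\<^bsub>free_module (env_alg A) (gmod ` gens n)\<^esub> inc n Y"
      by (simp add: f(2) g(2) dec_enc[OF f(1)] dec_enc[OF g(1)] inc_def dec_enc_add[OF f(1) g(1)] gcoeff_add fun_eq_iff)
  next
    fix a b X assume ab: "a \<in> carrier A" "b \<in> carrier A" and "X \<in> carrier (barres n)"
    then obtain f where f: "f \<in> bar (n + 2)" "X = enc f" by auto
    show "inc n (pure_tensor A a b \<odot>\<^bsub>barres n\<^esub> X) = pure_tensor A a b \<odot>\<^bsub>free_module (env_alg A) (gmod ` gens n)\<^esub> inc n X"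
      using ab by (simp add: f(2) barres_pure[OF ab f(1)] inc_def dec_enc[OF f(1)] dec_enc[OF bar_act[OF f(1)]]
        gcoeff_act[OF f(1) co(1) co(1)] co fun_eq_iff)
  qed
qed

text \<open>The words with generator \<open>t a # N @ [s b]\<close> span a copy of
  \<open>A (t a) \<otimes> (s b) A\<close>, a direct summand of the enveloping algebra.
  \<open>inc\<close> reads off the coefficients and \<open>\<pi>\<close> sends each free generator
  to its word; their composite fixes every word by \<open>unit_from_gen\<close>.\<close>

lemma projective_barres: "projective_module (env_alg A) (barres n)"
proof -
  interpret E: kalg "env_alg A" by (rule A.env_kalg)
  interpret M: left_module "env_alg A" "barres n" by (rule left_module_barres)
  have R: "ring (env_alg A)" by (rule E.ring_axioms)
  let ?S = "gmod ` gens n" and ?F = "free_module (env_alg A) (gmod ` gens n)"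
  have "(\<lambda>p. p) \<in> ?S \<rightarrow> carrier (barres n)" using gens_subset[of n] by (auto simp: gmod_def)
  from free_module_lift[OF left_module_barres this] obtain \<pi> where
    p: "\<pi> \<in> module_hom (env_alg A) ?F (barres n)" and p': "\<forall>p\<in>?S. \<pi> (free_gen (env_alg A) p) = p"
    by (elim bexE conjE)
  note inc = module_homD[OF inc_hom] and pi = module_homD[OF p]
  have *: "\<pi> (inc n (enc f)) = enc f" if "f \<in> bar (n + 2)" for f
    using that
  proof (induct f rule: bar_induct)
    case zero
    have "inc n \<zero>\<^bsub>barres n\<^esub> = \<zero>\<^bsub>?F\<^esub>"
      by (rule module_hom_zero[OF inc_hom left_module_barres left_module_free[OF R]])
    moreover have "\<pi> \<zero>\<^bsub>?F\<^esub> = \<zero>\<^bsub>barres n\<^esub>"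
      by (rule module_hom_zero[OF p left_module_free[OF R] left_module_barres])
    ultimately show ?case by simp
  next
    case (add f g)
    have fg: "enc f \<in> carrier (barres n)" "enc g \<in> carrier (barres n)" using add by auto
    have "enc (\<lambda>x. f x + g x) = enc f \<oplus>\<^bsub>barres n\<^esub> enc g" using add by (simp add: dec_enc[of f "n + 2"] dec_enc[of g "n + 2"])
    then have "\<pi> (inc n (enc (\<lambda>x. f x + g x))) = \<pi> (inc n (enc f)) \<oplus>\<^bsub>barres n\<^esub> \<pi> (inc n (enc g))"
      using inc(1,2) fg pi(2) by simp
    then show ?case using add by (simp add: dec_enc[of f "n + 2"] dec_enc[of g "n + 2"])
  next
    case (unit k L)
    then obtain a N b where L: "L = a # N @ [b]" "a \<in> B" "b \<in> B" by (auto elim: J_cases)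
    let ?g = "t a # N @ [s b]"
    have g: "?g \<in> gens n" using unit L unfolding gens_def by (intro image_eqI[of _ _ L]) auto
    have gJ: "?g \<in> J (n + 2)" using g gens_subset[of n] by auto
    have kpt: "k \<odot>\<^bsub>env_alg A\<^esub> pt L \<in> carrier (env_alg A)" using L by simp
    have fg: "free_gen (env_alg A) (gmod ?g) \<in> carrier ?F" using g by (intro free_gen_closed R) auto
    have "inc n (enc (\<lambda>x. k * unit_vec_at L x)) = (k \<odot>\<^bsub>env_alg A\<^esub> pt L) \<odot>\<^bsub>?F\<^esub> free_gen (env_alg A) (gmod ?g)"
    proof
      fix p
      show "inc n (enc (\<lambda>x. k * unit_vec_at L x)) p = ((k \<odot>\<^bsub>env_alg A\<^esub> pt L) \<odot>\<^bsub>?F\<^esub> free_gen (env_alg A) (gmod ?g)) p"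
      proof (cases "p \<in> gmod ` gens n")
        case True
        then obtain h where h: "h \<in> gens n" "p = gmod h" by auto
        have "gmod h = gmod ?g \<longleftrightarrow> h = ?g" using gmod_inj h g by (auto dest: inj_onD)
        have "dec (enc (\<lambda>x. k * unit_vec_at L x)) = (\<lambda>x. k * unit_vec_at L x)"
          by (rule dec_enc[OF bar_smult[OF bar_unit[OF unit]]])
        then have "inc n (enc (\<lambda>x. k * unit_vec_at L x)) p = k \<odot>\<^bsub>env_alg A\<^esub> (if gen L = h then pt L else \<zero>\<^bsub>env_alg A\<^esub>)"
          using h by (simp add: inc_def inv_into_f_f[OF gmod_inj] gcoeff_smult gcoeff_unit[OF unit])
        then show ?thesis using h L(1) kpt \<open>gmod h = gmod ?g \<longleftrightarrow> h = ?g\<close> by (auto simp: free_gen_def)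
      next
        case False
        then have "p \<noteq> gmod ?g" using g by auto
        then show ?thesis using False kpt by (simp add: inc_def free_gen_def)
      qed
    qed
    then have "\<pi> (inc n (enc (\<lambda>x. k * unit_vec_at L x))) = (k \<odot>\<^bsub>env_alg A\<^esub> pt L) \<odot>\<^bsub>barres n\<^esub> gmod ?g"
      using pi(3)[OF kpt fg] p' g by simp
    also have "k \<odot>\<^bsub>env_alg A\<^esub> pt L = pure_tensor A (k \<odot>\<^bsub>A\<^esub> \<gamma> a) (\<gamma> b)"
      using L by (simp add: A.pure_tensor_smult)
    also have "\<dots> \<odot>\<^bsub>barres n\<^esub> gmod ?g = enc (\<lambda>x. k * unit_vec_at L x)"
      using L gJ unit_from_gen[OF L(2,3)] unfolding gmod_def
      by (subst barres_pure) (simp_all add: co_smult Lm_smult_left)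
    finally show ?case .
  qed
  show ?thesis unfolding projective_module_def
  proof (intro conjI left_module_barres exI[of _ ?S] exI[of _ "inc n"] exI[of _ \<pi>] inc_hom p ballI)
    fix X assume "X \<in> carrier (barres n)"
    then show "\<pi> (inc n X) = X" using * by auto
  qed
qed

lemma barres_resolution: "projective_resolution (env_alg A) (bimod A) barres bardiff"
  unfolding projective_resolution_def
proof (intro conjI allI projective_barres bardiff_hom bar_res_exact)
  show "\<exists>\<epsilon>\<in>module_hom (env_alg A) (barres 0) (bimod A). \<epsilon> ` carrier (barres 0) = carrier (bimod A) \<and>
     {x \<in> carrier (barres 0). \<epsilon> x = \<zero>\<^bsub>bimod A\<^esub>} = bardiff 0 ` carrier (barres 1)"
    using bar_res_augmentation unfolding augmentation_def One_nat_def
    by (intro bexI[of _ "\<lambda>X. \<Gamma> (\<lambda>b. bd [b] (dec X))"] conjI) (elim conjE, assumption)+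
qed

section \<open>Hochschild cohomology from bar cochains\<close>

text \<open>The matrix of a bimodule map has in its row \<open>L\<close> the coordinates of the
  image of \<open>L\<close>; this gives surjectivity. Injectivity holds because the words span the
  bar term and \<open>\<Gamma>\<close> is injective.\<close>

lemma hom_model_bar:
  "hom_model (env_alg A) (bimod A) barres bardiff K \<delta> (\<lambda>n \<phi> X. \<Gamma> (ev (n + 2) \<phi> (dec X)))"
proof (intro hom_model.intro)
  fix n \<phi> assume \<phi>: "\<phi> \<in> K n"
  note eV = ev_V[OF \<phi>]
  show "(\<lambda>X. \<Gamma> (ev (n + 2) \<phi> (dec X))) \<in> module_hom (env_alg A) (barres n) (bimod A)"
  proof (rule A.module_hom_envI[OF left_module_barres A.left_module_bimod])
    fix X assume "X \<in> carrier (barres n)"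
    then obtain f where f: "f \<in> bar (n + 2)" "X = enc f" by auto
    show "\<Gamma> (ev (n + 2) \<phi> (dec X)) \<in> carrier (bimod A)" using eV by simp
    fix Y assume "Y \<in> carrier (barres n)"
    then obtain g where g: "g \<in> bar (n + 2)" "Y = enc g" by auto
    show "\<Gamma> (ev (n + 2) \<phi> (dec (X \<oplus>\<^bsub>barres n\<^esub> Y))) = \<Gamma> (ev (n + 2) \<phi> (dec X)) \<oplus>\<^bsub>bimod A\<^esub> \<Gamma> (ev (n + 2) \<phi> (dec Y))"
      using eV by (simp add: f(2) g(2) dec_enc[OF f(1)] dec_enc[OF g(1)] dec_enc_add[OF f(1) g(1)] ev_add \<Gamma>_add)
  next
    fix a b X assume ab: "a \<in> carrier A" "b \<in> carrier A" and "X \<in> carrier (barres n)"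
    then obtain f where f: "f \<in> bar (n + 2)" "X = enc f" by auto
    show "\<Gamma> (ev (n + 2) \<phi> (dec (pure_tensor A a b \<odot>\<^bsub>barres n\<^esub> X))) = pure_tensor A a b \<odot>\<^bsub>bimod A\<^esub> \<Gamma> (ev (n + 2) \<phi> (dec X))"
      using eV ab by (simp add: f(2) barres_pure[OF ab f(1)] dec_enc[OF f(1)] dec_enc[OF bar_act[OF f(1)]]
          ev_act[OF \<phi> f(1)] bimod_pure \<Gamma>_mul mul_V co A.m_assoc)
  qed
  show "(\<lambda>i. c * \<phi> i) \<in> K n" for c by (rule K_smult[OF \<phi>])
  show "\<delta> n \<phi> \<in> K (Suc n)" by (rule K_del[OF \<phi>])
  fix x assume "x \<in> carrier (barres n)"
  then obtain f where f: "f \<in> bar (n + 2)" "x = enc f" by auto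
  show "\<Gamma> (ev (n + 2) (\<lambda>i. c * \<phi> i) (dec x)) = (c \<odot>\<^bsub>env_alg A\<^esub> \<one>\<^bsub>env_alg A\<^esub>) \<odot>\<^bsub>bimod A\<^esub> \<Gamma> (ev (n + 2) \<phi> (dec x))" for c
    using eV unfolding bimod_env_module
    by (simp add: kbimod.env_module_central[OF A.kbimod_self] ev_smult_left \<Gamma>_smult)
next
  fix n \<phi> \<psi> assume \<phi>: "\<phi> \<in> K n" and \<psi>: "\<psi> \<in> K n"
  show "(\<lambda>i. \<phi> i + \<psi> i) \<in> K n" by (rule K_add[OF \<phi> \<psi>])
  show "\<Gamma> (ev (n + 2) (\<lambda>i. \<phi> i + \<psi> i) (dec x)) = \<Gamma> (ev (n + 2) \<phi> (dec x)) \<oplus>\<^bsub>bimod A\<^esub> \<Gamma> (ev (n + 2) \<psi> (dec x))" for x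
    using ev_V[OF \<phi>] ev_V[OF \<psi>] by (simp add: ev_add_left \<Gamma>_add)
next
  fix n \<phi> \<psi> assume \<phi>: "\<phi> \<in> K n" and \<psi>: "\<psi> \<in> K n"
    and eq: "\<And>x. x \<in> carrier (barres n) \<Longrightarrow> \<Gamma> (ev (n + 2) \<phi> (dec x)) = \<Gamma> (ev (n + 2) \<psi> (dec x))"
  show "\<phi> = \<psi>"
  proof (rule ext, clarify)
    fix L b
    show "\<phi> (L, b) = \<psi> (L, b)"
    proof (cases "L \<in> J (n + 2)")
      case True
      then have u: "unit_vec_at L \<in> bar (n + 2)" by simp
      have "ev (n + 2) \<phi> (unit_vec_at L) = ev (n + 2) \<psi> (unit_vec_at L)"
        using eq[of "enc (unit_vec_at L)"] u by (intro \<Gamma>_inj ev_V \<phi> \<psi>) (simp add: dec_enc[OF u])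
      then show ?thesis unfolding ev_unit[OF True] by (rule fun_cong)
    next
      case False
      then have "\<phi> (L, b) = 0" "\<psi> (L, b) = 0" using K_supp[OF \<phi>, of L b] K_supp[OF \<psi>, of L b] by blast+
      then show ?thesis by simp
    qed
  qed
next
  fix F n assume F: "F \<in> module_hom (env_alg A) (barres n) (bimod A)"
  note Fh = module_homD[OF F]
  define \<phi> where "\<phi> = (\<lambda>(L, b). if L \<in> J (n + 2) then co (F (enc (unit_vec_at L))) b else 0)"
  have Fc: "F (enc f) \<in> carrier A" if "f \<in> bar (n + 2)" for f
    using Fh(1)[of "enc f"] that by simp
  \<comment> \<open>Linearity over the enveloping algebra includes linearity over the field, since
    \<open>k\<close> acts as the pure tensor of \<open>k \<odot> \<one>\<close> and
    \<open>\<one>\<close>.\<close>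
  have Fk: "F (enc (\<lambda>x. k * f x)) = k \<odot>\<^bsub>A\<^esub> F (enc f)" if f: "f \<in> bar (n + 2)" for k f
  proof -
    have "enc (\<lambda>x. k * f x) = pure_tensor A (k \<odot>\<^bsub>A\<^esub> \<one>\<^bsub>A\<^esub>) \<one>\<^bsub>A\<^esub> \<odot>\<^bsub>barres n\<^esub> enc f"
      using f by (subst barres_pure) (simp_all add: co_smult co_one Lm_smult_left Rm_one Lm_one)
    then show ?thesis using Fh(3)[of "pure_tensor A (k \<odot>\<^bsub>A\<^esub> \<one>\<^bsub>A\<^esub>) \<one>\<^bsub>A\<^esub>" "enc f"] f Fc[OF f]
      by (simp add: bimod_pure A.ks_mult_left)
  qed
  have ev: "ev (n + 2) \<phi> f = co (F (enc f))" if "f \<in> bar (n + 2)" for f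
    using that
  proof (induct f rule: bar_induct)
    case zero
    then show ?case using Fk[OF bar_zero, of 0] Fc[OF bar_zero] co_smult[of "F (enc (\<lambda>_. 0))" 0] by (simp add: fun_eq_iff)
  next
    case (unit k L)
    then show ?case using co_smult[OF Fc[OF bar_unit[OF unit]], of k]
      by (simp add: ev_smult ev_unit Fk \<phi>_def)
  next
    case (add f g)
    then show ?case using Fh(2)[of "enc f" "enc g"] co_add[OF Fc[of f] Fc[of g]]
      by (simp add: ev_add dec_enc[of f "n + 2"] dec_enc[of g "n + 2"])
  qed
  have "\<phi> \<in> K n"
  proof (rule K_I)
    fix L b assume "\<phi> (L, b) \<noteq> 0"
    then show "L \<in> J (n + 2) \<and> b \<in> B"
      using co(1)[OF Fc[OF bar_unit, of L]] by (auto simp: \<phi>_def V_def split: if_splits)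
  next
    fix x y f assume x: "x \<in> V" and y: "y \<in> V" and f: "f \<in> bar (n + 2)"
    have "enc (Lm x (Rm y f)) = pure_tensor A (\<Gamma> x) (\<Gamma> y) \<odot>\<^bsub>barres n\<^esub> enc f"
      using x y f by (subst barres_pure) simp_all
    then have "F (enc (Lm x (Rm y f))) = \<Gamma> x \<otimes>\<^bsub>A\<^esub> F (enc f) \<otimes>\<^bsub>A\<^esub> \<Gamma> y"
      using Fh(3)[of "pure_tensor A (\<Gamma> x) (\<Gamma> y)" "enc f"] x y f Fc[OF f] by (simp add: bimod_pure)
    then show "ev (n + 2) \<phi> (Lm x (Rm y f)) = mul x (mul (ev (n + 2) \<phi> f) y)"
      using x y Fc[OF f] by (simp add: ev[OF f] ev[OF bar_act[OF f]] co_mult mul_assoc)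
  qed
  moreover have "\<forall>X\<in>carrier (barres n). \<Gamma> (ev (n + 2) \<phi> (dec X)) = F X"
  proof
    fix X assume "X \<in> carrier (barres n)"
    then obtain f where f: "f \<in> bar (n + 2)" "X = enc f" by auto
    then show "\<Gamma> (ev (n + 2) \<phi> (dec X)) = F X" using Fc[OF f(1)] by (simp add: dec_enc[OF f(1)] ev co)
  qed
  ultimately show "\<exists>\<phi>\<in>K n. \<forall>X\<in>carrier (barres n). \<Gamma> (ev (n + 2) \<phi> (dec X)) = F X"
    unfolding Bex_def by (intro exI[of _ \<phi>] conjI)
next
  fix n show "(\<lambda>_. 0) \<in> K n" by (rule K_zero)
next
  fix n \<phi> X assume "X \<in> carrier (barres (Suc n))"
  then obtain f where f: "f \<in> bar (Suc n + 2)" "X = enc f" by auto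
  have f': "f \<in> bar (Suc (n + 2))" using f(1) by simp
  show "\<Gamma> (ev (Suc n + 2) (\<delta> n \<phi>) (dec X)) = \<Gamma> (ev (n + 2) \<phi> (dec (bardiff n X)))"
    unfolding f(2) bardiff_def dec_enc[OF f(1)] dec_enc[OF bar_bd'[OF f(1)]]
    using ev_del[OF f', of \<phi>] by simp
qed

text \<open>The bar resolution is a witness for the \<open>SOME\<close> in \<open>Ext\<close>, so
  the selected pair is a projective resolution of the same module, and
  \<open>pres_hom_cohomology\<close> moves the computation from it to the bar resolution.\<close>

theorem pres_HH: "\<exists>q. pres (HH A n) (model_cocycles K \<delta> n) (model_coboundaries K \<delta> n) q"
proof -
  interpret hom_model "env_alg A" "bimod A" barres bardiff K \<delta> "\<lambda>n \<phi> X. \<Gamma> (ev (n + 2) \<phi> (dec X))"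
    by (rule hom_model_bar)
  define Pd where "Pd = (SOME (P, d). projective_resolution (env_alg A) (bimod A) P
    (d :: nat \<Rightarrow> ((('a \<times> 'a \<Rightarrow> 'k) set \<times> 'a) list \<Rightarrow> ('a \<times> 'a \<Rightarrow> 'k) set) \<Rightarrow> _))"
  obtain P d where Pd: "Pd = (P, d)" by (cases Pd)
  have "case Pd of (P, d) \<Rightarrow> projective_resolution (env_alg A) (bimod A) P d"
    unfolding Pd_def by (rule someI[of _ "(barres, bardiff)"]) (simp add: barres_resolution)
  then have res: "projective_resolution (env_alg A) (bimod A) P d" by (simp add: Pd)
  have "HH A n = hom_cohomology (env_alg A) P d (bimod A) n"
    using Pd unfolding HH_def Ext_def Pd_def by simp
  then show ?thesis
    using pres_hom_cohomology[OF A.env_kalg A.left_module_bimod A.left_module_bimod res barres_resolution] by simp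
qed

end

section \<open>Dimensions of spaces of functions\<close>

definition frec :: "('x \<Rightarrow> 'k::field) set \<Rightarrow> ('k, 'x \<Rightarrow> 'k) module" where
  "frec Z = \<lparr>carrier = Z, mult = undefined, one = undefined, zero = (\<lambda>_. 0),
     add = (\<lambda>f g x. f x + g x), smult = (\<lambda>c f x. c * f x)\<rparr>"

definition fsub :: "('x \<Rightarrow> 'k::field) set \<Rightarrow> bool" where
  "fsub Z \<longleftrightarrow> (\<lambda>_. 0) \<in> Z \<and> (\<forall>f\<in>Z. \<forall>g\<in>Z. (\<lambda>x. f x + g x) \<in> Z) \<and> (\<forall>c. \<forall>f\<in>Z. (\<lambda>x. c * f x) \<in> Z)"

definition fdim :: "('x \<Rightarrow> 'k::field) set \<Rightarrow> nat" where
  "fdim Z = vectorspace.dim class_ring (frec Z)"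

text \<open>One finite set has to contain the supports of all functions in \<open>Z\<close>; this is
  what makes the space finite-dimensional.\<close>

definition finsupp :: "('x \<Rightarrow> 'k::field) set \<Rightarrow> bool" where
  "finsupp Z \<longleftrightarrow> (\<exists>S. finite S \<and> (\<forall>f\<in>Z. supp f \<subseteq> S))"

definition flin :: "('x \<Rightarrow> 'k::field) set \<Rightarrow> (('x \<Rightarrow> 'k) \<Rightarrow> 'y \<Rightarrow> 'k) \<Rightarrow> bool" where
  "flin Z T \<longleftrightarrow> (\<forall>f\<in>Z. \<forall>g\<in>Z. T (\<lambda>x. f x + g x) = (\<lambda>y. T f y + T g y)) \<and>
     (\<forall>c. \<forall>f\<in>Z. T (\<lambda>x. c * f x) = (\<lambda>y. c * T f y))"

lemma frec_simps [simp]: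
  "carrier (frec Z) = Z" "zero (frec Z) = (\<lambda>_. 0)"
  "add (frec Z) = (\<lambda>f g x. f x + g x)" "smult (frec Z) = (\<lambda>c f x. c * f x)"
  by (simp_all add: frec_def)

lemma fsubD:
  assumes "fsub Z"
  shows "(\<lambda>_. 0) \<in> Z" "f \<in> Z \<Longrightarrow> g \<in> Z \<Longrightarrow> (\<lambda>x. f x + g x) \<in> Z" "f \<in> Z \<Longrightarrow> (\<lambda>x. c * f x) \<in> Z"
    "f \<in> Z \<Longrightarrow> g \<in> Z \<Longrightarrow> (\<lambda>x. f x - g x) \<in> Z"
proof -
  show 1: "(\<lambda>_. 0) \<in> Z" "f \<in> Z \<Longrightarrow> g \<in> Z \<Longrightarrow> (\<lambda>x. f x + g x) \<in> Z" "f \<in> Z \<Longrightarrow> (\<lambda>x. c * f x) \<in> Z" for f g c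
    using assms by (simp_all add: fsub_def)
  show "f \<in> Z \<Longrightarrow> g \<in> Z \<Longrightarrow> (\<lambda>x. f x - g x) \<in> Z"
    using 1(2)[of f "\<lambda>x. -1 * g x"] 1(3)[of g "-1"] by simp
qed

lemma flinD:
  assumes "flin Z T"
  shows "f \<in> Z \<Longrightarrow> g \<in> Z \<Longrightarrow> T (\<lambda>x. f x + g x) = (\<lambda>y. T f y + T g y)"
    "f \<in> Z \<Longrightarrow> T (\<lambda>x. c * f x) = (\<lambda>y. c * T f y)"
  using assms by (simp_all add: flin_def)

lemma flin_diff:
  assumes "flin Z T" "fsub Z" "f \<in> Z" "g \<in> Z"
  shows "T (\<lambda>x. f x - g x) = (\<lambda>y. T f y - T g y)"
  using flinD(1)[OF assms(1,3) fsubD(3)[OF assms(2,4), of "-1"]] flinD(2)[OF assms(1,4), of "-1"] by simp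

lemma flin_zero: "flin Z T \<Longrightarrow> fsub Z \<Longrightarrow> T (\<lambda>_. 0) = (\<lambda>_. 0)"
  using flinD(2)[of Z T "\<lambda>_. 0" 0] fsubD(1)[of Z] by simp

lemma frec_kvs:
  assumes "fsub Z" shows "kvs (frec Z)"
proof -
  note Z = fsubD[OF assms]
  have "abelian_group (frec Z)"
  proof (rule abelian_groupI, goal_cases)
    case (6 f)
    have "(\<lambda>x. -1 * f x) \<in> carrier (frec Z)" using 6 Z(3)[of f "-1"] by simp
    then show ?case unfolding Bex_def by (intro exI[of _ "\<lambda>x. -1 * f x"]) (simp add: fun_eq_iff)
  qed (use Z in \<open>simp_all add: add_ac\<close>)
  moreover have "kvs_axioms (frec Z)"
    by unfold_locales (use Z in \<open>simp_all add: algebra_simps\<close>)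
  ultimately show ?thesis by (rule kvs.intro)
qed

lemma frec_vectorspace: "fsub Z \<Longrightarrow> vectorspace class_ring (frec Z)"
  by (intro kvs_vectorspace frec_kvs)

text \<open>Remove one coordinate \<open>a\<close>: either all functions vanish there, or a single
  \<open>h\<close> with \<open>h a \<noteq> 0\<close> together with generators of the functions
  vanishing at \<open>a\<close> generates everything. Generation is expressed by containment in all
  subspaces, so spans enter only when the library is called.\<close>

lemma finitely_generated:
  assumes "finite S" "fsub Z" "\<And>f. f \<in> Z \<Longrightarrow> supp f \<subseteq> S"
  shows "\<exists>G. finite G \<and> G \<subseteq> Z \<and> (\<forall>U. fsub U \<longrightarrow> G \<subseteq> U \<longrightarrow> Z \<subseteq> U)"
  using assms
proof (induct S arbitrary: Z rule: finite_induct)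
  case empty
  have "Z \<subseteq> U" if "fsub U" for U
  proof
    fix f assume "f \<in> Z"
    then have "f = (\<lambda>_. 0)" using empty(2) by (auto simp: supp_def)
    then show "f \<in> U" using fsubD(1)[OF that] by simp
  qed
  then show ?case by (intro exI[of _ "{}"]) simp
next
  case (insert a S)
  note Z = fsubD[OF insert(4)]
  let ?Z0 = "{f \<in> Z. f a = 0}"
  have "fsub ?Z0" unfolding fsub_def using Z by simp
  moreover have "supp f \<subseteq> S" if "f \<in> ?Z0" for f
    using insert(5)[of f] that by (auto simp: supp_def)
  ultimately obtain G where G: "finite G" "G \<subseteq> ?Z0" "\<And>U. fsub U \<Longrightarrow> G \<subseteq> U \<Longrightarrow> ?Z0 \<subseteq> U"
    using insert(3)[of ?Z0] by auto
  show ?case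
  proof (cases "Z \<subseteq> ?Z0")
    case True
    show ?thesis
    proof (intro exI[of _ G] conjI allI impI)
      show "finite G" "G \<subseteq> Z" using G by auto
      fix U assume "fsub U" "G \<subseteq> U"
      then show "Z \<subseteq> U" using G(3)[of U] True by blast
    qed
  next
    case False
    then obtain h where h: "h \<in> Z" "h a \<noteq> 0" by auto
    show ?thesis
    proof (intro exI[of _ "insert h G"] conjI allI impI subsetI)
      show "finite (insert h G)" using G by simp
      show "x \<in> insert h G \<Longrightarrow> x \<in> Z" for x using G h by auto
      fix U f assume U: "fsub U" "insert h G \<subseteq> U" and f: "f \<in> Z"
      let ?f = "\<lambda>x. f x - (f a / h a) * h x"
      have "?f \<in> Z" using Z(4)[OF f Z(3)[OF h(1), of "f a / h a"]] .
      then have "?f \<in> ?Z0" using h(2) by simp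
      then have 1: "?f \<in> U" using G(3)[of U] U by blast
      have "(\<lambda>x. (f a / h a) * h x) \<in> U" by (rule fsubD(3)[OF U(1)]) (use U(2) in simp)
      from fsubD(2)[OF U(1) 1 this] show "f \<in> U" by simp
    qed
  qed
qed

lemma frec_span:
  assumes "fsub Z" "G \<subseteq> Z"
  shows "fsub (LinearCombinations.module.span class_ring (frec Z) G)" "G \<subseteq> LinearCombinations.module.span class_ring (frec Z) G"
    "LinearCombinations.module.span class_ring (frec Z) G \<subseteq> Z"
proof -
  interpret V: vectorspace class_ring "frec Z" by (rule frec_vectorspace[OF assms(1)])
  have G: "G \<subseteq> carrier (frec Z)" using assms(2) by simp
  interpret U: submodule class_ring "V.span G" "frec Z" by (rule V.span_is_submodule[OF G])
  show "fsub (V.span G)"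
    using U.zero_closed U.m_closed U.smult_closed by (simp add: fsub_def)
  show "G \<subseteq> V.span G" by (rule V.in_own_span[OF G])
  show "V.span G \<subseteq> Z" using V.span_is_subset2[OF G] by simp
qed

lemma frec_fin_dim:
  assumes "fsub Z" "finsupp Z"
  shows "vectorspace.fin_dim class_ring (frec Z)"
proof -
  interpret V: vectorspace class_ring "frec Z" by (rule frec_vectorspace[OF assms(1)])
  from assms(2) obtain S where "finite S" "\<And>f. f \<in> Z \<Longrightarrow> supp f \<subseteq> S" unfolding finsupp_def by auto
  from finitely_generated[OF this(1) assms(1) this(2)] obtain G where
    G: "finite G" "G \<subseteq> Z" "\<forall>U. fsub U \<longrightarrow> G \<subseteq> U \<longrightarrow> Z \<subseteq> U" by blast
  have "V.span G = carrier (frec Z)" using G(3) frec_span[OF assms(1) G(2)] by auto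
  then show ?thesis unfolding V.fin_dim_def using G(1,2) by auto
qed

lemma linear_map_class_ringI:
  assumes "kvs V" "kvs W"
    and "\<And>x. x \<in> carrier V \<Longrightarrow> T x \<in> carrier W"
    and "\<And>x y. x \<in> carrier V \<Longrightarrow> y \<in> carrier V \<Longrightarrow> T (x \<oplus>\<^bsub>V\<^esub> y) = T x \<oplus>\<^bsub>W\<^esub> T y"
    and "\<And>c x. x \<in> carrier V \<Longrightarrow> T (c \<odot>\<^bsub>V\<^esub> x) = c \<odot>\<^bsub>W\<^esub> T x"
  shows "linear_map class_ring V W T"
proof -
  interpret V: vectorspace class_ring V by (rule kvs_vectorspace[OF assms(1)])
  interpret W: vectorspace class_ring W by (rule kvs_vectorspace[OF assms(2)])
  show ?thesis
    by unfold_locales (use assms(3-5) in \<open>auto simp: LinearCombinations.module_hom_def\<close>)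
qed

lemma rank_nullity_onto:
  assumes Z: "fsub Z" "finsupp Z" and H: "kvs H"
    and q: "q ` Z = carrier H"
    "\<And>x y. x \<in> Z \<Longrightarrow> y \<in> Z \<Longrightarrow> q (\<lambda>i. x i + y i) = q x \<oplus>\<^bsub>H\<^esub> q y"
    "\<And>c x. x \<in> Z \<Longrightarrow> q (\<lambda>i. c * x i) = c \<odot>\<^bsub>H\<^esub> q x"
  shows "vectorspace.dim class_ring H + fdim {x \<in> Z. q x = \<zero>\<^bsub>H\<^esub>} = fdim Z"
proof -
  interpret linear_map class_ring "frec Z" H q
    by (rule linear_map_class_ringI[OF frec_kvs[OF Z(1)] H]) (use q in auto)
  have "W.vs imT = H" using q(1) by (simp add: mod_hom.im_def)
  moreover have "V.vs kerT = frec {x \<in> Z. q x = \<zero>\<^bsub>H\<^esub>}"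
  proof -
    have "kerT = {x \<in> Z. q x = \<zero>\<^bsub>H\<^esub>}" by (simp add: mod_hom.ker_def)
    then show ?thesis unfolding frec_def by simp
  qed
  ultimately show ?thesis using rank_nullity[OF frec_fin_dim[OF Z]] by (simp add: fdim_def)
qed

lemma pres_dim:
  assumes "pres H Z B q" "fsub Z" "finsupp Z" "B \<subseteq> Z"
  shows "vectorspace.dim class_ring H + fdim B = fdim Z"
proof -
  have "{x \<in> Z. q x = \<zero>\<^bsub>H\<^esub>} = B" using assms(1,4) by (auto simp: pres_def)
  then show ?thesis
    using rank_nullity_onto[OF assms(2,3), of H q] assms(1) by (simp add: pres_def)
qed

lemma fdim_onto:
  assumes "fsub X" "finsupp X" "fsub Y" "T ` X = Y" "flin X T"
  shows "fdim Y + fdim {x \<in> X. T x = (\<lambda>_. 0)} = fdim X"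
  using rank_nullity_onto[OF assms(1,2) frec_kvs[OF assms(3)], of T] assms(4) flinD[OF assms(5)]
  by (simp add: fdim_def)

lemma fsub_zero: "fsub {\<lambda>_. 0}" "finsupp {\<lambda>_. 0}"
  by (auto simp: fsub_def finsupp_def supp_def)

lemma fdim_zero [simp]: "fdim {\<lambda>_::'x. 0::'k::field} = 0"
proof -
  have "{x \<in> {\<lambda>_. 0}. x = (\<lambda>_::'x. 0 :: 'k)} = {\<lambda>_. 0}" by auto
  with fdim_onto[OF fsub_zero(1,2) fsub_zero(1), of "\<lambda>x. x"] show ?thesis
    by (auto simp: flin_def)
qed

lemma fdim_bij:
  assumes "fsub X" "finsupp X" "fsub Y" "T ` X = Y" "flin X T" "\<And>x. x \<in> X \<Longrightarrow> T x = (\<lambda>_. 0) \<Longrightarrow> x = (\<lambda>_. 0)"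
  shows "fdim X = fdim Y"
proof -
  have "{x \<in> X. T x = (\<lambda>_. 0)} = {\<lambda>_. 0}"
  proof (intro equalityI subsetI)
    fix x assume "x \<in> {x \<in> X. T x = (\<lambda>_. 0)}"
    then show "x \<in> {\<lambda>_. 0}" using assms(6)[of x] by simp
  qed (use fsubD(1)[OF assms(1)] flin_zero[OF assms(5,1)] in simp)
  with fdim_onto[OF assms(1-5)] show ?thesis by simp
qed

lemma fsub_kernel: "fsub X \<Longrightarrow> flin X T \<Longrightarrow> fsub {x \<in> X. T x = (\<lambda>_. 0)}"
proof -
  assume X: "fsub X" and T: "flin X T"
  show ?thesis unfolding fsub_def
  proof (intro conjI ballI allI)
    show "(\<lambda>_. 0) \<in> {x \<in> X. T x = (\<lambda>_. 0)}" using fsubD(1)[OF X] flin_zero[OF T X] by simp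
    fix f assume f: "f \<in> {x \<in> X. T x = (\<lambda>_. 0)}"
    then show "(\<lambda>x. c * f x) \<in> {x \<in> X. T x = (\<lambda>_. 0)}" for c
      using fsubD(3)[OF X, of f c] flinD(2)[OF T, of f c] by simp
    fix g assume "g \<in> {x \<in> X. T x = (\<lambda>_. 0)}"
    with f show "(\<lambda>x. f x + g x) \<in> {x \<in> X. T x = (\<lambda>_. 0)}"
      using fsubD(2)[OF X, of f g] flinD(1)[OF T, of f g] by simp
  qed
qed

lemma finsupp_subset: "finsupp X \<Longrightarrow> Y \<subseteq> X \<Longrightarrow> finsupp Y"
  unfolding finsupp_def by (elim exE conjE, intro exI conjI) auto

section \<open>Dimension of a fibre product\<close>

text \<open>The hypotheses make \<open>X\<close> the fibre product of \<open>X1\<close> and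
  \<open>X2\<close> over \<open>U\<close>. Since \<open>c1\<close> is onto, so is \<open>r2\<close>,
  and \<open>r1\<close> identifies the kernel of \<open>r2\<close> with that of \<open>c1\<close>;
  rank-nullity for \<open>r2\<close> and \<open>c1\<close> gives the formula.\<close>

lemma fdim_glue:
  assumes X: "fsub X" "finsupp X" and X1: "fsub X1" "finsupp X1" and X2: "fsub X2" and U: "fsub U"
    and r1: "flin X r1" "\<And>x. x \<in> X \<Longrightarrow> r1 x \<in> X1" and r2: "flin X r2" "\<And>x. x \<in> X \<Longrightarrow> r2 x \<in> X2"
    and c1: "flin X1 c1" "c1 ` X1 = U" and c2: "flin X2 c2" "\<And>x. x \<in> X2 \<Longrightarrow> c2 x \<in> U"
    and comm: "\<And>x. x \<in> X \<Longrightarrow> c1 (r1 x) = c2 (r2 x)"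
    and inj: "\<And>x. x \<in> X \<Longrightarrow> r1 x = (\<lambda>_. 0) \<Longrightarrow> r2 x = (\<lambda>_. 0) \<Longrightarrow> x = (\<lambda>_. 0)"
    and glue: "\<And>x1 x2. x1 \<in> X1 \<Longrightarrow> x2 \<in> X2 \<Longrightarrow> c1 x1 = c2 x2 \<Longrightarrow> \<exists>x\<in>X. r1 x = x1 \<and> r2 x = x2"
  shows "fdim X + fdim U = fdim X1 + fdim X2"
proof -
  have onto: "r2 ` X = X2"
  proof (intro equalityI subsetI)
    fix x2 assume x2: "x2 \<in> X2"
    then obtain x1 where "x1 \<in> X1" "c1 x1 = c2 x2" using c1(2) c2(2)[OF x2] by (metis imageE)
    then obtain x where "x \<in> X" "r2 x = x2" using glue[of x1 x2] x2 by auto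
    then show "x2 \<in> r2 ` X" by auto
  qed (use r2(2) in auto)
  let ?K = "{x \<in> X. r2 x = (\<lambda>_. 0)}" and ?K1 = "{x \<in> X1. c1 x = (\<lambda>_. 0)}"
  have 1: "fdim X2 + fdim ?K = fdim X" by (rule fdim_onto[OF X X2 onto r2(1)])
  have 2: "fdim U + fdim ?K1 = fdim X1" by (rule fdim_onto[OF X1 U c1(2,1)])
  have c20: "c2 (\<lambda>_. 0) = (\<lambda>_. 0)" by (rule flin_zero[OF c2(1) X2])
  have "fdim ?K = fdim ?K1"
  proof (rule fdim_bij[where T = r1])
    show "fsub ?K" by (rule fsub_kernel[OF X(1) r2(1)])
    show "finsupp ?K" by (rule finsupp_subset[OF X(2)]) auto
    show "fsub ?K1" by (rule fsub_kernel[OF X1(1) c1(1)])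
    show "flin ?K r1" using r1(1) by (simp add: flin_def)
    show "x = (\<lambda>_. 0)" if "x \<in> ?K" "r1 x = (\<lambda>_. 0)" for x using inj[of x] that by simp
    show "r1 ` ?K = ?K1"
    proof (intro equalityI subsetI)
      fix y assume "y \<in> r1 ` ?K"
      then show "y \<in> ?K1" using r1(2) comm c20 by auto
    next
      fix y assume y: "y \<in> ?K1"
      then obtain x where "x \<in> X" "r1 x = y" "r2 x = (\<lambda>_. 0)"
        using glue[of y "\<lambda>_. 0"] fsubD(1)[OF X2] c20 by auto
      then show "y \<in> r1 ` ?K" by auto
    qed
  qed
  with 1 2 show ?thesis by simp
qed

lemma fdim_line:
  assumes "u \<noteq> (\<lambda>_. 0)"
  shows "fdim (range (\<lambda>c x. c * u x)) = 1" "fsub (range (\<lambda>c x. c * u x))"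
proof -
  let ?L = "range (\<lambda>c x. c * u x)"
  show L: "fsub ?L"
    unfolding fsub_def
  proof (intro conjI ballI allI)
    show "(\<lambda>_. 0) \<in> ?L" by (intro image_eqI[of _ _ 0]) auto
    fix f g assume "f \<in> ?L"
    then obtain a where a: "f = (\<lambda>x. a * u x)" by auto
    show "(\<lambda>x. c * f x) \<in> ?L" for c by (intro image_eqI[of _ _ "c * a"]) (auto simp: a)
    assume "g \<in> ?L"
    then obtain b where b: "g = (\<lambda>x. b * u x)" by auto
    show "(\<lambda>x. f x + g x) \<in> ?L" by (intro image_eqI[of _ _ "a + b"]) (auto simp: a b distrib_right)
  qed
  interpret V: vectorspace class_ring "frec ?L" by (rule frec_vectorspace[OF L])
  have u: "u \<in> ?L" by (intro image_eqI[of _ _ 1]) auto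
  have "V.dim = 1"
  proof (rule V.dim1I[of u])
    note sp = frec_span[OF L, of "{u}"]
    have "?L \<subseteq> V.span {u}"
      using fsubD(3)[OF sp(1), of u] sp(2) u by auto
    then show "V.span {u} = carrier (frec ?L)" using sp(3) u by auto
  qed (use u assms in auto)
  then show "fdim ?L = 1" by (simp add: fdim_def)
qed

section \<open>Isomorphisms from presentations\<close>

lemma (in abelian_group) minus_eq_zero_iff:
  assumes "x \<in> carrier G" "y \<in> carrier G" shows "x \<ominus> y = \<zero> \<longleftrightarrow> x = y"
proof
  assume "x \<ominus> y = \<zero>"
  then have "(x \<ominus> y) \<oplus> y = y" using assms by simp
  then show "x = y" using assms by (simp add: minus_eq a_assoc l_neg)
qed (use assms in \<open>simp add: minus_eq r_neg\<close>)

text \<open>Both presentations identify two elements of \<open>Z\<close> exactly when their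
  difference lies in \<open>B\<close>, so sending \<open>q z\<close> to \<open>q' z\<close> is well
  defined and injective.\<close>

lemma pres_iso:
  assumes p: "pres H Z B q" and p': "pres H' Z B q'" and Z: "fsub Z"
  shows "vs_isomorphic H H'"
proof -
  have H: "kvs H" and H': "kvs H'" using p p' by (auto simp: pres_def)
  interpret H: kvs H by (rule H)
  interpret H': kvs H' by (rule H')
  have im: "q ` Z = carrier H" "q' ` Z = carrier H'" using p p' by (simp_all add: pres_def)
  have qc: "q z \<in> carrier H" "q' z \<in> carrier H'" if "z \<in> Z" for z
    using im[symmetric] that by simp_all
  have rep: "\<exists>x\<in>Z. X = q x" if "X \<in> carrier H" for X using that im(1)[symmetric] by auto
  have qa: "q (\<lambda>i. x i + y i) = q x \<oplus>\<^bsub>H\<^esub> q y" "q' (\<lambda>i. x i + y i) = q' x \<oplus>\<^bsub>H'\<^esub> q' y" if "x \<in> Z" "y \<in> Z" for x y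
    using p p' that by (simp_all add: pres_def)
  have qs: "q (\<lambda>i. c * x i) = c \<odot>\<^bsub>H\<^esub> q x" "q' (\<lambda>i. c * x i) = c \<odot>\<^bsub>H'\<^esub> q' x" if "x \<in> Z" for c x
    using p p' that by (simp_all add: pres_def)
  have q0: "q x = \<zero>\<^bsub>H\<^esub> \<longleftrightarrow> x \<in> B" "q' x = \<zero>\<^bsub>H'\<^esub> \<longleftrightarrow> x \<in> B" if "x \<in> Z" for x
    using p p' that by (simp_all add: pres_def)
  have d: "q (\<lambda>i. x i - y i) = q x \<ominus>\<^bsub>H\<^esub> q y" "q' (\<lambda>i. x i - y i) = q' x \<ominus>\<^bsub>H'\<^esub> q' y"
    if xy: "x \<in> Z" "y \<in> Z" for x y
    using qa[OF xy(1) fsubD(3)[OF Z xy(2), of "-1"]] qs[OF xy(2), of "-1"] H.ks_neg[of "q y" 1] H'.ks_neg[of "q' y" 1] qc[OF xy(2)]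
    by (simp_all add: H.minus_eq H'.minus_eq)
  have eq: "q x = q y \<longleftrightarrow> (\<lambda>i. x i - y i) \<in> B" "q' x = q' y \<longleftrightarrow> (\<lambda>i. x i - y i) \<in> B"
    if xy: "x \<in> Z" "y \<in> Z" for x y
    using q0[OF fsubD(4)[OF Z xy]] d[OF xy] H.minus_eq_zero_iff[OF qc(1)[OF xy(1)] qc(1)[OF xy(2)]]
      H'.minus_eq_zero_iff[OF qc(2)[OF xy(1)] qc(2)[OF xy(2)]]
    by simp_all
  define T where "T X = q' (SOME z. z \<in> Z \<and> q z = X)" for X
  have T: "T (q z) = q' z" if z: "z \<in> Z" for z
  proof -
    have "(SOME y. y \<in> Z \<and> q y = q z) \<in> Z \<and> q (SOME y. y \<in> Z \<and> q y = q z) = q z"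
      by (rule someI[of _ z]) (use z in simp)
    then have "q' (SOME y. y \<in> Z \<and> q y = q z) = q' z" using eq[of "SOME y. y \<in> Z \<and> q y = q z" z] z by simp
    then show ?thesis by (simp add: T_def)
  qed
  have "linear_map class_ring H H' T"
  proof (rule linear_map_class_ringI[OF H H'])
    fix X assume "X \<in> carrier H"
    then obtain x where x: "x \<in> Z" "X = q x" using rep by blast
    then show "T X \<in> carrier H'" using T qc by simp
    show "T (c \<odot>\<^bsub>H\<^esub> X) = c \<odot>\<^bsub>H'\<^esub> T X" for c
      using T[OF fsubD(3)[OF Z x(1), of c]] T[OF x(1)] qs[OF x(1), of c] x(2) by simp
    fix Y assume "Y \<in> carrier H"
    then obtain y where y: "y \<in> Z" "Y = q y" using rep by blast
    show "T (X \<oplus>\<^bsub>H\<^esub> Y) = T X \<oplus>\<^bsub>H'\<^esub> T Y"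
      using T[OF fsubD(2)[OF Z x(1) y(1)]] T[OF x(1)] T[OF y(1)] qa[OF x(1) y(1)] x(2) y(2) by simp
  qed
  moreover have "bij_betw T (carrier H) (carrier H')"
  proof (rule bij_betw_imageI)
    show "inj_on T (carrier H)"
    proof (rule inj_onI)
      fix X Y assume "X \<in> carrier H" "Y \<in> carrier H" and e: "T X = T Y"
      then obtain x y where "x \<in> Z" "X = q x" "y \<in> Z" "Y = q y" using rep by blast
      with e T eq show "X = Y" by simp
    qed
    show "T ` carrier H = carrier H'"
    proof -
      have "T ` carrier H = T ` q ` Z" using im by simp
      also have "\<dots> = q' ` Z" unfolding image_image using T by simp
      finally show ?thesis using im by simp
    qed
  qed
  ultimately show ?thesis unfolding vs_isomorphic_def by (intro exI[of _ T] conjI)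
qed

section \<open>A Mayer-Vietoris argument\<close>

locale fcomplex =
  fixes K :: "nat \<Rightarrow> ('x \<Rightarrow> 'k::field) set" and d :: "nat \<Rightarrow> ('x \<Rightarrow> 'k) \<Rightarrow> 'x \<Rightarrow> 'k"
  assumes K_sub: "fsub (K n)" and K_fin: "finsupp (K n)" and d_lin: "flin (K n) (d n)"
    and d_closed: "f \<in> K n \<Longrightarrow> d n f \<in> K (Suc n)"
    and d_d: "f \<in> K n \<Longrightarrow> d (Suc n) (d n f) = (\<lambda>_. 0)"
begin

abbreviation "Z \<equiv> model_cocycles K d"
abbreviation "Bd \<equiv> model_coboundaries K d"

lemma Z_iff: "f \<in> Z n \<longleftrightarrow> f \<in> K n \<and> d n f = (\<lambda>_. 0)"
  by (simp add: model_cocycles_def)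

lemma Z_eq: "Z n = {f \<in> K n. d n f = (\<lambda>_. 0)}"
  by (simp add: model_cocycles_def)

lemma Z_sub: "fsub (Z n)"
  unfolding Z_eq by (rule fsub_kernel[OF K_sub d_lin])

lemma Z_fin: "finsupp (Z n)"
  by (rule finsupp_subset[OF K_fin]) (auto simp: Z_iff)

lemma Bd_subset: "Bd n \<subseteq> Z n"
proof (cases n)
  case 0
  then show ?thesis using fsubD(1)[OF Z_sub[of 0]] by simp
next
  case (Suc m)
  then show ?thesis using d_closed d_d by (auto simp: Z_iff)
qed

lemma Bd_sub: "fsub (Bd n)"
proof (cases n)
  case 0
  then show ?thesis by (simp add: fsub_zero)
next
  case (Suc m)
  show ?thesis unfolding Suc model_coboundaries.simps fsub_def
  proof (intro conjI ballI allI)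
    show "(\<lambda>_. 0) \<in> d m ` K m"
      by (rule image_eqI[where x = "\<lambda>_. 0"]) (simp_all add: flin_zero[OF d_lin K_sub] fsubD(1)[OF K_sub])
    fix f assume "f \<in> d m ` K m"
    then obtain f' where f: "f' \<in> K m" "f = d m f'" by auto
    show "(\<lambda>x. c * f x) \<in> d m ` K m" for c
      by (rule image_eqI[where x = "\<lambda>x. c * f' x"])
        (simp_all add: f(2) flinD(2)[OF d_lin f(1)] fsubD(3)[OF K_sub f(1)])
    fix g assume "g \<in> d m ` K m"
    then obtain g' where g: "g' \<in> K m" "g = d m g'" by auto
    show "(\<lambda>x. f x + g x) \<in> d m ` K m"
      by (rule image_eqI[where x = "\<lambda>x. f' x + g' x"])
        (simp_all add: f(2) g(2) flinD(1)[OF d_lin f(1) g(1)] fsubD(2)[OF K_sub f(1) g(1)])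
  qed
qed

lemma dim_K0: "fdim (Bd (Suc 0)) + fdim (Z 0) = fdim (K 0)"
  using fdim_onto[OF K_sub[of 0] K_fin Bd_sub[of "Suc 0"] _ d_lin] by (simp add: Z_eq)

lemma dim_H0: "pres H (Z 0) (Bd 0) q \<Longrightarrow> vectorspace.dim class_ring H = fdim (Z 0)"
  using pres_dim[OF _ Z_sub Z_fin Bd_subset, of H 0 q] by simp

text \<open>The coboundaries of degree one have dimension \<open>fdim (K 0) - fdim (Z 0)\<close>,
  and \<open>Z 0\<close> is the cohomology in degree zero. Stated with sums, which avoids truncated
  subtraction.\<close>

lemma dim_H1:
  assumes "pres H0 (Z 0) (Bd 0) q0" "pres H1 (Z (Suc 0)) (Bd (Suc 0)) q1"
  shows "vectorspace.dim class_ring H1 + fdim (K 0) = fdim (Z (Suc 0)) + vectorspace.dim class_ring H0"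
  using pres_dim[OF assms(2) Z_sub Z_fin Bd_subset] dim_K0 dim_H0[OF assms(1)] by simp

lemma Z_diff_d:
  "f \<in> Z (Suc n) \<Longrightarrow> g \<in> K n \<Longrightarrow> (\<lambda>x. f x - d n g x) \<in> Z (Suc n)"
  by (rule fsubD(4)[OF Z_sub]) (use d_closed d_d in \<open>simp_all add: Z_iff\<close>)

end

text \<open>Exactness of the sequence of complexes, spelled out: \<open>inj\<close> on the left,
  \<open>glue\<close> in the middle, \<open>ext1\<close> on the right, where extending to the first
  side is enough. The one map \<open>c\<close> restricts from both sides because all cochains are
  functions of the same type.\<close>

locale mv = R: fcomplex KR dR + A1: fcomplex K1 d1 + A2: fcomplex K2 d2 + C: fcomplex KC dC
  for KR K1 K2 KC :: "nat \<Rightarrow> ('x \<Rightarrow> 'k::field) set" and dR d1 d2 dC +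
  fixes r1 r2 c :: "('x \<Rightarrow> 'k) \<Rightarrow> 'x \<Rightarrow> 'k"
  assumes lin: "flin UNIV r1" "flin UNIV r2" "flin UNIV c"
    and r1: "f \<in> KR n \<Longrightarrow> r1 f \<in> K1 n" "f \<in> KR n \<Longrightarrow> d1 n (r1 f) = r1 (dR n f)"
    and r2: "f \<in> KR n \<Longrightarrow> r2 f \<in> K2 n" "f \<in> KR n \<Longrightarrow> d2 n (r2 f) = r2 (dR n f)"
    and c1: "f \<in> K1 n \<Longrightarrow> c f \<in> KC n" "f \<in> K1 n \<Longrightarrow> dC n (c f) = c (d1 n f)"
    and c2: "f \<in> K2 n \<Longrightarrow> c f \<in> KC n" "f \<in> K2 n \<Longrightarrow> dC n (c f) = c (d2 n f)"
    and comm: "f \<in> KR n \<Longrightarrow> c (r1 f) = c (r2 f)"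
    and inj: "f \<in> KR n \<Longrightarrow> r1 f = (\<lambda>_. 0) \<Longrightarrow> r2 f = (\<lambda>_. 0) \<Longrightarrow> f = (\<lambda>_. 0)"
    and glue: "f1 \<in> K1 n \<Longrightarrow> f2 \<in> K2 n \<Longrightarrow> c f1 = c f2 \<Longrightarrow> \<exists>f\<in>KR n. r1 f = f1 \<and> r2 f = f2"
    and ext1: "g \<in> KC n \<Longrightarrow> \<exists>f\<in>K1 n. c f = g"
    and core: "n \<ge> 1 \<Longrightarrow> C.Z n \<subseteq> C.Bd n"
begin

lemma flin_any: "flin UNIV T \<Longrightarrow> flin X T"
  by (simp add: flin_def)

lemmas lin' = lin[THEN flin_any]

lemma fsub_UNIV: "fsub UNIV" by (simp add: fsub_def)

lemma zeros: "r1 (\<lambda>_. 0) = (\<lambda>_. 0)" "r2 (\<lambda>_. 0) = (\<lambda>_. 0)" "c (\<lambda>_. 0) = (\<lambda>_. 0)"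
  using lin flin_zero fsub_UNIV by blast+

lemma diffs: "r1 (\<lambda>x. f x - g x) = (\<lambda>x. r1 f x - r1 g x)" "r2 (\<lambda>x. f x - g x) = (\<lambda>x. r2 f x - r2 g x)"
  "c (\<lambda>x. f x - g x) = (\<lambda>x. c f x - c g x)"
  using lin[THEN flin_diff, OF fsub_UNIV] by simp_all

lemma inj_eq:
  assumes f: "f \<in> KR n" and g: "g \<in> KR n" and "r1 f = r1 g" "r2 f = r2 g" shows "f = g"
proof -
  have "(\<lambda>x. f x - g x) = (\<lambda>_. 0)"
    by (rule inj[OF fsubD(4)[OF R.K_sub f g]]) (use assms in \<open>simp_all add: diffs\<close>)
  then show ?thesis by (simp add: fun_eq_iff)
qed

lemma Z_r: "f \<in> R.Z n \<Longrightarrow> r1 f \<in> A1.Z n" "f \<in> R.Z n \<Longrightarrow> r2 f \<in> A2.Z n"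
  using r1 r2 zeros by (simp_all add: R.Z_iff A1.Z_iff A2.Z_iff)

lemma Z_c: "f \<in> A1.Z n \<Longrightarrow> c f \<in> C.Z n" "f \<in> A2.Z n \<Longrightarrow> c f \<in> C.Z n"
  using c1 c2 zeros by (simp_all add: C.Z_iff A1.Z_iff A2.Z_iff)

lemma Z_glue:
  assumes f1: "f1 \<in> A1.Z n" and f2: "f2 \<in> A2.Z n" and "c f1 = c f2"
  shows "\<exists>f\<in>R.Z n. r1 f = f1 \<and> r2 f = f2"
proof -
  from glue[of f1 n f2] assms obtain f where f: "f \<in> KR n" "r1 f = f1" "r2 f = f2"
    by (auto simp: A1.Z_iff A2.Z_iff)
  have "dR n f = (\<lambda>_. 0)"
    by (rule inj[OF R.d_closed[OF f(1)]])
      (use r1(2)[OF f(1)] r2(2)[OF f(1)] f f1 f2 in \<open>simp_all add: A1.Z_iff A2.Z_iff\<close>)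
  with f show ?thesis by (auto simp: R.Z_iff)
qed

text \<open>A cocycle of positive degree on the core is a coboundary, and the cochain that it bounds
  extends to \<open>A1\<close>. It is thus the restriction of a coboundary of \<open>A1\<close>;
  this replaces the connecting homomorphisms.\<close>

lemma Z_onto:
  assumes g: "g \<in> C.Z (Suc n)"
  shows "\<exists>f\<in>K1 n. c (d1 n f) = g"
proof -
  have "g \<in> C.Bd (Suc n)" using core[of "Suc n"] g by auto
  then obtain h where h: "h \<in> KC n" "g = dC n h" by auto
  from ext1[OF h(1)] obtain f where f: "f \<in> K1 n" "c f = h" ..
  then have "c (d1 n f) = g" using c1(2)[OF f(1)] h by simp
  with f show ?thesis by auto
qed

lemma dim_glue_K0: "fdim (KR 0) + fdim (KC 0) = fdim (K1 0) + fdim (K2 0)"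
proof (rule fdim_glue[where ?r1.0 = r1 and ?r2.0 = r2 and ?c1.0 = c and ?c2.0 = c])
  show "c ` K1 0 = KC 0" using c1(1) ext1[of _ 0] by (auto simp: image_iff) metis
qed (use R.K_sub R.K_fin A1.K_sub A1.K_fin A2.K_sub C.K_sub lin' r1(1) r2(1) c2(1) comm inj glue in \<open>auto\<close>)

text \<open>Restriction of 1-cocycles from \<open>A1\<close> to the core is onto: by
  \<open>Z_onto\<close> coboundaries already suffice.\<close>

lemma dim_glue_Z1: "fdim (R.Z (Suc 0)) + fdim (C.Z (Suc 0)) = fdim (A1.Z (Suc 0)) + fdim (A2.Z (Suc 0))"
proof (rule fdim_glue[where ?r1.0 = r1 and ?r2.0 = r2 and ?c1.0 = c and ?c2.0 = c])
  show "c ` A1.Z (Suc 0) = C.Z (Suc 0)"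
  proof (intro equalityI subsetI)
    fix g assume g: "g \<in> C.Z (Suc 0)"
    from Z_onto[OF this] obtain f where f: "f \<in> K1 0" "c (d1 0 f) = g" ..
    then have "d1 0 f \<in> A1.Z (Suc 0)" using A1.d_closed A1.d_d by (simp add: A1.Z_iff)
    then show "g \<in> c ` A1.Z (Suc 0)" using f(2) by auto
  qed (use Z_c in auto)
  show "c (r1 x) = c (r2 x)" if "x \<in> R.Z (Suc 0)" for x using comm[of x "Suc 0"] that by (simp add: R.Z_iff)
  show "x = (\<lambda>_. 0)" if "x \<in> R.Z (Suc 0)" "r1 x = (\<lambda>_. 0)" "r2 x = (\<lambda>_. 0)" for x
    by (rule inj[of x "Suc 0"]) (use that in \<open>simp_all add: R.Z_iff\<close>)
  show "\<exists>x\<in>R.Z (Suc 0). r1 x = x1 \<and> r2 x = x2" if "x1 \<in> A1.Z (Suc 0)" "x2 \<in> A2.Z (Suc 0)" "c x1 = c x2" for x1 x2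
    using Z_glue[OF that] .
qed (use R.Z_sub R.Z_fin A1.Z_sub A1.Z_fin A2.Z_sub C.Z_sub lin' Z_r Z_c in \<open>simp_all\<close>)

text \<open>In degree zero the gluing takes place over the line spanned by \<open>u\<close>, onto
  which \<open>A1.Z 0\<close> maps, and not over all of \<open>C.Z 0\<close>.\<close>

lemma dim_glue_Z0:
  assumes u: "u \<noteq> (\<lambda>_. 0)"
    and 1: "\<And>f. f \<in> A1.Z 0 \<Longrightarrow> \<exists>k. c f = (\<lambda>x. k * u x)" "\<exists>f\<in>A1.Z 0. c f = u"
    and 2: "\<And>f. f \<in> A2.Z 0 \<Longrightarrow> \<exists>k. c f = (\<lambda>x. k * u x)"
  shows "fdim (R.Z 0) + 1 = fdim (A1.Z 0) + fdim (A2.Z 0)"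
proof -
  let ?U = "range (\<lambda>k x. k * u x)"
  have "fdim (R.Z 0) + fdim ?U = fdim (A1.Z 0) + fdim (A2.Z 0)"
  proof (rule fdim_glue[where ?r1.0 = r1 and ?r2.0 = r2 and ?c1.0 = c and ?c2.0 = c])
    show "c ` A1.Z 0 = ?U"
    proof (intro equalityI subsetI)
      fix g assume "g \<in> ?U"
      then obtain k where k: "g = (\<lambda>x. k * u x)" by auto
      from 1(2) obtain f where f: "f \<in> A1.Z 0" "c f = u" ..
      have "c (\<lambda>x. k * f x) = g" using flinD(2)[OF lin(3), of f k] f(2) k by simp
      moreover have "(\<lambda>x. k * f x) \<in> A1.Z 0" by (rule fsubD(3)[OF A1.Z_sub f(1)])
      ultimately show "g \<in> c ` A1.Z 0" by (intro image_eqI[where x = "\<lambda>x. k * f x"]) simp_all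
    next
      fix g assume "g \<in> c ` A1.Z 0"
      then obtain f where f: "f \<in> A1.Z 0" "g = c f" by auto
      from 1(1)[OF f(1)] obtain k where "c f = (\<lambda>x. k * u x)" ..
      then show "g \<in> ?U" unfolding f(2) by (rule range_eqI)
    qed
    show "c f \<in> ?U" if "f \<in> A2.Z 0" for f
    proof -
      from 2[OF that] obtain k where "c f = (\<lambda>x. k * u x)" ..
      then show ?thesis by (rule range_eqI)
    qed
    show "c (r1 x) = c (r2 x)" if "x \<in> R.Z 0" for x using comm[of x 0] that by (simp add: R.Z_iff)
    show "x = (\<lambda>_. 0)" if "x \<in> R.Z 0" "r1 x = (\<lambda>_. 0)" "r2 x = (\<lambda>_. 0)" for x
      by (rule inj[of x 0]) (use that in \<open>simp_all add: R.Z_iff\<close>)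
    show "\<exists>x\<in>R.Z 0. r1 x = x1 \<and> r2 x = x2" if "x1 \<in> A1.Z 0" "x2 \<in> A2.Z 0" "c x1 = c x2" for x1 x2
      using Z_glue[OF that] .
  qed (use R.Z_sub R.Z_fin A1.Z_sub A1.Z_fin A2.Z_sub fdim_line(2)[OF u] lin' Z_r in \<open>simp_all\<close>)
  then show ?thesis using fdim_line(1)[OF u] by simp
qed

text \<open>For \<open>R\<close>, \<open>A1\<close> and \<open>A2\<close> the dimensions of
  \<open>H1\<close> and \<open>K 0\<close> add up to those of \<open>Z 1\<close> and
  \<open>H0\<close>. The spaces \<open>K 0\<close> and \<open>Z 1\<close> glue over the core, where
  coboundaries and cocycles of degree one agree, so \<open>fdim (KC 0) - fdim (C.Z 1)\<close> is the
  dimension of \<open>HC0\<close>.\<close>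

lemma dim_H:
  assumes u: "u \<noteq> (\<lambda>_. 0)"
    and 1: "\<And>f. f \<in> A1.Z 0 \<Longrightarrow> \<exists>k. c f = (\<lambda>x. k * u x)" "\<exists>f\<in>A1.Z 0. c f = u"
    and 2: "\<And>f. f \<in> A2.Z 0 \<Longrightarrow> \<exists>k. c f = (\<lambda>x. k * u x)"
    and pR: "pres HR0 (R.Z 0) (R.Bd 0) qR0" "pres HR1 (R.Z 1) (R.Bd 1) qR1"
    and p1: "pres H10 (A1.Z 0) (A1.Bd 0) q10" "pres H11 (A1.Z 1) (A1.Bd 1) q11"
    and p2: "pres H20 (A2.Z 0) (A2.Bd 0) q20" "pres H21 (A2.Z 1) (A2.Bd 1) q21"
    and pC: "pres HC0 (C.Z 0) (C.Bd 0) qC0"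
  shows "int (vectorspace.dim class_ring HR0) =
      int (vectorspace.dim class_ring H10) + int (vectorspace.dim class_ring H20) - 1"
    "int (vectorspace.dim class_ring HR1) =
      int (vectorspace.dim class_ring H11) + int (vectorspace.dim class_ring H21) + int (vectorspace.dim class_ring HC0) - 1"
proof -
  note h0 = R.dim_H0[OF pR(1)] A1.dim_H0[OF p1(1)] A2.dim_H0[OF p2(1)] C.dim_H0[OF pC]
  show *: "int (vectorspace.dim class_ring HR0) =
      int (vectorspace.dim class_ring H10) + int (vectorspace.dim class_ring H20) - 1"
    using dim_glue_Z0[OF u 1 2] h0 by simp
  have "C.Bd (Suc 0) = C.Z (Suc 0)" using core[of 1] C.Bd_subset[of "Suc 0"] by auto
  then have "fdim (C.Z (Suc 0)) + fdim (C.Z 0) = fdim (KC 0)" using C.dim_K0 by simp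
  then show "int (vectorspace.dim class_ring HR1) =
      int (vectorspace.dim class_ring H11) + int (vectorspace.dim class_ring H21) + int (vectorspace.dim class_ring HC0) - 1"
    using * h0 dim_glue_K0 dim_glue_Z1
      R.dim_H1[OF pR[unfolded One_nat_def]] A1.dim_H1[OF p1[unfolded One_nat_def]] A2.dim_H1[OF p2[unfolded One_nat_def]]
    by simp
qed

text \<open>The pair of restrictions presents the direct sum by the cocycles and coboundaries of
  \<open>R\<close>; \<open>pres_iso\<close> then yields the isomorphism. Both surjectivity and the
  description of the kernel correct a discrepancy on the core by a coboundary of
  \<open>A1\<close>.\<close>

lemma iso_direct_sum:
  assumes pR: "pres HR (R.Z (Suc (Suc n))) (R.Bd (Suc (Suc n))) qR"
    and p1: "pres H1 (A1.Z (Suc (Suc n))) (A1.Bd (Suc (Suc n))) q1"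
    and p2: "pres H2 (A2.Z (Suc (Suc n))) (A2.Bd (Suc (Suc n))) q2"
  shows "vs_isomorphic HR (direct_sum H1 H2)"
proof -
  let ?i = "Suc (Suc n)"
  have H1: "kvs H1" by (rule p1[unfolded pres_def, THEN conjunct1])
  have H2: "kvs H2" by (rule p2[unfolded pres_def, THEN conjunct1])
  have D: "kvs (direct_sum H1 H2)"
    by (rule vectorspace_kvs[OF direct_sum_is_vs[OF kvs_vectorspace[OF H1] kvs_vectorspace[OF H2]]])
  note q1 = presD[OF p1] and q2 = presD[OF p2]
  note im = q1(1) q2(1) and qa = q1(2) q2(2) and qs = q1(3) q2(3) and q0 = q1(4) q2(4)
  interpret h1: kvs H1 by (rule H1)
  interpret h2: kvs H2 by (rule H2)
  let ?q = "\<lambda>z. (q1 (r1 z), q2 (r2 z))"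
  have "pres (direct_sum H1 H2) (R.Z ?i) (R.Bd ?i) ?q"
    unfolding pres_def
  proof (intro conjI ballI allI)
    show "kvs (direct_sum H1 H2)" by (rule D)
    show "?q (\<lambda>i. x i + y i) = ?q x \<oplus>\<^bsub>direct_sum H1 H2\<^esub> ?q y" if "x \<in> R.Z ?i" "y \<in> R.Z ?i" for x y
      using that Z_r flinD(1)[OF lin(1)] flinD(1)[OF lin(2)] by (simp add: direct_sum_def qa)
    show "?q (\<lambda>i. k * x i) = k \<odot>\<^bsub>direct_sum H1 H2\<^esub> ?q x" if "x \<in> R.Z ?i" for x k
      using that Z_r flinD(2)[OF lin(1)] flinD(2)[OF lin(2)] by (simp add: direct_sum_def qs)
    show "?q ` R.Z ?i = carrier (direct_sum H1 H2)"
    proof (intro equalityI subsetI)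
      fix p assume "p \<in> ?q ` R.Z ?i"
      then show "p \<in> carrier (direct_sum H1 H2)" using im Z_r by (auto simp: direct_sum_def)
    next
      fix p assume "p \<in> carrier (direct_sum H1 H2)"
      then obtain a b where p: "p = (a, b)" "a \<in> carrier H1" "b \<in> carrier H2" by (auto simp: direct_sum_def)
      obtain f1 where f1: "f1 \<in> A1.Z ?i" "a = q1 f1" using p(2) im(1) by auto
      obtain f2 where f2: "f2 \<in> A2.Z ?i" "b = q2 f2" using p(3) im(2) by auto
      \<comment> \<open>The two cocycles need not agree on the core. Their difference there is the
        restriction of a coboundary, and subtracting that from \<open>f1\<close> keeps its class and
        makes the pair glue.\<close>
      have "(\<lambda>x. c f1 x - c f2 x) \<in> C.Z ?i" by (intro fsubD(4)[OF C.Z_sub] Z_c f1 f2)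
      from Z_onto[OF this] obtain h where h: "h \<in> K1 (Suc n)" "c (d1 (Suc n) h) = (\<lambda>x. c f1 x - c f2 x)" ..
      let ?f = "\<lambda>x. f1 x - d1 (Suc n) h x"
      have f: "?f \<in> A1.Z ?i" by (rule A1.Z_diff_d[OF f1(1) h(1)])
      have dh: "d1 (Suc n) h \<in> A1.Z ?i" using A1.d_closed[OF h(1)] A1.d_d[OF h(1)] by (simp add: A1.Z_iff)
      have "c ?f = c f2" unfolding diffs h(2) by simp
      from Z_glue[OF f f2(1) this] obtain z where z: "z \<in> R.Z ?i" "r1 z = ?f" "r2 z = f2" by auto
      have "q1 f1 = q1 ?f \<oplus>\<^bsub>H1\<^esub> q1 (d1 (Suc n) h)" using qa(1)[OF f dh] by simp
      also have "q1 (d1 (Suc n) h) = \<zero>\<^bsub>H1\<^esub>" using q0(1)[OF dh] h(1) by simp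
      also have "q1 ?f \<oplus>\<^bsub>H1\<^esub> \<zero>\<^bsub>H1\<^esub> = q1 ?f" using im(1)[symmetric] f by simp
      finally have "p = ?q z" using z p f1 f2 by simp
      then show "p \<in> ?q ` R.Z ?i" using z(1) by (rule image_eqI)
    qed
    fix z assume z: "z \<in> R.Z ?i"
    have "?q z = \<zero>\<^bsub>direct_sum H1 H2\<^esub> \<longleftrightarrow> r1 z \<in> A1.Bd ?i \<and> r2 z \<in> A2.Bd ?i"
      using q0(1)[OF Z_r(1)[OF z]] q0(2)[OF Z_r(2)[OF z]] by (simp add: direct_sum_def)
    also have "\<dots> \<longleftrightarrow> z \<in> R.Bd ?i"
    proof
      assume "z \<in> R.Bd ?i"
      then obtain y where "y \<in> KR (Suc n)" "z = dR (Suc n) y" by auto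
      then show "r1 z \<in> A1.Bd ?i \<and> r2 z \<in> A2.Bd ?i"
        using r1[of y "Suc n"] r2[of y "Suc n"] by (auto simp flip: r1(2) r2(2))
    next
      assume "r1 z \<in> A1.Bd ?i \<and> r2 z \<in> A2.Bd ?i"
      then obtain g1 g2 where g: "g1 \<in> K1 (Suc n)" "r1 z = d1 (Suc n) g1" "g2 \<in> K2 (Suc n)" "r2 z = d2 (Suc n) g2"
        by auto
      have zK: "z \<in> KR ?i" using z by (simp add: R.Z_iff)
      \<comment> \<open>The bounding cochains differ on the core by a cocycle of degree
        \<open>Suc n\<close>. This degree is positive because the total degree is at least two; one
        degree lower the difference would lie in \<open>H0\<close> of the core, which need not
        vanish.\<close>
      let ?e = "\<lambda>x. c g1 x - c g2 x"
      have "?e \<in> KC (Suc n)" using c1(1)[OF g(1)] c2(1)[OF g(3)] by (intro fsubD(4)[OF C.K_sub])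
      moreover have "dC (Suc n) ?e = (\<lambda>_. 0)"
        using flin_diff[OF C.d_lin C.K_sub c1(1)[OF g(1)] c2(1)[OF g(3)]] c1(2)[OF g(1)] c2(2)[OF g(3)] g comm[OF zK]
        by simp
      ultimately have "?e \<in> C.Z (Suc n)" by (simp add: C.Z_iff)
      from Z_onto[OF this] obtain h where h: "h \<in> K1 n" "c (d1 n h) = ?e" ..
      have dh: "d1 n h \<in> K1 (Suc n)" "d1 (Suc n) (d1 n h) = (\<lambda>_. 0)" using A1.d_closed A1.d_d h(1) by auto
      let ?g = "\<lambda>x. g1 x - d1 n h x"
      have gK: "?g \<in> K1 (Suc n)" by (rule fsubD(4)[OF A1.K_sub g(1) dh(1)])
      have gd: "d1 (Suc n) ?g = r1 z"
        using flin_diff[OF A1.d_lin A1.K_sub g(1) dh(1)] dh(2) g(2) by simp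
      have "c ?g = c g2" unfolding diffs h(2) by simp
      from glue[OF gK g(3) this] obtain y where y: "y \<in> KR (Suc n)" "r1 y = ?g" "r2 y = g2" by auto
      have "dR (Suc n) y = z"
        by (rule inj_eq[OF R.d_closed[OF y(1)] zK])
          (use r1(2)[OF y(1)] r2(2)[OF y(1)] y gd g in simp_all)
      then show "z \<in> R.Bd ?i" using y(1) by auto
    qed
    finally show "?q z = \<zero>\<^bsub>direct_sum H1 H2\<^esub> \<longleftrightarrow> z \<in> R.Bd ?i" .
  qed
  then show ?thesis by (rule pres_iso[OF pR _ R.Z_sub])
qed

end

section \<open>Full subcategories\<close>

context lincat begin

definition BW :: "'b set \<Rightarrow> 'b set" where "BW W = {b \<in> B. s b \<in> W \<and> t b \<in> W}"

text \<open>\<open>W\<close> is a set of identities, that is of objects. Setting the values outside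
  the subcategory to zero, and not removing them, keeps cochains of all subcategories in one
  function type.\<close>

definition rs :: "'b set \<Rightarrow> ('b list \<times> 'b \<Rightarrow> 'k) \<Rightarrow> 'b list \<times> 'b \<Rightarrow> 'k" where
  "rs W \<phi> = (\<lambda>(L, b). if set L \<subseteq> BW W then \<phi> (L, b) else 0)"

lemma BW_subset: "BW W \<subseteq> B" by (auto simp: BW_def)

lemma sum_BW: "(\<And>x. x \<in> B \<Longrightarrow> x \<notin> BW W \<Longrightarrow> F x = 0) \<Longrightarrow> (\<Sum>x\<in>BW W. F x) = (\<Sum>x\<in>B. F x)"
  by (rule sum.mono_neutral_left) (use finite_B BW_subset in auto)

lemma \<mu>_BW: "a \<in> BW W \<Longrightarrow> b \<in> BW W \<Longrightarrow> \<mu> a b c \<noteq> 0 \<Longrightarrow> c \<in> BW W"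
  using \<mu>_supp[of a b c] by (auto simp: BW_def)

lemma lincat_BW: "lincat (BW W) s t \<mu>"
proof
  show "finite (BW W)" using finite_B by (simp add: BW_def)
  fix a b c d assume a: "a \<in> BW W" and b: "b \<in> BW W" and c: "c \<in> BW W"
  have ab: "a \<in> B" "b \<in> B" "c \<in> B" using a b c BW_subset by auto
  have "(\<Sum>x\<in>BW W. \<mu> a b x * \<mu> x c d) = (\<Sum>x\<in>B. \<mu> a b x * \<mu> x c d)"
    using \<mu>_BW[OF a b] by (intro sum_BW) auto
  moreover have "(\<Sum>x\<in>BW W. \<mu> b c x * \<mu> a x d) = (\<Sum>x\<in>B. \<mu> b c x * \<mu> a x d)"
    using \<mu>_BW[OF b c] by (intro sum_BW) auto
  ultimately show "(\<Sum>x\<in>BW W. \<mu> a b x * \<mu> x c d) = (\<Sum>x\<in>BW W. \<mu> b c x * \<mu> a x d)"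
    using \<mu>_assoc[OF ab] by simp
next
  fix a b c assume "a \<in> BW W" "b \<in> BW W" "\<mu> a b c \<noteq> 0"
  then show "c \<in> BW W \<and> t a = s b \<and> s c = s a \<and> t c = t b"
    using \<mu>_supp[of a b c] by (auto simp: BW_def)
qed (auto simp: BW_def \<mu>_unit_left \<mu>_unit_right)

lemma BW_nested: "U \<subseteq> W \<Longrightarrow> lincat.BW (BW W) s t U = BW U"
proof -
  interpret W: lincat "BW W" s t \<mu> by (rule lincat_BW)
  show "U \<subseteq> W \<Longrightarrow> W.BW U = BW U" unfolding W.BW_def by (auto simp: BW_def)
qed

lemma rs_nested: "U \<subseteq> W \<Longrightarrow> lincat.rs (BW W) s t U = rs U"
proof -
  interpret W: lincat "BW W" s t \<mu> by (rule lincat_BW)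
  show "U \<subseteq> W \<Longrightarrow> W.rs U = rs U" by (rule ext) (auto simp: W.rs_def rs_def BW_nested)
qed

lemma J_BW: "lincat.J (BW W) s t m = {L \<in> J m. set L \<subseteq> BW W}"
proof -
  interpret W: lincat "BW W" s t \<mu> by (rule lincat_BW)
  show ?thesis using BW_subset by (auto simp: W.J_def J_def)
qed

lemma mul_BW:
  assumes "\<And>b. x b \<noteq> 0 \<Longrightarrow> b \<in> BW W" "\<And>b. y b \<noteq> 0 \<Longrightarrow> b \<in> BW W"
  shows "lincat.mul (BW W) \<mu> x y = mul x y"
proof -
  interpret W: lincat "BW W" s t \<mu> by (rule lincat_BW)
  show ?thesis
  proof
    fix c
    have "(\<Sum>a\<in>BW W. \<Sum>b\<in>BW W. x a * y b * \<mu> a b c) = (\<Sum>a\<in>BW W. \<Sum>b\<in>B. x a * y b * \<mu> a b c)"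
      by (intro sum.cong refl sum_BW) (use assms(2) in auto)
    also have "\<dots> = (\<Sum>a\<in>B. \<Sum>b\<in>B. x a * y b * \<mu> a b c)"
      by (intro sum_BW) (use assms(1) in \<open>auto intro!: sum.neutral\<close>)
    finally show "W.mul x y c = mul x y c" by (simp add: W.mul_def mul_def)
  qed
qed

lemma bd_BW:
  assumes "\<And>L. f L \<noteq> 0 \<Longrightarrow> set L \<subseteq> BW W"
  shows "lincat.bd (BW W) \<mu> M f = bd M f"
proof -
  interpret W: lincat "BW W" s t \<mu> by (rule lincat_BW)
  show ?thesis using assms
  proof (induct M arbitrary: f)
    case (Cons c M)
    have "(\<Sum>a\<in>BW W. \<Sum>b\<in>BW W. \<mu> a b c * f (a # b # M)) = (\<Sum>a\<in>BW W. \<Sum>b\<in>B. \<mu> a b c * f (a # b # M))"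
      by (intro sum.cong refl sum_BW) (use Cons(2)[of "_ # _ # M"] in auto)
    also have "\<dots> = (\<Sum>a\<in>B. \<Sum>b\<in>B. \<mu> a b c * f (a # b # M))"
      by (intro sum_BW) (use Cons(2)[of "_ # _ # M"] in \<open>auto intro!: sum.neutral\<close>)
    finally have 1: "(\<Sum>a\<in>BW W. \<Sum>b\<in>BW W. \<mu> a b c * f (a # b # M)) = (\<Sum>a\<in>B. \<Sum>b\<in>B. \<mu> a b c * f (a # b # M))" .
    have "W.bd M (\<lambda>L. f (c # L)) = bd M (\<lambda>L. f (c # L))"
      by (rule Cons(1)) (use Cons(2)[of "c # _"] in auto)
    with 1 show ?case by simp
  qed simp
qed

text \<open>A value at \<open>L\<close> is the value at the generator multiplied by the first letter
  on the left and the last on the right. Whatever occurs in it therefore starts where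
  \<open>L\<close> starts and ends where \<open>L\<close> ends.\<close>

lemma K_parallel:
  assumes \<phi>: "\<phi> \<in> K n" and nz: "\<phi> (L, b) \<noteq> 0"
  shows "b \<in> B" "s b = s (hd L)" "t b = t (last L)"
proof -
  have L: "L \<in> J (n + 2)" "b \<in> B" using K_supp[OF \<phi> nz] by auto
  then show "b \<in> B" by simp
  from L obtain a N c where L': "L = a # N @ [c]" "a \<in> B" "c \<in> B" by (auto elim: J_cases)
  have "\<phi> (L, b) = mul (unit_vec_at a) (mul (\<lambda>d. \<phi> (t a # N @ [s c], d)) (unit_vec_at c)) b"
    using K_gen[OF \<phi> L(1)[unfolded L'(1)]] unfolding L'(1) by (simp add: fun_eq_iff)
  with nz have nz': "mul (unit_vec_at a) (mul (\<lambda>d. \<phi> (t a # N @ [s c], d)) (unit_vec_at c)) b \<noteq> 0" by simp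
  have "b \<in> {d \<in> B. s d = s a}" using supp_mul_unit_left[OF L'(2)] nz' by (auto simp: supp_def)
  moreover have "b \<in> {d \<in> B. t d = t c}"
    using supp_mul_unit_right[OF L'(3), of "mul (unit_vec_at a) (\<lambda>d. \<phi> (t a # N @ [s c], d))"] nz' by (auto simp: supp_def mul_assoc)
  ultimately show "s b = s (hd L)" "t b = t (last L)" by (simp_all add: L'(1))
qed

lemma BW_ends: "a \<in> BW W \<Longrightarrow> t a \<in> BW W" "a \<in> BW W \<Longrightarrow> s a \<in> BW W"
  by (auto simp: BW_def)

lemma set_gen_BW:
  assumes "L \<in> J (n + 2)" "set L \<subseteq> BW W" shows "set (gen L) \<subseteq> BW W"
proof -
  from assms(1) obtain a N c where "L = a # N @ [c]" by (auto elim: J_cases)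
  with assms(2) show ?thesis using BW_ends by auto
qed

text \<open>Describes the cochains of a full subcategory with the products and words of the ambient
  category: the subcategory is closed under composition, so its own \<open>mul\<close> agrees with
  the ambient one on elements supported in it.\<close>

lemma K_BW_iff:
  "\<phi> \<in> lincat.K (BW W) s t \<mu> n \<longleftrightarrow>
    (\<forall>L b. \<phi> (L, b) \<noteq> 0 \<longrightarrow> L \<in> J (n + 2) \<and> set L \<subseteq> BW W \<and> b \<in> BW W) \<and>
    (\<forall>L\<in>J (n + 2). set L \<subseteq> BW W \<longrightarrow> (\<lambda>b. \<phi> (L, b)) =
        mul (unit_vec_at (hd L)) (mul (\<lambda>b. \<phi> (gen L, b)) (unit_vec_at (last L))))"
  (is "?l \<longleftrightarrow> ?S \<and> ?G")
proof -
  interpret W: lincat "BW W" s t \<mu> by (rule lincat_BW)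
  have eq: "W.mul (unit_vec_at (hd L)) (W.mul (\<lambda>b. \<phi> (gen L, b)) (unit_vec_at (last L))) =
      mul (unit_vec_at (hd L)) (mul (\<lambda>b. \<phi> (gen L, b)) (unit_vec_at (last L)))"
    if S: ?S and L: "L \<in> J (n + 2)" "set L \<subseteq> BW W" for L
  proof -
    from L obtain a N c where L': "L = a # N @ [c]" by (auto elim: J_cases)
    have "hd L \<in> BW W" "last L \<in> BW W" using L(2) by (auto simp: L')
    have 1: "W.mul (\<lambda>b. \<phi> (gen L, b)) (unit_vec_at (last L)) = mul (\<lambda>b. \<phi> (gen L, b)) (unit_vec_at (last L))"
      by (rule mul_BW) (use S \<open>last L \<in> BW W\<close> in \<open>auto simp: unit_vec_at_def split: if_splits\<close>)
    show ?thesis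
      unfolding 1[symmetric]
      by (rule mul_BW) (use \<open>hd L \<in> BW W\<close> W.mul_V in \<open>auto simp: unit_vec_at_def W.V_def split: if_splits\<close>)
  qed
  show ?thesis
  proof
    assume "\<phi> \<in> W.K n"
    then have S: ?S and G: "\<And>L. L \<in> J (n + 2) \<Longrightarrow> set L \<subseteq> BW W \<Longrightarrow> (\<lambda>b. \<phi> (L, b)) =
        W.mul (unit_vec_at (hd L)) (W.mul (\<lambda>b. \<phi> (gen L, b)) (unit_vec_at (last L)))"
      unfolding W.K_def J_BW by simp_all
    have ?G
    proof (intro ballI impI)
      fix L assume L: "L \<in> J (n + 2)" "set L \<subseteq> BW W"
      show "(\<lambda>b. \<phi> (L, b)) = mul (unit_vec_at (hd L)) (mul (\<lambda>b. \<phi> (gen L, b)) (unit_vec_at (last L)))"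
        unfolding eq[OF S L, symmetric] by (rule G[OF L])
    qed
    with S show "?S \<and> ?G" ..
  next
    assume SG: "?S \<and> ?G"
    then have S: ?S and G: ?G by simp_all
    show "\<phi> \<in> W.K n"
      unfolding W.K_def J_BW
    proof (intro CollectI conjI ballI)
      show "\<forall>L b. \<phi> (L, b) \<noteq> 0 \<longrightarrow> L \<in> {L \<in> J (n + 2). set L \<subseteq> BW W} \<and> b \<in> BW W"
        using S by simp
      fix L assume "L \<in> {L \<in> J (n + 2). set L \<subseteq> BW W}"
      then have L: "L \<in> J (n + 2)" "set L \<subseteq> BW W" by simp_all
      show "(\<lambda>b. \<phi> (L, b)) = W.mul (unit_vec_at (hd L)) (W.mul (\<lambda>b. \<phi> (gen L, b)) (unit_vec_at (last L)))"
        unfolding eq[OF S L] using G L by simp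
    qed
  qed
qed

text \<open>The values of a restricted cochain stay in the subcategory because they are parallel to
  words in it and the subcategory is full.\<close>

lemma rs_K: "\<phi> \<in> K n \<Longrightarrow> rs W \<phi> \<in> lincat.K (BW W) s t \<mu> n"
  unfolding K_BW_iff
proof (intro conjI allI ballI impI)
  assume \<phi>: "\<phi> \<in> K n"
  fix L b assume nz: "rs W \<phi> (L, b) \<noteq> 0"
  then have nz': "\<phi> (L, b) \<noteq> 0" "set L \<subseteq> BW W" by (auto simp: rs_def split: if_splits)
  show LJ: "L \<in> J (n + 2)" using K_supp[OF \<phi> nz'(1)] by simp
  show "set L \<subseteq> BW W" by (rule nz'(2))
  from LJ obtain a N c where L': "L = a # N @ [c]" by (auto elim: J_cases)
  have "a \<in> BW W" "c \<in> BW W" using nz'(2) by (auto simp: L')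
  then show "b \<in> BW W" using K_parallel[OF \<phi> nz'(1)] by (simp add: L' BW_def)
next
  assume \<phi>: "\<phi> \<in> K n"
  fix L assume L: "L \<in> J (n + 2)" "set L \<subseteq> BW W"
  then show "(\<lambda>b. rs W \<phi> (L, b)) = mul (unit_vec_at (hd L)) (mul (\<lambda>b. rs W \<phi> (gen L, b)) (unit_vec_at (last L)))"
    using \<phi> set_gen_BW[OF L] by (simp add: rs_def K_def)
qed

text \<open>The boundary of a word in the subcategory consists of words in the subcategory, so
  truncation loses no term of the sum.\<close>

lemma rs_del:
  assumes m: "m \<ge> 1" shows "lincat.del (BW W) s t \<mu> m (rs W \<phi>) = rs W (del m \<phi>)"
proof -
  interpret W: lincat "BW W" s t \<mu> by (rule lincat_BW)
  have "W.del m (rs W \<phi>) (L, b) = rs W (del m \<phi>) (L, b)" for L b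
  proof (cases "L \<in> W.J (Suc m)")
    case True
    then have L: "L \<in> J (Suc m)" "set L \<subseteq> BW W" by (simp_all add: J_BW)
    have bd: "W.bd M (unit_vec_at L) = bd M (unit_vec_at L)" for M
      by (rule bd_BW) (use L(2) in \<open>auto simp: unit_vec_at_def split: if_splits\<close>)
    have "bd M (unit_vec_at L) = 0" if "M \<in> J m" "M \<notin> W.J m" for M
      using W.bar_bd[OF W.bar_unit[OF True] m] that(2) by (auto simp: W.bar_def bd)
    then have "(\<Sum>M\<in>J m. bd M (unit_vec_at L) * \<phi> (M, b)) = (\<Sum>M\<in>W.J m. bd M (unit_vec_at L) * \<phi> (M, b))"
      by (intro sum.mono_neutral_right) (auto simp: J_BW)
    also have "\<dots> = (\<Sum>M\<in>W.J m. W.bd M (unit_vec_at L) * rs W \<phi> (M, b))"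
      by (intro sum.cong refl) (auto simp: bd rs_def J_BW)
    finally show ?thesis using True L by (simp add: W.del_def del_def rs_def)
  next
    case False
    then show ?thesis by (auto simp: W.del_def del_def rs_def J_BW)
  qed
  then show ?thesis by auto
qed

section \<open>Extending and gluing cochains\<close>

lemma fcomplex: "fcomplex K \<delta>"
proof
  fix n
  show "fsub (K n)" unfolding fsub_def by (intro conjI ballI allI K_zero K_add K_smult)
  have "supp \<phi> \<subseteq> J (n + 2) \<times> B" if "\<phi> \<in> K n" for \<phi>
    using K_supp[OF that] by (auto simp: supp_def)
  then show "finsupp (K n)" unfolding finsupp_def
    by (intro exI[of _ "J (n + 2) \<times> B"] conjI ballI) (simp_all add: finite_B)
  show "flin (K n) (\<delta> n)" by (simp add: flin_def del_add del_smult)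
  fix f assume "f \<in> K n"
  then show "\<delta> n f \<in> K (Suc n)" by (rule K_del)
  show "\<delta> (Suc n) (\<delta> n f) = (\<lambda>_. 0)" using del_del[of "n + 2" f] by simp
qed

text \<open>The cochain with prescribed values \<open>\<psi>\<close> on bimodule generators, cut down to the right endpoints.\<close>

definition mk :: "nat \<Rightarrow> ('b list \<Rightarrow> 'b \<Rightarrow> 'k) \<Rightarrow> 'b list \<times> 'b \<Rightarrow> 'k" where
  "mk n \<psi> = (\<lambda>(L, b). if L \<in> J (n + 2)
     then mul (unit_vec_at (hd L)) (mul (\<psi> (gen L)) (unit_vec_at (last L))) b else 0)"

lemma mk_K: "mk n \<psi> \<in> K n"
  unfolding K_def
proof (intro CollectI conjI allI impI ballI)
  fix L b assume nz: "mk n \<psi> (L, b) \<noteq> 0"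
  then show "L \<in> J (n + 2)" by (auto simp: mk_def split: if_splits)
  with nz show "b \<in> B" using mul_V by (auto simp: mk_def V_def)
next
  fix L assume LJ: "L \<in> J (n + 2)"
  then obtain a N c where L: "L = a # N @ [c]" "a \<in> B" "c \<in> B" by (auto elim: J_cases)
  have g: "t a # N @ [s c] \<in> J (n + 2)" using LJ unfolding L(1) by (rule J_gen)
  let ?\<psi> = "\<psi> (t a # N @ [s c])"
  have "(\<lambda>b. mk n \<psi> (gen L, b)) = mul (unit_vec_at (t a)) (mul ?\<psi> (unit_vec_at (s c)))"
    using g L by (simp add: mk_def)
  then have "mul (unit_vec_at (hd L)) (mul (\<lambda>b. mk n \<psi> (gen L, b)) (unit_vec_at (last L))) =
    mul (mul (unit_vec_at a) (unit_vec_at (t a))) (mul ?\<psi> (mul (unit_vec_at (s c)) (unit_vec_at c)))"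
    by (simp add: L(1) mul_assoc)
  also have "\<dots> = mul (unit_vec_at a) (mul ?\<psi> (unit_vec_at c))"
    using L by (simp add: mul_unit_t mul_s_unit)
  finally show "(\<lambda>b. mk n \<psi> (L, b)) = mul (unit_vec_at (hd L)) (mul (\<lambda>b. mk n \<psi> (gen L, b)) (unit_vec_at (last L)))"
    using LJ L by (simp add: mk_def)
qed

lemma rs_mk:
  assumes g: "g \<in> lincat.K (BW W) s t \<mu> n"
    and \<psi>: "\<And>L. L \<in> J (n + 2) \<Longrightarrow> set L \<subseteq> BW W \<Longrightarrow> \<psi> (gen L) = (\<lambda>b. g (gen L, b))"
  shows "rs W (mk n \<psi>) = g"
proof (rule ext, clarify)
  note G = g[unfolded K_BW_iff]
  fix L b
  show "rs W (mk n \<psi>) (L, b) = g (L, b)"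
  proof (cases "L \<in> J (n + 2) \<and> set L \<subseteq> BW W")
    case True
    then have "(\<lambda>b. g (L, b)) = mul (unit_vec_at (hd L)) (mul (\<lambda>b. g (gen L, b)) (unit_vec_at (last L)))"
      using G by blast
    from fun_cong[OF this, of b] show ?thesis using True \<psi>[of L] by (simp add: rs_def mk_def)
  next
    case False
    then have "g (L, b) = 0" using G by blast
    then show ?thesis using False by (auto simp: rs_def mk_def)
  qed
qed

lemma rs_surj: "g \<in> lincat.K (BW W) s t \<mu> n \<Longrightarrow> \<exists>\<phi>\<in>K n. rs W \<phi> = g"
  using rs_mk[of g W n "\<lambda>L b. g (L, b)"] mk_K[of n "\<lambda>L b. g (L, b)"] by auto

text \<open>A cochain is determined freely by its values on generators: take those of
  \<open>f1\<close> on generators in the first subcategory and those of \<open>f2\<close> elsewhere.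
  On generators common to both the choice does not matter by \<open>eq\<close>.\<close>

lemma rs_glue:
  assumes f1: "f1 \<in> lincat.K (BW W1) s t \<mu> n" and f2: "f2 \<in> lincat.K (BW W2) s t \<mu> n"
    and eq: "rs (W1 \<inter> W2) f1 = rs (W1 \<inter> W2) f2"
  shows "\<exists>\<phi>\<in>K n. rs W1 \<phi> = f1 \<and> rs W2 \<phi> = f2"
proof -
  define \<psi> where "\<psi> G = (\<lambda>b. if set G \<subseteq> BW W1 then f1 (G, b) else f2 (G, b))" for G
  have "rs W1 (mk n \<psi>) = f1"
    using set_gen_BW by (intro rs_mk f1) (auto simp: \<psi>_def)
  moreover have "rs W2 (mk n \<psi>) = f2"
  proof (rule rs_mk[OF f2])
    fix L assume "L \<in> J (n + 2)" "set L \<subseteq> BW W2"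
    then have g: "set (gen L) \<subseteq> BW W2" by (rule set_gen_BW)
    have "f1 (gen L, b) = f2 (gen L, b)" if "set (gen L) \<subseteq> BW W1" for b
    proof -
      have "set (gen L) \<subseteq> BW (W1 \<inter> W2)" using g that by (auto simp: BW_def)
      then show ?thesis using fun_cong[OF eq, of "(gen L, b)"] by (simp add: rs_def)
    qed
    then show "\<psi> (gen L) = (\<lambda>b. f2 (gen L, b))" by (auto simp: \<psi>_def)
  qed
  ultimately show ?thesis using mk_K by blast
qed

lemma flin_rs: "flin UNIV (rs W)"
  by (auto simp: flin_def rs_def fun_eq_iff)

text \<open>The hypothesis \<open>cover\<close> provides injectivity: a string that lies in neither
  subcategory has nothing parallel to it. Gluing and extension come from the free choice of values
  on generators.\<close>

lemma mv_lincat: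
  assumes cover: "\<And>L n. L \<in> J (n + 2) \<Longrightarrow> set L \<subseteq> BW W1 \<or> set L \<subseteq> BW W2 \<or>
      (\<forall>b\<in>B. \<not> (s b = s (hd L) \<and> t b = t (last L)))"
    and core: "\<And>n. n \<ge> 1 \<Longrightarrow> model_cocycles (lincat.K (BW (W1 \<inter> W2)) s t \<mu>) (\<lambda>n. lincat.del (BW (W1 \<inter> W2)) s t \<mu> (n + 2)) n \<subseteq>
      model_coboundaries (lincat.K (BW (W1 \<inter> W2)) s t \<mu>) (\<lambda>n. lincat.del (BW (W1 \<inter> W2)) s t \<mu> (n + 2)) n"
  shows "mv K (lincat.K (BW W1) s t \<mu>) (lincat.K (BW W2) s t \<mu>) (lincat.K (BW (W1 \<inter> W2)) s t \<mu>)
    \<delta> (\<lambda>n. lincat.del (BW W1) s t \<mu> (n + 2)) (\<lambda>n. lincat.del (BW W2) s t \<mu> (n + 2))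
    (\<lambda>n. lincat.del (BW (W1 \<inter> W2)) s t \<mu> (n + 2)) (rs W1) (rs W2) (rs (W1 \<inter> W2))"
proof -
  interpret W1: lincat "BW W1" s t \<mu> by (rule lincat_BW)
  interpret W2: lincat "BW W2" s t \<mu> by (rule lincat_BW)
  interpret C: lincat "BW (W1 \<inter> W2)" s t \<mu> by (rule lincat_BW)
  note n1 = BW_nested[OF Int_lower1[of W1 W2]] rs_nested[OF Int_lower1[of W1 W2]]
  note n2 = BW_nested[OF Int_lower2[of W1 W2]] rs_nested[OF Int_lower2[of W1 W2]]
  have two: "2 \<le> n + 2" "1 \<le> n + 2" for n :: nat by simp_all
  show ?thesis
  proof (intro mv.intro mv_axioms.intro fcomplex W1.fcomplex W2.fcomplex C.fcomplex flin_rs)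
    fix f n assume f: "f \<in> K n"
    show "rs W1 f \<in> W1.K n" "rs W2 f \<in> W2.K n" by (rule rs_K[OF f])+
    show "W1.del (n + 2) (rs W1 f) = rs W1 (\<delta> n f)" "W2.del (n + 2) (rs W2 f) = rs W2 (\<delta> n f)"
      by (rule rs_del, simp)+
    show "rs (W1 \<inter> W2) (rs W1 f) = rs (W1 \<inter> W2) (rs W2 f)"
      by (auto simp: rs_def BW_def fun_eq_iff)
    assume z: "rs W1 f = (\<lambda>_. 0)" "rs W2 f = (\<lambda>_. 0)"
    show "f = (\<lambda>_. 0)"
    proof (rule ext, clarify)
      fix L b
      show "f (L, b) = 0"
      proof (rule ccontr)
        assume nz: "f (L, b) \<noteq> 0"
        have "L \<in> J (n + 2)" using K_supp[OF f nz] by simp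
        \<comment> \<open>The element \<open>b\<close> is parallel to \<open>L\<close>, which rules
          out the third alternative.\<close>
        from cover[OF this] K_parallel[OF f nz] have "set L \<subseteq> BW W1 \<or> set L \<subseteq> BW W2" by auto
        then show False
          using nz fun_cong[OF z(1), of "(L, b)"] fun_cong[OF z(2), of "(L, b)"] by (auto simp: rs_def)
      qed
    qed
  next
    fix f n assume f: "f \<in> W1.K n"
    show "rs (W1 \<inter> W2) f \<in> C.K n" using W1.rs_K[OF f, of "W1 \<inter> W2"] unfolding n1 .
    show "C.del (n + 2) (rs (W1 \<inter> W2) f) = rs (W1 \<inter> W2) (W1.del (n + 2) f)"
      using W1.rs_del[OF two(2), of "W1 \<inter> W2" n f] unfolding n1 .
  next
    fix f n assume f: "f \<in> W2.K n"
    show "rs (W1 \<inter> W2) f \<in> C.K n" using W2.rs_K[OF f, of "W1 \<inter> W2"] unfolding n2 .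
    show "C.del (n + 2) (rs (W1 \<inter> W2) f) = rs (W1 \<inter> W2) (W2.del (n + 2) f)"
      using W2.rs_del[OF two(2), of "W1 \<inter> W2" n f] unfolding n2 .
  next
    fix f1 n f2 assume "f1 \<in> W1.K n" "f2 \<in> W2.K n" "rs (W1 \<inter> W2) f1 = rs (W1 \<inter> W2) f2"
    then show "\<exists>f\<in>K n. rs W1 f = f1 \<and> rs W2 f = f2" by (rule rs_glue)
  next
    fix g n assume g: "g \<in> C.K n"
    show "\<exists>f\<in>W1.K n. rs (W1 \<inter> W2) f = g" using W1.rs_surj[of g "W1 \<inter> W2" n] g unfolding n1 by simp
  qed (rule core)
qed

end

context lincat begin

section \<open>Central elements\<close>

text \<open>The multiplication map from two-letter words to the algebra, that is the cochain of
  degree zero that corresponds to the unit in the centre.\<close>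

definition idc :: "'b list \<times> 'b \<Rightarrow> 'k" where
  "idc = (\<lambda>(L, b). if L \<in> J 2 then \<mu> (hd L) (last L) b else 0)"

lemma J2_cases:
  assumes "L \<in> J 2" obtains a b where "L = [a, b]" "a \<in> B" "b \<in> B" "t a = s b"
  using assms by (auto simp: J_def length_Suc_conv numeral_2_eq_2)

lemma J2I: "a \<in> B \<Longrightarrow> b \<in> B \<Longrightarrow> t a = s b \<Longrightarrow> [a, b] \<in> J 2"
  by (simp add: J_def)

lemma ev_idc: "f \<in> bar 2 \<Longrightarrow> ev 2 idc f = (\<lambda>b. bd [b] f)"
proof (induct f rule: bar_induct)
  case (unit k L)
  then obtain p q where L: "L = [p, q]" "p \<in> B" "q \<in> B" by (auto elim: J2_cases)
  have "bd [b] (unit_vec_at L) = \<mu> p q b" for b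
  proof -
    have "(\<Sum>a\<in>B. \<Sum>c\<in>B. \<mu> a c b * unit_vec_at [p, q] [a, c]) =
      (\<Sum>a\<in>B. unit_vec_at p a * (\<Sum>c\<in>B. unit_vec_at q c * \<mu> a c b))"
      unfolding sum_distrib_left by (intro sum.cong refl) (auto simp: unit_vec_at_def)
    also have "\<dots> = \<mu> p q b" using L finite_B by (simp add: sum_unit_vec)
    finally show ?thesis unfolding L(1) by simp
  qed
  then show ?case using unit L by (simp only: ev_smult ev_unit bd_smult) (simp add: idc_def)
next
  case (add f g)
  then show ?case by (simp only: ev_add bd_add)
qed simp

lemma idc_K: "idc \<in> K 0"
proof (rule K_I)
  fix L b assume nz: "idc (L, b) \<noteq> 0"
  then have L2: "L \<in> J 2" by (simp add: idc_def split: if_splits)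
  then obtain p q where L: "L = [p, q]" "p \<in> B" "q \<in> B" by (rule J2_cases)
  have "\<mu> p q b \<noteq> 0" using nz L2 by (simp add: idc_def L(1))
  then show "L \<in> J (0 + 2) \<and> b \<in> B" using \<mu>_supp[OF L(2,3)] L2 by simp
next
  fix x y f assume f: "f \<in> bar (0 + 2)"
  then have f2: "f \<in> bar 2" by simp
  have "ev 2 idc (Lm x (Rm y f)) = (\<lambda>b. bd [b] (Lm x (Rm y f)))"
    by (rule ev_idc) (intro bar_Lm bar_Rm f2)
  also have "\<dots> = (\<lambda>b. Lm x (Rm y (\<lambda>M. bd M f)) [b])"
    by (rule ext) (rule fun_cong[OF bd_act])
  also have "\<dots> = mul x (mul (\<lambda>b. bd [b] f) y)" by (rule bar_one_act)
  finally show "ev (0 + 2) idc (Lm x (Rm y f)) = mul x (mul (ev (0 + 2) idc f) y)"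
    using ev_idc[OF f2] by simp
qed

text \<open>On two-letter words \<open>idc\<close> evaluates as the bar differential, so its
  coboundary is the bar differential applied twice.\<close>

lemma idc_Z: "idc \<in> model_cocycles K \<delta> 0"
proof -
  have "\<delta> 0 idc (L, b) = 0" for L b
  proof (cases "L \<in> J (Suc 2)")
    case True
    have "(\<lambda>M. bd M (unit_vec_at L)) \<in> bar 2" using True by (intro bar_bd) auto
    from fun_cong[OF ev_idc[OF this], of b] have "del 2 idc (L, b) = 0"
      unfolding del_simp[OF True] bd_bd by simp
    then show ?thesis by simp
  qed (simp add: del_def)
  then have "\<delta> 0 idc = (\<lambda>_. 0)" by (simp add: fun_eq_iff)
  then show ?thesis unfolding model_cocycles_def using idc_K by simp
qed

lemma rs_idc: "rs W idc = lincat.idc (BW W) s t \<mu>"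
proof -
  interpret W: lincat "BW W" s t \<mu> by (rule lincat_BW)
  show ?thesis by (auto simp: fun_eq_iff rs_def idc_def W.idc_def J_BW)
qed

lemma idc_nonzero: "x \<in> B \<Longrightarrow> s x = x \<Longrightarrow> idc \<noteq> (\<lambda>_. 0)"
proof -
  assume x: "x \<in> B" "s x = x"
  then have "idc ([x, x], x) = 1"
    using J2I[of x x] ts[of x] \<mu>_unit_left[of x x] by (simp add: idc_def)
  then show ?thesis by (metis zero_neq_one)
qed

lemma mul_idem_right:
  assumes "\<And>c. x c \<noteq> 0 \<Longrightarrow> c \<in> B \<and> t c = e" "e \<in> B" "s e = e"
  shows "mul x (unit_vec_at e) = x"
proof
  fix c
  have "mul x (unit_vec_at e) c = (\<Sum>a\<in>B. \<Sum>b\<in>B. unit_vec_at e b * (x a * \<mu> a b c))"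
    by (simp add: mul_def mult_ac)
  also have "\<dots> = (\<Sum>a\<in>B. x a * \<mu> a e c)" using assms(2) finite_B by (simp add: sum_unit_vec)
  also have "\<dots> = (\<Sum>a\<in>B. if a = c then x c else 0)"
    by (intro sum.cong refl) (use assms in \<open>auto simp: idem_coeff_right\<close>)
  also have "\<dots> = x c" using assms(1)[of c] finite_B by auto
  finally show "mul x (unit_vec_at e) c = x c" .
qed

lemma mul_idem_left:
  assumes "\<And>c. x c \<noteq> 0 \<Longrightarrow> c \<in> B \<and> s c = e" "e \<in> B" "s e = e"
  shows "mul (unit_vec_at e) x = x"
proof
  fix c
  have "mul (unit_vec_at e) x c = (\<Sum>a\<in>B. unit_vec_at e a * (\<Sum>b\<in>B. x b * \<mu> a b c))"
    by (simp add: mul_def mult_ac sum_distrib_left)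
  also have "\<dots> = (\<Sum>b\<in>B. x b * \<mu> e b c)" using assms(2) finite_B by (simp add: sum_unit_vec)
  also have "\<dots> = (\<Sum>b\<in>B. if b = c then x c else 0)"
    by (intro sum.cong refl) (use assms in \<open>auto simp: idem_coeff\<close>)
  also have "\<dots> = x c" using assms(1)[of c] finite_B by auto
  finally show "mul (unit_vec_at e) x c = x c" .
qed

lemma K0_values:
  assumes \<phi>: "\<phi> \<in> K 0" and ab: "a \<in> B" "b \<in> B" "t a = s b"
  shows "(\<lambda>c. \<phi> ([a, b], c)) = mul (unit_vec_at a) (mul (\<lambda>c. \<phi> ([t a, t a], c)) (unit_vec_at b))"
  using K_gen[OF \<phi>, of a "[]" b] J2I[OF ab] ab(3) by simp

text \<open>The boundary of \<open>1 \<otimes> a \<otimes> 1\<close> is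
  \<open>a \<otimes> 1 - 1 \<otimes> a\<close>; a 0-cocycle that takes equal values on these two is
  an element that commutes with \<open>a\<close>.\<close>

lemma bd_unit3:
  assumes "a \<in> B"
  shows "(\<lambda>M. bd M (unit_vec_at [s a, a, t a])) = (\<lambda>M. unit_vec_at [a, t a] M - unit_vec_at [s a, a] M :: 'k)"
proof
  fix M
  have L: "[s a, a, t a] \<in> J 3" using assms by (simp add: J_def)
  show "bd M (unit_vec_at [s a, a, t a]) = (unit_vec_at [a, t a] M - unit_vec_at [s a, a] M :: 'k)"
  proof (cases "length M = 2")
    case True
    then obtain c d where M: "M = [c, d]" by (auto simp: length_Suc_conv numeral_2_eq_2)
    have "(\<Sum>p\<in>B. \<Sum>q\<in>B. \<mu> p q c * unit_vec_at [s a, a, t a] [p, q, d]) =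
      (\<Sum>p\<in>B. unit_vec_at (s a) p * (\<Sum>q\<in>B. unit_vec_at a q * (if d = t a then \<mu> p q c else 0)))"
      unfolding sum_distrib_left by (intro sum.cong refl) (auto simp: unit_vec_at_def)
    also have "\<dots> = (if d = t a then \<mu> (s a) a c else 0)"
      using assms finite_B by (simp add: sum_unit_vec)
    finally have 1: "(\<Sum>p\<in>B. \<Sum>q\<in>B. \<mu> p q c * unit_vec_at [s a, a, t a] [p, q, d]) = unit_vec_at [a, t a] M"
      using assms by (simp add: \<mu>_unit_left M) (simp add: unit_vec_at_def)
    have "(\<Sum>p\<in>B. \<Sum>q\<in>B. \<mu> p q d * unit_vec_at [s a, a, t a] [c, p, q]) =
      (\<Sum>p\<in>B. unit_vec_at a p * (\<Sum>q\<in>B. unit_vec_at (t a) q * (if c = s a then \<mu> p q d else 0)))"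
      unfolding sum_distrib_left by (intro sum.cong refl) (auto simp: unit_vec_at_def)
    also have "\<dots> = (if c = s a then \<mu> a (t a) d else 0)"
      using assms finite_B by (simp add: sum_unit_vec)
    finally have 2: "(\<Sum>p\<in>B. \<Sum>q\<in>B. \<mu> p q d * unit_vec_at [s a, a, t a] [c, p, q]) = unit_vec_at [s a, a] M"
      using assms by (simp add: \<mu>_unit_right M) (simp add: unit_vec_at_def)
    show ?thesis using 1 2 by (simp add: M)
  next
    case False
    have "(\<lambda>M. bd M (unit_vec_at [s a, a, t a])) \<in> bar 2" using L by (intro bar_bd) (simp_all add: numeral_3_eq_3 numeral_2_eq_2)
    then have "bd M (unit_vec_at [s a, a, t a]) = (0 :: 'k)" using False by (auto simp: bar_def J_def)
    moreover have "M \<noteq> [a, t a]" "M \<noteq> [s a, a]" using False by auto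
    ultimately show ?thesis by (simp add: unit_vec_at_def)
  qed
qed

text \<open>With \<open>z x\<close> for the value at \<open>[x, x]\<close>, the cocycle condition
  reads \<open>a z(t a) = z(s a) a\<close>. Compare the coefficients of \<open>a\<close>: by
  \<open>r\<close> and \<open>l\<close> only the identity components of \<open>z\<close> contribute
  to it.\<close>

lemma central_arrow:
  assumes \<phi>: "\<phi> \<in> model_cocycles K \<delta> 0" and a: "a \<in> B"
    and r: "\<And>c. c \<in> B \<Longrightarrow> \<mu> a c a = (if c = t a then 1 else 0)"
    and l: "\<And>c. c \<in> B \<Longrightarrow> \<mu> c a a = (if c = s a then 1 else 0)"
  shows "\<phi> ([s a, s a], s a) = \<phi> ([t a, t a], t a)"
proof -
  have \<phi>K: "\<phi> \<in> K 0" and \<phi>d: "\<delta> 0 \<phi> = (\<lambda>_. 0)" using \<phi> by (auto simp: model_cocycles_def)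
  have L: "[s a, a, t a] \<in> J (Suc 2)" using a by (simp add: J_def)
  have J: "[a, t a] \<in> J 2" "[s a, a] \<in> J 2" using a by (auto intro: J2I)
  have "0 = del 2 \<phi> ([s a, a, t a], a)" using \<phi>d by simp
  also have "\<dots> = ev 2 \<phi> (\<lambda>M. unit_vec_at [a, t a] M + (-1) * unit_vec_at [s a, a] M) a"
    unfolding del_simp[OF L] bd_unit3[OF a] by simp
  also have "\<dots> = \<phi> ([a, t a], a) - \<phi> ([s a, a], a)"
    unfolding ev_add ev_smult ev_unit[OF J(1)] ev_unit[OF J(2)] by simp
  finally have eq: "\<phi> ([a, t a], a) = \<phi> ([s a, a], a)" by simp
  have pt: "c \<in> B \<and> t c = t a" if "\<phi> ([t a, t a], c) \<noteq> 0" for c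
    using K_parallel[OF \<phi>K that] a by simp
  have ps: "c \<in> B \<and> s c = s a" if "\<phi> ([s a, s a], c) \<noteq> 0" for c
    using K_parallel[OF \<phi>K that] a by simp
  have "(\<lambda>c. \<phi> ([a, t a], c)) = mul (unit_vec_at a) (mul (\<lambda>c. \<phi> ([t a, t a], c)) (unit_vec_at (t a)))"
    by (rule K0_values[OF \<phi>K]) (use a in simp_all)
  also have "mul (\<lambda>c. \<phi> ([t a, t a], c)) (unit_vec_at (t a)) = (\<lambda>c. \<phi> ([t a, t a], c))"
    by (rule mul_idem_right[OF pt]) (use a in simp_all)
  finally have "\<phi> ([a, t a], a) = mul (unit_vec_at a) (\<lambda>c. \<phi> ([t a, t a], c)) a" by (rule fun_cong)
  also have "\<dots> = (\<Sum>p\<in>B. unit_vec_at a p * (\<Sum>c\<in>B. \<phi> ([t a, t a], c) * \<mu> p c a))"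
    by (simp add: mul_def sum_distrib_left mult_ac)
  also have "\<dots> = (\<Sum>c\<in>B. \<phi> ([t a, t a], c) * \<mu> a c a)" using a finite_B by (simp add: sum_unit_vec)
  also have "\<dots> = (\<Sum>c\<in>B. unit_vec_at (t a) c * \<phi> ([t a, t a], c))"
    by (intro sum.cong refl) (auto simp: r unit_vec_at_def)
  also have "\<dots> = \<phi> ([t a, t a], t a)" using a finite_B by (simp add: sum_unit_vec)
  finally have 1: "\<phi> ([a, t a], a) = \<phi> ([t a, t a], t a)" .
  have "(\<lambda>c. \<phi> ([s a, a], c)) = mul (unit_vec_at (s a)) (mul (\<lambda>c. \<phi> ([t (s a), t (s a)], c)) (unit_vec_at a))"
    by (rule K0_values[OF \<phi>K]) (use a in simp_all)
  also have "\<dots> = mul (mul (unit_vec_at (s a)) (\<lambda>c. \<phi> ([s a, s a], c))) (unit_vec_at a)"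
    unfolding mul_assoc using a by simp
  also have "mul (unit_vec_at (s a)) (\<lambda>c. \<phi> ([s a, s a], c)) = (\<lambda>c. \<phi> ([s a, s a], c))"
    by (rule mul_idem_left[OF ps]) (use a in simp_all)
  finally have "\<phi> ([s a, a], a) = mul (\<lambda>c. \<phi> ([s a, s a], c)) (unit_vec_at a) a" by (rule fun_cong)
  also have "\<dots> = (\<Sum>c\<in>B. \<Sum>p\<in>B. unit_vec_at a p * (\<phi> ([s a, s a], c) * \<mu> c p a))"
    by (simp add: mul_def mult_ac)
  also have "\<dots> = (\<Sum>c\<in>B. \<phi> ([s a, s a], c) * \<mu> c a a)" using a finite_B by (simp add: sum_unit_vec)
  also have "\<dots> = (\<Sum>c\<in>B. unit_vec_at (s a) c * \<phi> ([s a, s a], c))"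
    by (intro sum.cong refl) (auto simp: l unit_vec_at_def)
  also have "\<dots> = \<phi> ([s a, s a], s a)" using a finite_B by (simp add: sum_unit_vec)
  finally show ?thesis using 1 eq by simp
qed

text \<open>Without closed morphisms other than identities, the value at \<open>[x, x]\<close> has
  only an identity component, which is \<open>k\<close>. The value at \<open>[a, b]\<close> is then
  \<open>k\<close> times the product of \<open>a\<close> and \<open>b\<close>.\<close>

lemma rs_central:
  assumes \<phi>: "\<phi> \<in> K 0" and k: "\<And>x. x \<in> BW W \<Longrightarrow> s x = x \<Longrightarrow> \<phi> ([x, x], x) = k"
    and acyclic: "\<And>b. b \<in> BW W \<Longrightarrow> s b = t b \<Longrightarrow> b = s b"
  shows "rs W \<phi> = (\<lambda>i. k * rs W idc i)"
proof (rule ext, clarify)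
  fix L c
  show "rs W \<phi> (L, c) = k * rs W idc (L, c)"
  proof (cases "L \<in> J 2 \<and> set L \<subseteq> BW W")
    case True
    then obtain a b where L: "L = [a, b]" "a \<in> B" "b \<in> B" "t a = s b" by (auto elim: J2_cases)
    have aW: "t a \<in> BW W" using True L BW_ends by auto
    have "(\<lambda>c. \<phi> ([t a, t a], c)) = (\<lambda>c. k * unit_vec_at (t a) c)"
    proof
      fix c
      show "\<phi> ([t a, t a], c) = k * unit_vec_at (t a) c"
      proof (cases "c = t a")
        case True
        then show ?thesis using k[OF aW] L by (simp add: unit_vec_at_def)
      next
        case False
        have "\<phi> ([t a, t a], c) = 0"
        proof (rule ccontr)
          assume "\<phi> ([t a, t a], c) \<noteq> 0"
          from K_parallel[OF \<phi> this] L have "c \<in> B" "s c = t a" "t c = t a" by simp_all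
          moreover from this have "c \<in> BW W" using aW L by (simp add: BW_def)
          ultimately show False using acyclic[of c] False by simp
        qed
        then show ?thesis using False by (simp add: unit_vec_at_def)
      qed
    qed
    then have "(\<lambda>c. \<phi> (L, c)) = mul (unit_vec_at a) (mul (\<lambda>c. k * unit_vec_at (s b) c) (unit_vec_at b))"
      using K0_values[OF \<phi> L(2-4)] unfolding L(1) L(4) by simp
    also have "\<dots> = (\<lambda>c. k * \<mu> a b c)"
      unfolding mul_smult_left mul_smult_right mul_s_unit[OF L(3)] using L(2,3) by (simp add: mul_unit)
    finally have "\<phi> (L, c) = k * \<mu> a b c" by (rule fun_cong)
    then show ?thesis using True L(1) by (simp add: rs_def idc_def)
  next
    case False
    moreover have "\<phi> (L, c) = 0" if "L \<notin> J 2" using K_supp[OF \<phi>, of L c] that by auto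
    ultimately show ?thesis by (simp add: rs_def idc_def)
  qed
qed

end

section \<open>Path algebras\<close>

text \<open>The sum of the stationary paths at the vertices of \<open>X\<close>. Multiplying by it
  on the left selects the paths that start in \<open>X\<close>, on the right those that end in
  \<open>X\<close>.\<close>

definition vid :: "'v set \<Rightarrow> ('v, 'e) path \<Rightarrow> 'k::field" where
  "vid X = (\<lambda>(u, p). if u \<in> X \<and> p = [] then 1 else 0)"

lemma unit_vec_vid: "unit_vec_at (x, []) = vid {x}"
  by (auto simp: fun_eq_iff unit_vec_at_def vid_def)

lemma path_algebra_simps:
  "f \<in> carrier (path_algebra Q) \<longleftrightarrow> finite (supp f) \<and> supp f \<subseteq> paths Q"
  "f \<oplus>\<^bsub>path_algebra Q\<^esub> g = (\<lambda>x. f x + g x)"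
  "\<zero>\<^bsub>path_algebra Q\<^esub> = (\<lambda>_. 0)"
  "\<one>\<^bsub>path_algebra Q\<^esub> = vid (verts Q)"
  "c \<odot>\<^bsub>path_algebra Q\<^esub> f = (\<lambda>x. c * f x)"
  by (simp_all add: path_algebra_def vid_def)

lemma path_mult:
  "(f \<otimes>\<^bsub>path_algebra Q\<^esub> g) (u, p) =
    (\<Sum>i\<le>length p. f (u, take i p) * g (pre_digraph.awlast Q u (take i p), drop i p))"
  by (simp add: path_algebra_def)

lemma path_mult_linear:
  "(\<lambda>x. f x + g x) \<otimes>\<^bsub>path_algebra Q\<^esub> h = (\<lambda>x. (f \<otimes>\<^bsub>path_algebra Q\<^esub> h) x + (g \<otimes>\<^bsub>path_algebra Q\<^esub> h) x)"
  "h \<otimes>\<^bsub>path_algebra Q\<^esub> (\<lambda>x. f x + g x) = (\<lambda>x. (h \<otimes>\<^bsub>path_algebra Q\<^esub> f) x + (h \<otimes>\<^bsub>path_algebra Q\<^esub> g) x)"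
  "(\<lambda>x. c * f x) \<otimes>\<^bsub>path_algebra Q\<^esub> h = (\<lambda>x. c * (f \<otimes>\<^bsub>path_algebra Q\<^esub> h) x)"
  "h \<otimes>\<^bsub>path_algebra Q\<^esub> (\<lambda>x. c * f x) = (\<lambda>x. c * (h \<otimes>\<^bsub>path_algebra Q\<^esub> f) x)"
  "(\<lambda>x. f x - g x) \<otimes>\<^bsub>path_algebra Q\<^esub> h = (\<lambda>x. (f \<otimes>\<^bsub>path_algebra Q\<^esub> h) x - (g \<otimes>\<^bsub>path_algebra Q\<^esub> h) x)"
  "h \<otimes>\<^bsub>path_algebra Q\<^esub> (\<lambda>x. f x - g x) = (\<lambda>x. (h \<otimes>\<^bsub>path_algebra Q\<^esub> f) x - (h \<otimes>\<^bsub>path_algebra Q\<^esub> g) x)"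
  by (rule ext, clarify,
      simp add: path_mult sum.distrib sum_subtractf sum_distrib_left algebra_simps)+

lemma path_mult_zero:
  "(\<lambda>_. 0) \<otimes>\<^bsub>path_algebra Q\<^esub> h = (\<lambda>_. 0)" "h \<otimes>\<^bsub>path_algebra Q\<^esub> (\<lambda>_. 0) = (\<lambda>_. 0)"
  by (rule ext, clarify, simp add: path_mult)+

lemma awlast_Nil [simp]: "last (pre_digraph.awalk_verts Q u []) = u"
  by (simp add: pre_digraph.awalk_verts.simps)

lemma vid_mult: "(vid X \<otimes>\<^bsub>path_algebra Q\<^esub> f) (u, p) = (if u \<in> X then f (u, p) else 0)"
proof -
  have "(\<Sum>i\<le>length p. vid X (u, take i p) * f (pre_digraph.awlast Q u (take i p), drop i p)) =
    (\<Sum>i\<le>length p. if i = 0 then (if u \<in> X then f (u, p) else 0) else 0)"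
    by (intro sum.cong refl) (auto simp: vid_def)
  then show ?thesis by (simp add: path_mult)
qed

lemma mult_vid:
  "(f \<otimes>\<^bsub>path_algebra Q\<^esub> vid X) (u, p) = (if pre_digraph.awlast Q u p \<in> X then f (u, p) else 0)"
proof -
  have "(\<Sum>i\<le>length p. f (u, take i p) * vid X (pre_digraph.awlast Q u (take i p), drop i p)) =
    (\<Sum>i\<le>length p. if i = length p then (if pre_digraph.awlast Q u p \<in> X then f (u, p) else 0) else 0)"
    by (intro sum.cong refl) (auto simp: vid_def)
  then show ?thesis by (simp add: path_mult)
qed

lemma unit_path_mult:
  "unit_vec_at (u, p) \<otimes>\<^bsub>path_algebra Q\<^esub> unit_vec_at (v, q) =
    (if pre_digraph.awlast Q u p = v then unit_vec_at (u, p @ q) else (\<lambda>_. 0 :: 'k::field))"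
proof (rule ext, clarify)
  fix w r
  let ?x = "if w = u \<and> r = p @ q \<and> pre_digraph.awlast Q u p = v then 1 else 0 :: 'k"
  have "(\<Sum>i\<le>length r. unit_vec_at (u, p) (w, take i r) *
      unit_vec_at (v, q) (pre_digraph.awlast Q w (take i r), drop i r)) =
    (\<Sum>i\<le>length r. if i = length p then ?x else 0)"
  proof (intro sum.cong refl)
    fix i assume "i \<in> {..length r}"
    then have "take i r = p \<and> drop i r = q \<longleftrightarrow> i = length p \<and> r = p @ q"
      using append_take_drop_id[of i r] by auto
    note split = this
    have "unit_vec_at (u, p) (w, take i r) * unit_vec_at (v, q) (pre_digraph.awlast Q w (take i r), drop i r) =
      (if w = u \<and> pre_digraph.awlast Q u p = v \<and> (take i r = p \<and> drop i r = q) then 1 else 0 :: 'k)"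
      by (simp add: unit_vec_at_def)
    then show "unit_vec_at (u, p) (w, take i r) * unit_vec_at (v, q) (pre_digraph.awlast Q w (take i r), drop i r) =
      (if i = length p then ?x else 0)"
      unfolding split by simp
  qed
  then show "(unit_vec_at (u, p) \<otimes>\<^bsub>path_algebra Q\<^esub> unit_vec_at (v, q)) (w, r) =
    (if pre_digraph.awlast Q u p = v then unit_vec_at (u, p @ q) else (\<lambda>_. 0 :: 'k)) (w, r)"
    by (auto simp: path_mult unit_vec_at_def)
qed

lemma (in wf_digraph) path_mult_closed:
  assumes f: "f \<in> carrier (path_algebra G)" and g: "g \<in> carrier (path_algebra G)"
  shows "f \<otimes>\<^bsub>path_algebra G\<^esub> g \<in> carrier (path_algebra G)"
proof -
  have fg: "finite (supp f)" "supp f \<subseteq> paths G" "finite (supp g)" "supp g \<subseteq> paths G"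
    using f g by (simp_all add: path_algebra_simps)
  have *: "\<exists>i. (u, take i p) \<in> supp f \<and> (awlast u (take i p), drop i p) \<in> supp g"
    if nz: "(u, p) \<in> supp (f \<otimes>\<^bsub>path_algebra G\<^esub> g)" for u p
  proof -
    from nz have "(\<Sum>i\<le>length p. f (u, take i p) * g (awlast u (take i p), drop i p)) \<noteq> 0"
      by (simp add: supp_def path_mult)
    from sum.not_neutral_contains_not_neutral[OF this] show ?thesis by (auto simp: supp_def)
  qed
  have "supp (f \<otimes>\<^bsub>path_algebra G\<^esub> g) \<subseteq> (\<lambda>((u, p), (v, q)). (u, p @ q)) ` (supp f \<times> supp g)"
  proof clarify
    fix u p assume "(u, p) \<in> supp (f \<otimes>\<^bsub>path_algebra G\<^esub> g)"
    from *[OF this] obtain i where i: "(u, take i p) \<in> supp f" "(awlast u (take i p), drop i p) \<in> supp g" by auto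
    show "(u, p) \<in> (\<lambda>((u, p), (v, q)). (u, p @ q)) ` (supp f \<times> supp g)"
      by (rule image_eqI[of _ _ "((u, take i p), (awlast u (take i p), drop i p))"]) (use i in auto)
  qed
  moreover have "supp (f \<otimes>\<^bsub>path_algebra G\<^esub> g) \<subseteq> paths G"
  proof clarify
    fix u p assume "(u, p) \<in> supp (f \<otimes>\<^bsub>path_algebra G\<^esub> g)"
    from *[OF this] obtain i where "(u, take i p) \<in> paths G" "(awlast u (take i p), drop i p) \<in> paths G"
      using fg by blast
    then obtain v w where "awalk u (take i p) v" "awalk (awlast u (take i p)) (drop i p) w"
      by (auto simp: paths_def)
    then have "awalk u (take i p @ drop i p) w" unfolding awalk_append_iff by auto
    then show "(u, p) \<in> paths G" by (auto simp: paths_def)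
  qed
  ultimately show ?thesis
    unfolding path_algebra_simps using fg by (meson finite_SigmaI finite_imageI finite_subset)
qed

lemma awalk_verts_induce [simp]: "pre_digraph.awalk_verts (Q \<restriction> W) u p = pre_digraph.awalk_verts Q u p"
  by (induct p arbitrary: u) (simp_all add: pre_digraph.awalk_verts.simps)

lemma cas_induce [simp]: "pre_digraph.cas (Q \<restriction> W) u p v = pre_digraph.cas Q u p v"
  by (induct p arbitrary: u) (simp_all add: pre_digraph.cas.simps)

lemma path_mult_induce: "f \<otimes>\<^bsub>path_algebra (Q \<restriction> W)\<^esub> g = f \<otimes>\<^bsub>path_algebra Q\<^esub> g"
  by (rule ext, clarify) (simp add: path_mult)

lemma in_paths_induce:
  "(u, p) \<in> paths (Q \<restriction> W) \<longleftrightarrow> u \<in> W \<and> set p \<subseteq> {a \<in> arcs Q. tail Q a \<in> W \<and> head Q a \<in> W} \<and> (\<exists>v. pre_digraph.cas Q u p v)"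
  by (simp add: paths_def pre_digraph.awalk_def)

lemma in_paths:
  "(u, p) \<in> paths Q \<longleftrightarrow> u \<in> verts Q \<and> set p \<subseteq> arcs Q \<and> (\<exists>v. pre_digraph.cas Q u p v)"
  by (simp add: paths_def pre_digraph.awalk_def)

lemma paths_induce_subset: "W \<subseteq> verts Q \<Longrightarrow> paths (Q \<restriction> W) \<subseteq> paths Q"
  by (auto simp: in_paths_induce in_paths)

lemma carrier_induce: "W \<subseteq> verts Q \<Longrightarrow> carrier (path_algebra (Q \<restriction> W)) \<subseteq> carrier (path_algebra Q)"
  using paths_induce_subset[of W Q] by (meson path_algebra_simps(1) subsetI subset_trans)

lemma (in wf_digraph) induce_verts_self: "G \<restriction> verts G = G"
  by (simp add: induce_subgraph_def wellformed cong: conj_cong)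

lemma vid_carrier: 
  assumes X: "finite X" "X \<subseteq> verts Q"
  shows "(vid X :: ('v, 'e) path \<Rightarrow> 'k::field) \<in> carrier (path_algebra Q)"
proof -
  have "supp (vid X :: ('v, 'e) path \<Rightarrow> 'k) \<subseteq> (\<lambda>x. (x, [])) ` X" by (auto simp: supp_def vid_def split: if_splits)
  moreover have "(\<lambda>x. (x, [])) ` X \<subseteq> paths Q" using X by (auto simp: in_paths pre_digraph.cas.simps)
  ultimately show ?thesis using X unfolding path_algebra_simps by (meson finite_imageI finite_subset subset_trans)
qed

lemma unit_path_carrier: "p \<in> paths Q \<Longrightarrow> unit_vec_at p \<in> carrier (path_algebra Q)"
  by (simp add: path_algebra_simps)

lemma path_supp_closed:
  fixes f g :: "_ \<Rightarrow> 'k::field"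
  assumes "finite (supp f)" "supp f \<subseteq> S" "finite (supp g)" "supp g \<subseteq> S"
  shows "finite (supp (\<lambda>x. f x + g x)) \<and> supp (\<lambda>x. f x + g x) \<subseteq> S"
    "finite (supp (\<lambda>x. c * f x)) \<and> supp (\<lambda>x. c * f x) \<subseteq> S"
  using assms supp_add_subset[of f g] supp_smult_subset[of c f]
  by (meson finite_UnI finite_subset subset_trans Un_least)+

text \<open>The product of the subquiver's path algebra is the same function as that of
  \<open>G\<close>, so associativity is inherited; only the unit differs, and is checked directly.
  The ring hypothesis for \<open>G\<close> is available later because an ideal in the library's
  sense carries it.\<close>

lemma (in fin_digraph) kalg_induce:
  assumes R: "ring (path_algebra G :: ('k::field, ('a, 'b) path \<Rightarrow> 'k) module)" and W: "W \<subseteq> verts G"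
  shows "kalg (path_algebra (G \<restriction> W) :: ('k, ('a, 'b) path \<Rightarrow> 'k) module)"
proof -
  let ?P = "path_algebra (G \<restriction> W) :: ('k, ('a, 'b) path \<Rightarrow> 'k) module"
  interpret R: ring "path_algebra G :: ('k, ('a, 'b) path \<Rightarrow> 'k) module" by (rule R)
  interpret W: wf_digraph "G \<restriction> W" by (rule wellformed_induce_subgraph)
  note sub = subsetD[OF carrier_induce[OF W]]
  have Wfin: "finite W" using W finite_verts finite_subset by blast
  have ab: "abelian_group ?P"
  proof (rule abelian_groupI)
    fix f assume f: "f \<in> carrier ?P"
    have "(\<lambda>x. (-1) * f x) \<in> carrier ?P"
      using f path_supp_closed(2)[of f _ f "-1"] unfolding path_algebra_simps by blast
    then show "\<exists>y\<in>carrier ?P. y \<oplus>\<^bsub>?P\<^esub> f = \<zero>\<^bsub>?P\<^esub>"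
      by (rule bexI[rotated]) (simp add: path_algebra_simps)
  qed (use path_supp_closed(1) in \<open>auto simp: path_algebra_simps supp_def algebra_simps\<close>)
  have mon: "Group.monoid ?P"
  proof (rule Group.monoidI)
    fix f g assume "f \<in> carrier ?P" "g \<in> carrier ?P"
    then show "f \<otimes>\<^bsub>?P\<^esub> g \<in> carrier ?P" by (rule W.path_mult_closed)
  next
    show "\<one>\<^bsub>?P\<^esub> \<in> carrier ?P" using Wfin unfolding path_algebra_simps(4) by (intro vid_carrier) auto
  next
    fix f g h assume "f \<in> carrier ?P" "g \<in> carrier ?P" "h \<in> carrier ?P"
    then show "f \<otimes>\<^bsub>?P\<^esub> g \<otimes>\<^bsub>?P\<^esub> h = f \<otimes>\<^bsub>?P\<^esub> (g \<otimes>\<^bsub>?P\<^esub> h)"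
      unfolding path_mult_induce by (intro R.m_assoc sub)
  next
    fix f assume f: "f \<in> carrier ?P"
    have nz: "(u, p) \<in> paths (G \<restriction> W)" if "f (u, p) \<noteq> 0" for u p
      using f that by (auto simp: path_algebra_simps supp_def)
    show "\<one>\<^bsub>?P\<^esub> \<otimes>\<^bsub>?P\<^esub> f = f"
    proof (rule ext, clarify)
      fix u p show "(\<one>\<^bsub>?P\<^esub> \<otimes>\<^bsub>?P\<^esub> f) (u, p) = f (u, p)"
        using nz[of u p] by (auto simp: path_algebra_simps(4) vid_mult in_paths_induce)
    qed
    show "f \<otimes>\<^bsub>?P\<^esub> \<one>\<^bsub>?P\<^esub> = f"
    proof (rule ext, clarify)
      fix u p
      have "awlast u p \<in> W" if "f (u, p) \<noteq> 0"
        using nz[OF that] W.awlast_in_verts[of u p] by (auto simp: in_paths_induce)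
      then show "(f \<otimes>\<^bsub>?P\<^esub> \<one>\<^bsub>?P\<^esub>) (u, p) = f (u, p)"
        by (auto simp: path_algebra_simps(4) mult_vid)
    qed
  qed
  have rg: "ring ?P"
    by (rule ringI[OF ab mon]) (simp_all add: path_algebra_simps(2) path_mult_linear)
  show ?thesis
  proof (intro kalg.intro kalg_axioms.intro rg kvs.intro kvs_axioms.intro ab)
    fix f c assume "f \<in> carrier ?P"
    then show "c \<odot>\<^bsub>?P\<^esub> f \<in> carrier ?P"
      using path_supp_closed(2)[of f _ f c] unfolding path_algebra_simps by blast
  qed (simp_all add: path_algebra_simps path_mult_linear algebra_simps)
qed

section \<open>Multiplicative bases of bound quiver algebras\<close>

text \<open>Admissibility in pathwise form: long paths vanish in the quotient, and elements of the
  ideal have no stationary path and no arrow in their support.\<close>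

locale bq = fin_digraph Q for Q :: "('v, 'e) pre_digraph" +
  fixes I :: "(('v, 'e) path \<Rightarrow> 'k::field) set" and m :: nat
  assumes I_ideal: "ideal I (path_algebra Q)" and two_le_m: "2 \<le> m"
    and long: "p \<in> paths Q \<Longrightarrow> m \<le> length (snd p) \<Longrightarrow> unit_vec_at p \<in> I"
    and short: "f \<in> I \<Longrightarrow> length (snd p) \<le> 1 \<Longrightarrow> f p = 0"

text \<open>Splitting off the last arrow puts a path of length at least \<open>n\<close> into the
  \<open>n\<close>-th power of the arrow ideal. In the other direction, elements of the square are
  tested through the larger ideal \<open>L\<close>.\<close>

lemma admissible_bq:
  fixes I :: "(('v, 'e) path \<Rightarrow> 'k::field) set"
  assumes "bound_quiver Q I" shows "\<exists>m. bq Q I m"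
proof -
  let ?P = "path_algebra Q :: ('k, ('v, 'e) path \<Rightarrow> 'k) module"
  let ?F = "arrow_ideal Q :: (('v, 'e) path \<Rightarrow> 'k) set"
  from assms obtain m where Q: "fin_digraph Q" and I: "ideal I ?P" and m: "2 \<le> m"
    and Im: "ideal_power ?P ?F m \<subseteq> I" and I2: "I \<subseteq> ideal_power ?P ?F 2"
    unfolding bound_quiver_def admissible_ideal_def by auto
  interpret fin_digraph Q by (rule Q)
  interpret I: ideal I ?P by (rule I)
  have arr: "unit_vec_at (tail Q a, [a]) \<in> carrier ?P" if "a \<in> arcs Q" for a
    using that by (intro unit_path_carrier) (auto simp: in_paths pre_digraph.cas.simps)
  have F: "unit_vec_at (tail Q a, [a]) \<in> ?F" if "a \<in> arcs Q" for a
    using I.genideal_self[of "(\<lambda>a. unit_vec_at (tail Q a, [a])) ` arcs Q"] arr that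
    unfolding arrow_ideal_def by auto
  have long: "(u, p) \<in> paths Q \<Longrightarrow> n \<le> length p \<Longrightarrow> unit_vec_at (u, p) \<in> ideal_power ?P ?F n" for n u p
  proof (induct n arbitrary: p)
    case 0
    then show ?case by (simp add: unit_path_carrier)
  next
    case (Suc n)
    then obtain q a where p: "p = q @ [a]" by (cases p rule: rev_cases) auto
    from Suc(2) obtain v where "awalk u (q @ [a]) v" by (auto simp: paths_def p)
    then have w: "awalk u q (awlast u q)" "awalk (awlast u q) [a] v" by (simp_all add: awalk_append_iff)
    then have a: "a \<in> arcs Q" "awlast u q = tail Q a" by (auto simp: awalk_def)
    have "unit_vec_at (u, q) \<in> ideal_power ?P ?F n"
      using Suc w p by (intro Suc(1)) (auto simp: paths_def)
    then have "unit_vec_at (u, q) \<otimes>\<^bsub>?P\<^esub> unit_vec_at (tail Q a, [a]) \<in> ideal_prod ?P (ideal_power ?P ?F n) ?F"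
      using F[OF a(1)] by (rule ideal_prod.prod)
    then show ?case using a by (simp add: unit_path_mult p)
  qed
  \<comment> \<open>The elements that vanish on stationary paths form an ideal containing the
    arrows, hence the arrow ideal.\<close>
  define L where "L = {f \<in> carrier ?P. \<forall>u. f (u, []) = 0}"
  have L: "ideal L ?P"
  proof (rule idealI)
    show "subgroup L (add_monoid ?P)"
    proof (rule group.subgroupI[OF I.a_group])
      fix f assume f: "f \<in> L"
      then have neg: "(\<lambda>x. (-1) * f x) \<in> carrier ?P"
        using path_supp_closed(2)[of f _ f "-1"] unfolding L_def path_algebra_simps by blast
      have "\<ominus>\<^bsub>?P\<^esub> f = (\<lambda>x. (-1) * f x)"
        by (rule I.minus_equality) (use f neg in \<open>simp_all add: L_def path_algebra_simps(2,3)\<close>)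
      then show "inv\<^bsub>add_monoid ?P\<^esub> f \<in> L"
        using f neg by (simp add: a_inv_def[symmetric] L_def)
    next
      have "\<zero>\<^bsub>?P\<^esub> \<in> L" by (simp add: L_def path_algebra_simps(3)) (simp add: path_algebra_simps supp_def)
      then show "L \<noteq> {}" by auto
    next
      fix f g assume fg: "f \<in> L" "g \<in> L"
      have "f \<oplus>\<^bsub>?P\<^esub> g \<in> carrier ?P" by (rule I.a_closed) (use fg in \<open>simp_all add: L_def\<close>)
      moreover have "\<forall>u. (f \<oplus>\<^bsub>?P\<^esub> g) (u, []) = 0" using fg by (simp add: L_def path_algebra_simps(2))
      ultimately show "f \<otimes>\<^bsub>add_monoid ?P\<^esub> g \<in> L" by (simp add: L_def)
    qed (auto simp: L_def)
  qed (use I.ring_axioms in \<open>auto simp: L_def path_mult\<close>)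
  have FL: "?F \<subseteq> L"
    unfolding arrow_ideal_def
    by (rule I.genideal_minimal[OF L]) (use arr in \<open>auto simp: L_def unit_vec_at_def\<close>)
  \<comment> \<open>\<open>ideal_power\<close> starts with the whole algebra, so the first power is
    the product of the algebra with the arrow ideal, which again lies in \<open>L\<close>.\<close>
  have 1: "f \<in> L" if "f \<in> ideal_prod ?P (carrier ?P) ?F" for f
    using that
  proof (induct f rule: ideal_prod.induct)
    case (prod f g)
    then show ?case using FL ideal.I_l_closed[OF L] by blast
  next
    case (sum f g)
    then show ?case by (intro additive_subgroup.a_closed ideal.axioms(1)[OF L])
  qed
  \<comment> \<open>However a path of length at most one is cut in two, one piece is stationary, and
    both factors vanish on stationary paths.\<close>
  have 2: "f p = 0" if "f \<in> ideal_prod ?P (ideal_prod ?P (carrier ?P) ?F) ?F" "length (snd p) \<le> 1" for f p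
    using that
  proof (induct f rule: ideal_prod.induct)
    case (prod f g)
    then have z: "f (u, []) = 0" "g (u, []) = 0" for u using 1 FL by (auto simp: L_def)
    obtain u q where p: "p = (u, q)" by (cases p)
    with prod(3) have "q = [] \<or> (\<exists>a. q = [a])" by (auto simp: le_Suc_eq length_Suc_conv)
    then show ?case using z by (auto simp: p path_mult)
  qed (simp add: path_algebra_simps)
  have "bq Q I m"
  proof (intro bq.intro bq_axioms.intro Q I m)
    show "unit_vec_at p \<in> I" if "p \<in> paths Q" "m \<le> length (snd p)" for p
      using long[of "fst p" "snd p" m] that Im by auto
    show "f p = 0" if "f \<in> I" "length (snd p) \<le> 1" for f p
      using I2 that 2[of f p] by (auto simp: numeral_2_eq_2)
  qed
  then show ?thesis ..
qed

context bq begin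

sublocale P: ideal I "path_algebra Q" by (rule I_ideal)

lemma P_kalg: "kalg (path_algebra Q :: ('k, ('v, 'e) path \<Rightarrow> 'k) module)"
  using kalg_induce[OF P.ring_axioms order_refl] by (simp add: induce_verts_self)

sublocale A: kalg "path_algebra Q :: ('k, ('v, 'e) path \<Rightarrow> 'k) module" by (rule P_kalg)

sublocale I: kquot "path_algebra Q" I by (rule kalg_quot(2)[OF P_kalg I_ideal])

lemma I_add: "f \<in> I \<Longrightarrow> g \<in> I \<Longrightarrow> (\<lambda>x. f x + g x) \<in> I"
  using I.W_add[of f g] by (simp add: path_algebra_simps)

lemma I_smult: "f \<in> I \<Longrightarrow> (\<lambda>x. c * f x) \<in> I"
  using I.W_smult[of f c] by (simp add: path_algebra_simps)

lemma I_diff: "f \<in> I \<Longrightarrow> g \<in> I \<Longrightarrow> (\<lambda>x. f x - g x) \<in> I"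
  using I_add[OF _ I_smult[of g "-1"], of f] by simp

lemma I_zero: "(\<lambda>_. 0) \<in> I"
  using I.W_zero by (simp add: path_algebra_simps)

lemma finite_short_paths: "finite {p \<in> paths Q. length (snd p) < m}"
proof (rule finite_subset)
  show "{p \<in> paths Q. length (snd p) < m} \<subseteq> verts Q \<times> {p. set p \<subseteq> arcs Q \<and> length p \<le> m}"
    by (auto simp: in_paths)
  show "finite (verts Q \<times> {p. set p \<subseteq> arcs Q \<and> length p \<le> m})"
    by (intro finite_cartesian_product finite_lists_length_le) auto
qed

text \<open>\<open>B\<close> is taken maximal among the sets of short paths that are linearly independent modulo \<open>I\<close>.\<close>

lemma ex_basis:
  obtains B where "{p \<in> paths Q. length (snd p) \<le> 1} \<subseteq> B" "finite B" "B \<subseteq> paths Q"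
    "\<And>f. f \<in> I \<Longrightarrow> supp f \<subseteq> B \<Longrightarrow> f = (\<lambda>_. 0)"
    "\<And>p. p \<in> paths Q \<Longrightarrow> \<exists>g. supp g \<subseteq> B \<and> (\<lambda>x. unit_vec_at p x - g x) \<in> I"
proof -
  let ?X = "{p \<in> paths Q. length (snd p) < m}" and ?S = "{p \<in> paths Q. length (snd p) \<le> 1}"
  define F where "F = {B. ?S \<subseteq> B \<and> B \<subseteq> ?X \<and> (\<forall>f\<in>I. supp f \<subseteq> B \<longrightarrow> f = (\<lambda>_. 0))}"
  have "finite F" by (rule finite_subset[of _ "Pow ?X"]) (use finite_short_paths in \<open>auto simp: F_def\<close>)
  moreover have "?S \<in> F"
    unfolding F_def
  proof (intro CollectI conjI ballI impI)
    show "?S \<subseteq> ?X" using two_le_m by auto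
    fix f assume f: "f \<in> I" "supp f \<subseteq> ?S"
    show "f = (\<lambda>_. 0)"
    proof
      fix p show "f p = 0" using f(2) short[OF f(1), of p] by (cases "f p = 0") (auto simp: supp_def)
    qed
  qed simp
  ultimately obtain B where BF: "B \<in> F" and max: "\<forall>B'\<in>F. B \<subseteq> B' \<longrightarrow> B = B'"
    using finite_has_maximal[of F] by auto
  have B: "?S \<subseteq> B" "B \<subseteq> ?X" "\<And>f. f \<in> I \<Longrightarrow> supp f \<subseteq> B \<Longrightarrow> f = (\<lambda>_. 0)"
    using BF unfolding F_def by simp_all
  have ex: "\<exists>g. supp g \<subseteq> B \<and> (\<lambda>x. unit_vec_at p x - g x) \<in> I" if p: "p \<in> paths Q" for p
  proof -
    consider "m \<le> length (snd p)" | "p \<in> B" | "length (snd p) < m" "p \<notin> B" by linarith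
    then show ?thesis
    proof cases
      case 1
      then show ?thesis using long[OF p] by (intro exI[of _ "\<lambda>_. 0"]) (auto simp: supp_def)
    next
      case 2
      then show ?thesis using I_zero by (intro exI[of _ "unit_vec_at p"]) simp
    next
      case 3
      \<comment> \<open>By maximality \<open>p\<close> satisfies a relation with \<open>B\<close>
        modulo \<open>I\<close>. Its coefficient at \<open>p\<close> is nonzero because
        \<open>B\<close> alone is independent, so the relation can be solved for
        \<open>p\<close>.\<close>
      then have "insert p B \<notin> F" using max by auto
      moreover have "?S \<subseteq> insert p B" "insert p B \<subseteq> ?X" using B(1,2) p 3 by auto
      ultimately obtain f where f: "f \<in> I" "supp f \<subseteq> insert p B" "f \<noteq> (\<lambda>_. 0)"
        unfolding F_def by blast
      have fp: "f p \<noteq> 0"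
      proof
        assume "f p = 0"
        then have "supp f \<subseteq> B" using f(2) by (auto simp: supp_def)
        then show False using B(3) f by blast
      qed
      have "supp (\<lambda>x. unit_vec_at p x - inverse (f p) * f x) \<subseteq> B"
        using f(2) fp by (auto simp: supp_def unit_vec_at_def split: if_splits)
      moreover have "(\<lambda>x. unit_vec_at p x - (unit_vec_at p x - inverse (f p) * f x)) \<in> I"
        using I_smult[OF f(1), of "inverse (f p)"] by simp
      ultimately show ?thesis by (intro exI[of _ "\<lambda>x. unit_vec_at p x - inverse (f p) * f x"] conjI)
    qed
  qed
  have BX: "finite B" "B \<subseteq> paths Q" using B(2) finite_short_paths by (auto intro: finite_subset)
  show thesis by (rule that[OF B(1) BX B(3) ex])
qed

end

section \<open>Normal forms and structure constants\<close>

locale bq_basis = bq Q I m for Q :: "('v, 'e) pre_digraph" and I :: "(('v, 'e) path \<Rightarrow> 'k::field) set" and m +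
  fixes B :: "('v, 'e) path set"
  assumes short_B: "p \<in> paths Q \<Longrightarrow> length (snd p) \<le> 1 \<Longrightarrow> p \<in> B"
    and finite_basis: "finite B" and B_paths: "B \<subseteq> paths Q"
    and indep: "f \<in> I \<Longrightarrow> supp f \<subseteq> B \<Longrightarrow> f = (\<lambda>_. 0)"
    and span: "p \<in> paths Q \<Longrightarrow> \<exists>g. supp g \<subseteq> B \<and> (\<lambda>x. unit_vec_at p x - g x) \<in> I"
begin

abbreviation pmult (infixl "\<star>" 70) where
  "pmult \<equiv> mult (path_algebra Q :: ('k, ('v, 'e) path \<Rightarrow> 'k) module)"

text \<open>The combination of basis paths congruent to \<open>f\<close> modulo \<open>I\<close>. It
  exists by \<open>span\<close> and is unique by \<open>indep\<close>, so \<open>SOME\<close>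
  involves no choice on elements of the path algebra.\<close>

definition nf :: "(('v, 'e) path \<Rightarrow> 'k) \<Rightarrow> ('v, 'e) path \<Rightarrow> 'k" where
  "nf f = (SOME g. supp g \<subseteq> B \<and> (\<lambda>x. f x - g x) \<in> I)"

abbreviation fin :: "('v, 'e) path \<Rightarrow> 'v" where "fin p \<equiv> awlast (fst p) (snd p)"

definition src :: "('v, 'e) path \<Rightarrow> ('v, 'e) path" where "src p = (fst p, [])"

definition tgt :: "('v, 'e) path \<Rightarrow> ('v, 'e) path" where "tgt p = (fin p, [])"

definition mu :: "('v, 'e) path \<Rightarrow> ('v, 'e) path \<Rightarrow> ('v, 'e) path \<Rightarrow> 'k" where
  "mu a b = nf (unit_vec_at a \<star> unit_vec_at b)"

abbreviation PC :: "(('v, 'e) path \<Rightarrow> 'k) set" where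
  "PC \<equiv> carrier (path_algebra Q)"

lemma PC_I: "finite (supp f) \<Longrightarrow> supp f \<subseteq> paths Q \<Longrightarrow> f \<in> PC" by (simp add: path_algebra_simps)

lemma B_carrier: "supp f \<subseteq> B \<Longrightarrow> f \<in> PC"
  using finite_basis B_paths by (meson PC_I finite_subset subset_trans)

lemma nf_unique:
  assumes "supp g \<subseteq> B" "(\<lambda>x. f x - g x) \<in> I" shows "nf f = g"
proof -
  have "supp (nf f) \<subseteq> B \<and> (\<lambda>x. f x - nf f x) \<in> I"
    unfolding nf_def by (rule someI[of "\<lambda>g. supp g \<subseteq> B \<and> (\<lambda>x. f x - g x) \<in> I"]) (use assms in simp)
  then have n: "supp (nf f) \<subseteq> B" "(\<lambda>x. f x - nf f x) \<in> I" by simp_all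
  from I_diff[OF assms(2) n(2)] have "(\<lambda>x. nf f x - g x) \<in> I" by simp
  moreover have "supp (\<lambda>x. nf f x - g x) \<subseteq> B" using n(1) assms(1) supp_diff_subset[of "nf f" g] by blast
  ultimately have "(\<lambda>x. nf f x - g x) = (\<lambda>_. 0)" by (intro indep)
  then show ?thesis by (simp add: fun_eq_iff)
qed

lemma nf_ex: "f \<in> PC \<Longrightarrow> \<exists>g. supp g \<subseteq> B \<and> (\<lambda>x. f x - g x) \<in> I"
proof -
  assume "f \<in> PC"
  then have "finite (supp f)" "supp f \<subseteq> paths Q" by (simp_all add: path_algebra_simps)
  then show ?thesis
  proof (induct f rule: fun_supp_induct)
    case zero
    show ?case using I_zero by (intro exI[of _ "\<lambda>_. 0"]) (simp add: supp_def)
  next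
    case (unit c p)
    from span[OF unit] obtain g where g: "supp g \<subseteq> B" "(\<lambda>x. unit_vec_at p x - g x) \<in> I" by auto
    show ?case
      by (rule exI[of _ "\<lambda>x. c * g x"])
        (use g(1) supp_smult_subset[of c g] I_smult[OF g(2), of c] in \<open>auto simp: algebra_simps\<close>)
  next
    case (add f h)
    from add(5) obtain g where g: "supp g \<subseteq> B" "(\<lambda>x. f x - g x) \<in> I" by auto
    from add(6) obtain k where k: "supp k \<subseteq> B" "(\<lambda>x. h x - k x) \<in> I" by auto
    have "supp (\<lambda>x. g x + k x) \<subseteq> B" using g(1) k(1) supp_add_subset[of g k] by auto
    then show ?case
      by (intro exI[of _ "\<lambda>x. g x + k x"] conjI) (use I_add[OF g(2) k(2)] in \<open>simp_all add: algebra_simps\<close>)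
  qed
qed

lemma nf_supp: "f \<in> PC \<Longrightarrow> supp (nf f) \<subseteq> B"
  and nf_I: "f \<in> PC \<Longrightarrow> (\<lambda>x. f x - nf f x) \<in> I"
proof -
  assume "f \<in> PC"
  from nf_ex[OF this] obtain g where g: "supp g \<subseteq> B" "(\<lambda>x. f x - g x) \<in> I" by auto
  from nf_unique[OF g] g show "supp (nf f) \<subseteq> B" "(\<lambda>x. f x - nf f x) \<in> I" by simp_all
qed

lemma nf_carrier: "f \<in> PC \<Longrightarrow> nf f \<in> PC" by (rule B_carrier[OF nf_supp])

lemma nf_id: "supp f \<subseteq> B \<Longrightarrow> nf f = f" by (rule nf_unique) (simp_all add: I_zero)

lemma nf_zero: "nf (\<lambda>_. 0) = (\<lambda>_. 0)" by (rule nf_id) (simp add: supp_def)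

lemma nf_cong: "f \<in> PC \<Longrightarrow> (\<lambda>x. g x - f x) \<in> I \<Longrightarrow> nf g = nf f"
  by (rule nf_unique[OF nf_supp]) (use I_add[of "\<lambda>x. g x - f x" "\<lambda>x. f x - nf f x"] nf_I in auto)

lemma nf_add: "f \<in> PC \<Longrightarrow> g \<in> PC \<Longrightarrow> nf (\<lambda>x. f x + g x) = (\<lambda>x. nf f x + nf g x)"
  by (rule nf_unique)
    (use supp_add_subset[of "nf f" "nf g"] nf_supp[of f] nf_supp[of g] I_add[OF nf_I[of f] nf_I[of g]] in
      \<open>auto simp: algebra_simps\<close>)

lemma nf_smult: "f \<in> PC \<Longrightarrow> nf (\<lambda>x. c * f x) = (\<lambda>x. c * nf f x)"
  by (rule nf_unique)
    (use supp_smult_subset[of c "nf f"] nf_supp[of f] I_smult[OF nf_I[of f], of c] in \<open>auto simp: algebra_simps\<close>)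

lemma star_closed: "f \<in> PC \<Longrightarrow> g \<in> PC \<Longrightarrow> f \<star> g \<in> PC" by (rule P.m_closed)

lemma nf_star_l: "f \<in> PC \<Longrightarrow> g \<in> PC \<Longrightarrow> nf (nf f \<star> g) = nf (f \<star> g)"
  by (rule sym, rule nf_cong)
    (use P.I_r_closed[OF nf_I[of f], of g] in \<open>simp_all add: star_closed nf_carrier path_mult_linear\<close>)

lemma nf_star_r: "f \<in> PC \<Longrightarrow> g \<in> PC \<Longrightarrow> nf (f \<star> nf g) = nf (f \<star> g)"
  by (rule sym, rule nf_cong)
    (use P.I_l_closed[OF nf_I[of g], of f] in \<open>simp_all add: star_closed nf_carrier path_mult_linear\<close>)

lemma unit_PC: "b \<in> B \<Longrightarrow> unit_vec_at b \<in> PC" by (rule B_carrier) simp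

lemma expand_l:
  assumes x: "supp x \<subseteq> B" and y: "y \<in> PC"
  shows "nf (x \<star> y) d = (\<Sum>a\<in>B. x a * nf (unit_vec_at a \<star> y) d)"
  using finite_subset[OF x finite_basis] x
proof (induct x rule: fun_supp_induct)
  case zero
  show ?case by (simp add: path_mult_zero nf_zero)
next
  case (unit c b)
  then have "(\<Sum>a\<in>B. c * unit_vec_at b a * nf (unit_vec_at a \<star> y) d) =
    (\<Sum>a\<in>B. if a = b then c * nf (unit_vec_at a \<star> y) d else 0)"
    by (intro sum.cong refl) (auto simp: unit_vec_at_def)
  then show ?case using unit y finite_basis
    by (simp add: path_mult_linear nf_smult star_closed unit_PC)
next
  case (add f g)
  then show ?case using y B_carrier
    by (simp add: path_mult_linear nf_add star_closed sum.distrib algebra_simps)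
qed

lemma expand_r:
  assumes x: "supp x \<subseteq> B" and y: "y \<in> PC"
  shows "nf (y \<star> x) d = (\<Sum>a\<in>B. x a * nf (y \<star> unit_vec_at a) d)"
  using finite_subset[OF x finite_basis] x
proof (induct x rule: fun_supp_induct)
  case zero
  show ?case by (simp add: path_mult_zero nf_zero)
next
  case (unit c b)
  then have "(\<Sum>a\<in>B. c * unit_vec_at b a * nf (y \<star> unit_vec_at a) d) =
    (\<Sum>a\<in>B. if a = b then c * nf (y \<star> unit_vec_at a) d else 0)"
    by (intro sum.cong refl) (auto simp: unit_vec_at_def)
  then show ?case using unit y finite_basis
    by (simp add: path_mult_linear nf_smult star_closed unit_PC)
next
  case (add f g)
  then show ?case using y B_carrier
    by (simp add: path_mult_linear nf_add star_closed sum.distrib algebra_simps)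
qed

lemma fin_verts: "p \<in> paths Q \<Longrightarrow> fst p \<in> verts Q \<and> fin p \<in> verts Q"
  by (auto simp: paths_def awalk_def intro!: awlast_in_verts)

lemma star_unit:
  "unit_vec_at a \<star> unit_vec_at b = (if fin a = fst b then unit_vec_at (fst a, snd a @ snd b) else (\<lambda>_. 0))"
  using unit_path_mult[where u = "fst a" and p = "snd a" and v = "fst b" and q = "snd b" and Q = Q] by simp

lemma concat_path:
  assumes "a \<in> paths Q" "b \<in> paths Q" "fin a = fst b"
  shows "(fst a, snd a @ snd b) \<in> paths Q" "awlast (fst a) (snd a @ snd b) = fin b"
proof -
  from assms(1,2) obtain v w where w: "awalk (fst a) (snd a) v" "awalk (fst b) (snd b) w" by (auto simp: paths_def)
  then have "awalk (fst a) (snd a @ snd b) w" using assms(3) by (auto simp: awalk_append_iff)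
  moreover from w this show "awlast (fst a) (snd a @ snd b) = fin b" by (auto simp: awlast_of_awalk)
  ultimately show "(fst a, snd a @ snd b) \<in> paths Q" by (auto simp: paths_def)
qed

text \<open>Multiplying the difference of \<open>p\<close> and its normal form by the idempotents at
  the two ends of \<open>p\<close> keeps it in \<open>I\<close> and fixes \<open>p\<close>. The part
  of the normal form parallel to \<open>p\<close> is thus also a normal form of \<open>p\<close>,
  and uniqueness makes it the whole.\<close>

lemma nf_unit_parallel:
  assumes p: "p \<in> paths Q" and nz: "nf (unit_vec_at p) q \<noteq> 0"
  shows "q \<in> B" "fst q = fst p" "fin q = fin p"
proof -
  note pc = unit_path_carrier[OF p]
  let ?f = "unit_vec_at p :: _ \<Rightarrow> 'k"
  note fv = fin_verts[OF p]
  have e: "vid {fst p} \<in> PC" "vid {fin p} \<in> PC" using fv by (auto intro!: vid_carrier)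
  define g where "g = vid {fst p} \<star> nf ?f \<star> vid {fin p}"
  have g: "g (u, r) = (if u = fst p \<and> awlast u r = fin p then nf ?f (u, r) else 0)" for u r
    by (simp add: g_def mult_vid vid_mult)
  have f: "vid {fst p} \<star> ?f \<star> vid {fin p} = ?f"
    by (rule ext, clarify) (cases p, auto simp: mult_vid vid_mult unit_vec_at_def)
  have "vid {fst p} \<star> (\<lambda>x. ?f x - nf ?f x) \<star> vid {fin p} \<in> I"
    by (intro P.I_r_closed P.I_l_closed nf_I pc e)
  then have "(\<lambda>x. ?f x - g x) \<in> I" unfolding path_mult_linear f g_def .
  moreover have "supp g \<subseteq> B" using nf_supp[OF pc] by (auto simp: supp_def g split: if_splits)
  ultimately have "nf ?f = g" by (intro nf_unique)
  then show "fst q = fst p" "fin q = fin p" using nz g[of "fst q" "snd q"] by (auto split: if_splits)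
  show "q \<in> B" using nz nf_supp[OF pc] by (auto simp: supp_def)
qed

lemma src_B: "p \<in> paths Q \<Longrightarrow> src p \<in> B" and tgt_B: "p \<in> paths Q \<Longrightarrow> tgt p \<in> B"
  using fin_verts[of p] by (auto intro!: short_B simp: src_def tgt_def in_paths pre_digraph.cas.simps)

sublocale L: lincat B src tgt mu
proof
  show "finite B" by (rule finite_basis)
  fix a assume "a \<in> B"
  then have a: "a \<in> B" "a \<in> paths Q" using B_paths by auto
  show "src a \<in> B" "tgt a \<in> B" by (rule src_B[OF a(2)], rule tgt_B[OF a(2)])
  show "src (src a) = src a" "tgt (src a) = src a" "src (tgt a) = tgt a" "tgt (tgt a) = tgt a"
    by (simp_all add: src_def tgt_def)
  show "mu (src a) a c = (if c = a then 1 else 0)" for c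
    using a nf_id[of "unit_vec_at a"] by (simp add: mu_def star_unit src_def) (simp add: unit_vec_at_def)
  show "mu a (tgt a) c = (if c = a then 1 else 0)" for c
    using a nf_id[of "unit_vec_at a"] by (simp add: mu_def star_unit tgt_def) (simp add: unit_vec_at_def)
  fix b assume "b \<in> B"
  then have b: "b \<in> B" "b \<in> paths Q" using B_paths by auto
  show "c \<in> B \<and> tgt a = src b \<and> src c = src a \<and> tgt c = tgt b" if nz: "mu a b c \<noteq> 0" for c
  proof -
    have eq: "fin a = fst b" using nz by (auto simp: mu_def star_unit nf_zero split: if_splits)
    then have "nf (unit_vec_at (fst a, snd a @ snd b)) c \<noteq> 0" using nz by (simp add: mu_def star_unit)
    from nf_unit_parallel[OF concat_path(1)[OF a(2) b(2) eq] this] concat_path(2)[OF a(2) b(2) eq] eq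
    show ?thesis by (simp add: src_def tgt_def)
  qed
  fix c d assume "c \<in> B"
  then have u: "unit_vec_at a \<in> PC" "unit_vec_at b \<in> PC" "unit_vec_at c \<in> PC" using a b by (simp_all add: unit_PC)
  have "(\<Sum>x\<in>B. mu a b x * mu x c d) = nf (nf (unit_vec_at a \<star> unit_vec_at b) \<star> unit_vec_at c) d"
    unfolding mu_def by (rule expand_l[symmetric]) (intro nf_supp star_closed u)+
  also have "\<dots> = nf (unit_vec_at a \<star> unit_vec_at b \<star> unit_vec_at c) d"
    using u by (simp add: nf_star_l star_closed)
  also have "\<dots> = nf (unit_vec_at a \<star> (unit_vec_at b \<star> unit_vec_at c)) d"
    using P.m_assoc[OF u] by simp
  also have "\<dots> = nf (unit_vec_at a \<star> nf (unit_vec_at b \<star> unit_vec_at c)) d"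
    using u by (simp add: nf_star_r star_closed)
  also have "\<dots> = (\<Sum>x\<in>B. mu b c x * mu a x d)"
    unfolding mu_def by (rule expand_r) (intro nf_supp star_closed u)+
  finally show "(\<Sum>x\<in>B. mu a b x * mu x c d) = (\<Sum>x\<in>B. mu b c x * mu a x d)" .
qed

lemma L_mul: "supp x \<subseteq> B \<Longrightarrow> supp y \<subseteq> B \<Longrightarrow> L.mul x y = nf (x \<star> y)"
proof
  fix d assume x: "supp x \<subseteq> B" and y: "supp y \<subseteq> B"
  have "nf (x \<star> y) d = (\<Sum>a\<in>B. x a * (\<Sum>b\<in>B. y b * mu a b d))"
    unfolding expand_l[OF x B_carrier[OF y]] mu_def
    by (intro sum.cong refl arg_cong2[of _ _ _ _ "(*)"] expand_r y unit_PC)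
  then show "L.mul x y d = nf (x \<star> y) d" by (simp add: L.mul_def sum_distrib_left mult_ac)
qed

text \<open>A product of the arrow with a path that is not stationary is zero or a path of length at
  least two. Passing to the normal form changes it by an element of \<open>I\<close>, which has
  coefficient zero at every arrow, so the arrow cannot appear.\<close>

lemma arrow_coeff:
  assumes e: "e \<in> arcs Q" and c: "c \<in> B"
  defines "a \<equiv> (tail Q e, [e])"
  shows "mu a c a = (if c = tgt a then 1 else 0)" "mu c a a = (if c = src a then 1 else 0)"
proof -
  have aP: "a \<in> paths Q" using e by (auto simp: a_def in_paths pre_digraph.cas.simps)
  have aB: "a \<in> B" using aP by (intro short_B) (simp_all add: a_def)
  have cP: "c \<in> paths Q" using c B_paths by auto
  have long: "nf (unit_vec_at p) a = 0" if "p \<in> paths Q" "2 \<le> length (snd p)" for p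
  proof -
    have "unit_vec_at p a - nf (unit_vec_at p) a = 0"
      using short[OF nf_I[OF unit_path_carrier[OF that(1)]], of a] by (simp add: a_def)
    moreover have "p \<noteq> a" using that(2) by (auto simp: a_def)
    ultimately show ?thesis by (simp add: unit_vec_at_def)
  qed
  show "mu a c a = (if c = tgt a then 1 else 0)"
  proof (cases "c = tgt a")
    case True
    then show ?thesis using L.\<mu>_unit_right[OF aB] by simp
  next
    case False
    have "mu a c a = 0"
    proof (cases "fin a = fst c")
      case True
      then have "snd c \<noteq> []" using False by (auto simp: tgt_def prod_eq_iff)
      then have "2 \<le> length (snd a @ snd c)" by (cases "snd c") (auto simp: a_def)
      then show ?thesis using long[OF concat_path(1)[OF aP cP True]] True by (simp add: mu_def star_unit)
    qed (simp add: mu_def star_unit nf_zero)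
    then show ?thesis using False by simp
  qed
  show "mu c a a = (if c = src a then 1 else 0)"
  proof (cases "c = src a")
    case True
    then show ?thesis using L.\<mu>_unit_left[OF aB] by simp
  next
    case False
    have "mu c a a = 0"
    proof (cases "fin c = fst a")
      case True
      then have "snd c \<noteq> []" using False by (cases c) (auto simp: src_def)
      then have "2 \<le> length (snd c @ snd a)" by (cases "snd c") (auto simp: a_def)
      then show ?thesis using long[OF concat_path(1)[OF cP aP True]] True by (simp add: mu_def star_unit)
    qed (simp add: mu_def star_unit nf_zero)
    then show ?thesis using False by simp
  qed
qed

section \<open>The algebras of convex vertex sets\<close>

definition st :: "'v set \<Rightarrow> ('v, 'e) path set" where "st W = (\<lambda>v. (v, [])) ` W"

lemma in_BW: "b \<in> L.BW (st W) \<longleftrightarrow> b \<in> B \<and> fst b \<in> W \<and> fin b \<in> W"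
  by (auto simp: L.BW_def st_def src_def tgt_def)

definition convex :: "'v set \<Rightarrow> bool" where
  "convex W \<longleftrightarrow> (\<forall>p\<in>paths Q. fst p \<in> W \<longrightarrow> fin p \<in> W \<longrightarrow> p \<in> paths (Q \<restriction> W))"

lemma paths_induce_ends: "p \<in> paths (Q \<restriction> W) \<Longrightarrow> fst p \<in> W \<and> fin p \<in> W"
proof -
  assume p: "p \<in> paths (Q \<restriction> W)"
  interpret W: wf_digraph "Q \<restriction> W" by (rule wellformed_induce_subgraph)
  show ?thesis using p W.awlast_in_verts[of "fst p" "snd p"] by (cases p) (auto simp: in_paths_induce)
qed

text \<open>By convexity the basis paths with both ends in \<open>W\<close> are paths of the
  subquiver. Conversely the normal form of a path of the subquiver is parallel to it and uses only
  such basis paths. As the restricted ideal is an intersection with \<open>I\<close>, independence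
  and spanning carry over.\<close>

lemma presented_sub:
  assumes W: "W \<subseteq> verts Q" and conv: "convex W"
  shows "presented (L.BW (st W)) src tgt mu (sub_bq_algebra Q I W)
    (\<lambda>x. restrict_ideal Q I W +>\<^bsub>path_algebra (Q \<restriction> W)\<^esub> x)"
proof -
  let ?P = "path_algebra (Q \<restriction> W) :: ('k, ('v, 'e) path \<Rightarrow> 'k) module"
  let ?I = "restrict_ideal Q I W"
  have kP: "kalg ?P" by (rule kalg_induce[OF P.ring_axioms W])
  interpret K: kalg ?P by (rule kP)
  interpret LW: lincat "L.BW (st W)" src tgt mu by (rule L.lincat_BW)
  note sub = subsetD[OF carrier_induce[OF W]]
  have PW: "supp x \<subseteq> paths (Q \<restriction> W)" if "x \<in> carrier ?P" for x
    using that by (simp add: path_algebra_simps)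
  have neg: "\<ominus>\<^bsub>?P\<^esub> f = (\<lambda>x. - f x)" if f: "f \<in> carrier ?P" for f
  proof -
    have "(\<lambda>x. (-1) * f x) \<in> carrier ?P"
      using K.ks_closed[OF f, of "-1"] unfolding path_algebra_simps(5) .
    then show ?thesis using f by (intro K.minus_equality) (simp_all add: path_algebra_simps(2,3))
  qed
  have idl: "ideal ?I ?P"
  proof (rule idealI[OF K.ring_axioms])
    show "subgroup ?I (add_monoid ?P)"
    proof (rule group.subgroupI[OF K.a_group])
      show "?I \<subseteq> carrier (add_monoid ?P)" by (auto simp: restrict_ideal_def)
      have "\<zero>\<^bsub>?P\<^esub> \<in> ?I" using I_zero K.zero_closed
        by (simp add: restrict_ideal_def) (simp add: path_algebra_simps(3))
      then show "?I \<noteq> {}" by auto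
    next
      fix f assume f: "f \<in> ?I"
      then have f': "f \<in> carrier ?P" "f \<in> I" by (simp_all add: restrict_ideal_def)
      have "\<ominus>\<^bsub>?P\<^esub> f \<in> I" using I_smult[OF f'(2), of "-1"] by (simp add: neg[OF f'(1)])
      then show "inv\<^bsub>add_monoid ?P\<^esub> f \<in> ?I"
        using K.a_inv_closed[OF f'(1)] unfolding a_inv_def[symmetric] restrict_ideal_def by simp
    next
      fix f g assume fg: "f \<in> ?I" "g \<in> ?I"
      then have "f \<oplus>\<^bsub>?P\<^esub> g \<in> carrier ?P" by (intro K.a_closed) (simp_all add: restrict_ideal_def)
      moreover have "f \<oplus>\<^bsub>?P\<^esub> g \<in> I" using fg I_add[of f g] by (simp add: restrict_ideal_def path_algebra_simps(2))
      ultimately show "f \<otimes>\<^bsub>add_monoid ?P\<^esub> g \<in> ?I" by (simp add: restrict_ideal_def)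
    qed
  next
    fix f g assume f: "f \<in> ?I" and g: "g \<in> carrier ?P"
    then have "f \<otimes>\<^bsub>?P\<^esub> g \<in> carrier ?P" "g \<otimes>\<^bsub>?P\<^esub> f \<in> carrier ?P"
      by (auto simp: restrict_ideal_def intro: K.m_closed)
    moreover have "f \<star> g \<in> I" "g \<star> f \<in> I"
      using f g sub by (auto simp: restrict_ideal_def intro: P.I_l_closed P.I_r_closed)
    ultimately show "g \<otimes>\<^bsub>?P\<^esub> f \<in> ?I" "f \<otimes>\<^bsub>?P\<^esub> g \<in> ?I"
      unfolding restrict_ideal_def path_mult_induce by simp_all
  qed
  interpret Id: ideal ?I ?P by (rule idl)
  interpret q: kquot ?P ?I by (rule kalg_quot(2)[OF kP idl])
  have kq: "kalg (sub_bq_algebra Q I W)"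
    unfolding sub_bq_algebra_def bq_algebra_def by (rule kalg_quot(1)[OF kP idl])
  have Vsupp: "x \<in> LW.V \<longleftrightarrow> supp x \<subseteq> L.BW (st W)" for x :: "_ \<Rightarrow> 'k"
    by (auto simp: LW.V_def supp_def)
  have BWp: "L.BW (st W) \<subseteq> paths (Q \<restriction> W)"
    using conv B_paths by (auto simp: in_BW convex_def)
  have V: "x \<in> carrier ?P" "supp x \<subseteq> B" if "x \<in> LW.V" for x
    using that BWp L.BW_subset finite_subset[OF _ LW.finite_B] unfolding Vsupp path_algebra_simps by (meson subset_trans)+
  have eqI: "?I +>\<^bsub>?P\<^esub> x = ?I +>\<^bsub>?P\<^esub> y \<longleftrightarrow> (\<lambda>i. x i - y i) \<in> I"
    if xy: "x \<in> carrier ?P" "y \<in> carrier ?P" for x y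
  proof -
    have "x \<ominus>\<^bsub>?P\<^esub> y = (\<lambda>i. x i - y i)"
      unfolding a_minus_def neg[OF xy(2)] by (simp add: path_algebra_simps(2))
    moreover have "x \<ominus>\<^bsub>?P\<^esub> y \<in> carrier ?P" using xy by simp
    ultimately show ?thesis using q.coset_eq_iff[OF xy] by (simp add: restrict_ideal_def)
  qed
  have nfV: "nf f \<in> LW.V" if f: "f \<in> carrier ?P" for f
  proof -
    have "finite (supp f)" "supp f \<subseteq> paths (Q \<restriction> W)" using f by (simp_all add: path_algebra_simps)
    then show ?thesis
    proof (induct f rule: fun_supp_induct)
      case zero
      then show ?case by (simp add: nf_zero LW.V_def)
    next
      case (unit c p)
      then have p: "p \<in> paths Q" using paths_induce_subset[OF W] by auto
      have "nf (unit_vec_at p) \<in> LW.V"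
        unfolding LW.V_def using nf_unit_parallel[OF p] paths_induce_ends[OF unit] by (auto simp: in_BW)
      then show ?case using nf_smult[OF unit_path_carrier[OF p], of c] by (simp add: LW.V_def)
    next
      case (add f g)
      have "f \<in> PC" "g \<in> PC" using add paths_induce_subset[OF W] by (meson PC_I subset_trans)+
      then show ?case using add(5,6) nf_add[of f g] unfolding LW.V_def by (simp, metis add.right_neutral)
    qed
  qed
  show ?thesis
    unfolding presented_def presented_axioms_def
  proof (intro conjI allI impI LW.lincat_axioms kq)
    fix x y a c
    show "?I +>\<^bsub>?P\<^esub> x \<in> carrier (sub_bq_algebra Q I W)" if "x \<in> LW.V"
      using V(1)[OF that] by (simp add: sub_bq_algebra_def bq_algebra_def K.a_rcosetsI q.W_subset)
    show "?I +>\<^bsub>?P\<^esub> (\<lambda>b. x b + y b) = (?I +>\<^bsub>?P\<^esub> x) \<oplus>\<^bsub>sub_bq_algebra Q I W\<^esub> (?I +>\<^bsub>?P\<^esub> y)"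
      if "x \<in> LW.V" "y \<in> LW.V"
      using q.coset_add[OF V(1)[OF that(1)] V(1)[OF that(2)]]
      by (simp add: sub_bq_algebra_def bq_algebra_def path_algebra_simps(2))
    show "?I +>\<^bsub>?P\<^esub> (\<lambda>b. c * x b) = c \<odot>\<^bsub>sub_bq_algebra Q I W\<^esub> (?I +>\<^bsub>?P\<^esub> x)" if "x \<in> LW.V"
      using q.quot_smult[OF V(1)[OF that], of c]
      by (simp add: sub_bq_algebra_def bq_algebra_def path_algebra_simps(5))
    show "?I +>\<^bsub>?P\<^esub> LW.mul x y = (?I +>\<^bsub>?P\<^esub> x) \<otimes>\<^bsub>sub_bq_algebra Q I W\<^esub> (?I +>\<^bsub>?P\<^esub> y)"
      if xy: "x \<in> LW.V" "y \<in> LW.V"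
    proof -
      have xB: "b \<in> L.BW (st W)" if "x b \<noteq> 0" for b using that xy(1) unfolding LW.V_def by blast
      have yB: "b \<in> L.BW (st W)" if "y b \<noteq> 0" for b using that xy(2) unfolding LW.V_def by blast
      have m: "LW.mul x y = nf (x \<star> y)"
        by (rule trans[OF L.mul_BW[OF xB yB] L_mul[OF V(2)[OF xy(1)] V(2)[OF xy(2)]]])
      have c: "x \<star> y \<in> carrier ?P" using K.m_closed[OF V(1)[OF xy(1)] V(1)[OF xy(2)]] by (simp add: path_mult_induce)
      have "(\<lambda>i. nf (x \<star> y) i - (x \<star> y) i) \<in> I"
        using I_smult[OF nf_I[OF sub[OF c]], of "-1"] by simp
      then have "?I +>\<^bsub>?P\<^esub> nf (x \<star> y) = ?I +>\<^bsub>?P\<^esub> (x \<star> y)"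
        using eqI[OF V(1)[OF nfV[OF c]] c] by simp
      then show ?thesis
        using Id.rcoset_mult_add[OF V(1)[OF xy(1)] V(1)[OF xy(2)]]
        by (simp add: m sub_bq_algebra_def bq_algebra_def path_mult_induce)
    qed
    have "LW.one = vid W"
      using W by (auto simp: fun_eq_iff LW.one_def vid_def in_BW src_def in_paths pre_digraph.cas.simps intro!: short_B)
    then show "?I +>\<^bsub>?P\<^esub> LW.one = \<one>\<^bsub>sub_bq_algebra Q I W\<^esub>"
      by (simp add: sub_bq_algebra_def bq_algebra_def path_algebra_simps(4))
    show "x = y" if xy: "x \<in> LW.V" "y \<in> LW.V" "?I +>\<^bsub>?P\<^esub> x = ?I +>\<^bsub>?P\<^esub> y"
    proof -
      have "(\<lambda>i. x i - y i) \<in> I" using eqI[OF V(1)[OF xy(1)] V(1)[OF xy(2)]] xy(3) by simp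
      moreover have "supp (\<lambda>i. x i - y i) \<subseteq> B" using V(2)[OF xy(1)] V(2)[OF xy(2)] supp_diff_subset[of x y] by blast
      ultimately have "(\<lambda>i. x i - y i) = (\<lambda>_. 0)" by (rule indep)
      then show ?thesis by (simp add: fun_eq_iff)
    qed
    show "\<exists>x\<in>LW.V. ?I +>\<^bsub>?P\<^esub> x = a" if "a \<in> carrier (sub_bq_algebra Q I W)"
    proof -
      from that have "a \<in> a_rcosets\<^bsub>?P\<^esub> ?I" by (simp add: sub_bq_algebra_def bq_algebra_def)
      then obtain f where f: "f \<in> carrier ?P" "a = ?I +>\<^bsub>?P\<^esub> f" by (rule q.rcosetsE)
      have "(\<lambda>i. nf f i - f i) \<in> I" using I_smult[OF nf_I[OF sub[OF f(1)]], of "-1"] by simp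
      then have "?I +>\<^bsub>?P\<^esub> nf f = a" using eqI[OF V(1)[OF nfV[OF f(1)]] f(1)] f(2) by simp
      then show ?thesis using nfV[OF f(1)] by (intro bexI[of _ "nf f"])
    qed
  qed
qed

end

section \<open>Strings in closed vertex sets, components and closed walks\<close>

context lincat begin

lemma chain_forward:
  assumes "\<And>b. b \<in> B \<Longrightarrow> s b \<in> S \<Longrightarrow> t b \<in> S" "composable L" "set L \<subseteq> B" "L \<noteq> []" "s (hd L) \<in> S"
  shows "set L \<subseteq> BW S"
  using assms(2-)
proof (induct L)
  case (Cons a L)
  then show ?case using assms(1)[of a] by (cases L) (auto simp: BW_def)
qed simp

lemma chain_backward:
  assumes "\<And>b. b \<in> B \<Longrightarrow> t b \<in> S \<Longrightarrow> s b \<in> S" "composable L" "set L \<subseteq> B" "L \<noteq> []" "t (last L) \<in> S"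
  shows "set L \<subseteq> BW S"
  using assms(2-)
proof (induct L)
  case (Cons a L)
  show ?case
  proof (cases L)
    case Nil
    then show ?thesis using Cons(2-) assms(1)[of a] by (simp add: BW_def)
  next
    case (Cons b M)
    with Cons.hyps Cons.prems have "set L \<subseteq> BW S" by simp
    moreover from this have "t a \<in> S" using Cons Cons.prems by (simp add: BW_def)
    ultimately show ?thesis using Cons.prems assms(1)[of a] by (simp add: BW_def)
  qed
qed simp

end

text \<open>A function that takes equal values at the two ends of every arc is constant along
  undirected walks; it will be the scalar part of a central element.\<close>

lemma (in wf_digraph) mk_symmetric_invariant:
  assumes "u \<rightarrow>\<^sup>*\<^bsub>mk_symmetric G\<^esub> v" and "\<And>e. e \<in> arcs G \<Longrightarrow> f (tail G e) = f (head G e)"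
  shows "f v = f u"
proof -
  interpret S: pair_wf_digraph "mk_symmetric G" by (rule wellformed_mk_symmetric)
  show ?thesis using assms(1)
  proof (induct rule: S.reachable_induct)
    case (step x y)
    from step(2) have "(x, y) \<in> parcs (mk_symmetric G)" by simp
    then obtain e where "e \<in> arcs G" "(x, y) = (tail G e, head G e) \<or> (x, y) = (head G e, tail G e)"
      unfolding parcs_mk_symmetric by blast
    then show ?case using assms(2)[of e] step(3) by auto
  qed simp
qed

lemma forest_closed_walk:
  assumes "wf_digraph G" "forest G" "pre_digraph.awalk G u p u" shows "p = []"
proof (rule ccontr)
  interpret wf_digraph G by fact
  assume "p \<noteq> []"
  then have "closed_w p" using assms(3) by (auto simp: closed_w_def)
  then show False using closed_w_imp_cycle assms(2) by (auto simp: forest_def)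
qed

section \<open>Oriented algebras in terms of vertex sets\<close>

context bq_basis begin

text \<open>Vanishing of Peirce components is used in this form: no basis path leaves
  \<open>W\<close>, or in \<open>backward\<close> none enters it. A whole string is then confined to
  \<open>W\<close> by its first or its last vertex.\<close>

definition forward :: "'v set \<Rightarrow> bool" where
  "forward W \<longleftrightarrow> (\<forall>b\<in>B. fst b \<in> W \<longrightarrow> fin b \<in> W)"

definition backward :: "'v set \<Rightarrow> bool" where
  "backward W \<longleftrightarrow> (\<forall>b\<in>B. fin b \<in> W \<longrightarrow> fst b \<in> W)"

lemma arrow_B: "e \<in> arcs Q \<Longrightarrow> (tail Q e, [e]) \<in> B"
  by (rule short_B) (auto simp: in_paths pre_digraph.cas.simps)

lemma fin_arrow: "fin (u, [e]) = head Q e"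
  by (simp add: awalk_verts.simps)

text \<open>The arrows belong to \<open>B\<close>, so a walk that starts in \<open>W\<close> is kept
  there arrow by arrow.\<close>

lemma forward_convex: "forward W \<Longrightarrow> convex W"
  unfolding convex_def
proof (intro ballI impI)
  assume W: "forward W"
  have *: "u \<in> W \<Longrightarrow> set p \<subseteq> arcs Q \<Longrightarrow> cas u p v \<Longrightarrow> set p \<subseteq> {a \<in> arcs Q. tail Q a \<in> W \<and> head Q a \<in> W}" for u p v
  proof (induct p arbitrary: u)
    case (Cons e p)
    then have e: "e \<in> arcs Q" "tail Q e = u" "cas (head Q e) p v" by auto
    then have "head Q e \<in> W" using W arrow_B[of e] Cons(2) fin_arrow[of u e] by (auto simp: forward_def)
    then show ?case using Cons e by auto
  qed simp
  fix p assume p: "p \<in> paths Q" "fst p \<in> W"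
  show "p \<in> paths (Q \<restriction> W)" using p *[of "fst p" "snd p"] by (cases p) (auto simp: in_paths in_paths_induce)
qed

lemma backward_convex: "backward W \<Longrightarrow> convex W"
  unfolding convex_def
proof (intro ballI impI)
  assume W: "backward W"
  have *: "v \<in> W \<Longrightarrow> set p \<subseteq> arcs Q \<Longrightarrow> cas u p v \<Longrightarrow>
      u \<in> W \<and> set p \<subseteq> {a \<in> arcs Q. tail Q a \<in> W \<and> head Q a \<in> W}" for u p v
  proof (induct p arbitrary: u)
    case (Cons e p)
    then have e: "e \<in> arcs Q" "tail Q e = u" "cas (head Q e) p v" by auto
    then have "head Q e \<in> W \<and> set p \<subseteq> {a \<in> arcs Q. tail Q a \<in> W \<and> head Q a \<in> W}"
      using Cons by simp
    moreover from this have "u \<in> W" using W arrow_B[OF e(1)] fin_arrow[of u e] e(2) by (auto simp: backward_def)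
    ultimately show ?case using e by simp
  qed simp
  fix p assume p: "p \<in> paths Q" "fin p \<in> W"
  then obtain v where v: "cas (fst p) (snd p) v" "set (snd p) \<subseteq> arcs Q" by (cases p) (auto simp: in_paths)
  then have "v \<in> W" using p(2) awlast_if_cas by auto
  from *[OF this v(2,1)] v show "p \<in> paths (Q \<restriction> W)" by (cases p) (auto simp: in_paths_induce)
qed

lemma convex_Int:
  assumes "convex W1" "convex W2" shows "convex (W1 \<inter> W2)"
  unfolding convex_def
proof (intro ballI impI)
  fix p assume p: "p \<in> paths Q" "fst p \<in> W1 \<inter> W2" "fin p \<in> W1 \<inter> W2"
  then have "p \<in> paths (Q \<restriction> W1)" "p \<in> paths (Q \<restriction> W2)" using assms by (simp_all add: convex_def)
  then show "p \<in> paths (Q \<restriction> (W1 \<inter> W2))" by (cases p) (auto simp: in_paths_induce)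
qed

lemma bq_kalg: "kalg (bq_algebra Q I)"
  unfolding bq_algebra_def by (rule kalg_quot(1)[OF P_kalg I_ideal])

abbreviation coset :: "(('v, 'e) path \<Rightarrow> 'k) \<Rightarrow> (('v, 'e) path \<Rightarrow> 'k) set" where
  "coset f \<equiv> I +>\<^bsub>path_algebra Q\<^esub> f"

lemma bq_simps:
  "\<one>\<^bsub>bq_algebra Q I\<^esub> = coset (vid (verts Q))" "\<zero>\<^bsub>bq_algebra Q I\<^esub> = I"
  "f \<in> PC \<Longrightarrow> g \<in> PC \<Longrightarrow> coset f \<oplus>\<^bsub>bq_algebra Q I\<^esub> coset g = coset (\<lambda>x. f x + g x)"
  "f \<in> PC \<Longrightarrow> g \<in> PC \<Longrightarrow> coset f \<otimes>\<^bsub>bq_algebra Q I\<^esub> coset g = coset (f \<star> g)"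
  "f \<in> PC \<Longrightarrow> coset f \<in> carrier (bq_algebra Q I)"
  "f \<in> PC \<Longrightarrow> coset f = I \<longleftrightarrow> f \<in> I"
  by (simp_all add: bq_algebra_def path_algebra_simps(4) I.coset_add P.rcoset_mult_add P.a_rcosetsI
      I.W_subset I.coset_zero_iff path_algebra_simps(2))

lemma vid_PC: "X \<subseteq> verts Q \<Longrightarrow> vid X \<in> PC"
  by (rule vid_carrier) (auto intro: finite_subset)

lemma vertex_idem_sum_coset:
  assumes "X \<subseteq> verts Q" shows "vertex_idem_sum Q I X = coset (vid X)"
proof -
  interpret R: kalg "bq_algebra Q I" by (rule bq_kalg)
  have "finite X" using assms by (auto intro: finite_subset)
  then show ?thesis using assms
  proof (induct X rule: finite_induct)
    case empty
    have "(vid {} :: ('v, 'e) path \<Rightarrow> 'k) = (\<lambda>_. 0)" by (auto simp: vid_def)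
    then have "coset (vid {}) = I" using bq_simps(6)[OF vid_PC[OF empty_subsetI]] I_zero by simp
    then show ?case by (simp add: vertex_idem_sum_def bq_simps(2))
  next
    case (insert x X)
    have v: "vertex_idem Q I y = coset (vid {y})" for y by (simp add: vertex_idem_def unit_vec_vid)
    have "vertex_idem Q I y \<in> carrier (bq_algebra Q I)" if "y \<in> insert x X" for y
      unfolding v using that insert by (intro bq_simps(5) vid_PC) auto
    then have "vertex_idem_sum Q I (insert x X) =
        vertex_idem Q I x \<oplus>\<^bsub>bq_algebra Q I\<^esub> vertex_idem_sum Q I X"
      unfolding vertex_idem_sum_def using insert(1,2) by (subst R.finsum_insert) auto
    also have "\<dots> = coset (\<lambda>i. vid {x} i + vid X i)"
      using insert by (simp add: v bq_simps(3) vid_PC)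
    also have "(\<lambda>i. vid {x} i + vid X i) = (vid (insert x X) :: _ \<Rightarrow> 'k)"
      using insert(2) by (auto simp: vid_def fun_eq_iff)
    finally show ?case .
  qed
qed

text \<open>The equation holds only modulo \<open>I\<close>, but elements of \<open>I\<close> vanish
  on stationary paths, so it can be evaluated there and read as a statement about vertices.\<close>

lemma idem_product_zero:
  assumes "X \<subseteq> verts Q" "Y \<subseteq> verts Q" "coset (vid X) \<otimes>\<^bsub>bq_algebra Q I\<^esub> coset (vid Y) = \<zero>\<^bsub>bq_algebra Q I\<^esub>"
  shows "X \<inter> Y = {}"
proof -
  have "vid X \<star> vid Y \<in> I"
    using assms(3) bq_simps(4)[OF vid_PC[OF assms(1)] vid_PC[OF assms(2)]]
      bq_simps(6)[OF star_closed[OF vid_PC[OF assms(1)] vid_PC[OF assms(2)]]] by (simp add: bq_simps(2))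
  from short[OF this] have z: "(vid X \<star> vid Y) (x, [] :: 'e list) = 0" for x by simp
  have "x \<notin> Y" if "x \<in> X" for x
    using z[of x] that unfolding vid_mult by (simp add: vid_def split: if_splits)
  then show ?thesis by blast
qed

text \<open>The idempotents at its ends fix \<open>b\<close>, so if the component vanished,
  \<open>b\<close> would lie in \<open>I\<close>, against the independence of the basis.\<close>

lemma peirce_zero:
  assumes X: "X \<subseteq> verts Q" and Y: "Y \<subseteq> verts Q"
    and z: "peirce (bq_algebra Q I) (coset (vid X)) (coset (vid Y)) = {\<zero>\<^bsub>bq_algebra Q I\<^esub>}"
    and b: "b \<in> B" "fst b \<in> X" "fin b \<in> Y"
  shows False
proof -
  have u: "unit_vec_at b \<in> PC" by (rule unit_PC[OF b(1)])
  have f: "vid X \<star> unit_vec_at b \<star> vid Y = unit_vec_at b"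
    by (rule ext, clarify) (cases b, use b in \<open>auto simp: mult_vid vid_mult unit_vec_at_def\<close>)
  have "coset (vid X) \<otimes>\<^bsub>bq_algebra Q I\<^esub> coset (unit_vec_at b) \<otimes>\<^bsub>bq_algebra Q I\<^esub> coset (vid Y) = \<zero>\<^bsub>bq_algebra Q I\<^esub>"
    using z bq_simps(5)[OF u] unfolding peirce_def by blast
  then have "coset (unit_vec_at b) = I"
    using u vid_PC[OF X] vid_PC[OF Y] by (simp add: bq_simps(2,4) star_closed f)
  then have "unit_vec_at b \<in> I" using bq_simps(6)[OF u] by simp
  then have "unit_vec_at b = (\<lambda>_. 0 :: 'k)" by (rule indep) (use b in simp)
  from fun_cong[OF this, of b] show False by (simp add: unit_vec_at_def)
qed

text \<open>Each alternative for the orientation, combined with the absence of paths between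
  \<open>V1\<close> and \<open>V2\<close>, says whether paths can leave or enter
  \<open>V1 \<union> V\<close> and \<open>V2 \<union> V\<close>. In the mixed alternative strings
  may run from \<open>V2\<close> through \<open>V\<close> to \<open>V1\<close>, but their composites
  vanish, as no basis path joins these ends.\<close>

lemma oriented_vertices:
  assumes V: "V \<subseteq> verts Q" and V1: "V1 \<subseteq> verts Q" and V2: "V2 \<subseteq> verts Q"
    and o: "oriented (bq_algebra Q I) (vertex_idem_sum Q I V) (vertex_idem_sum Q I V1) (vertex_idem_sum Q I V2)"
  shows "V1 \<inter> V2 = {}" "verts Q = V1 \<union> V2 \<union> V"
    "forward (V1 \<union> V) \<and> forward (V2 \<union> V) \<or> backward (V1 \<union> V) \<and> backward (V2 \<union> V) \<or>
     forward (V1 \<union> V) \<and> backward (V2 \<union> V) \<and> (\<forall>b\<in>B. \<not> (fst b \<in> V2 \<and> fin b \<in> V1))"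
proof -
  note o = o[unfolded vertex_idem_sum_coset[OF V] vertex_idem_sum_coset[OF V1] vertex_idem_sum_coset[OF V2]
      oriented_def orthogonal_idempotents_def]
  have d: "V \<inter> V1 = {}" "V \<inter> V2 = {}"
    using o by (auto dest: idem_product_zero[OF V V1] idem_product_zero[OF V V2])
  show d12: "V1 \<inter> V2 = {}" using o by (auto dest: idem_product_zero[OF V1 V2])
  have "coset (vid (verts Q)) = coset (\<lambda>x. vid V1 x + vid V x) \<oplus>\<^bsub>bq_algebra Q I\<^esub> coset (vid V2)"
    using o bq_simps(3)[OF vid_PC[OF V1] vid_PC[OF V]] by (simp add: bq_simps(1))
  also have "(\<lambda>x. vid V1 x + vid V x) = (vid (V1 \<union> V) :: _ \<Rightarrow> 'k)"
    using d by (auto simp: fun_eq_iff vid_def)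
  also have "coset (vid (V1 \<union> V)) \<oplus>\<^bsub>bq_algebra Q I\<^esub> coset (vid V2) = coset (\<lambda>x. vid (V1 \<union> V) x + vid V2 x)"
    using V V1 V2 by (intro bq_simps(3) vid_PC) auto
  also have "(\<lambda>x. vid (V1 \<union> V) x + vid V2 x) = (vid (V1 \<union> V2 \<union> V) :: _ \<Rightarrow> 'k)"
    using d d12 by (auto simp: fun_eq_iff vid_def)
  finally have eq: "coset (vid (verts Q)) = coset (vid (V1 \<union> V2 \<union> V))" .
  have pc: "vid (verts Q) \<in> PC" "vid (V1 \<union> V2 \<union> V) \<in> PC" using V V1 V2 by (auto intro!: vid_PC)
  have I: "vid (verts Q) \<ominus>\<^bsub>path_algebra Q\<^esub> vid (V1 \<union> V2 \<union> V) \<in> I"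
    using I.coset_eq_iff[OF pc] eq by simp
  have neg: "\<ominus>\<^bsub>path_algebra Q\<^esub> vid (V1 \<union> V2 \<union> V) = (\<lambda>i. - (vid (V1 \<union> V2 \<union> V) i :: 'k))"
    using A.ks_neg[OF pc(2), of 1] by (simp add: path_algebra_simps(5))
  have "verts Q \<subseteq> V1 \<union> V2 \<union> V"
  proof
    fix x assume x: "x \<in> verts Q"
    have "vid (verts Q) (x, [] :: 'e list) - (vid (V1 \<union> V2 \<union> V) (x, [] :: 'e list) :: 'k) = 0"
      using short[OF I, of "(x, [])"] unfolding a_minus_def neg path_algebra_simps(2) by simp
    then show "x \<in> V1 \<union> V2 \<union> V" using x by (simp add: vid_def split: if_splits)
  qed
  then show cover: "verts Q = V1 \<union> V2 \<union> V" using V V1 V2 by auto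
  define no where "no X Y \<longleftrightarrow> (\<forall>b\<in>B. fst b \<in> X \<longrightarrow> fin b \<notin> Y)" for X Y
  have no: "no X Y" if "peirce (bq_algebra Q I) (coset (vid X)) (coset (vid Y)) = {\<zero>\<^bsub>bq_algebra Q I\<^esub>}"
    "X \<subseteq> verts Q" "Y \<subseteq> verts Q" for X Y
    using peirce_zero[OF that(2,3,1)] by (auto simp: no_def)
  have n12: "no V1 V2" "no V2 V1" using o no V1 V2 by simp_all
  have ends: "fst b \<in> V1 \<union> V2 \<union> V" "fin b \<in> V1 \<union> V2 \<union> V" if "b \<in> B" for b
    using fin_verts[of b] B_paths that cover by auto
  have "no V V1 \<and> no V V2 \<or> no V1 V \<and> no V2 V \<or> no V1 V \<and> no V V2"
    using o no[OF _ V V1] no[OF _ V V2] no[OF _ V1 V] no[OF _ V2 V] by blast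
  then consider "no V V1" "no V V2" | "no V1 V" "no V2 V" | "no V1 V" "no V V2" by blast
  then show "forward (V1 \<union> V) \<and> forward (V2 \<union> V) \<or> backward (V1 \<union> V) \<and> backward (V2 \<union> V) \<or>
     forward (V1 \<union> V) \<and> backward (V2 \<union> V) \<and> (\<forall>b\<in>B. \<not> (fst b \<in> V2 \<and> fin b \<in> V1))"
  proof cases
    case 1
    then have "forward (V1 \<union> V)" "forward (V2 \<union> V)"
      using n12 ends unfolding forward_def no_def by (blast, blast)
    then show ?thesis by simp
  next
    case 2
    then have "backward (V1 \<union> V)" "backward (V2 \<union> V)"
      using n12 ends unfolding backward_def no_def by (blast, blast)
    then show ?thesis by simp
  next
    case 3
    then have "forward (V1 \<union> V)" "backward (V2 \<union> V)"
      using n12 ends unfolding forward_def backward_def no_def by (blast, blast)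
    moreover have "\<forall>b\<in>B. \<not> (fst b \<in> V2 \<and> fin b \<in> V1)" using n12 by (auto simp: no_def)
    ultimately show ?thesis by simp
  qed
qed

lemma st_iff: "src b \<in> st W \<longleftrightarrow> fst b \<in> W" "tgt b \<in> st W \<longleftrightarrow> fin b \<in> W"
  by (auto simp: st_def src_def tgt_def)

text \<open>The identity component \<open>val\<close> of a central element agrees at both ends of
  every arrow of the subquiver on \<open>W\<close>, hence is constant on \<open>V\<close>.
  Acyclicity of the core leaves no other component at a vertex of \<open>V\<close>, so the
  restriction is a scalar multiple of the unit cochain.\<close>

lemma central_core:
  assumes W: "W \<subseteq> verts Q" "V \<subseteq> W" and conn: "connected_within Q W V"
    and acyclic: "\<And>b. b \<in> L.BW (st V) \<Longrightarrow> src b = tgt b \<Longrightarrow> b = src b"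
    and f: "f \<in> model_cocycles (lincat.K (L.BW (st W)) src tgt mu) (\<lambda>n. lincat.del (L.BW (st W)) src tgt mu (n + 2)) 0"
  shows "\<exists>k. L.rs (st V) f = (\<lambda>i. k * lincat.idc (L.BW (st V)) src tgt mu i)"
proof -
  interpret LW: lincat "L.BW (st W)" src tgt mu by (rule L.lincat_BW)
  interpret G: wf_digraph "Q \<restriction> W" by (rule wellformed_induce_subgraph)
  define val where "val v = f ([(v, []), (v, [])], (v, []))" for v
  have arc: "val (tail Q e) = val (head Q e)" if e: "e \<in> arcs (Q \<restriction> W)" for e
  proof -
    let ?a = "(tail Q e, [e])"
    have e': "e \<in> arcs Q" "tail Q e \<in> W" "head Q e \<in> W" using e by simp_all
    have a: "?a \<in> L.BW (st W)" using arrow_B[OF e'(1)] e' by (simp add: in_BW awalk_verts.simps)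
    have "f ([src ?a, src ?a], src ?a) = f ([tgt ?a, tgt ?a], tgt ?a)"
    proof (rule LW.central_arrow[OF f a])
      fix c assume "c \<in> L.BW (st W)"
      then have c: "c \<in> B" using L.BW_subset by blast
      show "mu ?a c ?a = (if c = tgt ?a then 1 else 0)" "mu c ?a ?a = (if c = src ?a then 1 else 0)"
        by (rule arrow_coeff[OF e'(1) c])+
    qed
    then show ?thesis by (simp add: val_def src_def tgt_def awalk_verts.simps)
  qed
  obtain x0 where x0: "x0 \<in> V" using conn by (auto simp: connected_within_def)
  have val: "val x = val x0" if "x \<in> V" for x
    using conn x0 that arc by (intro G.mk_symmetric_invariant[of x0 x val]) (auto simp: connected_within_def)
  have stm: "st V \<subseteq> st W" using W(2) by (auto simp: st_def)
  note n = L.BW_nested[OF stm] L.rs_nested[OF stm]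
  have "LW.rs (st V) f = (\<lambda>i. val x0 * LW.rs (st V) LW.idc i)"
  proof (rule LW.rs_central)
    show "f \<in> LW.K 0" using f by (simp add: model_cocycles_def)
    show "b = src b" if "b \<in> LW.BW (st V)" "src b = tgt b" for b
      by (rule acyclic) (use that n in simp_all)
    fix x assume x: "x \<in> LW.BW (st V)" "src x = x"
    then have "fst x \<in> V" unfolding n by (simp add: in_BW)
    moreover have "f ([x, x], x) = val (fst x)" unfolding val_def using x(2) by (simp add: src_def)
    ultimately show "f ([x, x], x) = val x0" using val by simp
  qed
  then show ?thesis unfolding LW.rs_idc unfolding n by auto
qed

text \<open>One basis and one multiplication table present all four algebras, each through the basis
  paths with ends in its vertex set; \<open>V\<close> is the intersection of the two larger sets
  because \<open>V1\<close> and \<open>V2\<close> are disjoint. Connectedness and acyclicity enter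
  through \<open>central_core\<close>, in the dimension formulas.\<close>

lemma oriented_cohomology:
  fixes V V1 V2
  defines "R \<equiv> bq_algebra Q I" and "C \<equiv> sub_bq_algebra Q I V"
    and "A1 \<equiv> sub_bq_algebra Q I (V1 \<union> V)" and "A2 \<equiv> sub_bq_algebra Q I (V2 \<union> V)"
  assumes V: "V \<subseteq> verts Q" and V1: "V1 \<subseteq> verts Q" and V2: "V2 \<subseteq> verts Q"
    and o: "oriented R (vertex_idem_sum Q I V) (vertex_idem_sum Q I V1) (vertex_idem_sum Q I V2)"
    and core: "core_algebra (Q \<restriction> V) (restrict_ideal Q I V)"
  shows "connected_within Q (V1 \<union> V) V \<Longrightarrow> connected_within Q (V2 \<union> V) V \<Longrightarrow>
      int (HH_dim R 0) = int (HH_dim A1 0) + int (HH_dim A2 0) - 1 \<and>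
      int (HH_dim R 1) = int (HH_dim A1 1) + int (HH_dim A2 1) + int (HH_dim C 0) - 1"
    and "2 \<le> i \<Longrightarrow> vs_isomorphic (HH R i) (direct_sum (HH A1 i) (HH A2 i))"
proof -
  define W1 where "W1 = V1 \<union> V"
  define W2 where "W2 = V2 \<union> V"
  note ov = oriented_vertices[OF V V1 V2 o[unfolded R_def]]
  have W: "W1 \<subseteq> verts Q" "W2 \<subseteq> verts Q" using V V1 V2 by (auto simp: W1_def W2_def)
  have VW: "V = W1 \<inter> W2" using ov(1) by (auto simp: W1_def W2_def)
  have stV: "st V = st W1 \<inter> st W2" unfolding VW by (auto simp: st_def)
  note dir = ov(3)[folded W1_def W2_def]
  have conv: "convex W1" "convex W2" using dir forward_convex backward_convex by blast+
  have convV: "convex V" unfolding VW by (rule convex_Int[OF conv])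
  have BWQ: "L.BW (st (verts Q)) = B"
    using B_paths fin_verts by (auto simp: in_BW)
  \<comment> \<open>\<open>R\<close> is treated as the algebra of the full subquiver on all
    vertices, which makes its presentation another instance of \<open>presented_sub\<close>.\<close>
  have "convex (verts Q)" by (simp add: convex_def induce_verts_self)
  note pR = presented_sub[OF order_refl this]
  have resQ: "restrict_ideal Q I (verts Q) = I"
    using I.W_subset by (auto simp: restrict_ideal_def induce_verts_self)
  have sR: "sub_bq_algebra Q I (verts Q) = R"
    unfolding sub_bq_algebra_def R_def resQ induce_verts_self ..
  interpret LC: lincat "L.BW (st V)" src tgt mu by (rule L.lincat_BW)
  interpret L1: lincat "L.BW (st W1)" src tgt mu by (rule L.lincat_BW)
  interpret L2: lincat "L.BW (st W2)" src tgt mu by (rule L.lincat_BW)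
  have HR: "\<exists>q. pres (HH R n) (model_cocycles L.K L.\<delta> n) (model_coboundaries L.K L.\<delta> n) q" for n
    using presented.pres_HH[OF pR, of n] unfolding sR BWQ .
  have H1: "\<exists>q. pres (HH A1 n) (model_cocycles L1.K L1.\<delta> n) (model_coboundaries L1.K L1.\<delta> n) q" for n
    using presented.pres_HH[OF presented_sub[OF W(1) conv(1)], of n] unfolding A1_def W1_def .
  have H2: "\<exists>q. pres (HH A2 n) (model_cocycles L2.K L2.\<delta> n) (model_coboundaries L2.K L2.\<delta> n) q" for n
    using presented.pres_HH[OF presented_sub[OF W(2) conv(2)], of n] unfolding A2_def W2_def .
  have HC: "\<exists>q. pres (HH C n) (model_cocycles LC.K LC.\<delta> n) (model_coboundaries LC.K LC.\<delta> n) q" for n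
    using presented.pres_HH[OF presented_sub[OF V convV], of n] unfolding C_def .
  have coreC: "model_cocycles LC.K LC.\<delta> n \<subseteq> model_coboundaries LC.K LC.\<delta> n" if n: "n \<ge> 1" for n
  proof
    fix z assume z: "z \<in> model_cocycles LC.K LC.\<delta> n"
    from HC obtain q where q: "pres (HH C n) (model_cocycles LC.K LC.\<delta> n) (model_coboundaries LC.K LC.\<delta> n) q" ..
    have "carrier (HH C n) = {\<zero>\<^bsub>HH C n\<^esub>}"
      using core n unfolding core_algebra_def C_def sub_bq_algebra_def by blast
    moreover have "q z \<in> carrier (HH C n)" unfolding presD(1)[OF q, symmetric] by (rule imageI[OF z])
    ultimately have "q z = \<zero>\<^bsub>HH C n\<^esub>" by simp
    then show "z \<in> model_coboundaries LC.K LC.\<delta> n" unfolding presD(4)[OF q z] .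
  qed
  interpret M: mv L.K L1.K L2.K LC.K L.\<delta> L1.\<delta> L2.\<delta> LC.\<delta> "L.rs (st W1)" "L.rs (st W2)" "L.rs (st V)"
    unfolding stV
  proof (rule L.mv_lincat[of "st W1" "st W2"])
    fix n :: nat
    assume n: "n \<ge> 1"
    show "model_cocycles (lincat.K (L.BW (st W1 \<inter> st W2)) src tgt mu) (\<lambda>n. lincat.del (L.BW (st W1 \<inter> st W2)) src tgt mu (n + 2)) n
      \<subseteq> model_coboundaries (lincat.K (L.BW (st W1 \<inter> st W2)) src tgt mu) (\<lambda>n. lincat.del (L.BW (st W1 \<inter> st W2)) src tgt mu (n + 2)) n"
      using coreC[OF n] unfolding stV .
  next
    fix M and n :: nat assume "M \<in> L.J (n + 2)"
    then have M: "L.composable M" "set M \<subseteq> B" "M \<noteq> []" by (auto simp: L.J_def)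
    have MB: "hd M \<in> B" "last M \<in> B" using M by auto
    have fw: "set M \<subseteq> L.BW (st W)" if "forward W" "fst (hd M) \<in> W" for W
      by (rule L.chain_forward[OF _ M]) (use that in \<open>auto simp: st_iff forward_def\<close>)
    have bw: "set M \<subseteq> L.BW (st W)" if "backward W" "fin (last M) \<in> W" for W
      by (rule L.chain_backward[OF _ M]) (use that in \<open>auto simp: st_iff backward_def\<close>)
    have verts: "fst (hd M) \<in> W1 \<union> V2" "fin (last M) \<in> W2 \<union> V1"
      using MB B_paths fin_verts[of "hd M"] fin_verts[of "last M"] ov(2) by (auto simp: W1_def W2_def)
    have sub: "V2 \<subseteq> W2" "V1 \<subseteq> W1" by (auto simp: W1_def W2_def)
    \<comment> \<open>If both sets are closed forwards, the first vertex decides which side contains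
      the string; if both are closed backwards, the last one does. In the mixed case a start in
      \<open>W1\<close> or an end in \<open>W2\<close> confines the string, and what remains runs
      from \<open>V2\<close> to \<open>V1\<close>.\<close>
    consider "set M \<subseteq> L.BW (st W1) \<or> set M \<subseteq> L.BW (st W2)"
      | "fst (hd M) \<in> V2" "fin (last M) \<in> V1" "\<forall>b\<in>B. \<not> (fst b \<in> V2 \<and> fin b \<in> V1)"
      using dir fw bw verts sub by blast
    then show "set M \<subseteq> L.BW (st W1) \<or> set M \<subseteq> L.BW (st W2) \<or>
        (\<forall>b\<in>B. \<not> (src b = src (hd M) \<and> tgt b = tgt (last M)))"
    proof cases
      case 2
      then have "\<not> (src b = src (hd M) \<and> tgt b = tgt (last M))" if "b \<in> B" for b
        using that by (auto simp: src_def tgt_def)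
      then show ?thesis by blast
    qed blast
  qed
  show "vs_isomorphic (HH R i) (direct_sum (HH A1 i) (HH A2 i))" if "2 \<le> i"
  proof -
    from that obtain n where i: "i = Suc (Suc n)" by (metis Suc_1 Suc_le_D add_2_eq_Suc le_Suc_ex)
    from HR[of i] obtain q where q: "pres (HH R i) (model_cocycles L.K L.\<delta> i) (model_coboundaries L.K L.\<delta> i) q" ..
    from H1[of i] obtain q1 where q1: "pres (HH A1 i) (model_cocycles L1.K L1.\<delta> i) (model_coboundaries L1.K L1.\<delta> i) q1" ..
    from H2[of i] obtain q2 where q2: "pres (HH A2 i) (model_cocycles L2.K L2.\<delta> i) (model_coboundaries L2.K L2.\<delta> i) q2" ..
    show ?thesis using M.iso_direct_sum[OF q[unfolded i] q1[unfolded i] q2[unfolded i]] unfolding i .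
  qed
  assume c1: "connected_within Q (V1 \<union> V) V" and c2: "connected_within Q (V2 \<union> V) V"
  have acyclic: "b = src b" if b: "b \<in> L.BW (st V)" "src b = tgt b" for b
  proof -
    have "b \<in> paths (Q \<restriction> V)" using b(1) convV B_paths by (auto simp: in_BW convex_def)
    then obtain v where v: "pre_digraph.awalk (Q \<restriction> V) (fst b) (snd b) v" by (auto simp: paths_def)
    interpret G: wf_digraph "Q \<restriction> V" by (rule wellformed_induce_subgraph)
    have "v = fin b" using G.awalk_ends[OF v] G.awlast_of_awalk[OF v] by simp
    also have "\<dots> = fst b" using b(2) by (simp add: src_def tgt_def)
    finally have "snd b = []"
      using v core forest_closed_walk[OF G.wf_digraph_axioms] by (auto simp: core_algebra_def)
    then show ?thesis by (simp add: src_def prod_eq_iff)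
  qed
  obtain x0 where x0: "x0 \<in> V" using c1 by (auto simp: connected_within_def)
  \<comment> \<open>The core is nonempty, so its unit cochain spans a genuine line; this line is the
    \<open>- 1\<close> in the two formulas.\<close>
  have "LC.idc \<noteq> (\<lambda>_. 0)"
    by (rule LC.idc_nonzero[of "(x0, [])"])
      (use x0 V in \<open>auto simp: in_BW src_def in_paths pre_digraph.cas.simps intro!: short_B\<close>)
  moreover have "\<exists>k. L.rs (st V) f = (\<lambda>i. k * LC.idc i)" if "f \<in> model_cocycles L1.K L1.\<delta> 0" for f
    by (rule central_core[OF W(1) _ c1[folded W1_def] acyclic that]) (simp add: W1_def)
  moreover have "\<exists>f\<in>model_cocycles L1.K L1.\<delta> 0. L.rs (st V) f = LC.idc"
  proof (intro bexI[of _ L1.idc])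
    have sub: "st V \<subseteq> st W1" by (auto simp: st_def W1_def)
    show "L.rs (st V) L1.idc = LC.idc"
      using L1.rs_idc[of "st V"] unfolding L.rs_nested[OF sub] L.BW_nested[OF sub] .
  qed (rule L1.idc_Z)
  moreover have "\<exists>k. L.rs (st V) f = (\<lambda>i. k * LC.idc i)" if "f \<in> model_cocycles L2.K L2.\<delta> 0" for f
    by (rule central_core[OF W(2) _ c2[folded W2_def] acyclic that]) (simp add: W2_def)
  ultimately have D: "\<lbrakk>pres (HH R 0) (model_cocycles L.K L.\<delta> 0) (model_coboundaries L.K L.\<delta> 0) q0;
      pres (HH R 1) (model_cocycles L.K L.\<delta> 1) (model_coboundaries L.K L.\<delta> 1) q1;
      pres (HH A1 0) (model_cocycles L1.K L1.\<delta> 0) (model_coboundaries L1.K L1.\<delta> 0) q2;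
      pres (HH A1 1) (model_cocycles L1.K L1.\<delta> 1) (model_coboundaries L1.K L1.\<delta> 1) q3;
      pres (HH A2 0) (model_cocycles L2.K L2.\<delta> 0) (model_coboundaries L2.K L2.\<delta> 0) q4;
      pres (HH A2 1) (model_cocycles L2.K L2.\<delta> 1) (model_coboundaries L2.K L2.\<delta> 1) q5;
      pres (HH C 0) (model_cocycles LC.K LC.\<delta> 0) (model_coboundaries LC.K LC.\<delta> 0) q6\<rbrakk> \<Longrightarrow>
      int (HH_dim R 0) = int (HH_dim A1 0) + int (HH_dim A2 0) - 1 \<and>
      int (HH_dim R 1) = int (HH_dim A1 1) + int (HH_dim A2 1) + int (HH_dim C 0) - 1" for q0 q1 q2 q3 q4 q5 q6
    using M.dim_H[of LC.idc] by (intro conjI) (rule M.dim_H[of LC.idc]; assumption)+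
  from HR[of 0] HR[of 1] H1[of 0] H1[of 1] H2[of 0] H2[of 1] HC[of 0]
  show "int (HH_dim R 0) = int (HH_dim A1 0) + int (HH_dim A2 0) - 1 \<and>
      int (HH_dim R 1) = int (HH_dim A1 1) + int (HH_dim A2 1) + int (HH_dim C 0) - 1"
    by (elim exE) (rule D)
qed

end

theorem proposition2p11:
  fixes Q :: "('v, 'e) pre_digraph"
    and I :: "(('v, 'e) path \<Rightarrow> 'k::field) set"
    and V V1 V2 :: "'v set"
  defines "R \<equiv> bq_algebra Q I"
    and "C \<equiv> sub_bq_algebra Q I V"
    and "A1 \<equiv> sub_bq_algebra Q I (V1 \<union> V)"
    and "A2 \<equiv> sub_bq_algebra Q I (V2 \<union> V)"
  assumes "bound_quiver Q I"
    and "V \<subseteq> verts Q" and "V1 \<subseteq> verts Q" and "V2 \<subseteq> verts Q"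
    and "oriented R (vertex_idem_sum Q I V) (vertex_idem_sum Q I V1) (vertex_idem_sum Q I V2)"
    and "core_algebra (Q \<restriction> V) (restrict_ideal Q I V)"
  shows "(connected_within Q (V1 \<union> V) V \<and> connected_within Q (V2 \<union> V) V \<longrightarrow>
            int (HH_dim R 0) = int (HH_dim A1 0) + int (HH_dim A2 0) - 1 \<and>
            int (HH_dim R 1) =
              int (HH_dim A1 1) + int (HH_dim A2 1) + int (HH_dim C 0) - 1) \<and>
         (\<forall>i\<ge>2. vs_isomorphic (HH R i) (direct_sum (HH A1 i) (HH A2 i)))"
proof -
  from admissible_bq[OF assms(5)] obtain m where "bq Q I m" ..
  then interpret bq Q I m .
  obtain B where B: "{p \<in> paths Q. length (snd p) \<le> 1} \<subseteq> B" "finite B" "B \<subseteq> paths Q"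
    "\<And>f. f \<in> I \<Longrightarrow> supp f \<subseteq> B \<Longrightarrow> f = (\<lambda>_. 0)"
    "\<And>p. p \<in> paths Q \<Longrightarrow> \<exists>g. supp g \<subseteq> B \<and> (\<lambda>x. unit_vec_at p x - g x) \<in> I"
    by (rule ex_basis) blast
  interpret bq_basis Q I m B
    by unfold_locales (use B in auto)
  note H = oriented_cohomology[OF assms(6-8) assms(9)[unfolded R_def] assms(10)]
  show ?thesis unfolding R_def A1_def A2_def C_def using H by blast
qed

end
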